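(* Let $R$ be a ring, let $\mathbf K(\mathrm{Proj})$ be the homotopy category of complexes of projective right $R$-modules, and let $\mathcal K$ be its full subcategory whose objects are the totally acyclic complexes. If the Verdier quotient $\mathbf K(\mathrm{Proj})/\mathcal K$ has small Hom-sets, then every right $R$-module has a Gorenstein-projective precover.
   Context: $R$ is an associative, not necessarily commutative, ring with unit; modules are right $R$-modules; $\mathrm{Mod}\text{-}R$ is the category of all modules and $\mathrm{Proj}$ the full subcategory of projective modules. The homotopy category $\mathbf K(\mathrm{Mod}\text{-}R)$ has as objects the (unbounded) cochain complexes of modules and as morphisms the homotopy classes of cochain maps. Shifts are given by $X[n]^k=X^{k-n}$, $d_{X[n]}^k=(-1)^n d_X^{k-n}$. The cone of a cochain map $f:X\to Y$ has $\mathrm{cone}(f)^n=X^{n+1}\oplus Y^n$ and $d^n(x,y)=(-d_X^{n+1}(x),\,d_Y^n(y)-f^{n+1}(x))$. $\mathbf K(\mathrm{Mod}\text{-}R)$ is triangulated with exact triangles those isomorphic to $X\xrightarrow{f}Y\to \mathrm{cone}(f)\to X[-1]$ (canonical injection and projection). $\mathbf K(\mathrm{Proj})$ is the full subcategory of $\mathbf K(\mathrm{Mod}\text{-}R)$ on the complexes of projective modules. A complex $X$ is totally acyclic if every $X^n$ is projective, $X$ is acyclic (exact), and $\mathrm{Hom}_R(X,P)$ is acyclic for every projective module $P$. A module $M$ is Gorenstein-projective if $M\cong \mathrm{Ker}\, d_X^0$ for some totally acyclic complex $X$. A Gorenstein-projective precover of a module $M$ is a homomorphism $f:G\to M$ with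 $G$ Gorenstein-projective such that $\mathrm{Hom}_R(G',f)$ is surjective for every Gorenstein-projective module $G'$. $\mathrm{Mor}_{\mathcal K}$ is the class of morphisms $f:X\to Y$ in $\mathbf K(\mathrm{Proj})$ for which there is an exact triangle $X\xrightarrow{f}Y\to Z\to X[-1]$ with $Z\in\mathcal K$. The Verdier quotient $\mathbf K(\mathrm{Proj})/\mathcal K$ has the same objects as $\mathbf K(\mathrm{Proj})$; a morphism $X\to Y$ is an equivalence class of triples $(Z,f,g)$ with $f:Z\to X$ in $\mathrm{Mor}_{\mathcal K}$ and $g:Z\to Y$ a morphism in $\mathbf K(\mathrm{Proj})$, where $(Z,f,g)\sim(Z',f',g')$ iff there are a triple $(Z'',f'',g'')$ of the same kind and morphisms $u:Z''\to Z$, $v:Z''\to Z'$ with $fu=f''=f'v$ and $gu=g''=g'v$. It has small Hom-sets if, for all objects $X,Y$, the class of morphisms from $X$ to $Y$ is a (small) set rather than a proper class. *)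

theory Defs
  imports "HOL-Algebra.Module" "HOL-Library.Equipollence"
begin

section \<open>Sets and classes\<close>

text \<open>
  HOL has no primitive distinction between sets and proper classes. The ambient universe of sets
  is therefore a type \<^typ>\<open>'v\<close> with a function \<open>elts\<close> giving the members of a set, subject to the
  axioms of ZF (choice is inherited from HOL). Arbitrary subsets of \<^typ>\<open>'v\<close> play the role of
  classes; those of the form \<open>elts x\<close> are the sets.
\<close>

locale set_universe =
  fixes elts :: "'v \<Rightarrow> 'v set"
  assumes extensionality: "elts x = elts y \<Longrightarrow> x = y"
    and foundation: "wf {(x, y). x \<in> elts y}"
    and infinity: "\<exists>x. (\<exists>e\<in>elts x. elts e = {}) \<and> (\<forall>y\<in>elts x. \<exists>z\<in>elts x. elts z = insert y (elts y))"
    and union: "\<exists>y. elts y = (\<Union>z\<in>elts x. elts z)"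
    and power: "\<exists>y. elts y = {z. elts z \<subseteq> elts x}"
    and separation: "A \<subseteq> elts x \<Longrightarrow> \<exists>y. elts y = A"
    and replacement: "\<exists>y. elts y = f ` elts x"

text \<open>
  Applied to a collection of arbitrary type, smallness means being in bijection with a set. In
  particular, for a quotient of a proper class by an equivalence relation whose equivalence
  classes may be proper, it says that there is a set of representatives.
\<close>

definition small :: "('v \<Rightarrow> 'v set) \<Rightarrow> 'a set \<Rightarrow> bool" where
  "small elts A \<longleftrightarrow> (\<exists>x. A \<approx> elts x)"


section \<open>Right modules over a not necessarily commutative ring\<close>

text \<open>
  The library's module locale requires a commutative ring. We reuse its records, but the scalar
  multiplication \<open>a \<odot>\<^bsub>M\<^esub> x\<close> has to be read as \<open>x a\<close>, as the law \<open>smult_assoc\<close> shows.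
\<close>

locale right_module = R?: ring R + M?: abelian_group M
  for R :: "('r, 'q) ring_scheme" (structure) and M :: "('r, 'a) module" (structure) +
  assumes smult_closed: "\<lbrakk>a \<in> carrier R; x \<in> carrier M\<rbrakk> \<Longrightarrow> a \<odot>\<^bsub>M\<^esub> x \<in> carrier M"
    and smult_add_scalar: "\<lbrakk>a \<in> carrier R; b \<in> carrier R; x \<in> carrier M\<rbrakk>
      \<Longrightarrow> (a \<oplus>\<^bsub>R\<^esub> b) \<odot>\<^bsub>M\<^esub> x = a \<odot>\<^bsub>M\<^esub> x \<oplus>\<^bsub>M\<^esub> b \<odot>\<^bsub>M\<^esub> x"
    and smult_add_vector: "\<lbrakk>a \<in> carrier R; x \<in> carrier M; y \<in> carrier M\<rbrakk>
      \<Longrightarrow> a \<odot>\<^bsub>M\<^esub> (x \<oplus>\<^bsub>M\<^esub> y) = a \<odot>\<^bsub>M\<^esub> x \<oplus>\<^bsub>M\<^esub> a \<odot>\<^bsub>M\<^esub> y"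
    and smult_assoc: "\<lbrakk>a \<in> carrier R; b \<in> carrier R; x \<in> carrier M\<rbrakk>
      \<Longrightarrow> (a \<otimes>\<^bsub>R\<^esub> b) \<odot>\<^bsub>M\<^esub> x = b \<odot>\<^bsub>M\<^esub> (a \<odot>\<^bsub>M\<^esub> x)"
    and smult_one: "x \<in> carrier M \<Longrightarrow> \<one>\<^bsub>R\<^esub> \<odot>\<^bsub>M\<^esub> x = x"

definition mod_hom ::
    "('r, 'q) ring_scheme \<Rightarrow> ('r, 'a) module \<Rightarrow> ('r, 'b) module \<Rightarrow> ('a \<Rightarrow> 'b) set" where
  "mod_hom R M N = {f \<in> carrier M \<rightarrow> carrier N.
     (\<forall>x\<in>carrier M. \<forall>y\<in>carrier M. f (x \<oplus>\<^bsub>M\<^esub> y) = f x \<oplus>\<^bsub>N\<^esub> f y) \<and>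
     (\<forall>a\<in>carrier R. \<forall>x\<in>carrier M. f (a \<odot>\<^bsub>M\<^esub> x) = a \<odot>\<^bsub>N\<^esub> f x)}"

definition mod_iso ::
    "('r, 'q) ring_scheme \<Rightarrow> ('r, 'a) module \<Rightarrow> ('r, 'b) module \<Rightarrow> bool" where
  "mod_iso R M N \<longleftrightarrow> (\<exists>f\<in>mod_hom R M N. bij_betw f (carrier M) (carrier N))"

text \<open>The fields \<open>mult\<close> and \<open>one\<close> of the module record carry no meaning for modules.\<close>

definition mod_sum :: "('r, 'a) module \<Rightarrow> ('r, 'b) module \<Rightarrow> ('r, 'a \<times> 'b) module" where
  "mod_sum M N = \<lparr>carrier = carrier M \<times> carrier N, mult = undefined, one = undefined,
     zero = (\<zero>\<^bsub>M\<^esub>, \<zero>\<^bsub>N\<^esub>),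
     add = (\<lambda>(x, y) (x', y'). (x \<oplus>\<^bsub>M\<^esub> x', y \<oplus>\<^bsub>N\<^esub> y')),
     smult = (\<lambda>a (x, y). (a \<odot>\<^bsub>M\<^esub> x, a \<odot>\<^bsub>N\<^esub> y))\<rparr>"

text \<open>The class of objects of \<open>Mod-R\<close>.\<close>

definition Modules :: "('v \<Rightarrow> 'v set) \<Rightarrow> ('r, 'q) ring_scheme \<Rightarrow> ('r, 'v) module set" where
  "Modules elts R = {M. right_module R M \<and> small elts (carrier M)}"

definition projective :: "('v \<Rightarrow> 'v set) \<Rightarrow> ('r, 'q) ring_scheme \<Rightarrow> ('r, 'v) module \<Rightarrow> bool" where
  "projective elts R P \<longleftrightarrow> P \<in> Modules elts R \<and>
     (\<forall>A\<in>Modules elts R. \<forall>B\<in>Modules elts R. \<forall>p\<in>mod_hom R A B. \<forall>f\<in>mod_hom R P B.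
        p ` carrier A = carrier B \<longrightarrow> (\<exists>h\<in>mod_hom R P A. \<forall>x\<in>carrier P. p (h x) = f x))"


section \<open>Complexes and the homotopy category\<close>

record ('r, 'a) cochain =
  Ob :: "int \<Rightarrow> ('r, 'a) module"
  diff :: "int \<Rightarrow> 'a \<Rightarrow> 'a"

definition is_complex :: "('r, 'q) ring_scheme \<Rightarrow> ('r, 'a) cochain \<Rightarrow> bool" where
  "is_complex R X \<longleftrightarrow> (\<forall>n. right_module R (Ob X n) \<and> diff X n \<in> mod_hom R (Ob X n) (Ob X (n + 1)) \<and>
     (\<forall>x\<in>carrier (Ob X n). diff X (n + 1) (diff X n x) = \<zero>\<^bsub>Ob X (n + 1 + 1)\<^esub>))"

definition cochain_maps ::
    "('r, 'q) ring_scheme \<Rightarrow> ('r, 'a) cochain \<Rightarrow> ('r, 'b) cochain \<Rightarrow> (int \<Rightarrow> 'a \<Rightarrow> 'b) set" where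
  "cochain_maps R X Y = {f. \<forall>n. f n \<in> mod_hom R (Ob X n) (Ob Y n) \<and>
     (\<forall>x\<in>carrier (Ob X n). diff Y n (f n x) = f (n + 1) (diff X n x))}"

text \<open>
  Functions between carriers are arbitrary outside the carriers. Two cochain maps that agree on
  the carriers are homotopic (by the zero homotopy), so this freedom disappears in the homotopy
  classes.
\<close>

definition homotopy_rel :: "('r, 'q) ring_scheme \<Rightarrow> ('r, 'a) cochain \<Rightarrow> ('r, 'b) cochain \<Rightarrow>
    ((int \<Rightarrow> 'a \<Rightarrow> 'b) \<times> (int \<Rightarrow> 'a \<Rightarrow> 'b)) set" where
  "homotopy_rel R X Y = {(f, g). f \<in> cochain_maps R X Y \<and> g \<in> cochain_maps R X Y \<and>
     (\<exists>s. \<forall>n. s n \<in> mod_hom R (Ob X n) (Ob Y (n - 1)) \<and>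
       (\<forall>x\<in>carrier (Ob X n).
          f n x \<ominus>\<^bsub>Ob Y n\<^esub> g n x = diff Y (n - 1) (s n x) \<oplus>\<^bsub>Ob Y n\<^esub> s (n + 1) (diff X n x)))}"

definition KHom :: "('r, 'q) ring_scheme \<Rightarrow> ('r, 'a) cochain \<Rightarrow> ('r, 'b) cochain \<Rightarrow>
    (int \<Rightarrow> 'a \<Rightarrow> 'b) set set" where
  "KHom R X Y = cochain_maps R X Y // homotopy_rel R X Y"

definition Kclass :: "('r, 'q) ring_scheme \<Rightarrow> ('r, 'a) cochain \<Rightarrow> ('r, 'b) cochain \<Rightarrow>
    (int \<Rightarrow> 'a \<Rightarrow> 'b) \<Rightarrow> (int \<Rightarrow> 'a \<Rightarrow> 'b) set" where
  "Kclass R X Y f = homotopy_rel R X Y `` {f}"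

text \<open>The composite \<open>G F\<close> of two homotopy classes, from \<open>X\<close> to \<open>Z\<close>.\<close>

definition Kcomp :: "('r, 'q) ring_scheme \<Rightarrow> ('r, 'a) cochain \<Rightarrow> ('r, 'c) cochain \<Rightarrow>
    (int \<Rightarrow> 'b \<Rightarrow> 'c) set \<Rightarrow> (int \<Rightarrow> 'a \<Rightarrow> 'b) set \<Rightarrow> (int \<Rightarrow> 'a \<Rightarrow> 'c) set" where
  "Kcomp R X Z G F = (\<Union>g\<in>G. \<Union>f\<in>F. Kclass R X Z (\<lambda>n x. g n (f n x)))"

definition Kisos :: "('r, 'q) ring_scheme \<Rightarrow> ('r, 'a) cochain \<Rightarrow> ('r, 'b) cochain \<Rightarrow>
    (int \<Rightarrow> 'a \<Rightarrow> 'b) set set" where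
  "Kisos R X Y = {F \<in> KHom R X Y. \<exists>G\<in>KHom R Y X.
     Kcomp R X X G F = Kclass R X X (\<lambda>n x. x) \<and> Kcomp R Y Y F G = Kclass R Y Y (\<lambda>n x. x)}"

text \<open>The classes of objects of \<open>K(Mod-R)\<close> and of \<open>K(Proj)\<close>.\<close>

definition KMod :: "('v \<Rightarrow> 'v set) \<Rightarrow> ('r, 'q) ring_scheme \<Rightarrow> ('r, 'v) cochain set" where
  "KMod elts R = {X. is_complex R X \<and> (\<forall>n. Ob X n \<in> Modules elts R)}"

definition KProj :: "('v \<Rightarrow> 'v set) \<Rightarrow> ('r, 'q) ring_scheme \<Rightarrow> ('r, 'v) cochain set" where
  "KProj elts R = {X. is_complex R X \<and> (\<forall>n. projective elts R (Ob X n))}"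


section \<open>The triangulated structure\<close>

definition shift :: "int \<Rightarrow> ('r, 'a) cochain \<Rightarrow> ('r, 'a) cochain" where
  "shift n X = \<lparr>Ob = (\<lambda>k. Ob X (k - n)),
     diff = (\<lambda>k x. if even n then diff X (k - n) x else \<ominus>\<^bsub>Ob X (k + 1 - n)\<^esub> diff X (k - n) x)\<rparr>"

definition Kshift :: "int \<Rightarrow> (int \<Rightarrow> 'a \<Rightarrow> 'b) set \<Rightarrow> (int \<Rightarrow> 'a \<Rightarrow> 'b) set" where
  "Kshift n F = (\<lambda>f k. f (k - n)) ` F"

definition cone :: "('r, 'a) cochain \<Rightarrow> ('r, 'b) cochain \<Rightarrow> (int \<Rightarrow> 'a \<Rightarrow> 'b) \<Rightarrow>
    ('r, 'a \<times> 'b) cochain" where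
  "cone X Y f = \<lparr>Ob = (\<lambda>n. mod_sum (Ob X (n + 1)) (Ob Y n)),
     diff = (\<lambda>n (x, y). (\<ominus>\<^bsub>Ob X (n + 1 + 1)\<^esub> diff X (n + 1) x,
                         diff Y n y \<ominus>\<^bsub>Ob Y (n + 1)\<^esub> f (n + 1) x))\<rparr>"

definition cone_inj :: "('r, 'a) cochain \<Rightarrow> int \<Rightarrow> 'b \<Rightarrow> 'a \<times> 'b" where
  "cone_inj X n y = (\<zero>\<^bsub>Ob X (n + 1)\<^esub>, y)"

definition cone_proj :: "int \<Rightarrow> 'a \<times> 'b \<Rightarrow> 'a" where
  "cone_proj n = fst"

text \<open>
  The triangles \<open>X \<rightarrow> Y \<rightarrow> Z \<rightarrow> X[-1]\<close> isomorphic in \<open>K(Mod-R)\<close> to the cone triangle of a cochain map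
  \<open>f : X' \<rightarrow> Y'\<close>. The cone has its terms on the type \<^typ>\<open>'v \<times> 'v\<close> instead of \<^typ>\<open>'v\<close>, which is
  why homotopy classes are defined for complexes on different types.
\<close>

definition exact_triangle :: "('v \<Rightarrow> 'v set) \<Rightarrow> ('r, 'q) ring_scheme \<Rightarrow>
    ('r, 'v) cochain \<Rightarrow> ('r, 'v) cochain \<Rightarrow> ('r, 'v) cochain \<Rightarrow>
    (int \<Rightarrow> 'v \<Rightarrow> 'v) set \<Rightarrow> (int \<Rightarrow> 'v \<Rightarrow> 'v) set \<Rightarrow> (int \<Rightarrow> 'v \<Rightarrow> 'v) set \<Rightarrow> bool" where
  "exact_triangle elts R X Y Z F G H \<longleftrightarrow>
     X \<in> KMod elts R \<and> Y \<in> KMod elts R \<and> Z \<in> KMod elts R \<and>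
     F \<in> KHom R X Y \<and> G \<in> KHom R Y Z \<and> H \<in> KHom R Z (shift (-1) X) \<and>
     (\<exists>X'\<in>KMod elts R. \<exists>Y'\<in>KMod elts R. \<exists>f\<in>cochain_maps R X' Y'.
      \<exists>\<alpha>\<in>Kisos R X X'. \<exists>\<beta>\<in>Kisos R Y Y'. \<exists>\<gamma>\<in>Kisos R Z (cone X' Y' f).
        Kcomp R X Y' \<beta> F = Kcomp R X Y' (Kclass R X' Y' f) \<alpha> \<and>
        Kcomp R Y (cone X' Y' f) \<gamma> G =
          Kcomp R Y (cone X' Y' f) (Kclass R Y' (cone X' Y' f) (cone_inj X')) \<beta> \<and>
        Kcomp R Z (shift (-1) X') (Kshift (-1) \<alpha>) H =
          Kcomp R Z (shift (-1) X') (Kclass R (cone X' Y' f) (shift (-1) X') cone_proj) \<gamma>)"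


section \<open>Totally acyclic complexes and Gorenstein-projective modules\<close>

text \<open>Exactness at \<open>X\<^sup>n\<^sup>+\<^sup>1\<close>, for all \<open>n\<close>.\<close>

definition acyclic_complex :: "('r, 'a) cochain \<Rightarrow> bool" where
  "acyclic_complex X \<longleftrightarrow> (\<forall>n. {x \<in> carrier (Ob X (n + 1)). diff X (n + 1) x = \<zero>\<^bsub>Ob X (n + 1 + 1)\<^esub>}
     = diff X n ` carrier (Ob X n))"

text \<open>
  Exactness of \<open>Hom(X\<^sup>n\<^sup>+\<^sup>2, P) \<rightarrow> Hom(X\<^sup>n\<^sup>+\<^sup>1, P) \<rightarrow> Hom(X\<^sup>n, P)\<close> for all \<open>n\<close>: a homomorphism \<open>f\<close> on
  \<open>X\<^sup>n\<^sup>+\<^sup>1\<close> is a cocycle iff it is a coboundary.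
\<close>

definition Hom_acyclic :: "('r, 'q) ring_scheme \<Rightarrow> ('r, 'a) cochain \<Rightarrow> ('r, 'b) module \<Rightarrow> bool" where
  "Hom_acyclic R X P \<longleftrightarrow> (\<forall>n. \<forall>f\<in>mod_hom R (Ob X (n + 1)) P.
     (\<forall>x\<in>carrier (Ob X n). f (diff X n x) = \<zero>\<^bsub>P\<^esub>) \<longleftrightarrow>
     (\<exists>g\<in>mod_hom R (Ob X (n + 1 + 1)) P. \<forall>x\<in>carrier (Ob X (n + 1)). f x = g (diff X (n + 1) x)))"

definition totally_acyclic ::
    "('v \<Rightarrow> 'v set) \<Rightarrow> ('r, 'q) ring_scheme \<Rightarrow> ('r, 'v) cochain \<Rightarrow> bool" where
  "totally_acyclic elts R X \<longleftrightarrow> is_complex R X \<and> (\<forall>n. projective elts R (Ob X n)) \<and>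
     acyclic_complex X \<and> (\<forall>P. projective elts R P \<longrightarrow> Hom_acyclic R X P)"

definition ker_module :: "('r, 'a) cochain \<Rightarrow> int \<Rightarrow> ('r, 'a) module" where
  "ker_module X n =
     (Ob X n)\<lparr>carrier := {x \<in> carrier (Ob X n). diff X n x = \<zero>\<^bsub>Ob X (n + 1)\<^esub>}\<rparr>"

definition Gorenstein_projective ::
    "('v \<Rightarrow> 'v set) \<Rightarrow> ('r, 'q) ring_scheme \<Rightarrow> ('r, 'v) module \<Rightarrow> bool" where
  "Gorenstein_projective elts R M \<longleftrightarrow> M \<in> Modules elts R \<and>
     (\<exists>X. totally_acyclic elts R X \<and> mod_iso R M (ker_module X 0))"

definition Gorenstein_projective_precover :: "('v \<Rightarrow> 'v set) \<Rightarrow> ('r, 'q) ring_scheme \<Rightarrow>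
    ('r, 'v) module \<Rightarrow> ('r, 'v) module \<Rightarrow> ('v \<Rightarrow> 'v) \<Rightarrow> bool" where
  "Gorenstein_projective_precover elts R M G f \<longleftrightarrow>
     Gorenstein_projective elts R G \<and> f \<in> mod_hom R G M \<and>
     (\<forall>G'. Gorenstein_projective elts R G' \<longrightarrow>
        (\<forall>h\<in>mod_hom R G' M. \<exists>k\<in>mod_hom R G' G. \<forall>x\<in>carrier G'. f (k x) = h x))"


section \<open>The Verdier quotient of \<open>K(Proj)\<close> by the totally acyclic complexes\<close>

definition Mor_tac :: "('v \<Rightarrow> 'v set) \<Rightarrow> ('r, 'q) ring_scheme \<Rightarrow>
    ('r, 'v) cochain \<Rightarrow> ('r, 'v) cochain \<Rightarrow> (int \<Rightarrow> 'v \<Rightarrow> 'v) set set" where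
  "Mor_tac elts R X Y = {F \<in> KHom R X Y. X \<in> KProj elts R \<and> Y \<in> KProj elts R \<and>
     (\<exists>Z G H. totally_acyclic elts R Z \<and> exact_triangle elts R X Y Z F G H)}"

type_synonym ('r, 'v) roof = "('r, 'v) cochain \<times> (int \<Rightarrow> 'v \<Rightarrow> 'v) set \<times> (int \<Rightarrow> 'v \<Rightarrow> 'v) set"

definition roofs :: "('v \<Rightarrow> 'v set) \<Rightarrow> ('r, 'q) ring_scheme \<Rightarrow>
    ('r, 'v) cochain \<Rightarrow> ('r, 'v) cochain \<Rightarrow> ('r, 'v) roof set" where
  "roofs elts R X Y = {(Z, F, G). Z \<in> KProj elts R \<and> F \<in> Mor_tac elts R Z X \<and> G \<in> KHom R Z Y}"

definition roof_rel :: "('v \<Rightarrow> 'v set) \<Rightarrow> ('r, 'q) ring_scheme \<Rightarrow>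
    ('r, 'v) cochain \<Rightarrow> ('r, 'v) cochain \<Rightarrow> (('r, 'v) roof \<times> ('r, 'v) roof) set" where
  "roof_rel elts R X Y = {((Z, F, G), (Z', F', G')).
     (Z, F, G) \<in> roofs elts R X Y \<and> (Z', F', G') \<in> roofs elts R X Y \<and>
     (\<exists>Z'' F'' G''. (Z'', F'', G'') \<in> roofs elts R X Y \<and>
        (\<exists>U\<in>KHom R Z'' Z. \<exists>V\<in>KHom R Z'' Z'.
           Kcomp R Z'' X F U = F'' \<and> F'' = Kcomp R Z'' X F' V \<and>
           Kcomp R Z'' Y G U = G'' \<and> G'' = Kcomp R Z'' Y G' V))}"

definition Verdier_Hom :: "('v \<Rightarrow> 'v set) \<Rightarrow> ('r, 'q) ring_scheme \<Rightarrow>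
    ('r, 'v) cochain \<Rightarrow> ('r, 'v) cochain \<Rightarrow> ('r, 'v) roof set set" where
  "Verdier_Hom elts R X Y = roofs elts R X Y // roof_rel elts R X Y"

definition Verdier_small_Homs :: "('v \<Rightarrow> 'v set) \<Rightarrow> ('r, 'q) ring_scheme \<Rightarrow> bool" where
  "Verdier_small_Homs elts R \<longleftrightarrow>
     (\<forall>X\<in>KProj elts R. \<forall>Y\<in>KProj elts R. small elts (Verdier_Hom elts R X Y))"

end

(*
  Let X be a complex of projective modules. A morphism from S to X in the Verdier quotient is
  represented by a map from S to an extension C of X whose quotient C/X is totally acyclic. If the
  quotient category has small Hom-sets, a set of such maps suffices for all S supported on a
  countable set. Attaching these extensions to X and passing to the union of a tower of length
  omega_1 yields an extension U of X, with U/X totally acyclic, in which every map from a totally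
  acyclic complex to X becomes null-homotopic. Hence the cocone of the inclusion of X into U is
  weakly terminal among the totally acyclic complexes over X. If X is a free resolution of a module
  M, placed in negative degrees, then homomorphisms to M from the cycles in degree 0 of a totally
  acyclic complex T lift to maps from T to X, so the weakly terminal complex gives a precover of M.
*)
theory Submission
  imports Defs "HOL-Library.Poly_Mapping" "HOL-Library.Countable_Set"
begin

section \<open>Small collections\<close>

text \<open>The hypothesis bounds each Hom-set separately, while the totally acyclic complexes may
  form a proper class. The bridge is that contractibility can be tested on countably supported
  complexes. Let \<open>u\<close> map a totally acyclic complex to \<open>X\<close>. It becomes
  null-homotopic in some saturated extension \<open>W\<close> of \<open>U\<close>. Every map from a
  test complex to \<open>W/U\<close> is null-homotopic: saturation of \<open>U\<close> lifts it to
  \<open>W\<close>, the chosen fractions replace the lift by a map to \<open>U\<close> up to a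
  difference that dies, and saturation of \<open>W\<close> kills that difference. Hence
  \<open>W/U\<close> is contractible, and the null-homotopy of \<open>u\<close> can be pushed back
  into \<open>U\<close>. All this is carried out with matrices: a complex of projectives is an
  idempotent together with a differential on a free module whose basis lies in
  \<open>int \<times> 'v\<close>. Extensions are then inclusions of basis sets, unions of towers are
  unions of bases, and all maps are elements of one ring. The translation from and to modules given
  by carriers comes afterwards.\<close>

context set_universe
begin

abbreviation sml :: "'a set => bool" where
  "sml A \<equiv> small elts A"

lemma small_eqpoll: "sml A ==> B \<approx> A ==> sml B"
  unfolding small_def using eqpoll_trans by blast

lemma small_lepoll:
  assumes "sml A" "B \<lesssim> A" shows "sml B"
proof -
  obtain x where "A \<approx> elts x" using assms(1) unfolding small_def by blast
  then have "B \<lesssim> elts x" using assms(2) lepoll_trans2 by blast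
  then obtain f where f: "inj_on f B" "f ` B \<subseteq> elts x" unfolding lepoll_def by blast
  then obtain y where "elts y = f ` B" using separation by blast
  then have "B \<approx> elts y" using f(1) inj_on_image_eqpoll_self eqpoll_sym by metis
  then show ?thesis unfolding small_def by blast
qed

lemma small_subset: "sml A ==> B \<subseteq> A ==> sml B"
  using small_lepoll subset_imp_lepoll by blast

lemma small_image: "sml A ==> sml (f ` A)"
  using small_lepoll image_lepoll by blast

lemma small_elts [simp]: "sml (elts x)"
  unfolding small_def by blast

text \<open>For arbitrary types smallness is mere equipollence; replacement turns it into being the
  extension of a set as soon as the elements lie in \<open>'v\<close>.\<close>

lemma small_elts_eq:
  fixes A :: "'v set" assumes "sml A" shows "\<exists>x. elts x = A"
proof -
  obtain y where "A \<approx> elts y" using assms unfolding small_def by blast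
  then obtain g where "bij_betw g (elts y) A" using eqpoll_sym unfolding eqpoll_def by blast
  then have "A = g ` elts y" unfolding bij_betw_def by simp
  then show ?thesis using replacement by metis
qed

lemma small_inj_image: "sml (f ` A) ==> inj_on f A ==> sml A"
  using small_eqpoll inj_on_image_eqpoll_self eqpoll_sym by blast

lemma small_inject:
  assumes "sml A" shows "\<exists>f x. bij_betw (f :: 'a => 'v) A (elts x)"
  using assms unfolding small_def eqpoll_def by blast

text \<open>By separation every subset of \<open>elts x\<close> is the extension of some element of
  the power set, so \<open>elts\<close> maps that power set onto a collection containing
  \<open>Pow (elts x)\<close>.\<close>

lemma small_Pow:
  assumes "sml A" shows "sml (Pow A)"
proof -
  obtain f x where f: "bij_betw (f :: 'a => 'v) A (elts x)" using small_inject[OF assms] by blast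
  obtain y where y: "elts y = {z. elts z \<subseteq> elts x}" using power by blast
  have "Pow (elts x) \<lesssim> elts y"
  proof -
    have "Pow (elts x) \<subseteq> elts ` elts y" using y separation by (auto simp: image_iff) metis
    then show ?thesis using subset_image_lepoll by blast
  qed
  then have "sml (Pow (elts x))" using small_lepoll small_elts by blast
  moreover have "inj_on ((`) f) (Pow A)" "((`) f) ` Pow A \<subseteq> Pow (elts x)"
    using f unfolding bij_betw_def by (auto intro: inj_on_image_Pow)
  ultimately show ?thesis using small_inj_image small_subset by metis
qed

lemma infinite_set_exists: "\<exists>x. infinite (elts x)"
proof -
  obtain x where x: "\<exists>e\<in>elts x. elts e = {}" "\<forall>y\<in>elts x. \<exists>z\<in>elts x. elts z = insert y (elts y)"
    using infinity by blast
  \<comment> \<open>Foundation makes each successor \<open>insert y (elts y)\<close> strictly larger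
    than \<open>elts y\<close>, so the inductive set contains sets of every finite
    cardinality.\<close>
  have irr: "y \<notin> elts y" for y using foundation by (auto dest: wf_not_refl)
  have "\<exists>z\<in>elts x. finite (elts z) \<and> card (elts z) = n" for n
  proof (induction n)
    case 0
    obtain e where "e \<in> elts x" "elts e = {}" using x(1) by blast
    then show ?case by (intro bexI[of _ e]) auto
  next
    case (Suc n)
    then obtain z where z: "z \<in> elts x" "finite (elts z)" "card (elts z) = n" by blast
    then obtain w where "w \<in> elts x" "elts w = insert z (elts z)" using x by blast
    then show ?case using z irr by (intro bexI[of _ w]) auto
  qed
  then have "\<exists>z\<in>elts x. n = card (elts z)" for n by metis
  then have "(UNIV :: nat set) \<subseteq> (\<lambda>z. card (elts z)) ` elts x" by blast
  then have "infinite (elts x)" using finite_imageI finite_subset infinite_UNIV_nat by metis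
  then show ?thesis by blast
qed

lemma small_countable: "countable A ==> sml A"
proof -
  assume c: "countable A"
  obtain x where "infinite (elts x)" using infinite_set_exists by blast
  then have "(UNIV::nat set) \<lesssim> elts x" using infinite_le_lepoll by blast
  then have "sml (UNIV::nat set)" using small_lepoll small_elts by blast
  moreover have "A \<lesssim> (UNIV::nat set)" using c unfolding countable_def lepoll_def by blast
  ultimately show ?thesis using small_lepoll by blast
qed

lemma infinite_universe: "infinite (UNIV :: 'v set)"
  using infinite_set_exists finite_subset[OF subset_UNIV] by metis

text \<open>Russell's paradox: separation from a set of everything would give the set of all sets
  that are not members of themselves.\<close>

lemma not_small_universe: "\<not> sml (UNIV :: 'v set)"
proof
  assume "sml (UNIV :: 'v set)"
  then obtain u where u: "elts u = UNIV" using small_elts_eq by blast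
  obtain w where "elts w = {x. x \<notin> elts x}" using u separation[of "{x. x \<notin> elts x}" u] by auto
  then show False by blast
qed

text \<open>Any injection of pairs will do, so it comes from the cardinal arithmetic of the infinite
  type \<open>'v\<close> rather than from Kuratowski pairs. Its purpose is to tag basis elements and
  thereby form disjoint copies of bases.\<close>

definition cpair :: "'v => 'v => 'v" where
  "cpair = (SOME f. inj (\<lambda>(x, y). f x y))"

lemma inj_cpair: "inj (\<lambda>(x, y). cpair x y)"
proof -
  have "(UNIV :: 'v set) \<times> (UNIV :: 'v set) \<approx> (UNIV :: 'v set)"
    unfolding eqpoll_iff_card_of_ordIso by (rule card_of_Times_same_infinite[OF infinite_universe])
  then obtain g :: "'v \<times> 'v => 'v" where "inj g"
    unfolding eqpoll_def bij_betw_def by auto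
  then have "inj (\<lambda>(x, y). (\<lambda>x y. g (x, y)) x y)" by (simp add: case_prod_unfold)
  then show ?thesis unfolding cpair_def by (rule someI[where P = "\<lambda>f. inj (\<lambda>(x, y). f x y)"])
qed

lemma cpair_eq [simp]: "cpair x y = cpair x' y' \<longleftrightarrow> x = x' \<and> y = y'"
  using injD[OF inj_cpair, of "(x, y)" "(x', y')"] by auto

text \<open>Each fibre is replaced by a set of tagged codes; replacement collects these sets and the
  union axiom gives one set that contains the codes of the whole sum.\<close>

lemma small_Sigma:
  assumes A: "sml A" and B: "\<And>a. a \<in> A ==> sml (B a)" shows "sml (Sigma A B)"
proof -
  obtain f x where f: "bij_betw (f :: 'a => 'v) A (elts x)" using small_inject[OF A] by blast
  have "\<forall>a\<in>A. \<exists>g z. bij_betw (g :: 'b => 'v) (B a) (elts z)" using small_inject[OF B] by blast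
  then obtain g z where g: "\<And>a. a \<in> A ==> bij_betw (g a :: 'b => 'v) (B a) (elts (z a))" by metis
  have "\<exists>w. elts w = cpair (f a) ` elts (z a)" for a using replacement by blast
  then obtain w where w: "\<And>a. elts (w a) = cpair (f a) ` elts (z a)" by metis
  obtain u where u: "elts u = w ` A" using small_elts_eq small_image[OF A] by metis
  obtain y where y: "elts y = (\<Union>v\<in>elts u. elts v)" using union by blast
  let ?h = "\<lambda>(a, b). cpair (f a) (g a b)"
  have "?h ` Sigma A B \<subseteq> elts y"
    using bij_betwE[OF g] by (auto simp: w u y)
  moreover have "inj_on ?h (Sigma A B)"
  proof (rule inj_onI; clarify)
    fix a b a' b' assume *: "a \<in> A" "b \<in> B a" "a' \<in> A" "b' \<in> B a'"
      "cpair (f a) (g a b) = cpair (f a') (g a' b')"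
    then have "a = a'" using f unfolding bij_betw_def inj_on_def by auto
    then show "a = a' \<and> b = b'" using * g[of a] unfolding bij_betw_def inj_on_def by auto
  qed
  ultimately show ?thesis by (rule small_inj_image[OF small_subset[OF small_elts]])
qed

lemma small_Times: "sml A ==> sml B ==> sml (A \<times> B)"
  by (rule small_Sigma)

lemma small_UN:
  assumes "sml A" "\<And>a. a \<in> A ==> sml (B a)" shows "sml (\<Union>a\<in>A. B a)"
proof -
  have "(\<Union>a\<in>A. B a) = snd ` Sigma A B" by force
  then show ?thesis using small_image small_Sigma assms by metis
qed

lemma small_Un: "sml A ==> sml B ==> sml (A \<union> B)"
  using small_UN[of "{A, B}" "\<lambda>X. X"] small_countable[of "{A, B}"] by simp blast

text \<open>Anything with an evaluation \<open>\<phi>\<close> that is faithful on \<open>A\<close>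
  embeds through its graphs into \<open>Pow (A \<times> B)\<close>. Smallness of vectors and of
  matrices over small bases is reduced to this.\<close>

lemma small_functions:
  assumes "sml A" "sml B" and "\<And>f a. f \<in> F ==> a \<in> A ==> \<phi> f a \<in> B"
    and "\<And>f g. f \<in> F ==> g \<in> F ==> (\<And>a. a \<in> A ==> \<phi> f a = \<phi> g a) ==> f = g"
  shows "sml F"
proof -
  let ?G = "\<lambda>f. (\<lambda>a. (a, \<phi> f a)) ` A"
  have "?G ` F \<subseteq> Pow (A \<times> B)" using assms(3) by auto
  then have "sml (?G ` F)" using small_subset[OF small_Pow[OF small_Times[OF assms(1,2)]]] by blast
  moreover have "inj_on ?G F"
  proof (rule inj_onI)
    fix f g assume fg: "f \<in> F" "g \<in> F" "?G f = ?G g"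
    have "\<phi> f a = \<phi> g a" if "a \<in> A" for a
    proof -
      have "(a, \<phi> f a) \<in> ?G g" using fg(3) that by blast
      then show ?thesis by auto
    qed
    then show "f = g" using assms(4) fg by blast
  qed
  ultimately show ?thesis by (rule small_inj_image)
qed

text \<open>A small set of basis elements meets only a small set of tags, whereas the universe is
  not small. The free tag makes room for a copy that is disjoint from a given basis.\<close>

lemma fresh_tag:
  fixes B :: "('b \<times> 'v) set" assumes "sml B" shows "\<exists>t. \<forall>n y. (n, cpair t y) \<notin> B"
proof -
  have "sml {t. \<exists>n y. (n, cpair t y) \<in> B}"
  proof (rule small_subset)
    show "sml ((\<lambda>b. SOME t. \<exists>y. snd b = cpair t y) ` B)" using small_image assms .
    show "{t. \<exists>n y. (n, cpair t y) \<in> B} \<subseteq> (\<lambda>b. SOME t. \<exists>y. snd b = cpair t y) ` B"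
    proof clarify
      fix t n y assume "(n, cpair t y) \<in> B"
      moreover have "(SOME t'. \<exists>y'. snd (n, cpair t y) = cpair t' y') = t" by auto
      ultimately show "t \<in> (\<lambda>b. SOME t. \<exists>y. snd b = cpair t y) ` B"
        by (intro image_eqI[where x = "(n, cpair t y)"]) auto
    qed
  qed
  then have "{t. \<exists>n y. (n, cpair t y) \<in> B} \<noteq> UNIV" using not_small_universe by metis
  then show ?thesis by blast
qed

end

section \<open>Linear endomorphisms of a free module\<close>

abbreviation lookup :: "('i \<Rightarrow>\<^sub>0 'k::zero) => 'i => 'k" where
  "lookup \<equiv> Poly_Mapping.lookup"

abbreviation keys :: "('i \<Rightarrow>\<^sub>0 'k::zero) => 'i set" where
  "keys \<equiv> Poly_Mapping.keys"

text \<open>Scalars stand on the right, as suits right modules, so that linear maps can compose on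
  the left.\<close>

definition rscale :: "('i \<Rightarrow>\<^sub>0 'k::ring) => 'k => ('i \<Rightarrow>\<^sub>0 'k)" where
  "rscale x a = Poly_Mapping.map (\<lambda>c. c * a) x"

lemma lookup_rscale [simp]: "lookup (rscale x a) i = lookup x i * a"
  unfolding rscale_def by (simp add: Poly_Mapping.map.rep_eq when_def)

lemma rscale_simps [simp]:
  "rscale (x + y) a = rscale x a + rscale y a"
  "rscale x (a + b) = rscale x a + rscale x b"
  "rscale (rscale x a) b = rscale x (a * b)"
  "rscale 0 a = 0" "rscale x 0 = 0"
  "rscale (- x) a = - rscale x a"
  "rscale (x - y) a = rscale x a - rscale y a"
  "rscale (Poly_Mapping.single i c) a = Poly_Mapping.single i (c * a)"
  by (auto intro!: poly_mapping_eqI simp: lookup_add lookup_minus algebra_simps lookup_single when_def)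

lemma rscale_sum: "rscale (sum f A) a = (\<Sum>i\<in>A. rscale (f i) a)"
  by (induction A rule: infinite_finite_induct) auto

text \<open>All maps between all complexes are elements of this single ring of endomorphisms; domain
  and codomain are expressed by absorbing idempotents. Equations between maps thus become matters of
  ring normalisation.\<close>

typedef (overloaded) ('i, 'k::ring) lin = "{f :: ('i \<Rightarrow>\<^sub>0 'k) => ('i \<Rightarrow>\<^sub>0 'k).
    (\<forall>x y. f (x + y) = f x + f y) \<and> (\<forall>x a. f (rscale x a) = rscale (f x) a)}"
  morphisms app Lin
  by (rule exI[of _ "\<lambda>x. 0"]) auto

setup_lifting type_definition_lin

instantiation lin :: (type, ring) ring
begin

lift_definition zero_lin :: "('a, 'b) lin" is "\<lambda>x. 0" by simp
lift_definition plus_lin :: "('a, 'b) lin => ('a, 'b) lin => ('a, 'b) lin" is "\<lambda>f g x. f x + g x"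
  by (simp add: algebra_simps)
lift_definition minus_lin :: "('a, 'b) lin => ('a, 'b) lin => ('a, 'b) lin" is "\<lambda>f g x. f x - g x"
  by (simp add: algebra_simps)
lift_definition uminus_lin :: "('a, 'b) lin => ('a, 'b) lin" is "\<lambda>f x. - f x"
  by (simp add: algebra_simps)
lift_definition times_lin :: "('a, 'b) lin => ('a, 'b) lin => ('a, 'b) lin" is "\<lambda>f g x. f (g x)"
  by simp

instance
  by standard (transfer; simp add: algebra_simps fun_eq_iff)+

end

lemma app_Lin:
  assumes "\<And>x y. f (x + y) = f x + f y" "\<And>x a. f (rscale x a) = rscale (f x) a"
  shows "app (Lin f) = f"
  using assms by (simp add: Lin_inverse)

lemma app_add [simp]: "app f (x + y) = app f x + app f y"
  using app[of f] by simp

lemma app_rscale [simp]: "app f (rscale x a) = rscale (app f x) a"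
  using app[of f] by simp

lemma app_zero [simp]: "app f 0 = 0"
  using app_add[of f 0 0] by simp

lemma app_uminus [simp]: "app f (- x) = - app f x"
  using app_add[of f x "- x"] by (simp add: add_eq_0_iff2 add.commute)

lemma app_diff [simp]: "app f (x - y) = app f x - app f y"
  using app_add[of f x "- y"] by simp

lemma app_sum: "app f (sum g A) = (\<Sum>i\<in>A. app f (g i))"
  by (induction A rule: infinite_finite_induct) auto

lemma app_lin_simps [simp]:
  "app 0 x = 0" "app (f + g) x = app f x + app g x" "app (f - g) x = app f x - app g x"
  "app (- f) x = - app f x" "app (f * g) x = app f (app g x)"
  by (transfer; simp)+

lemma app_cong: "f = g ==> app f x = app g x"
  by simp

lemma lin_eqI: "(\<And>x. app f x = app g x) ==> f = g"
  by (metis app_inject ext)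

lemma poly_mapping_expand:
  fixes x :: "'i \<Rightarrow>\<^sub>0 'k::ring"
  assumes "finite A" "keys x \<subseteq> A" shows "x = (\<Sum>i\<in>A. Poly_Mapping.single i (lookup x i))"
proof (rule poly_mapping_eqI)
  fix j
  have "lookup (\<Sum>i\<in>A. Poly_Mapping.single i (lookup x i)) j = (\<Sum>i\<in>A. if i = j then lookup x i else 0)"
    by (simp add: lookup_sum lookup_single when_def)
  also have "\<dots> = lookup x j"
    using assms by (auto simp: sum.delta in_keys_iff)
  finally show "lookup x j = lookup (\<Sum>i\<in>A. Poly_Mapping.single i (lookup x i)) j" by simp
qed

section \<open>Free modules over the corner of a central idempotent\<close>

locale corner =
  fixes e :: "'k::ring"
  assumes idem: "e * e = e" and central: "\<And>x. e * x = x * e"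
begin

lemma e_simps [simp]: "e * e = e" "e * (e * x) = e * x" "x * e * e = x * e" "e * x * e = x * e"
  by (metis idem central mult.assoc)+

definition bas :: "'i => ('i \<Rightarrow>\<^sub>0 'k)" where
  "bas i = Poly_Mapping.single i e"

lemma rscale_bas [simp]: "rscale (bas i) e = bas i"
  unfolding bas_def by simp

text \<open>Besides deleting coordinates it multiplies by \<open>e\<close>, so that
  \<open>pr UNIV\<close> acts as the identity on vectors with coefficients in the corner. It
  replaces the unit, which the class \<open>ring\<close> does not provide.\<close>

definition pr :: "'i set => ('i, 'k) lin" where
  "pr B = Lin (Poly_Mapping.mapp (\<lambda>i c. if i \<in> B then c * e else 0))"

lemma lookup_pr: "lookup (app (pr B) x) i = (if i \<in> B then lookup x i * e else 0)"
proof -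
  let ?f = "Poly_Mapping.mapp (\<lambda>i c. if i \<in> B then c * e else 0)"
  have l: "lookup (?f x) i = (if i \<in> B then lookup x i * e else 0)" for x i
    by (simp add: lookup_mapp in_keys_iff when_def)
  have "c * a * e = c * e * a" for c a by (metis central mult.assoc)
  then have "app (Lin ?f) = ?f"
    by (intro app_Lin poly_mapping_eqI) (simp_all add: l lookup_add distrib_right)
  then show ?thesis unfolding pr_def by (simp add: l)
qed

definition eps :: "('i, 'k) lin" where "eps = pr UNIV"

lemma app_eps [simp]: "app eps x = rscale x e"
  unfolding eps_def by (rule poly_mapping_eqI) (simp add: lookup_pr)

lemma eps_central: "f * eps = eps * f"
  by (rule lin_eqI) simp

lemma eps_eps [simp]: "eps * eps = eps" "eps * (eps * f) = eps * f"
  by (rule lin_eqI, simp)+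

lemma pr_bas: "app (pr B) (bas i) = (if i \<in> B then bas i else 0)"
  by (rule poly_mapping_eqI) (simp add: lookup_pr bas_def lookup_single when_def)

lemma pr_pr [simp]: "pr A * pr B = pr (A \<inter> B)" "pr A * (pr B * f) = pr (A \<inter> B) * f"
proof -
  show "pr A * pr B = pr (A \<inter> B)"
    by (intro lin_eqI poly_mapping_eqI) (simp add: lookup_pr)
  then show "pr A * (pr B * f) = pr (A \<inter> B) * f" by (metis mult.assoc)
qed

lemma app_pr_pr [simp]: "app (pr A) (app (pr B) x) = app (pr (A \<inter> B)) x"
  by (metis app_lin_simps(5) pr_pr(1))

lemma pr_eps [simp]: "pr B * eps = pr B" "eps * pr B = pr B"
  "pr B * (eps * f) = pr B * f" "eps * (pr B * f) = pr B * f"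
  unfolding eps_def by auto

lemma pr_empty [simp]: "pr {} = 0"
  by (intro lin_eqI poly_mapping_eqI) (simp add: lookup_pr)

lemma pr_Diff: "A \<subseteq> B ==> pr (B - A) = pr B - pr A"
  by (intro lin_eqI poly_mapping_eqI) (auto simp: lookup_pr lookup_minus)

lemma pr_Compl: "pr (- A) = eps - pr A"
  unfolding eps_def by (intro lin_eqI poly_mapping_eqI) (auto simp: lookup_pr lookup_minus)

text \<open>This is the free module on \<open>B\<close> over the corner, as \<open>vs_iff\<close>
  spells out; the form as a fixed point set fits calculations with matrices.\<close>

definition vs :: "'i set => ('i \<Rightarrow>\<^sub>0 'k) set" where
  "vs B = {x. app (pr B) x = x}"

lemma vs_iff: "x \<in> vs B \<longleftrightarrow> rscale x e = x \<and> keys x \<subseteq> B"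
proof
  assume "x \<in> vs B"
  then have *: "lookup x i = (if i \<in> B then lookup x i * e else 0)" for i
    unfolding vs_def by (metis (mono_tags) lookup_pr mem_Collect_eq)
  then have "lookup x i * e = lookup x i" for i by (metis e_simps(3) mult_zero_left)
  then show "rscale x e = x \<and> keys x \<subseteq> B"
    using * by (auto intro!: poly_mapping_eqI simp: in_keys_iff) metis
next
  assume *: "rscale x e = x \<and> keys x \<subseteq> B"
  then have "lookup x i * e = lookup x i" for i by (metis lookup_rscale)
  then show "x \<in> vs B" using *
    unfolding vs_def by (auto intro!: poly_mapping_eqI simp: lookup_pr in_keys_iff subset_iff)
qed

lemma vs_pr [simp]: "app (pr B) x \<in> vs B"
  unfolding vs_def by simp

lemma vs_bas [simp]: "bas i \<in> vs B \<longleftrightarrow> i \<in> B \<or> e = 0"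
  unfolding vs_iff by (auto simp: bas_def)

lemma vs_closed [simp]: "0 \<in> vs B" "x \<in> vs B ==> y \<in> vs B ==> x + y \<in> vs B"
  "x \<in> vs B ==> y \<in> vs B ==> x - y \<in> vs B" "x \<in> vs B ==> - x \<in> vs B" "x \<in> vs B ==> rscale x a \<in> vs B"
  unfolding vs_def by auto

lemma vs_mono: "A \<subseteq> B ==> x \<in> vs A ==> x \<in> vs B"
  unfolding vs_iff by auto

lemma app_expand:
  assumes "f * eps = f" "finite A" "keys x \<subseteq> A"
  shows "app f x = (\<Sum>i\<in>A. rscale (app f (bas i)) (lookup x i))"
proof -
  have "rscale x e = (\<Sum>i\<in>A. rscale (bas i) (lookup x i))"
    by (subst poly_mapping_expand[OF assms(2,3)]) (simp add: rscale_sum bas_def central)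
  then have "app (f * eps) x = (\<Sum>i\<in>A. rscale (app f (bas i)) (lookup x i))"
    by (simp add: app_sum)
  then show ?thesis using assms(1) by simp
qed

text \<open>A map that absorbs \<open>eps\<close> ignores what lies outside the corner, and the
  vectors \<open>bas i\<close> generate everything inside.\<close>

lemma lin_eq_basI:
  assumes "f * eps = f" "g * eps = g" "\<And>i. app f (bas i) = app g (bas i)" shows "f = g"
proof (rule lin_eqI)
  fix x
  show "app f x = app g x"
    using app_expand[OF assms(1) finite_keys subset_refl, of x]
      app_expand[OF assms(2) finite_keys subset_refl, of x] by (simp only: assms(3))
qed

definition ext0 :: "('i => ('i \<Rightarrow>\<^sub>0 'k)) => ('i, 'k) lin" where
  "ext0 v = Lin (\<lambda>x. \<Sum>i\<in>keys x. rscale (rscale (v i) e) (lookup x i))"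

lemma app_ext0: "app (ext0 v) x = (\<Sum>i\<in>keys x. rscale (rscale (v i) e) (lookup x i))"
proof -
  let ?f = "\<lambda>x. \<Sum>i\<in>keys x. rscale (rscale (v i) e) (lookup x i)"
  have *: "?f z = (\<Sum>i\<in>A. rscale (rscale (v i) e) (lookup z i))" if "finite A" "keys z \<subseteq> A" for z A
    by (rule sum.mono_neutral_left) (use that in \<open>auto simp: in_keys_iff\<close>)
  have "?f (x + y) = ?f x + ?f y" for x y
  proof -
    let ?A = "keys x \<union> keys y"
    have "finite ?A" "keys (x + y) \<subseteq> ?A" "keys x \<subseteq> ?A" "keys y \<subseteq> ?A" by (auto simp: keys_add)
    then show ?thesis
      using *[of ?A "x + y"] *[of ?A x] *[of ?A y] by (simp add: lookup_add sum.distrib)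
  qed
  moreover have "?f (rscale x a) = rscale (?f x) a" for x a
  proof -
    have "keys (rscale x a) \<subseteq> keys x" by (auto simp: in_keys_iff)
    then show ?thesis using *[of "keys x" "rscale x a"] by (simp add: rscale_sum mult.assoc)
  qed
  ultimately have "app (Lin ?f) = ?f" by (rule app_Lin)
  then show ?thesis unfolding ext0_def by (rule fun_cong)
qed

text \<open>Values outside the corner are cut off.\<close>

definition ext :: "('i => ('i \<Rightarrow>\<^sub>0 'k)) => ('i, 'k) lin" where
  "ext v = ext0 v * eps"

lemma ext_eps [simp]: "ext v * eps = ext v" "eps * ext v = ext v"
  unfolding ext_def by (metis eps_central eps_eps mult.assoc)+

lemma app_ext_bas: "app (ext v) (bas i) = rscale (v i) e"
proof (cases "e = 0")
  case True
  have "bas i = 0" "rscale (v i) e = 0" unfolding bas_def using True by simp_all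
  then show ?thesis by (simp only: app_zero)
next
  case False
  have "app (ext v) (bas i) = app (ext0 v) (bas i)" unfolding ext_def by simp
  also have "\<dots> = rscale (v i) e" using False by (simp add: bas_def app_ext0)
  finally show ?thesis .
qed

lemma app_ext_bas' [simp]: "v i \<in> vs B ==> app (ext v) (bas i) = v i"
  by (simp add: app_ext_bas vs_iff)

lemma pr_absorb_left: "pr B * f = f \<longleftrightarrow> (\<forall>x. app f x \<in> vs B)"
  unfolding vs_def by (auto intro!: lin_eqI) (metis app_lin_simps(5))

lemma pr_absorb_eps: "pr B * f = f ==> f * eps = f" "f * pr B = f ==> f * eps = f"
  by (metis eps_central mult.assoc pr_eps(2)) (metis mult.assoc pr_eps(1))

lemma pr_absorb_leftI:
  assumes "f * eps = f" "\<And>i. app f (bas i) \<in> vs B" shows "pr B * f = f"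
  by (rule lin_eq_basI) (use assms in \<open>auto simp: vs_def mult.assoc\<close>)

lemma pr_absorb_rightI:
  assumes "f * eps = f" "\<And>i. i \<notin> B ==> app f (bas i) = 0" shows "f * pr B = f"
  by (rule lin_eq_basI) (use assms in \<open>auto simp: pr_bas mult.assoc\<close>)

lemma pr_mono_left: "pr A * f = f ==> A \<subseteq> B ==> pr B * f = f"
  by (metis inf.absorb2 pr_pr(2))

lemma pr_mono_right: "f * pr A = f ==> A \<subseteq> B ==> f * pr B = f"
  by (metis inf.absorb1 pr_pr(1) mult.assoc)

text \<open>The matrix that relabels the basis by \<open>h\<close>. For injective \<open>h\<close>
  the matrix \<open>coreloc h\<close> is its transpose and a left inverse.\<close>

definition reloc :: "('i => 'i) => ('i, 'k) lin" where
  "reloc h = ext (\<lambda>i. bas (h i))"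

definition coreloc :: "('i => 'i) => ('i, 'k) lin" where
  "coreloc h = ext (\<lambda>j. if j \<in> range h then bas (inv_into UNIV h j) else 0)"

lemma reloc_bas [simp]: "app (reloc h) (bas i) = bas (h i)"
  unfolding reloc_def by (simp add: app_ext_bas)

lemma coreloc_bas: "app (coreloc h) (bas j) = (if j \<in> range h then bas (inv_into UNIV h j) else 0)"
  unfolding coreloc_def by (simp add: app_ext_bas)

lemma coreloc_bas_inj [simp]: "inj h ==> app (coreloc h) (bas (h i)) = bas i"
  by (simp add: coreloc_bas)

lemma reloc_eps [simp]: "reloc h * eps = reloc h" "eps * reloc h = reloc h"
  "coreloc h * eps = coreloc h" "eps * coreloc h = coreloc h"
  unfolding reloc_def coreloc_def by simp_all

lemma coreloc_reloc: "inj h ==> coreloc h * reloc h = eps"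
  by (rule lin_eq_basI) (auto simp: mult.assoc)

lemma reloc_coreloc: "inj h ==> reloc h * coreloc h = pr (range h)"
  by (rule lin_eq_basI) (auto simp: mult.assoc coreloc_bas pr_bas)

lemma coreloc_reloc_disjoint: "range h \<inter> range h' = {} ==> coreloc h * reloc h' = 0"
  by (rule lin_eq_basI) (auto simp: mult.assoc coreloc_bas)

lemma pr_reloc: "inj h ==> pr (h ` B) * reloc h = reloc h * pr B"
  by (rule lin_eq_basI) (auto simp: mult.assoc pr_bas inj_image_mem_iff)

lemma coreloc_pr: "inj h ==> coreloc h * pr (h ` B) = pr B * coreloc h"
  by (rule lin_eq_basI) (auto simp: mult.assoc pr_bas coreloc_bas inj_image_mem_iff)

end

section \<open>Graded endomorphisms\<close>

context corner
begin

abbreviation lev :: "int => (int \<times> 'v) set" where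
  "lev n \<equiv> {n} \<times> UNIV"

text \<open>Homogeneity of degree \<open>k\<close>, put as an equation with the level projections
  instead of a condition on vectors, so that degrees of products follow by rewriting.\<close>

definition dg :: "int => (int \<times> 'v, 'k) lin => bool" where
  "dg k f \<longleftrightarrow> (\<forall>n. f * pr (lev n) = pr (lev (n + k)) * f)"

lemma dg_zero [simp]: "dg k 0"
  unfolding dg_def by simp

lemma dg_add: "dg k f ==> dg k g ==> dg k (f + g)"
  unfolding dg_def by (simp add: algebra_simps)

lemma dg_diff: "dg k f ==> dg k g ==> dg k (f - g)"
  unfolding dg_def by (simp add: algebra_simps)

lemma dg_uminus: "dg k f ==> dg k (- f)"
  unfolding dg_def by (simp add: algebra_simps)

lemma dg_mult: "dg k f ==> dg l g ==> m = k + l ==> dg m (f * g)"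
  unfolding dg_def by (simp add: mult.assoc add.commute add.left_commute)
    (simp add: mult.assoc[symmetric] add.commute add.left_commute)

lemma dg_pr [simp]: "dg 0 (pr B)"
  unfolding dg_def by (simp add: inf_commute)

lemma dg_eps [simp]: "dg 0 eps"
  unfolding eps_def by simp

lemma dg_basI:
  assumes "f * eps = f" "\<And>n x. app f (bas (n, x)) \<in> vs (lev (n + k))" shows "dg k f"
  unfolding dg_def
proof
  fix n
  show "f * pr (lev n) = pr (lev (n + k)) * f"
  proof (rule lin_eq_basI)
    fix i :: "int \<times> 'a"
    obtain m x where i: "i = (m, x)" by force
    have *: "app f (bas (m, x)) \<in> vs (lev (m + k))" by (rule assms(2))
    have "app (pr (lev (n + k))) (app f (bas (m, x))) = (if m = n then app f (bas (m, x)) else 0)"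
    proof -
      have L: "lev (n + k) \<inter> lev (m + k) = (if m = n then lev (m + k) else {})" by auto
      have **: "app (pr (lev (m + k))) (app f (bas (m, x))) = app f (bas (m, x))"
        using * unfolding vs_def by simp
      have "app (pr (lev (n + k))) (app (pr (lev (m + k))) y) = (if m = n then app (pr (lev (m + k))) y else 0)" for y
        unfolding app_pr_pr L by simp
      from this[of "app f (bas (m, x))"] show ?thesis unfolding ** .
    qed
    then show "app (f * pr (lev n)) (bas i) = app (pr (lev (n + k)) * f) (bas i)"
      by (auto simp: i pr_bas)
  qed (use assms(1) in \<open>auto simp: mult.assoc\<close>)
qed

lemma dg_ext: "(\<And>n x. v (n, x) \<in> vs (lev (n + k))) ==> dg k (ext v)"
  by (rule dg_basI) (auto simp: app_ext_bas)

lemma dg_vs: "dg k f ==> x \<in> vs (lev n) ==> app f x \<in> vs (lev (n + k))"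
proof -
  assume f: "dg k f" and x: "x \<in> vs (lev n)"
  have "app (f * pr (lev n)) x = app (pr (lev (n + k)) * f) x" using f unfolding dg_def by simp
  then show ?thesis using x unfolding vs_def by simp
qed

lemma dg_reloc: "(\<And>n x. fst (h (n, x)) = n + k) ==> dg k (reloc h)"
  unfolding reloc_def by (rule dg_ext) (auto simp: mem_Times_iff)

lemma dg_coreloc:
  assumes "inj h" "\<And>n x. fst (h (n, x)) = n + k" shows "dg (- k) (coreloc h)"
  unfolding coreloc_def
proof (rule dg_ext)
  fix n and x :: 'a
  have "inv_into UNIV h (n, x) \<in> lev (n - k)" if r: "(n, x) \<in> range h"
  proof -
    obtain i where "(n, x) = h i" using r by blast
    then obtain m y where *: "(n, x) = h (m, y)" by (cases i) simp
    then have "m = n - k" using assms(2)[of m y] by (metis add_diff_cancel_right' fst_conv)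
    then show ?thesis using * assms(1) by simp
  qed
  then show "(if (n, x) \<in> range h then bas (inv_into UNIV h (n, x)) else 0) \<in> vs (lev (n + - k))" by auto
qed

end

section \<open>Complexes of projective modules as idempotents with a differential\<close>

text \<open>A projective module is the image of an idempotent matrix on a free module. All degrees
  are kept together: one basis \<open>bs\<close>, one idempotent \<open>pj\<close> and one total
  differential \<open>df\<close>.\<close>

record (overloaded) ('i, 'k) dgm =
  bs :: "'i set"
  pj :: "('i, 'k::ring) lin"
  df :: "('i, 'k) lin"

text \<open>Vectors and matrices over small bases have their entries in the corner, so it is the
  corner that has to be small rather than the coefficient type.\<close>

locale universe_ring = set_universe elts + corner e
  for elts :: "'v => 'v set" and e :: "'k::ring" +
  assumes small_corner: "small elts {a. a * e = a}"
begin

type_synonym ('w, 'l) dgc = "(int \<times> 'w, 'l) dgm"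

definition ok :: "('v, 'k) dgc => bool" where
  "ok X \<longleftrightarrow> pr (bs X) * pj X = pj X \<and> pj X * pr (bs X) = pj X \<and> pj X * pj X = pj X \<and>
     pj X * df X = df X \<and> df X * pj X = df X \<and> df X * df X = 0 \<and> dg 0 (pj X) \<and> dg 1 (df X)"

text \<open>With products nested to the right, an equation for \<open>a * b\<close> does not match
  in the middle of a product; this is the form that does.\<close>

lemma mult_rule: "a * b = c ==> a * (b * z) = c * (z :: 'a::semigroup_mult)"
  by (simp add: mult.assoc[symmetric])

lemma okD:
  assumes "ok X"
  shows "pr (bs X) * pj X = pj X" "pj X * pr (bs X) = pj X" "pj X * pj X = pj X"
    "pj X * df X = df X" "df X * pj X = df X" "df X * df X = 0" "dg 0 (pj X)" "dg 1 (df X)"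
    "pr (bs X) * df X = df X" "df X * pr (bs X) = df X"
    "pj X * eps = pj X" "df X * eps = df X" "eps * pj X = pj X" "eps * df X = df X"
proof -
  show *: "pr (bs X) * pj X = pj X" "pj X * pr (bs X) = pj X" "pj X * pj X = pj X"
    "pj X * df X = df X" "df X * pj X = df X" "df X * df X = 0" "dg 0 (pj X)" "dg 1 (df X)"
    using assms unfolding ok_def by auto
  show "pr (bs X) * df X = df X" "df X * pr (bs X) = df X" by (metis * mult.assoc)+
  then show "pj X * eps = pj X" "df X * eps = df X" "eps * pj X = pj X" "eps * df X = df X"
    using * pr_absorb_eps by (metis eps_central)+
qed

lemmas okr = okD(1-6,9-14) okD(1-6,9-14)[THEN mult_rule]

text \<open>The two equations for \<open>pj Y\<close> make \<open>X\<close> a direct summand in each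
  degree, with complement on the basis \<open>bs Y - bs X\<close>. The differential is constrained
  on one side only, so it may lead from the complement into \<open>X\<close>.\<close>

definition sub :: "('v, 'k) dgc => ('v, 'k) dgc => bool" where
  "sub X Y \<longleftrightarrow> bs X \<subseteq> bs Y \<and> pj Y * pr (bs X) = pj X \<and> pr (bs X) * pj Y = pj X \<and>
     df Y * pr (bs X) = df X"

lemma subD:
  assumes "sub X Y" "ok X"
  shows "bs X \<subseteq> bs Y" "pj Y * pr (bs X) = pj X" "pr (bs X) * pj Y = pj X"
    "df Y * pr (bs X) = df X" "pj Y * pj X = pj X" "pj X * pj Y = pj X" "df Y * pj X = df X"
    "pj Y * df X = df X" "df Y * df X = 0"
proof -
  show *: "bs X \<subseteq> bs Y" "pj Y * pr (bs X) = pj X" "pr (bs X) * pj Y = pj X" "df Y * pr (bs X) = df X"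
    using assms(1) unfolding sub_def by auto
  show a: "pj Y * pj X = pj X" "pj X * pj Y = pj X" "df Y * pj X = df X"
    by (metis * okD(1-5)[OF assms(2)] mult.assoc)+
  show "pj Y * df X = df X" by (metis a okD(4)[OF assms(2)] mult.assoc)
  show "df Y * df X = 0" by (metis a(3) okD(4,6)[OF assms(2)] mult.assoc)
qed

lemmas subr = subD(2-) subD(2-)[THEN mult_rule]

lemma sub_refl: "ok X ==> sub X X"
  unfolding sub_def by (simp add: okD)

lemma sub_trans:
  assumes "sub X Y" "sub Y Z" shows "sub X Z"
proof -
  have "pr (bs Y) * pr (bs X) = pr (bs X)" "pr (bs X) * pr (bs Y) = pr (bs X)"
    using assms(1) unfolding sub_def by (auto simp: inf.absorb2 inf.absorb1)
  note p = this this[THEN mult_rule]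
  have X: "bs X \<subseteq> bs Y" "pj Y * pr (bs X) = pj X" "pr (bs X) * pj Y = pj X" "df Y * pr (bs X) = df X"
    and Y: "bs Y \<subseteq> bs Z" "pj Z * pr (bs Y) = pj Y" "pr (bs Y) * pj Z = pj Y" "df Z * pr (bs Y) = df Y"
    using assms unfolding sub_def by auto
  have "pj Z * pr (bs X) = pj Z * pr (bs Y) * pr (bs X)" "df Z * pr (bs X) = df Z * pr (bs Y) * pr (bs X)"
    "pr (bs X) * pj Z = pr (bs X) * (pr (bs Y) * pj Z)"
    using p by (simp_all add: mult.assoc)
  then show ?thesis unfolding sub_def using X Y by simp
qed

text \<open>It expresses total acyclicity of \<open>Y/X\<close> without forming the quotient.
  Functionals have values in the free module on all of \<open>int \<times> 'v\<close>, where every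
  small free module has a copy; neither vectors nor functionals are assumed homogeneous.\<close>

definition rta :: "('v, 'k) dgc => ('v, 'k) dgc => bool" where
  "rta X Y \<longleftrightarrow>
    (\<forall>x. app (pj Y) x = x \<and> app (df Y) x \<in> vs (bs X) -->
       (\<exists>y. app (pj Y) y = y \<and> x - app (df Y) y \<in> vs (bs X))) \<and>
    (\<forall>f. f * pj Y = f \<and> f * pr (bs X) = 0 \<and> f * df Y = 0 -->
       (\<exists>g. g * pj Y = g \<and> g * pr (bs X) = 0 \<and> f = g * df Y))"

lemma rtaD1:
  assumes "rta X Y" "app (pj Y) x = x" "app (df Y) x \<in> vs (bs X)"
  obtains y where "app (pj Y) y = y" "x - app (df Y) y \<in> vs (bs X)"
  using assms unfolding rta_def by blast

lemma rtaD2: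
  assumes "rta X Y" "f * pj Y = f" "f * pr (bs X) = 0" "f * df Y = 0"
  obtains g where "g * pj Y = g" "g * pr (bs X) = 0" "f = g * df Y"
  using assms unfolding rta_def by blast

definition Kext :: "('v, 'k) dgc => ('v, 'k) dgc => bool" where
  "Kext X Y \<longleftrightarrow> ok X \<and> ok Y \<and> sml (bs X) \<and> sml (bs Y) \<and> sub X Y \<and> rta X Y"

lemma in_sub:
  assumes "sub X Y" "ok X" "x \<in> vs (bs X)" "app (pj Y) x = x"
  shows "app (pj X) x = x" "app (df Y) x = app (df X) x"
proof -
  have x: "app (pr (bs X)) x = x" using assms(3) unfolding vs_def by simp
  have "app (pj Y * pr (bs X)) x = app (pj X) x" "app (df Y * pr (bs X)) x = app (df X) x"
    using subD(2,4)[OF assms(1,2)] by simp_all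
  then show "app (pj X) x = x" "app (df Y) x = app (df X) x" using x assms(4) by simp_all
qed

lemma app_okr:
  assumes "ok X"
  shows "app (pj X) (app (pj X) x) = app (pj X) x" "app (pj X) (app (df X) x) = app (df X) x"
    "app (df X) (app (pj X) x) = app (df X) x" "app (df X) (app (df X) x) = 0"
    "app (pj X) x \<in> vs (bs X)" "app (df X) x \<in> vs (bs X)"
  using okD[OF assms] unfolding pr_absorb_left by (metis app_lin_simps(1,5))+

text \<open>A cycle is corrected modulo \<open>Y\<close> first and modulo \<open>X\<close>
  afterwards. A functional is solved on \<open>Y\<close> first; the remainder vanishes on
  \<open>Y\<close> and is solved on \<open>Z\<close>.\<close>

lemma rta_trans:
  assumes ok: "ok X" "ok Y" "ok Z" and s: "sub X Y" "sub Y Z" and r: "rta X Y" "rta Y Z"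
  shows "rta X Z"
  unfolding rta_def
proof (intro conjI allI impI)
  fix x assume x: "app (pj Z) x = x \<and> app (df Z) x \<in> vs (bs X)"
  then have "app (df Z) x \<in> vs (bs Y)" using vs_mono subD(1)[OF s(1) ok(1)] by blast
  then obtain y where y: "app (pj Z) y = y" "x - app (df Z) y \<in> vs (bs Y)"
    using rtaD1[OF r(2), of x] x by blast
  let ?x = "x - app (df Z) y"
  have "app (pj Z) ?x = ?x" using x by (simp add: app_okr[OF ok(3)])
  then have 1: "app (pj Y) ?x = ?x" "app (df Y) ?x = app (df Z) x"
    using in_sub[OF s(2) ok(2) y(2)] by (simp_all add: app_okr[OF ok(3)])
  then obtain y' where y': "app (pj Y) y' = y'" "?x - app (df Y) y' \<in> vs (bs X)"
    using rtaD1[OF r(1), of ?x] x by metis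
  have 2: "app (pj Z) y' = y'" "app (df Z) y' = app (df Y) y'"
    using y'(1) subD(5,7)[OF s(2) ok(2)] by (metis app_lin_simps(5))+
  show "\<exists>y. app (pj Z) y = y \<and> x - app (df Z) y \<in> vs (bs X)"
    by (rule exI[of _ "y + y'"]) (use y' 2 y(1) in \<open>simp add: algebra_simps\<close>)
next
  fix f assume f: "f * pj Z = f \<and> f * pr (bs X) = 0 \<and> f * df Z = 0"
  have 1: "f * pj Y * df Y = 0" using f subD(4,7)[OF s(2) ok(2)] okD[OF ok(2)]
    by (metis mult.assoc mult_zero_left)
  have 2: "f * pj Y * pr (bs X) = 0"
    using f subr(1)[OF s(1) ok(1)] okD[OF ok(1)] by (metis mult.assoc mult_zero_left)
  have 3: "f * pj Y * pj Y = f * pj Y" by (simp add: mult.assoc okD[OF ok(2)])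
  obtain g1 where g1: "g1 * pj Y = g1" "g1 * pr (bs X) = 0" "f * pj Y = g1 * df Y"
    using rtaD2[OF r(1) 3 2 1] by blast
  let ?f = "f - g1 * df Z"
  have 4: "?f * pr (bs Y) = 0"
  proof -
    have "f * pr (bs Y) = f * pj Y" using f subD(2)[OF s(2) ok(2)] by (metis mult.assoc)
    moreover have "g1 * df Z * pr (bs Y) = g1 * df Y" using subD(4)[OF s(2) ok(2)] by (metis mult.assoc)
    ultimately show ?thesis using g1(3) by (simp add: left_diff_distrib)
  qed
  have 5: "?f * pj Z = ?f" "?f * df Z = 0"
    using f by (simp_all add: left_diff_distrib mult.assoc okD[OF ok(3)])
  obtain g2 where g2: "g2 * pj Z = g2" "g2 * pr (bs Y) = 0" "?f = g2 * df Z"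
    using rtaD2[OF r(2) 5(1) 4 5(2)] by blast
  have "g1 * pj Z = g1" using g1(1) subD(6)[OF s(2) ok(2)] by (metis mult.assoc)
  moreover have "g2 * pr (bs X) = 0"
  proof -
    have "pr (bs Y) * pr (bs X) = pr (bs X)" using subD(1)[OF s(1) ok(1)] by (simp add: inf.absorb2)
    then have "g2 * pr (bs X) = g2 * pr (bs Y) * pr (bs X)" by (simp add: mult.assoc)
    then show ?thesis using g2(2) by simp
  qed
  ultimately show "\<exists>g. g * pj Z = g \<and> g * pr (bs X) = 0 \<and> f = g * df Z"
    using g1 g2 by (intro exI[of _ "g1 + g2"]) (simp add: algebra_simps)
qed

lemma Kext_trans: "Kext X Y ==> Kext Y Z ==> Kext X Z"
  unfolding Kext_def using sub_trans rta_trans by blast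

lemma KextD:
  assumes "Kext X Y"
  shows "ok X" "ok Y" "sml (bs X)" "sml (bs Y)" "sub X Y" "rta X Y"
  using assms unfolding Kext_def by auto

text \<open>Total acyclicity of a complex is total acyclicity relative to the zero subcomplex.\<close>

definition emp :: "('v, 'k) dgc" where
  "emp = \<lparr>bs = {}, pj = 0, df = 0\<rparr>"

abbreviation TA :: "('v, 'k) dgc => bool" where
  "TA T \<equiv> rta emp T"

lemma vs_empty [simp]: "x \<in> vs {} \<longleftrightarrow> x = 0"
  unfolding vs_def by auto

lemma TA_def': "TA T \<longleftrightarrow>
    (\<forall>x. app (pj T) x = x \<and> app (df T) x = 0 --> (\<exists>y. app (pj T) y = y \<and> x = app (df T) y)) \<and>
    (\<forall>f. f * pj T = f \<and> f * df T = 0 --> (\<exists>g. g * pj T = g \<and> f = g * df T))"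
  unfolding rta_def emp_def by simp

text \<open>The quotient is realised on the complementary basis with the compressed differential. As
  \<open>df Y\<close> is block triangular, compression to the complement keeps the square
  zero.\<close>

definition quo :: "('v, 'k) dgc => ('v, 'k) dgc => ('v, 'k) dgc" where
  "quo X Y = \<lparr>bs = bs Y - bs X, pj = pj Y - pj X, df = pr (- bs X) * df Y\<rparr>"

lemma quo_facts:
  assumes ok: "ok X" "ok Y" and s: "sub X Y"
  shows "pr (- bs X) * pj Y = pj Y - pj X" "pj Y * pr (- bs X) = pj Y - pj X"
    "pr (- bs X) * df X = 0" "pr (- bs X) * pj X = 0" "pj X * pr (- bs X) = 0"
    "df Y * pr (- bs X) = df Y - df X" "df X * pr (- bs X) = 0"
proof -
  show "pr (- bs X) * pj Y = pj Y - pj X" "pj Y * pr (- bs X) = pj Y - pj X"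
    "df Y * pr (- bs X) = df Y - df X"
    unfolding pr_Compl using subD[OF s ok(1)] okD[OF ok(2)]
    by (simp_all add: left_diff_distrib right_diff_distrib)
  show "pr (- bs X) * df X = 0" "pr (- bs X) * pj X = 0" "pj X * pr (- bs X) = 0" "df X * pr (- bs X) = 0"
    unfolding pr_Compl using okD[OF ok(1)] by (simp_all add: left_diff_distrib right_diff_distrib)
qed

lemma ok_quo:
  assumes ok: "ok X" "ok Y" and s: "sub X Y" shows "ok (quo X Y)"
proof -
  note q = quo_facts[OF ok s] quo_facts[OF ok s, THEN mult_rule]
  note r = okr[OF ok(1)] okr[OF ok(2)] subr[OF s ok(1)]
  have 1: "pr (bs Y - bs X) * pj Y = pj Y - pj X" "pj Y * pr (bs Y - bs X) = pj Y - pj X"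
    using subD(1)[OF s ok(1)] r by (simp_all add: pr_Diff left_diff_distrib right_diff_distrib)
  have 2: "pr (bs Y - bs X) * pj X = 0" "pj X * pr (bs Y - bs X) = 0"
    using subD(1)[OF s ok(1)] r pr_mono_left[OF okD(1)[OF ok(1)]] pr_mono_right[OF okD(2)[OF ok(1)]]
    by (simp_all add: pr_Diff left_diff_distrib right_diff_distrib)
  have 3: "pj Y * (pr (- bs X) * df Y) = pr (- bs X) * df Y + pj Y * 0"
  proof -
    have "pj Y * (pr (- bs X) * df Y) = pr (- bs X) * (pj Y * df Y)"
      using q(1)[symmetric] q(2) by (simp add: mult.assoc[symmetric])
    then show ?thesis using okD(4)[OF ok(2)] by simp
  qed
  have 4: "pj X * (pr (- bs X) * df Y) = 0" using q by simp
  have 5: "df Y * (pr (- bs X) * df Y) = - df X * df Y"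
  proof -
    have "df Y * (pr (- bs X) * df Y) = (df Y - df X) * df Y" using q(6) by (simp add: mult.assoc[symmetric])
    then show ?thesis using okD(6)[OF ok(2)] by (simp add: left_diff_distrib)
  qed
  show ?thesis
    unfolding ok_def quo_def
    using 1 2 3 4 5 q r okD(7,8)[OF ok(1)] okD(7,8)[OF ok(2)]
    by (auto simp: left_diff_distrib right_diff_distrib mult.assoc intro!: dg_diff dg_mult[of 0 _ 1])
qed

text \<open>A vector of the complement is a cycle of the quotient exactly if its boundary in
  \<open>Y\<close> falls into \<open>X\<close>, which is the form in which \<open>rta\<close> can be
  applied.\<close>

lemma TA_quo:
  assumes ok: "ok X" "ok Y" and s: "sub X Y" and r: "rta X Y" shows "TA (quo X Y)"
  unfolding TA_def'
proof (intro conjI allI impI)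
  let ?Q = "quo X Y"
  note q = quo_facts[OF ok s]
  fix x assume x: "app (pj ?Q) x = x \<and> app (df ?Q) x = 0"
  have px: "app (pj Y) x = x"
    using x q(2) okD(3)[OF ok(2)] subD(5)[OF s ok(1)] unfolding quo_def
    by (metis (no_types, lifting) app_lin_simps(5) dgm.select_convs(2) right_diff_distrib)
  have "app (df Y) x \<in> vs (bs X)"
  proof -
    have "rscale (app (df Y) x) e - app (pr (bs X)) (app (df Y) x) = 0"
      using x unfolding quo_def by (simp add: pr_Compl)
    moreover have "rscale (app (df Y) x) e = app (df Y) x" using app_okr(6)[OF ok(2), of x] by (simp add: vs_iff)
    ultimately show ?thesis by (simp add: vs_def)
  qed
  then obtain y where y: "app (pj Y) y = y" "x - app (df Y) y \<in> vs (bs X)" using rtaD1[OF r px] by blast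
  let ?y = "app (pr (- bs X)) y"
  have a: "app (pr (- bs X)) z = 0" if "z \<in> vs (bs X)" for z
  proof -
    have z: "app (pr (bs X)) z = z" using that unfolding vs_def by simp
    have "app (pr (- bs X)) (app (pr (bs X)) z) = 0" unfolding app_pr_pr by simp
    then show ?thesis unfolding z .
  qed
  have px': "app (pr (- bs X)) x = x"
  proof -
    have "pr (- bs X) * pj ?Q = pj ?Q" unfolding quo_def using q by (simp add: right_diff_distrib)
    then show ?thesis using x by (metis app_lin_simps(5))
  qed
  have "app (pj ?Q) ?y = ?y"
  proof -
    have "pj ?Q * pr (- bs X) * pj Y = pr (- bs X) * pj Y" unfolding quo_def
      by (simp add: mult.assoc q(1) left_diff_distrib right_diff_distrib
          okr[OF ok(1)] okr[OF ok(2)] subr[OF s ok(1)])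
    then show ?thesis using y(1) by (metis app_lin_simps(5))
  qed
  moreover have "x = app (df ?Q) ?y"
  proof -
    have "df Y * pr (- bs X) = df Y - df X" by (rule q)
    then have "app (df Y) ?y = app (df Y) y - app (df X) y" by (metis app_lin_simps(3,5))
    moreover have "app (pr (- bs X)) (app (df X) y) = 0" using a app_okr(6)[OF ok(1)] by blast
    moreover have "app (pr (- bs X)) (x - app (df Y) y) = 0" using a y(2) by blast
    ultimately show ?thesis unfolding quo_def using px' by simp
  qed
  ultimately show "\<exists>y. app (pj ?Q) y = y \<and> x = app (df ?Q) y" by blast
next
  let ?Q = "quo X Y"
  note q = quo_facts[OF ok s]
  fix f assume f: "f * pj ?Q = f \<and> f * df ?Q = 0"
  have "pj ?Q * pr (bs X) = 0" unfolding quo_def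
    using okr[OF ok(1)] subr[OF s ok(1)] by (simp add: left_diff_distrib)
  then have "f * pj ?Q * pr (bs X) = 0" by (simp add: mult.assoc)
  then have 1: "f * pr (bs X) = 0" using f by simp
  have "pj ?Q * pj Y = pj ?Q" unfolding quo_def
    using okr[OF ok(2)] subr[OF s ok(1)] by (simp add: left_diff_distrib)
  then have "f * pj ?Q * pj Y = f * pj ?Q" by (simp add: mult.assoc)
  then have 2: "f * pj Y = f" using f by simp
  have "f * pj Y * eps = f * pj Y" using okD(11)[OF ok(2)] by (simp add: mult.assoc)
  then have f0: "f * pr (- bs X) = f" using 1 2 unfolding pr_Compl by (simp add: right_diff_distrib)
  have "f * df Y = f * pr (- bs X) * df Y" using f0 by simp
  then have 3: "f * df Y = 0" using f unfolding quo_def by (simp add: mult.assoc)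
  obtain g where g: "g * pj Y = g" "g * pr (bs X) = 0" "f = g * df Y" using rtaD2[OF r 2 1 3] by blast
  have "g * pj Y * eps = g * pj Y" using okD(11)[OF ok(2)] by (simp add: mult.assoc)
  then have g0: "g * pr (- bs X) = g" using g(1,2) unfolding pr_Compl by (simp add: right_diff_distrib)
  have "g * pj X = 0" using g(2) okD(1)[OF ok(1)] by (metis mult.assoc mult_zero_left)
  then have "g * pj ?Q = g" "f = g * df ?Q"
    using g g0 unfolding quo_def by (simp_all add: right_diff_distrib mult.assoc[symmetric])
  then show "\<exists>g. g * pj ?Q = g \<and> f = g * df ?Q" by blast
qed

section \<open>Morphisms and homotopies\<close>

definition hom :: "('v, 'k) dgc => ('v, 'k) dgc => (int \<times> 'v, 'k) lin => bool" where
  "hom X Y f \<longleftrightarrow> f * pj X = f \<and> pj Y * f = f \<and> df Y * f = f * df X \<and> dg 0 f"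

definition null :: "('v, 'k) dgc => ('v, 'k) dgc => (int \<times> 'v, 'k) lin => bool" where
  "null X Y f \<longleftrightarrow> (\<exists>s. s * pj X = s \<and> pj Y * s = s \<and> dg (- 1) s \<and> f = df Y * s + s * df X)"

lemma homD:
  assumes "hom X Y f" shows "f * pj X = f" "pj Y * f = f" "df Y * f = f * df X" "dg 0 f"
  using assms unfolding hom_def by auto

lemma hom_comp: "hom X Y f ==> hom Y Z g ==> hom X Z (g * f)"
  unfolding hom_def by (auto intro: dg_mult) (metis mult.assoc)+

lemma hom_diff: "hom X Y f ==> hom X Y g ==> hom X Y (f - g)"
  unfolding hom_def by (auto simp: algebra_simps intro: dg_diff)

lemma hom_id: "ok X ==> hom X X (pj X)"
  unfolding hom_def by (auto simp: okD)

lemma hom_sub: "hom S X f ==> sub X Y ==> ok X ==> hom S Y f"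
proof -
  assume f: "hom S X f" and s: "sub X Y" and o: "ok X"
  have "pj Y * (pj X * f) = pj X * f" "df Y * (pj X * f) = df X * f" using subr[OF s o] by simp_all
  then show ?thesis unfolding hom_def using homD[OF f] by simp
qed

lemma hom_incl: "sub X Y ==> ok X ==> hom X Y (pj X)"
  using hom_sub hom_id by blast

lemma null_zero: "null X Y 0"
  unfolding null_def by (intro exI[of _ 0]) simp

lemma null_diff:
  assumes "null X Y f" "null X Y g" shows "null X Y (f - g)"
proof -
  obtain s t where "s * pj X = s \<and> pj Y * s = s \<and> dg (- 1) s \<and> f = df Y * s + s * df X"
    "t * pj X = t \<and> pj Y * t = t \<and> dg (- 1) t \<and> g = df Y * t + t * df X"
    using assms unfolding null_def by blast
  then show ?thesis
    unfolding null_def by (intro exI[of _ "s - t"]) (auto simp: algebra_simps intro!: dg_diff)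
qed

lemma null_uminus: "null X Y f ==> null X Y (- f)"
  using null_diff[OF null_zero] by fastforce

lemma null_add: "null X Y f ==> null X Y g ==> null X Y (f + g)"
  using null_diff[OF _ null_uminus] by fastforce

lemma null_comp_left:
  assumes "null X Y f" "hom Y Z g" shows "null X Z (g * f)"
proof -
  obtain s where s: "s * pj X = s" "pj Y * s = s" "dg (- 1) s" "f = df Y * s + s * df X"
    using assms unfolding null_def by blast
  have "g * f = df Z * (g * s) + (g * s) * df X"
    using homD(3)[OF assms(2), THEN mult_rule] s(4) by (simp add: algebra_simps)
  moreover have "dg (- 1) (g * s)" using dg_mult[OF homD(4)[OF assms(2)] s(3)] by simp
  ultimately show ?thesis
    unfolding null_def using s(1) homD(2)[OF assms(2)]
    by (intro exI[of _ "g * s"]) (simp add: mult.assoc[symmetric], simp add: mult.assoc)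
qed

lemma null_comp_right:
  assumes "null X Y f" "hom W X g" shows "null W Y (f * g)"
proof -
  obtain s where s: "s * pj X = s" "pj Y * s = s" "dg (- 1) s" "f = df Y * s + s * df X"
    using assms unfolding null_def by blast
  have "f * g = df Y * (s * g) + (s * g) * df W"
    using homD(3)[OF assms(2)] s(4) by (simp add: algebra_simps)
  moreover have "dg (- 1) (s * g)" using dg_mult[OF s(3) homD(4)[OF assms(2)]] by simp
  ultimately show ?thesis
    unfolding null_def using s(2) homD(1)[OF assms(2)]
    by (intro exI[of _ "s * g"]) (simp add: mult.assoc, simp add: mult.assoc[symmetric])
qed

lemma null_sub:
  assumes "null S X f" "sub X Y" "ok X" shows "null S Y f"
proof -
  obtain s where s: "s * pj S = s" "pj X * s = s" "dg (- 1) s" "f = df X * s + s * df S"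
    using assms unfolding null_def by blast
  have "pj Y * s = s" "df Y * s = df X * s" using s(2) subD(5,7)[OF assms(2,3)] by (metis mult.assoc)+
  then show ?thesis unfolding null_def using s by metis
qed

text \<open>Up to homotopy \<open>T\<close> is a retract of \<open>S\<close>. A cycle is taken to
  \<open>S\<close> by \<open>b\<close>, bounded there and brought back by \<open>a\<close>, and the
  homotopy \<open>s\<close> corrects the bounding element; functionals travel the opposite
  way.\<close>

lemma TA_retract:
  assumes ok: "ok S" "ok T" and a: "hom S T a" and b: "hom T S b" and n: "null T T (a * b - pj T)" and t: "TA S"
  shows "TA T"
proof -
  obtain s where s: "s * pj T = s" "pj T * s = s" "a * b - pj T = df T * s + s * df T"
    using n unfolding null_def by blast
  then have ab: "a * b = pj T + df T * s + s * df T" by (simp add: algebra_simps)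
  note t = t[unfolded TA_def']
  show ?thesis unfolding TA_def'
  proof (intro conjI allI impI)
    fix x assume x: "app (pj T) x = x \<and> app (df T) x = 0"
    have "app (pj S) (app b x) = app b x" "app (df S) (app b x) = app b (app (df T) x)"
      using homD(2,3)[OF b] by (metis app_lin_simps(5))+
    then obtain y where y: "app (pj S) y = y" "app b x = app (df S) y" using t x by auto
    have "app a (app (df S) y) = app (df T) (app a y)" using homD(3)[OF a] by (metis app_lin_simps(5))
    then have "app (a * b) x = app (df T) (app a y)" using y by simp
    then have "x = app (df T) (app a y - app s x)" unfolding ab using x by (simp add: algebra_simps)
    moreover have "app (pj T) (app a y - app s x) = app a y - app s x"
      using homD(2)[OF a] s(2) by simp (metis app_lin_simps(5))
    ultimately show "\<exists>y. app (pj T) y = y \<and> x = app (df T) y" by blast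
  next
    fix f assume f: "f * pj T = f \<and> f * df T = 0"
    have "f * a * pj S = f * a" "f * a * df S = 0"
      using homD(1)[OF a] homD(3)[OF a, symmetric] f by (simp_all add: mult.assoc)
        (simp add: mult.assoc[symmetric])
    then obtain g where g: "g * pj S = g" "f * a = g * df S" using t by blast
    have "f * (a * b) = g * df S * b" using g(2) by (simp add: mult.assoc[symmetric])
    also have "\<dots> = g * b * df T" using homD(3)[OF b] by (simp add: mult.assoc)
    finally have "f * (a * b) = g * b * df T" .
    moreover have "f * (a * b) = f + f * s * df T"
      unfolding ab using f by (simp add: algebra_simps) (simp add: mult.assoc[symmetric])
    ultimately have "f = (g * b - f * s) * df T" by (simp add: algebra_simps)
    moreover have "(g * b - f * s) * pj T = g * b - f * s"
      using homD(1)[OF b] s(1) by (simp add: left_diff_distrib mult.assoc)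
    ultimately show "\<exists>g. g * pj T = g \<and> f = g * df T" by blast
  qed
qed

end

section \<open>Attaching totally acyclic complexes\<close>

context universe_ring
begin

text \<open>Degree shift and tag are applied together, since a mapping cone needs a shifted copy
  that is disjoint from a given basis.\<close>

definition tagm :: "int => 'v => int \<times> 'v => int \<times> 'v" where
  "tagm k t = (\<lambda>(n, x). (n + k, cpair t x))"

lemma tagm_simps [simp]: "inj (tagm k t)" "fst (tagm k t i) = fst i + k"
  "tagm k t (n, x) = (n + k, cpair t x)"
  unfolding tagm_def by (auto simp: inj_def case_prod_unfold prod_eq_iff)

lemma dg_tagm [simp]: "dg k (reloc (tagm k t))" "dg (- k) (coreloc (tagm k t))"
  by (auto intro!: dg_reloc dg_coreloc)

lemma pr_disjoint_reloc: "B \<inter> range h = {} ==> pr B * reloc h = 0"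
  by (rule lin_eq_basI) (auto simp: mult.assoc pr_bas)

lemma coreloc_disjoint_pr: "inj h ==> B \<inter> range h = {} ==> coreloc h * pr B = 0"
  by (rule lin_eq_basI) (auto simp: mult.assoc pr_bas coreloc_bas)

lemma pr_reloc_vimage: "pr B * reloc h = reloc h * pr (h -` B)"
  by (rule lin_eq_basI) (auto simp: mult.assoc pr_bas)

text \<open>\<open>C'\<close> is the mapping cone of \<open>u\<close>: a shifted copy of
  \<open>T\<close> with negative differential is added to \<open>C\<close>, and \<open>u\<close>
  leads from it into \<open>C\<close>. The quotient is a shift of \<open>T\<close>, and the
  inclusion of the copy is a null-homotopy of \<open>u\<close>.\<close>

lemma Kext_cone:
  assumes C: "ok C" "sml (bs C)" and T: "ok T" "sml (bs T)" "TA T" and u: "hom T C u"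
  shows "\<exists>C'. Kext C C' \<and> null T C' u"
proof -
  obtain t where t: "\<And>n y. (n, cpair t y) \<notin> bs C" using fresh_tag[OF C(2)] by blast
  \<comment> \<open>The copy lies one degree lower, so that \<open>u * c\<close> has degree 1 and
    can enter the differential.\<close>
  let ?h = "tagm (- 1) t"
  have dis: "bs C \<inter> range ?h = {}" using t by (auto simp: tagm_def)
  define r where "r = (reloc ?h :: (int \<times> 'v, 'k) lin)"
  define c where "c = (coreloc ?h :: (int \<times> 'v, 'k) lin)"
  define q where "q = pr (bs C)"
  have cr: "c * r = eps" unfolding c_def r_def by (rule coreloc_reloc) simp
  have e: "r * eps = r" "eps * c = c" unfolding c_def r_def by simp_all
  have qr: "q * r = 0" unfolding q_def r_def by (rule pr_disjoint_reloc[OF dis])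
  have cq: "c * q = 0" unfolding q_def c_def by (rule coreloc_disjoint_pr[OF _ dis]) simp
  have dgr: "dg (- 1) r" "dg 1 c" unfolding r_def c_def using dg_tagm[of "- 1" t] by simp_all
  have qq: "q * pj C = pj C" "pj C * q = pj C" "q * df C = df C" "df C * q = df C" "q * u = u"
  proof -
    show "q * pj C = pj C" "pj C * q = pj C" "q * df C = df C" "df C * q = df C"
      unfolding q_def using okD[OF C(1)] by auto
    have "q * pj C * u = pj C * u" unfolding q_def using okD(1)[OF C(1)] by simp
    then show "q * u = u" using homD(2)[OF u] by (simp add: mult.assoc)
  qed
  have z: "pj C * r = 0" "df C * r = 0" "c * pj C = 0" "c * df C = 0" "c * u = 0"
  proof -
    have "pj C * q * r = 0" "df C * q * r = 0" by (simp_all only: mult.assoc qr mult_zero_right)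
    then show "pj C * r = 0" "df C * r = 0" by (simp_all only: qq)
    have "c * q * pj C = 0" "c * q * df C = 0" "c * q * u = 0" by (simp_all only: cq mult_zero_left)
    then show "c * pj C = 0" "c * df C = 0" "c * u = 0" by (simp_all only: qq mult.assoc)
  qed
  have er: "eps * pj T = pj T" "eps * df T = df T" using okD[OF T(1)] by auto
  note rules = cr cr[THEN mult_rule] z z[THEN mult_rule] okr[OF C(1)] okr[OF T(1)]
    homD(1-3)[OF u] homD(1-3)[OF u, THEN mult_rule] er er[THEN mult_rule]
  define C' where "C' = \<lparr>bs = bs C \<union> ?h ` bs T, pj = pj C + r * pj T * c,
     df = df C + u * c - r * df T * c\<rparr>"
  have hT: "pr (?h ` bs T) * r = r * pr (bs T)" "c * pr (?h ` bs T) = pr (bs T) * c"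
    unfolding r_def c_def by (simp_all add: pr_reloc coreloc_pr)
  have b1: "pr (bs C') * pj C = pj C" "pj C * pr (bs C') = pj C"
    using pr_mono_left[OF okD(1)[OF C(1)], of "bs C'"] pr_mono_right[OF okD(2)[OF C(1)], of "bs C'"]
    unfolding C'_def by auto
  have b2: "pr (bs C') * (r * pj T * c) = r * pj T * c" "(r * pj T * c) * pr (bs C') = r * pj T * c"
  proof -
    have *: "pr (?h ` bs T) * (r * pj T * c) = r * pj T * c" "(r * pj T * c) * pr (?h ` bs T) = r * pj T * c"
      using hT[THEN mult_rule] hT by (simp_all add: mult.assoc okr[OF T(1)])
    show "pr (bs C') * (r * pj T * c) = r * pj T * c" "(r * pj T * c) * pr (bs C') = r * pj T * c"
      using pr_mono_left[OF *(1)] pr_mono_right[OF *(2)] unfolding C'_def by auto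
  qed
  have ok': "ok C'"
    unfolding ok_def
  proof (intro conjI)
    show "pr (bs C') * pj C' = pj C'" "pj C' * pr (bs C') = pj C'"
      using b1 b2 by (simp_all add: C'_def distrib_left distrib_right)
    show "pj C' * pj C' = pj C'" "pj C' * df C' = df C'" "df C' * pj C' = df C'" "df C' * df C' = 0"
      unfolding C'_def by (simp_all add: algebra_simps rules)
    show "dg 0 (pj C')" "dg 1 (df C')"
    proof -
      have "dg 0 (r * pj T * c)" "dg 1 (r * df T * c)" "dg 1 (u * c)"
        using dg_mult[OF dg_mult[OF dgr(1) okD(7)[OF T(1)] refl] dgr(2) refl]
          dg_mult[OF dg_mult[OF dgr(1) okD(8)[OF T(1)] refl] dgr(2) refl]
          dg_mult[OF homD(4)[OF u] dgr(2) refl] by simp_all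
      then show "dg 0 (pj C')" "dg 1 (df C')"
        unfolding C'_def using okD(7,8)[OF C(1)] by (auto intro: dg_add dg_diff)
    qed
  qed
  have sub': "sub C C'"
  proof -
    have qp: "c * pr (bs C) = 0" "pr (bs C) * r = 0" using cq qr unfolding q_def by auto
    show ?thesis unfolding sub_def C'_def
      by (simp add: distrib_left distrib_right left_diff_distrib right_diff_distrib mult.assoc
          okr[OF C(1)] qp qp[THEN mult_rule])
  qed
  have "rta C C'"
    unfolding rta_def
  proof (intro conjI allI impI)
    fix x assume x: "app (pj C') x = x \<and> app (df C') x \<in> vs (bs C)"
    have "app (c * q) y = 0" for y unfolding cq by simp
    then have c0: "app c y = 0" if "y \<in> vs (bs C)" for y
      using that unfolding q_def vs_def by simp (metis)
    have 1: "c * pj C' = pj T * c" "c * df C' = - (df T * c)"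
      unfolding C'_def by (simp_all add: algebra_simps rules)
    have "app (pj T) (app c x) = app c x" using x 1(1) by (metis app_lin_simps(5))
    moreover have "app (df T) (app c x) = 0"
      using c0[of "app (df C') x"] x app_cong[OF 1(2), of x] by simp
    ultimately obtain y where y: "app (pj T) y = y" "app c x = app (df T) y"
      using T(3) unfolding TA_def' by blast
    \<comment> \<open>The sign compensates for the negative differential on the copy of
      \<open>T\<close>.\<close>
    let ?y = "- app r y"
    have 2: "pj C' * r = r * pj T" "df C' * r = u - r * df T"
      unfolding C'_def by (simp_all add: algebra_simps rules) (use homD(1)[OF u] er okD(11)[OF T(1)] in \<open>metis mult.assoc\<close>)
    have "app (pj C') ?y = ?y" using y(1) app_cong[OF 2(1), of y] by simp
    moreover have "x - app (df C') ?y \<in> vs (bs C)"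
    proof -
      have "app (df C') (app r y) = app u y - app r (app (df T) y)"
        using app_cong[OF 2(2), of y] by simp
      moreover have "app (df T) y = app (pj T) (app c x)"
        unfolding y(2)[symmetric] using x 1(1) by (metis app_lin_simps(5))
      moreover have "x - app r (app (pj T) (app c x)) = app (pj C) x"
      proof -
        have "app (pj C') x = app (pj C) x + app r (app (pj T) (app c x))" unfolding C'_def by simp
        then show ?thesis using x by (metis add_diff_cancel_right')
      qed
      moreover have "x - app (df C') ?y = x + (app u y - app r (app (df T) y))" using calculation(1) by simp
      ultimately have "x - app (df C') ?y = (x - app r (app (pj T) (app c x))) + app u y" by simp
      then have "x - app (df C') ?y = app (pj C) x + app u y"
        unfolding \<open>x - app r (app (pj T) (app c x)) = app (pj C) x\<close> .
      moreover have "app u y \<in> vs (bs C)" using qq(5) unfolding q_def pr_absorb_left by blast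
      ultimately show ?thesis using app_okr(5)[OF C(1)] by simp
    qed
    ultimately show "\<exists>y. app (pj C') y = y \<and> x - app (df C') y \<in> vs (bs C)" by blast
  next
    fix f assume f: "f * pj C' = f \<and> f * pr (bs C) = 0 \<and> f * df C' = 0"
    have fq: "f * q = 0" using f unfolding q_def by simp
    have f0: "f * pj C = 0" "f * u = 0" "f * df C = 0"
      using fq qq(1,3,5) by (metis mult.assoc mult_zero_left)+
    \<comment> \<open>A functional that vanishes on \<open>C\<close> is determined by its
      restriction to the copy, that is, by a functional on \<open>T\<close>.\<close>
    have f1: "f = f * r * pj T * c"
    proof -
      have "f = f * pj C'" using f by simp
      then show ?thesis unfolding C'_def by (simp add: distrib_left f0 mult.assoc)
    qed
    have "f * r * df T = 0"
    proof -
      have "0 = f * df C' * r" using f by simp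
      also have "\<dots> = - (f * r * df T)" unfolding C'_def
        by (simp add: algebra_simps rules f0 f0[THEN mult_rule])
      finally show ?thesis by simp
    qed
    then have "f * r * pj T * pj T = f * r * pj T" "f * r * pj T * df T = 0"
      by (simp_all add: mult.assoc okr[OF T(1)])
    then obtain g where g: "g * pj T = g" "f * r * pj T = g * df T" using T(3) unfolding TA_def' by blast
    let ?g = "- (g * c)"
    have "?g * pj C' = ?g" unfolding C'_def by (simp add: algebra_simps rules g(1) g(1)[THEN mult_rule])
    moreover have "?g * pr (bs C) = 0" using cq unfolding q_def by (simp add: mult.assoc)
    moreover have "f = ?g * df C'"
    proof -
      have "?g * df C' = g * df T * c" unfolding C'_def by (simp add: algebra_simps rules)
      then show ?thesis using f1 g(2) by simp
    qed
    ultimately show "\<exists>g. g * pj C' = g \<and> g * pr (bs C) = 0 \<and> f = g * df C'" by blast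
  qed
  moreover have "sml (bs C')" unfolding C'_def using small_Un small_image C(2) T(2) by auto
  ultimately have K: "Kext C C'" unfolding Kext_def using ok' sub' C by blast
  have "null T C' u"
    unfolding null_def
  proof (intro exI[of _ "r * pj T"] conjI)
    show "r * pj T * pj T = r * pj T" by (simp add: mult.assoc okD[OF T(1)])
    show "pj C' * (r * pj T) = r * pj T" unfolding C'_def by (simp add: algebra_simps rules)
    show "dg (- 1) (r * pj T)" using dg_mult[OF dgr(1) okD(7)[OF T(1)]] by simp
    show "u = df C' * (r * pj T) + r * pj T * df T" unfolding C'_def by (simp add: algebra_simps rules)
  qed
  then show ?thesis using K by blast
qed

text \<open>Row vectors of endomorphisms, indexed by the second tag of a basis element.\<close>

definition sel :: "'v => 'v => int \<times> 'v => int \<times> 'v" where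
  "sel t i = (\<lambda>(n, x). (n, cpair t (cpair i x)))"

definition rsum :: "'v => ('v => (int \<times> 'v, 'k) lin) => (int \<times> 'v, 'k) lin" where
  "rsum t a = ext (\<lambda>j. if \<exists>i p. j = sel t i p
     then (let (i, p) = (SOME (i, p). j = sel t i p) in app (a i) (bas p)) else 0)"

lemma sel_eq [simp]: "sel t i p = sel t i' p' \<longleftrightarrow> i = i' \<and> p = p'"
  unfolding sel_def by (auto simp: case_prod_unfold prod_eq_iff)

lemma inj_sel [simp]: "inj (sel t i)"
  by (auto simp: inj_def)

lemma fst_sel [simp]: "fst (sel t i p) = fst p"
  unfolding sel_def by (simp add: case_prod_unfold)

definition selr :: "'v => (int \<times> 'v) set" where
  "selr t = {sel t i p | i p. True}"

lemma app_rsum_sel: "app (rsum t a) (bas (sel t i p)) = app (a i) (bas p)"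
proof -
  have "(SOME (i', p'). sel t i p = sel t i' p') = (i, p)" by (rule some_equality) auto
  then show ?thesis unfolding rsum_def app_ext_bas by (auto simp flip: app_rscale)
qed

lemma app_rsum_other: "j \<notin> selr t ==> app (rsum t a) (bas j) = 0"
  unfolding rsum_def app_ext_bas selr_def by auto

lemma rsum_eps [simp]: "rsum t a * eps = rsum t a" "eps * rsum t a = rsum t a"
  unfolding rsum_def by simp_all

lemma rsum_eqI:
  assumes "f * eps = f" "g * eps = g" "\<And>i. f * reloc (sel t i) = g * reloc (sel t i)"
    "f * pr (- selr t) = g * pr (- selr t)"
  shows "f = g"
proof (rule lin_eq_basI[OF assms(1,2)])
  fix j
  show "app f (bas j) = app g (bas j)"
  proof (cases "j \<in> selr t")
    case True
    then obtain i p where "j = sel t i p" unfolding selr_def by blast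
    then show ?thesis using app_cong[OF assms(3)[of i], of "bas p"] by simp
  next
    case False
    then show ?thesis using app_cong[OF assms(4), of "bas j"] by (simp add: pr_bas)
  qed
qed

lemma rsum_reloc [simp]: "rsum t a * reloc (sel t i) = a i * eps"
  by (rule lin_eq_basI) (simp_all add: mult.assoc app_rsum_sel flip: app_rscale)

lemma rsum_pr_disjoint: "B \<inter> selr t = {} ==> rsum t a * pr B = 0"
  by (rule lin_eq_basI) (auto simp: mult.assoc pr_bas intro!: app_rsum_other)

lemma reloc_sel_zero: "B \<inter> selr t = {} ==> pr B * reloc (sel t i) = 0"
  by (rule pr_disjoint_reloc) (auto simp: selr_def)

lemma coreloc_sel_zero: "B \<inter> selr t = {} ==> coreloc (sel t i) * pr B = 0"
  by (rule coreloc_disjoint_pr) (auto simp: selr_def)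

lemma coreloc_sel_reloc: "coreloc (sel t i) * reloc (sel t k) = (if i = k then eps else 0)"
proof (cases "i = k")
  case False
  then have "range (sel t i) \<inter> range (sel t k) = {}" by auto
  then show ?thesis using False by (simp add: coreloc_reloc_disjoint)
qed (simp add: coreloc_reloc)

lemma rsum_left: "f * rsum t a = rsum t (\<lambda>i. f * a i)"
proof (rule rsum_eqI[of _ _ t])
  show "f * rsum t a * eps = f * rsum t a" by (simp add: mult.assoc)
  show "f * rsum t a * reloc (sel t i) = rsum t (\<lambda>i. f * a i) * reloc (sel t i)" for i
    by (simp add: mult.assoc)
  show "f * rsum t a * pr (- selr t) = rsum t (\<lambda>i. f * a i) * pr (- selr t)"
    using rsum_pr_disjoint[of "- selr t" t] by (simp add: mult.assoc)
qed simp

lemma rsum_cong: "(\<And>i. a i = b i) ==> rsum t a = rsum t b"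
  by presburger

lemma rsum_zero: "rsum t (\<lambda>i. 0) = 0"
  by (rule rsum_eqI[of _ _ t]) (auto simp: rsum_pr_disjoint)

lemma rsum_pr:
  assumes "\<And>i. a i * pr (sel t i -` B) = a i * eps" shows "rsum t a * pr B = rsum t a"
proof (rule rsum_eqI[of _ _ t])
  show "rsum t a * pr B * reloc (sel t i) = rsum t a * reloc (sel t i)" for i
    using assms[of i] by (simp add: mult.assoc pr_reloc_vimage)
       (simp add: mult.assoc[symmetric], simp add: mult.assoc)
  have 0: "rsum t a * pr (- selr t) = 0" by (rule rsum_pr_disjoint) simp
  moreover have "rsum t a * pr B * pr (- selr t) = rsum t a * pr (- selr t) * pr B"
    by (simp add: mult.assoc Int_commute)
  ultimately show "rsum t a * pr B * pr (- selr t) = rsum t a * pr (- selr t)" by simp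
qed (simp_all add: mult.assoc)

lemma dg_rsum:
  assumes "\<And>i. dg k (a i)" shows "dg k (rsum t a)"
proof (rule dg_basI)
  fix n x
  show "app (rsum t a) (bas (n, x)) \<in> vs (lev (n + k))"
  proof (cases "(n, x) \<in> selr t")
    case True
    then obtain i p where p: "(n, x) = sel t i p" unfolding selr_def by blast
    then have "fst p = n" using fst_sel by (metis fst_conv)
    then have "bas p \<in> vs (lev n)" by (auto simp: mem_Times_iff)
    then show ?thesis unfolding p app_rsum_sel using dg_vs[OF assms[of i]] by simp
  qed (simp add: app_rsum_other)
qed simp

text \<open>\<open>C'\<close> is the amalgamated sum of the \<open>D i\<close> over
  \<open>C\<close>: one copy of the basis of \<open>C\<close> and a separately tagged copy of each
  complement. Its quotient by \<open>C\<close> is the direct sum of the quotients of the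
  \<open>D i\<close>, so total acyclicity is checked block by block.\<close>

lemma Kext_amalgam:
  fixes D :: "'v => ('v, 'k) dgc"
  assumes C: "ok C" "sml (bs C)" and J: "sml J" and D: "\<And>i. i \<in> J ==> Kext C (D i)"
  shows "\<exists>C'. Kext C C' \<and> (\<forall>i\<in>J. \<exists>j. hom (D i) C' j \<and> j * pr (bs C) = pj C)"
proof -
  obtain t where t: "\<And>n y. (n, cpair t y) \<notin> bs C" using fresh_tag[OF C(2)] by blast
  have dis: "bs C \<inter> selr t = {}" using t by (auto simp: selr_def sel_def)
  define q where "q = pr (bs C)"
  define q' where "q' = pr (- bs C)"
  define r where "r i = (reloc (sel t i) :: (int \<times> 'v, 'k) lin)" for i
  define c where "c i = (coreloc (sel t i) :: (int \<times> 'v, 'k) lin)" for i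
  \<comment> \<open>The projection onto the complement of \<open>C\<close> in \<open>D i\<close>.
    The value 0 outside \<open>J\<close> lets the row vectors run over all of
    \<open>'v\<close>.\<close>
  define P where "P i = (if i \<in> J then pj (D i) - pj C else 0)" for i
  \<comment> \<open>\<open>j i\<close> will embed \<open>D i\<close>: the part over \<open>C\<close>
    stays in place, the rest moves to the tagged block.\<close>
  define j where "j i = q + r i * q'" for i
  define d where "d i = df (D i)" for i
  define C' where "C' = \<lparr>bs = bs C \<union> (\<Union>i\<in>J. sel t i ` (bs (D i) - bs C)),
    pj = pj C + rsum t (\<lambda>i. r i * P i), df = df C + rsum t (\<lambda>i. j i * d i * P i)\<rparr>"
  have K: "ok (D i)" "sml (bs (D i))" "sub C (D i)" "rta C (D i)" if "i \<in> J" for i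
    using KextD[OF D[OF that]] by auto
  have q: "q * q = q" "q * q' = 0" "q' * q = 0" "q' * q' = q'" "q * pj C = pj C" "pj C * q = pj C"
    "q * df C = df C" "df C * q = df C" "q' * pj C = 0" "pj C * q' = 0" "q' * df C = 0" "df C * q' = 0"
    using okD[OF C(1)] unfolding q_def q'_def by (simp_all add: pr_Compl left_diff_distrib right_diff_distrib)
  have qeps: "eps * q = q" "q * eps = q" "eps * q' = q'" "q' * eps = q'" "q + q' = eps"
    unfolding q_def q'_def by (simp_all add: pr_Compl left_diff_distrib right_diff_distrib)
  have qr: "q * r i = 0" "c i * q = 0" for i
    unfolding q_def r_def c_def using reloc_sel_zero[OF dis] coreloc_sel_zero[OF dis] by auto
  have cr: "c i * r k = (if i = k then eps else 0)" for i k
    unfolding c_def r_def by (rule coreloc_sel_reloc)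
  have re: "r i * eps = r i" "eps * r i = r i" "c i * eps = c i" "eps * c i = c i" for i
    unfolding r_def c_def by simp_all
  have z: "pj C * r i = 0" "df C * r i = 0" "c i * pj C = 0" "c i * df C = 0" for i
  proof -
    have "pj C * q * r i = 0" "df C * q * r i = 0" by (simp_all only: mult.assoc qr mult_zero_right)
    then show "pj C * r i = 0" "df C * r i = 0" by (simp_all only: q)
    have "c i * q * pj C = 0" "c i * q * df C = 0" by (simp_all only: qr mult_zero_left)
    then show "c i * pj C = 0" "c i * df C = 0" by (simp_all only: q mult.assoc)
  qed
  have P0: "P i = 0" if "i \<notin> J" for i using that unfolding P_def by simp
  have P: "P i * P i = P i" "q * P i = 0" "P i * q = 0" "q' * P i = P i" "P i * q' = P i"
    "P i * eps = P i" "eps * P i = P i" "P i * pj C = 0" "pj C * P i = 0" "df C * P i = 0"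
    "pr (sel t i -` bs C') * P i = P i" "P i * pr (sel t i -` bs C') = P i" "dg 0 (P i)" for i
  proof -
    have *: "P i * P i = P i \<and> q * P i = 0 \<and> P i * q = 0 \<and> P i * eps = P i \<and> eps * P i = P i \<and>
      P i * pj C = 0 \<and> pj C * P i = 0 \<and> df C * P i = 0 \<and> dg 0 (P i) \<and>
      pr (sel t i -` bs C') * P i = P i \<and> P i * pr (sel t i -` bs C') = P i"
    proof (cases "i \<in> J")
      case True
      note k = K[OF True]
      have v: "sel t i -` bs C' = bs (D i) - bs C"
      proof -
        have n: "sel t i p \<notin> bs C" for p using dis unfolding selr_def by blast
        have C': "bs C' = bs C \<union> (\<Union>i\<in>J. sel t i ` (bs (D i) - bs C))" unfolding C'_def by simp
        show ?thesis
        proof (rule Set.set_eqI)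
          fix p
          have "sel t i p \<in> bs C' \<longleftrightarrow> (\<exists>k\<in>J. sel t i p \<in> sel t k ` (bs (D k) - bs C))"
            unfolding C' using n[of p] by blast
          also have "\<dots> \<longleftrightarrow> p \<in> bs (D i) - bs C"
          proof
            assume "\<exists>k\<in>J. sel t i p \<in> sel t k ` (bs (D k) - bs C)"
            then obtain k p' where "sel t i p = sel t k p'" "p' \<in> bs (D k) - bs C" by blast
            then show "p \<in> bs (D i) - bs C" unfolding sel_eq by blast
          qed (use True in blast)
          finally show "p \<in> sel t i -` bs C' \<longleftrightarrow> p \<in> bs (D i) - bs C" by blast
        qed
      qed
      note s = okr[OF k(1)] okr[OF C(1)] subr[OF k(3) C(1)]
      have dY: "df C * pj (D i) = df C"
      proof -
        have "df C * pj (D i) = df C * pj C * pj (D i)" by (simp only: okD(5)[OF C(1)])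
        also have "\<dots> = df C * (pj C * pj (D i))" by (rule mult.assoc)
        also have "\<dots> = df C" by (simp only: subD(6)[OF k(3) C(1)] okD(5)[OF C(1)])
        finally show ?thesis .
      qed
      have k1: "pr (bs (D i)) * pj C = pj C" "pj C * pr (bs (D i)) = pj C"
        using pr_mono_left[OF okD(1)[OF C(1)]] pr_mono_right[OF okD(2)[OF C(1)]] subD(1)[OF k(3) C(1)] by auto
      have "P i * P i = P i" "q * P i = 0" "P i * q = 0" "P i * eps = P i" "eps * P i = P i"
        "P i * pj C = 0" "pj C * P i = 0" "df C * P i = 0"
        unfolding P_def q_def using True by (simp_all add: left_diff_distrib right_diff_distrib s dY)
      moreover have "dg 0 (P i)" unfolding P_def using True okD(7)[OF C(1)] okD(7)[OF k(1)] by (auto intro: dg_diff)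
      moreover have "pr (sel t i -` bs C') * P i = P i" "P i * pr (sel t i -` bs C') = P i"
        unfolding P_def v pr_Diff[OF subD(1)[OF k(3) C(1)]] using True by (simp_all add: left_diff_distrib right_diff_distrib s k1)
      ultimately show ?thesis by blast
    qed (simp_all add: P0)
    then show "P i * P i = P i" "q * P i = 0" "P i * q = 0" "P i * eps = P i" "eps * P i = P i"
      "P i * pj C = 0" "pj C * P i = 0" "df C * P i = 0" "dg 0 (P i)"
      "pr (sel t i -` bs C') * P i = P i" "P i * pr (sel t i -` bs C') = P i" by auto
    have "q' = eps - q" unfolding q_def q'_def by (rule pr_Compl)
    then show "q' * P i = P i" "P i * q' = P i" using * by (simp_all add: left_diff_distrib right_diff_distrib)
  qed
  note Pr = P(1-12) P(1-12)[THEN mult_rule]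
  note zr = z z[THEN mult_rule] qr qr[THEN mult_rule] q q[THEN mult_rule] qeps(1-4) qeps(1-4)[THEN mult_rule]
    re re[THEN mult_rule] cr cr[THEN mult_rule]
  have rs0: "rsum t a * q = 0" "rsum t a * pj C = 0" "rsum t a * df C = 0" for a
  proof -
    show *: "rsum t a * q = 0" unfolding q_def by (rule rsum_pr_disjoint[OF dis])
    have "rsum t a * q * pj C = 0" "rsum t a * q * df C = 0" using * by simp_all
    then show "rsum t a * pj C = 0" "rsum t a * df C = 0" by (simp_all only: mult.assoc q)
  qed
  have rsr: "rsum t a * r i = a i * eps" for a i unfolding r_def by (rule rsum_reloc)
  have p_r: "pj C' * r i = r i * P i" and d_r: "df C' * r i = j i * d i * P i" for i
    unfolding C'_def by (simp_all add: distrib_right rsr z mult.assoc Pr)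
  have p_q: "pj C' * q = pj C" "pj C' * pj C = pj C" "pj C' * df C = df C"
    and d_q: "df C' * q = df C" "df C' * pj C = df C" "df C' * df C = 0"
    unfolding C'_def by (simp_all add: distrib_right rs0 q okD[OF C(1)])
  have jp: "j i * pj (D i) = pj C + r i * P i" and jd: "j i * df C = df C" and jpC: "j i * pj C = pj C"
    and jD: "q' * pj (D i) = P i" and dP: "d i * P i = d i - df C" "pj (D i) * P i = P i"
    if "i \<in> J" for i
  proof -
    note k = K[OF that]
    show a: "q' * pj (D i) = P i"
      using quo_facts(1)[OF C(1) k(1,3)] that unfolding q'_def P_def by simp
    show "j i * pj (D i) = pj C + r i * P i"
      unfolding j_def using a subD(3)[OF k(3) C(1)] by (simp add: distrib_right mult.assoc q_def)
    show "j i * df C = df C" "j i * pj C = pj C" unfolding j_def by (simp_all add: distrib_right mult.assoc q)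
    show "d i * P i = d i - df C" "pj (D i) * P i = P i"
      unfolding P_def d_def using that by (simp_all add: right_diff_distrib okr[OF k(1)] subr[OF k(3) C(1)])
  qed
  have pj_j: "pj C' * j i = j i * pj (D i)" and df_j: "df C' * j i = j i * d i" if "i \<in> J" for i
  proof -
    have "pj C' * j i = pj C' * q + pj C' * r i * q'" unfolding j_def by (simp add: distrib_left mult.assoc)
    also have "\<dots> = pj C + r i * P i" unfolding p_q p_r by (simp add: mult.assoc Pr)
    finally show "pj C' * j i = j i * pj (D i)" using jp[OF that] by simp
    have "df C' * j i = df C' * q + df C' * r i * q'" unfolding j_def by (simp add: distrib_left mult.assoc)
    also have "\<dots> = df C + j i * (d i * P i)" unfolding d_q d_r by (simp add: mult.assoc Pr)
    finally show "df C' * j i = j i * d i" using dP(1)[OF that] jd[OF that] by (simp add: right_diff_distrib)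
  qed
  have dgr: "dg 0 (r i)" "dg 0 (j i)" for i
  proof -
    show *: "dg 0 (r i)" unfolding r_def by (rule dg_reloc) simp
    show "dg 0 (j i)" unfolding j_def q_def q'_def by (intro dg_add dg_mult[OF *]) auto
  qed
  have dd: "pj (D i) * d i = d i" "d i * d i = 0" "dg 1 (d i)" if "i \<in> J" for i
    using okD[OF K(1)[OF that]] unfolding d_def by auto
  have dgA: "dg 0 (r i * P i)" "dg 1 (j i * d i * P i)" for i
  proof -
    show "dg 0 (r i * P i)" by (rule dg_mult[OF dgr(1) P(13)]) simp
    show "dg 1 (j i * d i * P i)"
    proof (cases "i \<in> J")
      case True
      have "dg 1 (j i * d i)" by (rule dg_mult[OF dgr(2) dd(3)[OF True]]) simp
      then show ?thesis using dg_mult[OF _ P(13)] by force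
    qed (simp add: P0)
  qed
  have oC': "ok C'"
    unfolding ok_def
  proof (intro conjI)
    have v: "pr (bs C') * r i = r i * pr (sel t i -` bs C')" for i
      unfolding r_def by (rule pr_reloc_vimage)
    have s: "bs C \<subseteq> bs C'" unfolding C'_def by auto
    have "pr (bs C') * rsum t (\<lambda>i. r i * P i) = rsum t (\<lambda>i. r i * P i)"
      unfolding rsum_left by (rule rsum_cong) (simp add: v[THEN mult_rule] mult.assoc Pr)
    then show "pr (bs C') * pj C' = pj C'"
      using pr_mono_left[OF okD(1)[OF C(1)] s] unfolding C'_def by (simp add: distrib_left)
    have "rsum t (\<lambda>i. r i * P i) * pr (bs C') = rsum t (\<lambda>i. r i * P i)"
      by (rule rsum_pr) (simp add: mult.assoc Pr)
    then show "pj C' * pr (bs C') = pj C'"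
      using pr_mono_right[OF okD(2)[OF C(1)] s] unfolding C'_def by (simp add: distrib_right)
    have "pj C' * pj C' = pj C' * pj C + rsum t (\<lambda>i. pj C' * (r i * P i))"
      by (subst (2) C'_def) (simp add: distrib_left rsum_left)
    also have "(\<lambda>i. pj C' * (r i * P i)) = (\<lambda>i. r i * P i)"
      by (rule HOL.ext) (simp add: mult.assoc[symmetric] p_r, simp add: mult.assoc Pr)
    finally show "pj C' * pj C' = pj C'" unfolding p_q by (simp add: C'_def)
    have "pj C' * df C' = pj C' * df C + rsum t (\<lambda>i. pj C' * (j i * d i * P i))"
      by (subst (2) C'_def) (simp add: distrib_left rsum_left)
    also have "(\<lambda>i. pj C' * (j i * d i * P i)) = (\<lambda>i. j i * d i * P i)"
    proof
      fix i show "pj C' * (j i * d i * P i) = j i * d i * P i"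
        by (cases "i \<in> J") (simp_all add: P0 mult.assoc pj_j[THEN mult_rule] dd(1)[THEN mult_rule])
    qed
    finally show "pj C' * df C' = df C'" unfolding p_q by (simp add: C'_def)
    have "df C' * pj C' = df C' * pj C + rsum t (\<lambda>i. df C' * (r i * P i))"
      by (subst (2) C'_def) (simp add: distrib_left rsum_left)
    also have "(\<lambda>i. df C' * (r i * P i)) = (\<lambda>i. j i * d i * P i)"
      by (rule HOL.ext) (simp add: mult.assoc[symmetric] d_r, simp add: mult.assoc Pr)
    finally show "df C' * pj C' = df C'" unfolding d_q by (simp add: C'_def)
    have "df C' * df C' = df C' * df C + rsum t (\<lambda>i. df C' * (j i * d i * P i))"
      by (subst (2) C'_def) (simp add: distrib_left rsum_left)
    also have "(\<lambda>i. df C' * (j i * d i * P i)) = (\<lambda>i. 0)"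
    proof
      fix i show "df C' * (j i * d i * P i) = 0"
        by (cases "i \<in> J") (simp_all add: P0 mult.assoc df_j[THEN mult_rule] dd(2)[THEN mult_rule])
    qed
    finally show "df C' * df C' = 0" unfolding d_q by (simp add: rsum_zero)
    show "dg 0 (pj C')" "dg 1 (df C')"
      unfolding C'_def using okD(7,8)[OF C(1)] dgA by (auto intro!: dg_add dg_rsum)
  qed
  have sC': "sub C C'"
    unfolding sub_def
  proof (intro conjI)
    show "bs C \<subseteq> bs C'" unfolding C'_def by auto
    show "pj C' * pr (bs C) = pj C" "df C' * pr (bs C) = df C" using p_q d_q unfolding q_def by auto
    have "q * rsum t (\<lambda>i. r i * P i) = 0"
      unfolding rsum_left by (simp add: zr rsum_zero)
    then show "pr (bs C) * pj C' = pj C" unfolding q_def[symmetric] unfolding C'_def by (simp add: distrib_left q)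
  qed
  have ji: "hom (D i) C' (j i * pj (D i))" "j i * pj (D i) * q = pj C" if "i \<in> J" for i
  proof -
    note k = K[OF that]
    show "j i * pj (D i) * q = pj C" using jpC[OF that] subD(2)[OF k(3) C(1)] unfolding q_def by (simp add: mult.assoc)
    have "dg 0 (j i * pj (D i))" by (rule dg_mult[OF dgr(2) okD(7)[OF k(1)]]) simp
    then show "hom (D i) C' (j i * pj (D i))"
      unfolding hom_def using okD[OF k(1)] pj_j[OF that, THEN mult_rule] df_j[OF that, THEN mult_rule]
      by (simp add: mult.assoc d_def)
  qed
  have cj: "c k * j i = (if k = i then q' else 0)" for k i
    unfolding j_def by (simp add: distrib_left zr)
  have rE: "rta C C'"
    unfolding rta_def
  proof (intro conjI allI impI)
    fix x assume x: "app (pj C') x = x \<and> app (df C') x \<in> vs (bs C)"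
    \<comment> \<open>\<open>c i\<close> reads off the coordinates in block \<open>i\<close>, where
      \<open>C'\<close> looks like \<open>D i\<close> modulo \<open>C\<close>.\<close>
    have cp: "c i * pj C' = P i * c i" and cd: "c i * df C' = q' * d i * P i * c i" for i
    proof -
      have "c i * rsum t a * r k = (if k = i then c i * a i else 0)"
        if "\<And>k. k \<noteq> i ==> c i * a k = 0" "c i * a i * eps = c i * a i" for a k
        using that by (simp add: mult.assoc rsr) (simp add: mult.assoc[symmetric])
      note * = this
      have 0: "rsum t a * pr (- selr t) = 0" "c i * pr (- selr t) = 0" for a
        using rsum_pr_disjoint[of "- selr t" t a] coreloc_sel_zero[of "- selr t" t i] by (auto simp: c_def)
      have 1: "c i * rsum t (\<lambda>k. r k * P k) = P i * c i"
      proof (rule rsum_eqI[of _ _ t])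
        fix k show "c i * rsum t (\<lambda>k. r k * P k) * reloc (sel t k) = P i * c i * reloc (sel t k)"
          unfolding r_def[symmetric] by (subst *) (simp_all add: mult.assoc zr Pr)
      qed (simp_all add: mult.assoc 0 re)
      have 2: "c i * rsum t (\<lambda>k. j k * d k * P k) = q' * d i * P i * c i"
      proof (rule rsum_eqI[of _ _ t])
        fix k show "c i * rsum t (\<lambda>k. j k * d k * P k) * reloc (sel t k) = q' * d i * P i * c i * reloc (sel t k)"
          unfolding r_def[symmetric] by (subst *) (simp_all add: mult.assoc cj[THEN mult_rule] zr Pr)
      qed (simp_all add: mult.assoc 0 re)
      show "c i * pj C' = P i * c i" "c i * df C' = q' * d i * P i * c i"
        unfolding C'_def by (simp_all add: distrib_left z 1 2)
    qed
    let ?F = "{i. app (c i) x \<noteq> 0}"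
    have c0: "app (c i) y = 0" if "y \<in> vs (bs C)" for i y
    proof -
      have "app (c i * q) y = 0" unfolding qr by simp
      then show ?thesis using that unfolding q_def vs_def by simp
    qed
    have Px: "app (P i) (app (c i) x) = app (c i) x" for i
      using app_cong[OF cp[of i], of x] x by simp
    have FJ: "?F \<subseteq> J"
    proof
      fix i assume "i \<in> ?F"
      then show "i \<in> J" using Px[of i] P0[of i] by (cases "i \<in> J") auto
    qed
    \<comment> \<open>Finite support of \<open>x\<close> is what allows the solutions in the single
      blocks to be added up.\<close>
    have fin: "finite ?F"
    proof (rule finite_subset)
      show "?F \<subseteq> (\<lambda>k. SOME i. \<exists>p. k = sel t i p) ` keys x"
      proof
        fix i assume i: "i \<in> ?F"
        have "\<exists>k\<in>keys x. k \<in> range (sel t i)"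
        proof (rule ccontr)
          assume "\<not> ?thesis"
          then have "keys x \<subseteq> - range (sel t i)" by auto
          have "c i * pr (- range (sel t i)) = 0" unfolding c_def by (rule coreloc_disjoint_pr) auto
          moreover have "app (pr (- range (sel t i))) x = rscale x e"
          proof (rule poly_mapping_eqI)
            fix k
            have "k \<in> range (sel t i) ==> lookup x k = 0"
              using \<open>keys x \<subseteq> - range (sel t i)\<close> unfolding subset_iff in_keys_iff by blast
            then show "lookup (app (pr (- range (sel t i))) x) k = lookup (rscale x e) k"
              by (cases "k \<in> range (sel t i)") (simp_all add: lookup_pr del: image_iff)
          qed
          moreover have "app (c i * pr (- range (sel t i))) x = app (c i) (app (pr (- range (sel t i))) x)" by simp
          ultimately have "app (c i) (rscale x e) = 0" by (simp only: app_lin_simps(1))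
          then have "app (c i * eps) x = 0" by simp
          then show False using i re(3) by simp
        qed
        then obtain p where p: "sel t i p \<in> keys x" by blast
        have "(SOME i'. \<exists>p'. sel t i p = sel t i' p') = i" by (rule some_equality) auto
        then have "i = (\<lambda>k. SOME i. \<exists>p. k = sel t i p) (sel t i p)" by (simp only:)
        then show "i \<in> (\<lambda>k. SOME i. \<exists>p. k = sel t i p) ` keys x" using p by (rule image_eqI)
      qed
    qed simp
    have "\<exists>y. app (pj (D i)) y = y \<and> app (c i) x - app (d i) y \<in> vs (bs C)" if "i \<in> ?F" for i
    proof -
      have i: "i \<in> J" using that FJ by blast
      have 1: "app (pj (D i)) (app (c i) x) = app (c i) x"
        using app_cong[OF dP(2)[OF i], of "app (c i) x"] Px[of i] by simp
      have "app (q') (app (d i) (app (c i) x)) = 0"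
        using app_cong[OF cd[of i], of x] x c0[of "app (df C') x" i] Px[of i] by simp
      then have "app (q + q') (app (d i) (app (c i) x)) = app q (app (d i) (app (c i) x))" by simp
      then have "app q (app (d i) (app (c i) x)) = app (d i) (app (c i) x)"
        unfolding qeps(5) using okD(14)[OF K(1)[OF i]] unfolding d_def by (metis app_lin_simps(5))
      then have 2: "app (df (D i)) (app (c i) x) \<in> vs (bs C)" unfolding q_def d_def vs_def by simp
      show ?thesis using rtaD1[OF K(4)[OF i] 1 2] unfolding d_def by metis
    qed
    then obtain y where y: "\<And>i. i \<in> ?F ==> app (pj (D i)) (y i) = y i"
      "\<And>i. i \<in> ?F ==> app (c i) x - app (d i) (y i) \<in> vs (bs C)" by metis
    let ?y = "\<Sum>i\<in>?F. app (j i) (y i)"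
    have py: "app (pj C') ?y = ?y"
      unfolding app_sum
    proof (rule sum.cong[OF refl])
      fix i assume i: "i \<in> ?F"
      then show "app (pj C') (app (j i) (y i)) = app (j i) (y i)"
        using arg_cong[OF pj_j, of i "\<lambda>f. app f (y i)"] FJ y(1)[OF i] by auto
    qed
    let ?z = "x - app (df C') ?y"
    have dy: "app (df C') ?y = (\<Sum>i\<in>?F. app (j i) (app (d i) (y i)))"
      unfolding app_sum
    proof (rule sum.cong[OF refl])
      fix i assume i: "i \<in> ?F"
      then show "app (df C') (app (j i) (y i)) = app (j i) (app (d i) (y i))"
        using arg_cong[OF df_j, of i "\<lambda>f. app f (y i)"] FJ by auto
    qed
    have cz: "app (c k) ?z = 0" for k
    proof -
      have "app (c k) (app (j i) w) = (if k = i then app q' w else 0)" for i w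
        using app_cong[OF cj[of k i], of w] by (cases "k = i") simp_all
      then have s: "app (c k) ?z = app (c k) x - (\<Sum>i\<in>?F. if k = i then app q' (app (d i) (y i)) else 0)"
        unfolding app_diff dy unfolding app_sum by simp
      show ?thesis
      proof (cases "k \<in> ?F")
        case True
        have "app q' (app (c k) x - app (d k) (y k)) = 0"
        proof -
          have "app (q' * q) w = 0" for w unfolding q by simp
          then have "app q' (app q w) = 0" for w by simp
          moreover have "app q (app (c k) x - app (d k) (y k)) = app (c k) x - app (d k) (y k)"
            using y(2)[OF True] unfolding q_def vs_def by blast
          ultimately show ?thesis by metis
        qed
        moreover have "app q' (app (c k) x) = app (c k) x"
          using app_cong[OF P(4)[of k], of "app (c k) x"] Px[of k] by simp
        ultimately show ?thesis using s True fin by (simp add: sum.delta)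
      next
        case False
        then show ?thesis using s by (simp add: sum.delta' fin)
      qed
    qed
    have "?z \<in> vs (bs C)"
    proof -
      have z0: "app (pj C') ?z = ?z"
        using x py okD(4)[OF oC'] by (simp add: app_okr[OF oC'])
      have 1: "app (pr (selr t)) z = 0" if cz: "\<And>k. app (c k) z = 0" for z
      proof (rule poly_mapping_eqI)
        fix k show "lookup (app (pr (selr t)) z) k = lookup 0 k"
        proof (cases "k \<in> selr t")
          case True
          then obtain i p where k: "k = sel t i p" unfolding selr_def by blast
          have "r i * c i = pr (range (sel t i))" unfolding r_def c_def by (rule reloc_coreloc) simp
          then have "app (pr (range (sel t i))) z = app (r i) (app (c i) z)"
            by (simp only: app_lin_simps flip: \<open>r i * c i = _\<close>)
          then have "lookup (app (pr (range (sel t i))) z) k = 0" unfolding cz by simp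
          then show ?thesis using k True by (simp add: lookup_pr)
        qed (simp add: lookup_pr)
      qed
      have "rsum t a * pr (selr t) = rsum t a" for a
        by (rule rsum_pr) (simp add: selr_def vimage_def eps_def[symmetric])
      then have "app (rsum t a) ?z = app (rsum t a) (app (pr (selr t)) ?z)" for a by (simp only: flip: app_lin_simps)
      then have "app (rsum t a) ?z = 0" for a unfolding 1[OF cz] by simp
      then have "?z = app (pj C) ?z" using z0 unfolding C'_def by simp
      then show ?thesis
        by (rule ssubst[where P = "\<lambda>w. w \<in> vs (bs C)"]) (rule app_okr(5)[OF C(1)])
    qed
    then show "\<exists>y. app (pj C') y = y \<and> x - app (df C') y \<in> vs (bs C)" using py by blast
  next
    fix f assume f: "f * pj C' = f \<and> f * pr (bs C) = 0 \<and> f * df C' = 0"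
    have fq: "f * q = 0" using f unfolding q_def by simp
    have fC: "f * pj C = 0"
    proof -
      have "f * q * pj C = 0" using fq by simp
      then show ?thesis by (simp only: mult.assoc q)
    qed
    have "\<exists>g. g * pj (D i) = g \<and> g * q = 0 \<and> f * j i * pj (D i) = g * d i" if "i \<in> J" for i
    proof -
      note k = K[OF that]
      have 1: "f * j i * pj (D i) * pj (D i) = f * j i * pj (D i)" by (simp add: mult.assoc okr[OF k(1)])
      have 2: "f * j i * pj (D i) * pr (bs C) = 0"
        using ji(2)[OF that] fC unfolding q_def by (simp add: mult.assoc)
      have "f * j i * pj (D i) * df (D i) = f * df C' * j i"
        using df_j[OF that] unfolding d_def by (simp add: mult.assoc okr[OF k(1)])
      then have 3: "f * j i * pj (D i) * df (D i) = 0" using f by simp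
      show ?thesis using rtaD2[OF k(4) 1 2 3] unfolding q_def d_def by metis
    qed
    then obtain g where g: "\<And>i. i \<in> J ==> g i * pj (D i) = g i" "\<And>i. i \<in> J ==> g i * q = 0"
      "\<And>i. i \<in> J ==> f * j i * pj (D i) = g i * d i" by metis
    have gP: "g i * P i = g i" "g i * q' = g i" if "i \<in> J" for i
    proof -
      have "g i * q * pj C = 0" using g(2)[OF that] by simp
      then have "g i * pj C = 0" by (simp only: mult.assoc q)
      then show *: "g i * P i = g i" using g(1)[OF that] that unfolding P_def by (simp add: right_diff_distrib)
      have "g i * P i * q' = g i * P i" by (simp only: mult.assoc P)
      then show "g i * q' = g i" using * by simp
    qed
    \<comment> \<open>Functionals call for no finiteness: a row vector with one solution per block
      is a linear map again.\<close>
    define G where "G i = (if i \<in> J then g i else 0)" for i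
    let ?g = "rsum t G"
    have "?g * pj C' = rsum t (\<lambda>i. ?g * (r i * P i))" unfolding C'_def by (simp add: distrib_left rs0 rsum_left)
    also have "(\<lambda>i. ?g * (r i * P i)) = G"
      by (rule HOL.ext) (simp add: mult.assoc[symmetric] rsr, simp add: mult.assoc Pr, simp add: G_def gP)
    finally have 1: "?g * pj C' = ?g" .
    have 2: "?g * pr (bs C) = 0" using rs0(1) unfolding q_def .
    have "?g * df C' = rsum t (\<lambda>i. ?g * (j i * d i * P i))" unfolding C'_def by (simp add: distrib_left rs0 rsum_left)
    also have "(\<lambda>i. ?g * (j i * d i * P i)) = (\<lambda>i. f * (r i * P i))"
    proof (rule HOL.ext)
      fix i
      show "?g * (j i * d i * P i) = f * (r i * P i)"
      proof (cases "i \<in> J")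
        case True
        have "?g * j i = G i * eps * q'" unfolding j_def by (simp add: distrib_left rs0 mult.assoc[symmetric] rsr)
        also have "\<dots> = g i" using True gP(2)[OF True] by (simp add: G_def mult.assoc qeps)
        finally have "?g * (j i * d i * P i) = g i * d i * P i" by (simp add: mult.assoc[symmetric])
        also have "\<dots> = f * j i * P i" unfolding g(3)[OF True, symmetric] by (simp add: mult.assoc dP(2)[OF True])
        also have "\<dots> = f * (r i * P i)" unfolding j_def by (simp add: distrib_left distrib_right mult.assoc Pr)
        finally show ?thesis .
      qed (simp add: P0)
    qed
    also have "rsum t (\<lambda>i. f * (r i * P i)) = f * pj C'" unfolding C'_def by (simp add: distrib_left fC rsum_left)
    also have "\<dots> = f" using f by simp
    finally show "\<exists>g. g * pj C' = g \<and> g * pr (bs C) = 0 \<and> f = g * df C'" using 1 2 by metis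
  qed
  have "sml (\<Union>i\<in>J. sel t i ` (bs (D i) - bs C))"
    by (rule small_UN[OF J small_image[OF small_subset[OF K(2) Diff_subset]]])
  then have "sml (bs C')" unfolding C'_def using small_Un[OF C(2)] by simp
  then have "Kext C C'" unfolding Kext_def using C oC' sC' rE by blast
  then show ?thesis using ji unfolding q_def by blast
qed

end

section \<open>Unions of chains and saturation\<close>

context corner
begin

text \<open>On overlaps the index is picked arbitrarily; under \<open>compat\<close> the value does
  not depend on the pick.\<close>

definition glue :: "'j set => ('j => 'i set) => ('j => ('i, 'k) lin) => ('i, 'k) lin" where
  "glue I B a = ext (\<lambda>b. if \<exists>i\<in>I. b \<in> B i then app (a (SOME i. i \<in> I \<and> b \<in> B i)) (bas b) else 0)"

definition compat :: "'j set => ('j => 'i set) => ('j => ('i, 'k) lin) => bool" where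
  "compat I B a \<longleftrightarrow> (\<forall>i\<in>I. \<forall>j\<in>I. \<forall>b\<in>B i \<inter> B j. app (a i) (bas b) = app (a j) (bas b))"

lemma glue_bas: "app (glue I B a) (bas b) =
    (if \<exists>i\<in>I. b \<in> B i then app (a (SOME i. i \<in> I \<and> b \<in> B i)) (bas b) else 0)"
  unfolding glue_def app_ext_bas by (auto simp flip: app_rscale)

lemma glue_bas_in:
  assumes "compat I B a" "i \<in> I" "b \<in> B i" shows "app (glue I B a) (bas b) = app (a i) (bas b)"
proof -
  let ?j = "SOME i. i \<in> I \<and> b \<in> B i"
  have j: "?j \<in> I \<and> b \<in> B ?j" by (rule someI[of _ i]) (use assms in blast)
  have "app (glue I B a) (bas b) = app (a ?j) (bas b)"
    unfolding glue_bas by (rule if_P) (use assms in blast)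
  also have "\<dots> = app (a i) (bas b)" using assms j unfolding compat_def by blast
  finally show ?thesis .
qed

lemma glue_cases:
  assumes "app (glue I B a) (bas b) \<noteq> 0"
  obtains i where "i \<in> I" "b \<in> B i" "app (glue I B a) (bas b) = app (a i) (bas b)"
proof -
  let ?j = "SOME i. i \<in> I \<and> b \<in> B i"
  have ex: "\<exists>i. i \<in> I \<and> b \<in> B i" using assms unfolding glue_bas by (auto split: if_splits)
  then have "?j \<in> I \<and> b \<in> B ?j" by (rule someI_ex)
  moreover have "app (glue I B a) (bas b) = app (a ?j) (bas b)" unfolding glue_bas using ex by auto
  ultimately show thesis using that by blast
qed

lemma glue_eps [simp]: "glue I B a * eps = glue I B a" "eps * glue I B a = glue I B a"
  unfolding glue_def by simp_all

lemma glue_pr: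
  assumes "compat I B a" "i \<in> I" "a i * pr (B i) = a i" shows "glue I B a * pr (B i) = a i"
proof (rule lin_eq_basI)
  show "a i * eps = a i" using assms(3) by (rule pr_absorb_eps)
  fix b
  have "app (a i) (bas b) = 0" if "b \<notin> B i"
    using app_cong[OF assms(3), of "bas b"] that by (simp add: pr_bas)
  then show "app (glue I B a * pr (B i)) (bas b) = app (a i) (bas b)"
    using glue_bas_in[OF assms(1,2)] by (simp add: pr_bas)
qed (simp add: mult.assoc)

lemma glue_supp: "glue I B a * pr (\<Union>i\<in>I. B i) = glue I B a"
  by (rule pr_absorb_rightI) (auto simp: glue_bas)

lemma pr_UN_eqI:
  assumes "f * pr (\<Union>i\<in>I. B i) = f" "g * pr (\<Union>i\<in>I. B i) = g" "\<And>i. i \<in> I ==> f * pr (B i) = g * pr (B i)"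
  shows "f = g"
proof (rule lin_eq_basI)
  show "f * eps = f" "g * eps = g" using assms(1,2) pr_absorb_eps by metis+
  fix b
  show "app f (bas b) = app g (bas b)"
  proof (cases "\<exists>i\<in>I. b \<in> B i")
    case True
    then obtain i where "i \<in> I" "b \<in> B i" by blast
    then show ?thesis using arg_cong[OF assms(3), of i "\<lambda>f. app f (bas b)"] by (simp add: pr_bas)
  next
    case False
    then show ?thesis using app_cong[OF assms(1), of "bas b"]
        app_cong[OF assms(2), of "bas b"] by (simp add: pr_bas)
  qed
qed

lemma glue_pr_zero:
  assumes "\<And>i. i \<in> I ==> a i * pr A = 0" shows "glue I B a * pr A = 0"
proof (rule lin_eq_basI)
  fix b
  show "app (glue I B a * pr A) (bas b) = app 0 (bas b)"
  proof (cases "b \<in> A")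
    case True
    have "app (glue I B a) (bas b) = 0"
    proof (rule ccontr)
      assume "app (glue I B a) (bas b) \<noteq> 0"
      then obtain i where "i \<in> I" "app (glue I B a) (bas b) = app (a i) (bas b)" using glue_cases by metis
      then show False using arg_cong[OF assms, of i "\<lambda>f. app f (bas b)"] True
          \<open>app (glue I B a) (bas b) \<noteq> 0\<close> by (simp add: pr_bas)
    qed
    then show ?thesis using True by (simp add: pr_bas)
  qed (simp add: pr_bas)
qed (simp_all add: mult.assoc)

lemma dg_glue:
  assumes "\<And>i. i \<in> I ==> dg k (a i)" shows "dg k (glue I B a)"
proof (rule dg_basI)
  fix n x
  show "app (glue I B a) (bas (n, x)) \<in> vs (lev (n + k))"
  proof (cases "app (glue I B a) (bas (n, x)) = 0")
    case False
    then obtain i where "i \<in> I" "app (glue I B a) (bas (n, x)) = app (a i) (bas (n, x))"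
      using glue_cases by metis
    then show ?thesis using dg_vs[OF assms, of i "bas (n, x)" n] by simp
  qed simp
qed simp

lemma pr_glue:
  assumes "\<And>i. i \<in> I ==> pr A * a i = a i" shows "pr A * glue I B a = glue I B a"
proof (rule pr_absorb_leftI)
  fix b
  show "app (glue I B a) (bas b) \<in> vs A"
  proof (cases "app (glue I B a) (bas b) = 0")
    case False
    then obtain i where "i \<in> I" "app (glue I B a) (bas b) = app (a i) (bas b)"
      using glue_cases by metis
    then show ?thesis using assms pr_absorb_left by metis
  qed simp
qed simp

end

section \<open>Unions of chains of complexes and transfinite towers\<close>

context universe_ring
begin

definition Uni :: "('v, 'k) dgc set => ('v, 'k) dgc" where
  "Uni F = \<lparr>bs = (\<Union>X\<in>F. bs X), pj = glue F bs pj, df = glue F bs df\<rparr>"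

definition chn :: "('v, 'k) dgc set => bool" where
  "chn F \<longleftrightarrow> (\<forall>X\<in>F. ok X) \<and> (\<forall>X\<in>F. \<forall>Y\<in>F. sub X Y \<or> sub Y X)"

lemma sub_bas:
  assumes "sub X Y" "b \<in> bs X"
  shows "app (pj X) (bas b) = app (pj Y) (bas b)" "app (df X) (bas b) = app (df Y) (bas b)"
proof -
  have "app (pj Y * pr (bs X)) (bas b) = app (pj X) (bas b)" "app (df Y * pr (bs X)) (bas b) = app (df X) (bas b)"
    using assms(1) unfolding sub_def by auto
  then show "app (pj X) (bas b) = app (pj Y) (bas b)" "app (df X) (bas b) = app (df Y) (bas b)"
    using assms(2) by (simp_all add: pr_bas)
qed

lemma chn_compat:
  assumes "chn F" shows "compat F bs pj" "compat F bs df"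
  unfolding compat_def using assms sub_bas unfolding chn_def by (metis Int_iff)+

lemma Uni_pr:
  assumes "chn F" "X \<in> F" shows "pj (Uni F) * pr (bs X) = pj X" "df (Uni F) * pr (bs X) = df X"
proof -
  have "ok X" using assms unfolding chn_def by blast
  then show "pj (Uni F) * pr (bs X) = pj X" "df (Uni F) * pr (bs X) = df X"
    unfolding Uni_def using glue_pr[OF chn_compat(1)[OF assms(1)] assms(2)]
      glue_pr[OF chn_compat(2)[OF assms(1)] assms(2)] okD by auto
qed

lemma bs_Uni: "bs (Uni F) = (\<Union>X\<in>F. bs X)"
  unfolding Uni_def by simp

lemma Uni_eqI:
  assumes "f * pr (bs (Uni F)) = f" "g * pr (bs (Uni F)) = g" "\<And>X. X \<in> F ==> f * pr (bs X) = g * pr (bs X)"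
  shows "f = g"
  using pr_UN_eqI[of f bs F g] assms unfolding bs_Uni by blast

text \<open>The product equations are checked after restriction to one member of the chain, where
  they are the equations of that member.\<close>

lemma ok_Uni:
  assumes F: "chn F" shows "ok (Uni F)"
  unfolding ok_def
proof (intro conjI)
  let ?U = "Uni F"
  have ok: "ok X" if "X \<in> F" for X using F that unfolding chn_def by blast
  show s: "pj ?U * pr (bs ?U) = pj ?U" using glue_supp unfolding Uni_def by fastforce
  have s': "df ?U * pr (bs ?U) = df ?U" using glue_supp unfolding Uni_def by fastforce
  have a: "pj ?U * pj X = pj X" "pj ?U * df X = df X" "df ?U * pj X = df X" "df ?U * df X = 0" if "X \<in> F" for X
  proof -
    note u = Uni_pr[OF F that, THEN mult_rule] okD[OF ok[OF that]]
    have "pj ?U * (pr (bs X) * pj X) = pj X" "pj ?U * (pr (bs X) * df X) = df X"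
      "df ?U * (pr (bs X) * pj X) = df X" "df ?U * (pr (bs X) * df X) = 0"
      unfolding u(1,2) using u by simp_all
    then show "pj ?U * pj X = pj X" "pj ?U * df X = df X" "df ?U * pj X = df X" "df ?U * df X = 0"
      using u by simp_all
  qed
  show "pr (bs ?U) * pj ?U = pj ?U"
    unfolding Uni_def dgm.simps
  proof (rule pr_glue)
    fix X assume X: "X \<in> F"
    then have "bs X \<subseteq> (\<Union>X\<in>F. bs X)" by blast
    then show "pr (\<Union>X\<in>F. bs X) * pj X = pj X" by (rule pr_mono_left[OF okD(1)[OF ok[OF X]]])
  qed
  show "pj ?U * pj ?U = pj ?U"
    by (rule Uni_eqI[of _ F]) (simp_all add: mult.assoc s Uni_pr[OF F] a)
  show "pj ?U * df ?U = df ?U"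
    by (rule Uni_eqI[of _ F]) (simp_all add: mult.assoc s' Uni_pr[OF F] a)
  show "df ?U * pj ?U = df ?U"
    by (rule Uni_eqI[of _ F]) (simp_all add: mult.assoc s s' Uni_pr[OF F] a)
  show "df ?U * df ?U = 0"
    by (rule Uni_eqI[of _ F]) (simp_all add: mult.assoc s' Uni_pr[OF F] a)
  show "dg 0 (pj ?U)" "dg 1 (df ?U)"
    unfolding Uni_def using ok okD(7,8) by (auto intro!: dg_glue)
qed

lemma sub_Uni:
  assumes F: "chn F" and X: "X \<in> F" shows "sub X (Uni F)"
  unfolding sub_def
proof (intro conjI)
  let ?U = "Uni F"
  have okX: "ok X" using F X unfolding chn_def by blast
  show "bs X \<subseteq> bs ?U" unfolding bs_Uni using X by blast
  then have l: "pj X * pr (bs ?U) = pj X" using pr_mono_right[OF okD(2)[OF okX]] by blast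
  show "pj ?U * pr (bs X) = pj X" "df ?U * pr (bs X) = df X" using Uni_pr[OF F X] by auto
  show "pr (bs X) * pj ?U = pj X"
  proof (rule Uni_eqI[of _ F])
    show "pr (bs X) * pj ?U * pr (bs ?U) = pr (bs X) * pj ?U" by (simp add: mult.assoc okD(2)[OF ok_Uni[OF F]])
    show "pj X * pr (bs ?U) = pj X" by (rule l)
    fix Y assume Y: "Y \<in> F"
    then have okY: "ok Y" using F unfolding chn_def by blast
    consider "sub X Y" | "sub Y X" using F X Y unfolding chn_def by blast
    then have "pr (bs X) * pj Y = pj X * pr (bs Y)"
    proof cases
      case 1
      then show ?thesis using subD(1,3)[OF 1 okX] pr_mono_right[OF okD(2)[OF okX]] by simp
    next
      case 2
      then show ?thesis using subD(1,2)[OF 2 okY] pr_mono_left[OF okD(1)[OF okY]] by simp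
    qed
    then show "pr (bs X) * pj ?U * pr (bs Y) = pj X * pr (bs Y)" by (simp add: mult.assoc Uni_pr[OF F Y])
  qed
qed

lemma small_Uni: "sml F ==> (\<And>X. X \<in> F ==> sml (bs X)) ==> sml (bs (Uni F))"
  unfolding bs_Uni by (rule small_UN)

text \<open>Applied to the support of a vector it shows that a vector of the union already lives in
  one member of the chain.\<close>

lemma chn_finite:
  assumes F: "chn F" "F \<noteq> {}" and K: "finite K" "K \<subseteq> bs (Uni F)" shows "\<exists>X\<in>F. K \<subseteq> bs X"
proof -
  have "subset.chain UNIV (bs ` F)"
    using F(1) unfolding subset_chain_def chn_def sub_def by (auto simp: image_iff)
  moreover have "K \<subseteq> \<Union> (bs ` F)" using K(2) unfolding bs_Uni by blast
  ultimately obtain B where "B \<in> bs ` F" "K \<subseteq> B"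
    using finite_subset_Union_chain[OF K(1), of "bs ` F"] F(2) by blast
  then show ?thesis by blast
qed

text \<open>
  A transfinite tower over \<open>C\<close>: the stage \<open>c \<alpha>\<close> extends the union \<open>below \<alpha>\<close> of \<open>C\<close> and the earlier stages.
\<close>

definition below :: "('v, 'k) dgc => ('w => ('v, 'k) dgc) => 'w rel => 'w => ('v, 'k) dgc" where
  "below C c r x = Uni (insert C (c ` {y. (y, x) \<in> r - Id}))"

text \<open>Stated for an initial segment \<open>X\<close>, so that it can be used inside the
  recursion that builds the tower, when only earlier stages are known.\<close>

lemma tower_chain:
  assumes wo: "Well_order r" and C: "ok C" and X: "X \<subseteq> Field r" "\<And>x y. x \<in> X ==> (y, x) \<in> r - Id ==> y \<in> X"
    and K: "\<And>x. x \<in> X ==> Kext (below C c r x) (c x)"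
  shows "x \<in> X ==> sub C (c x) \<and> (\<forall>y. (y, x) \<in> r - Id --> sub (c y) (c x))"
    and "chn (insert C (c ` X))"
proof -
  have wf: "wf (r - Id)" using wo unfolding well_order_on_def by blast
  have lin: "(y, z) \<in> r - Id \<or> (z, y) \<in> r - Id" if "y \<in> Field r" "z \<in> Field r" "y \<noteq> z" for y z
    using wo that unfolding well_order_on_def linear_order_on_def total_on_def by blast
  have okc: "ok (c x)" if "x \<in> X" for x using KextD(2)[OF K[OF that]] .
  have ch: "chn (insert C (c ` Y))"
    if Y: "Y \<subseteq> X" "\<And>x. x \<in> Y ==> sub C (c x) \<and> (\<forall>y. (y, x) \<in> r - Id --> sub (c y) (c x))" for Y
    unfolding chn_def
  proof (intro conjI ballI)
    show "ok Z" if "Z \<in> insert C (c ` Y)" for Z using that C okc Y(1) by blast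
    fix Z W assume "Z \<in> insert C (c ` Y)" "W \<in> insert C (c ` Y)"
    then consider "Z = C" | "W = C" | z w where "z \<in> Y" "w \<in> Y" "Z = c z" "W = c w" by blast
    then show "sub Z W \<or> sub W Z"
    proof cases
      case 1
      then show ?thesis using \<open>W \<in> _\<close> Y(2) sub_refl[OF C] by blast
    next
      case 2
      then show ?thesis using \<open>Z \<in> _\<close> Y(2) sub_refl[OF C] by blast
    next
      case 3
      show ?thesis
      proof (cases "z = w")
        case True
        then show ?thesis using 3 sub_refl okc Y(1) by blast
      next
        case False
        then show ?thesis using lin[of z w] 3 Y X(1) by blast
      qed
    qed
  qed
  have main: "x \<in> X --> sub C (c x) \<and> (\<forall>y. (y, x) \<in> r - Id --> sub (c y) (c x))" for x
  proof (induction x rule: wf_induct_rule[OF wf])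
    case (1 x)
    show ?case
    proof
      assume x: "x \<in> X"
      let ?Y = "{y. (y, x) \<in> r - Id}"
      have "chn (insert C (c ` ?Y))" by (rule ch) (use 1 X(2)[OF x] in auto)
      then have "sub Z (below C c r x)" if "Z \<in> insert C (c ` ?Y)" for Z
        unfolding below_def using sub_Uni that by blast
      then have "sub Z (c x)" if "Z \<in> insert C (c ` ?Y)" for Z
        using sub_trans KextD(5)[OF K[OF x]] that by blast
      then show "sub C (c x) \<and> (\<forall>y. (y, x) \<in> r - Id --> sub (c y) (c x))" by blast
    qed
  qed
  then show "x \<in> X ==> sub C (c x) \<and> (\<forall>y. (y, x) \<in> r - Id --> sub (c y) (c x))" by blast
  show "chn (insert C (c ` X))" by (rule ch) (use main in auto)
qed

text \<open>An analogue of Eklof's lemma: a well-ordered tower whose single steps are totally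
  acyclic has a totally acyclic union. \<open>E\<close> may be any place where the tower can be cut,
  so that the union is compared with intermediate stages as well as with \<open>C\<close>.\<close>

lemma tower_rta:
  assumes wo: "Well_order r" and C: "ok C" and ne: "Field r \<noteq> {}"
    and K: "\<And>x. x \<in> Field r ==> Kext (below C c r x) (c x)"
    and E: "ok E" "sub C E" "sub E (Uni (c ` Field r))"
    and alt: "\<And>x. x \<in> Field r ==> sub (c x) E \<or> sub E (below C c r x)"
  shows "rta E (Uni (c ` Field r))"
proof -
  let ?I = "Field r" and ?U = "Uni (c ` Field r)" and ?D = "below C c r"
  have wf: "wf (r - Id)" using wo unfolding well_order_on_def by blast
  have fld: "y \<in> ?I" if "(y, x) \<in> r - Id" for x y using that by (auto simp: Field_def)
  have lin: "(y, z) \<in> r - Id \<or> (z, y) \<in> r - Id" if "y \<in> Field r" "z \<in> Field r" "y \<noteq> z" for y z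
    using wo that unfolding well_order_on_def linear_order_on_def total_on_def by blast
  have tr: "(x, z) \<in> r - Id" if "(x, y) \<in> r - Id" "(y, z) \<in> r - Id" for x y z
    using wo that unfolding well_order_on_def linear_order_on_def partial_order_on_def preorder_on_def
    by (auto dest: transD antisymD)
  have okc: "ok (c x)" and okD': "ok (?D x)" and subDc: "sub (?D x) (c x)" and rt: "rta (?D x) (c x)" if "x \<in> ?I" for x
    using KextD[OF K[OF that]] by auto
  have chI: "chn (insert C (c ` ?I))" by (rule tower_chain(2)[OF wo C _ _ K]) (use fld in auto)
  then have chU: "chn (c ` ?I)" unfolding chn_def by blast
  have chD: "chn (insert C (c ` {y. (y, x) \<in> r - Id}))" for x
    using chI unfolding chn_def using fld[of _ x] by blast
  have okU: "ok ?U" by (rule ok_Uni[OF chU])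
  have cU: "sub (c x) ?U" if "x \<in> ?I" for x using sub_Uni[OF chU] that by blast
  have cD: "sub (c y) (?D x)" if "(y, x) \<in> r - Id" for x y
    unfolding below_def using sub_Uni[OF chD[of x]] that by blast
  have CD: "sub C (?D x)" for x unfolding below_def using sub_Uni[OF chD[of x]] by blast
  have cc: "sub (c y) (c x)" if "(y, x) \<in> r - Id" for x y
    using sub_trans[OF cD[OF that] subDc] that by (auto simp: Field_def)
  show ?thesis
    unfolding rta_def
  proof (intro conjI allI impI)
    \<comment> \<open>Well-founded descent: subtracting a boundary moves \<open>v\<close> below
      stage \<open>x\<close>, and finite support then puts it into \<open>C\<close> or a single
      earlier stage.\<close>
    have claim: "x \<in> ?I --> (\<forall>v. v \<in> vs (bs (c x)) \<and> app (pj ?U) v = v \<and> app (df ?U) v \<in> vs (bs E) -->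
      (\<exists>y. app (pj ?U) y = y \<and> v - app (df ?U) y \<in> vs (bs E)))" for x
    proof (induction x rule: wf_induct_rule[OF wf])
      case (1 x)
      show ?case
      proof (intro impI allI)
        fix v assume x: "x \<in> ?I" and v: "v \<in> vs (bs (c x)) \<and> app (pj ?U) v = v \<and> app (df ?U) v \<in> vs (bs E)"
        show "\<exists>y. app (pj ?U) y = y \<and> v - app (df ?U) y \<in> vs (bs E)"
        proof (cases "sub (c x) E")
          case True
          then have "v \<in> vs (bs E)" using v vs_mono subD(1)[OF True okc[OF x]] by blast
          then show ?thesis by (intro exI[of _ 0]) simp
        next
          case False
          then have ED: "sub E (?D x)" using alt[OF x] by blast
          have pv: "app (pj (c x)) v = v" "app (df ?U) v = app (df (c x)) v"
            using in_sub[OF cU[OF x] okc[OF x]] v by auto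
          have "app (df (c x)) v \<in> vs (bs (?D x))"
            using v pv(2) vs_mono[OF subD(1)[OF ED E(1)]] by auto
          then obtain y where y: "app (pj (c x)) y = y" "v - app (df (c x)) y \<in> vs (bs (?D x))"
            using rtaD1[OF rt[OF x] pv(1)] by blast
          have yU: "app (pj ?U) y = y" "app (df ?U) y = app (df (c x)) y"
            using y(1) subD(5,7)[OF cU[OF x] okc[OF x]] by (metis app_lin_simps(5))+
          let ?v = "v - app (df (c x)) y"
          have v': "app (pj ?U) ?v = ?v" "app (df ?U) ?v = app (df ?U) v"
            using v yU(2) app_okr(2,4)[OF okU, of y] by simp_all
          have "keys ?v \<subseteq> bs (?D x)" using y(2) unfolding vs_iff by blast
          then obtain Z where Z: "Z \<in> insert C (c ` {y. (y, x) \<in> r - Id})" "keys ?v \<subseteq> bs Z"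
            using chn_finite[OF chD[of x] _ finite_keys] unfolding below_def by blast
          then have vZ: "?v \<in> vs (bs Z)" using y(2) unfolding vs_iff by blast
          have "\<exists>y'. app (pj ?U) y' = y' \<and> ?v - app (df ?U) y' \<in> vs (bs E)"
          proof (cases "Z = C")
            case True
            then have "?v \<in> vs (bs E)" using vZ vs_mono[OF subD(1)[OF E(2) C]] by blast
            then show ?thesis by (intro exI[of _ 0]) simp
          next
            case False
            then obtain z where z: "(z, x) \<in> r - Id" "Z = c z" using Z by blast
            then show ?thesis using 1[OF z(1)] fld[OF z(1)] vZ v' v by auto
          qed
          then obtain y' where "app (pj ?U) y' = y'" "?v - app (df ?U) y' \<in> vs (bs E)" by blast
          then show ?thesis using yU by (intro exI[of _ "y + y'"]) (simp add: algebra_simps)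
        qed
      qed
    qed
    fix v assume v: "app (pj ?U) v = v \<and> app (df ?U) v \<in> vs (bs E)"
    then have vU: "v \<in> vs (bs ?U)" using app_okr(5)[OF okU] by metis
    then obtain Z where Z: "Z \<in> c ` ?I" "keys v \<subseteq> bs Z"
      using chn_finite[OF chU _ finite_keys] ne unfolding vs_iff by blast
    then have "v \<in> vs (bs Z)" using vU unfolding vs_iff by blast
    then show "\<exists>y. app (pj ?U) y = y \<and> v - app (df ?U) y \<in> vs (bs E)" using claim Z(1) v by blast
  next
    fix f assume f: "f * pj ?U = f \<and> f * pr (bs E) = 0 \<and> f * df ?U = 0"
    have fc: "f * pr (bs (c x)) = f * pj (c x)" "f * df (c x) = 0" if "x \<in> ?I" for x
    proof -
      have "f * pj ?U * pr (bs (c x)) = f * pj (c x)" "f * df ?U * pr (bs (c x)) = f * df (c x)"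
        by (simp_all add: mult.assoc subD(2,4)[OF cU[OF that] okc[OF that]])
      then show "f * pr (bs (c x)) = f * pj (c x)" "f * df (c x) = 0" using f by simp_all
    qed
    \<comment> \<open>Functionals are solved upwards. The solution on stage \<open>x\<close> has to
      restrict to all earlier ones, so that the solutions can be glued.\<close>
    define P where "P g x y \<longleftrightarrow> (x \<in> ?I --> y * pj (c x) = y \<and> y * pr (bs E) = 0 \<and>
      f * pr (bs (c x)) = y * df (c x) \<and> (\<forall>z. (z, x) \<in> r - Id --> y * pr (bs (c z)) = g z))" for g x y
    have "\<exists>g. \<forall>x. P g x (g x)"
    proof (rule dependent_wf_choice[OF wf])
      show "P g x y = P h x y" if "\<And>z. (z, x) \<in> r - Id ==> g z = h z" for g h x y
        unfolding P_def using that by auto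
    next
      fix x g assume IH: "\<And>y. (y, x) \<in> r - Id ==> P g y (g y)"
      show "\<exists>y. P g x y"
      proof (cases "x \<in> ?I")
        case True
        note x = True
        let ?lt = "{y. (y, x) \<in> r - Id}"
        have g: "g y * pj (c y) = g y" "g y * pr (bs E) = 0" "f * pr (bs (c y)) = g y * df (c y)"
          "g y * pr (bs (c y)) = g y" if "(y, x) \<in> r - Id" for y
        proof -
          show *: "g y * pj (c y) = g y" "g y * pr (bs E) = 0" "f * pr (bs (c y)) = g y * df (c y)"
            using IH[OF that] fld[OF that] unfolding P_def by auto
          have "g y * pj (c y) * pr (bs (c y)) = g y * pj (c y)"
            by (simp add: mult.assoc okD(2)[OF okc[OF fld[OF that]]])
          then show "g y * pr (bs (c y)) = g y" using * by simp
        qed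
        have gg: "g y * pr (bs (c z)) = g z" if "(z, y) \<in> r - Id" "(y, x) \<in> r - Id" for y z
          using IH[OF that(2)] fld[OF that(2)] that(1) unfolding P_def by auto
        consider "sub (c x) E" | "sub E (?D x)" using alt[OF x] by blast
        then show ?thesis
        proof cases
          \<comment> \<open>Inside \<open>E\<close> the functional vanishes, and so do all earlier
            solutions; 0 continues them.\<close>
          case 1
          have "f * pr (bs (c x)) = f * pr (bs E) * pr (bs (c x))"
            using subD(1)[OF 1 okc[OF x]] by (simp add: mult.assoc inf.absorb2)
          moreover have "g z = 0" if z: "(z, x) \<in> r - Id" for z
          proof -
            have "bs (c z) \<subseteq> bs E" using subD(1)[OF 1 okc[OF x]] subD(1)[OF cc[OF z] okc[OF fld[OF z]]] by blast
            then have "g z = g z * pr (bs E) * pr (bs (c z))"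
              using g(4)[OF z] by (simp add: mult.assoc inf.absorb2)
            then show ?thesis using g(2)[OF z] by simp
          qed
          ultimately show ?thesis using f by (intro exI[of _ 0]) (simp add: P_def)
        next
          case 2
          define g0 where "g0 = glue ?lt (\<lambda>y. bs (c y)) g"
          have cmp: "compat ?lt (\<lambda>y. bs (c y)) g"
            unfolding compat_def
          proof (intro ballI)
            fix y z b assume yz: "y \<in> ?lt" "z \<in> ?lt" "b \<in> bs (c y) \<inter> bs (c z)"
            have *: "app (g y) (bas b) = app (g z) (bas b)"
              if "(y, z) \<in> r - Id" "(z, x) \<in> r - Id" "b \<in> bs (c y)" for y z
              using arg_cong[OF gg[OF that(1,2)], of "\<lambda>h. app h (bas b)"] that(3) by (simp add: pr_bas)
            show "app (g y) (bas b) = app (g z) (bas b)"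
            proof (cases "y = z")
              case False
              then show ?thesis using lin[of y z] *[of y z] *[of z y] yz fld by auto
            qed simp
          qed
          have g0: "g0 * pr (bs (c y)) = g y" if "(y, x) \<in> r - Id" for y
            unfolding g0_def using glue_pr[OF cmp, of y] that g(4) by auto
          have g0E: "g0 * pr (bs E) = 0" unfolding g0_def by (rule glue_pr_zero) (use g(2) in auto)
          \<comment> \<open>The glued functional solves the equation on everything below
            \<open>x\<close>. On \<open>C\<close> both sides vanish, since \<open>C\<close> lies in
            \<open>E\<close>.\<close>
          have D0: "f * pr (bs (?D x)) = g0 * df (?D x)"
          proof (rule Uni_eqI[of _ "insert C (c ` ?lt)"], unfold below_def[symmetric])
            show "f * pr (bs (?D x)) * pr (bs (?D x)) = f * pr (bs (?D x))" by (simp add: mult.assoc)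
            show "g0 * df (?D x) * pr (bs (?D x)) = g0 * df (?D x)" by (simp add: mult.assoc okD(10)[OF okD'[OF x]])
            fix Z assume Z: "Z \<in> insert C (c ` ?lt)"
            show "f * pr (bs (?D x)) * pr (bs Z) = g0 * df (?D x) * pr (bs Z)"
            proof (cases "Z = C")
              case True
              have b: "bs C \<subseteq> bs E" "bs C \<subseteq> bs (?D x)" using subD(1)[OF E(2) C] subD(1)[OF CD C] by auto
              have "f * pr (bs (?D x)) * pr (bs C) = f * pr (bs E) * pr (bs C)"
                using b by (simp add: mult.assoc inf.absorb2)
              moreover have "g0 * df (?D x) * pr (bs C) = g0 * pr (bs E) * df C"
              proof -
                have "pr (bs E) * df C = df C" using pr_mono_left[OF okD(9)[OF C] b(1)] .
                then show ?thesis by (simp add: mult.assoc subD(4)[OF CD C])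
              qed
              ultimately show ?thesis using True f g0E by simp
            next
              case False
              then obtain y where y: "(y, x) \<in> r - Id" "Z = c y" using Z by blast
              note oky = okc[OF fld[OF y(1)]]
              have "f * pr (bs (?D x)) * pr (bs Z) = g y * df (c y)"
                using subD(1)[OF cD[OF y(1)] oky] y(2) g(3)[OF y(1)] by (simp add: mult.assoc inf.absorb2)
              moreover have "g0 * df (?D x) * pr (bs Z) = g0 * pr (bs (c y)) * df (c y)"
                using y(2) by (simp add: mult.assoc subD(4)[OF cD[OF y(1)] oky] okD[OF oky])
              ultimately show ?thesis using g0[OF y(1)] by simp
            qed
          qed
          \<comment> \<open>Composing with the idempotent below \<open>x\<close> makes the
            functional act on the whole stage. What it fails to solve there vanishes below
            \<open>x\<close> and is solved by total acyclicity of this one step.\<close>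
          define g1 where "g1 = g0 * pj (?D x)"
          let ?h = "f * pr (bs (c x)) - g1 * df (c x)"
          note rD = subr[OF subDc[OF x] okD'[OF x]] okr[OF okD'[OF x]] okr[OF okc[OF x]]
          have "bs (?D x) \<subseteq> bs (c x)" using subD(1)[OF subDc[OF x] okD'[OF x]] .
          then have h1: "?h * pr (bs (?D x)) = 0"
            using D0 by (simp add: left_diff_distrib mult.assoc g1_def rD inf.absorb2)
          have h2: "?h * pj (c x) = ?h" by (simp add: left_diff_distrib mult.assoc rD fc(1)[OF x])
          have h3: "?h * df (c x) = 0" by (simp add: left_diff_distrib mult.assoc rD fc(2)[OF x])
          obtain g2 where g2: "g2 * pj (c x) = g2" "g2 * pr (bs (?D x)) = 0" "?h = g2 * df (c x)"
            using rtaD2[OF rt[OF x] h2 h1 h3] by blast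
          have "P g x (g1 + g2)"
            unfolding P_def
          proof (intro impI conjI allI)
            show "(g1 + g2) * pj (c x) = g1 + g2" unfolding g1_def by (simp add: distrib_right g2(1) mult.assoc rD)
            have "g1 * pr (bs E) = g0 * pr (bs E) * pj E"
              unfolding g1_def by (simp add: mult.assoc subD(2)[OF 2 E(1)] okD(1)[OF E(1)])
            moreover have "g2 * pr (bs E) = g2 * pr (bs (?D x)) * pr (bs E)"
              using subD(1)[OF 2 E(1)] by (simp add: mult.assoc inf.absorb2)
            ultimately show "(g1 + g2) * pr (bs E) = 0" using g0E g2(2) by (simp add: distrib_right)
            show "f * pr (bs (c x)) = (g1 + g2) * df (c x)" using g2(3) by (simp add: distrib_right algebra_simps)
            fix z assume z: "(z, x) \<in> r - Id"
            note okz = okc[OF fld[OF z]]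
            have "g1 * pr (bs (c z)) = g0 * pr (bs (c z)) * pj (c z)"
              unfolding g1_def by (simp add: mult.assoc subD(2)[OF cD[OF z] okz] okD(1)[OF okz])
            moreover have "g2 * pr (bs (c z)) = g2 * pr (bs (?D x)) * pr (bs (c z))"
              using subD(1)[OF cD[OF z] okz] by (simp add: mult.assoc inf.absorb2)
            ultimately show "(g1 + g2) * pr (bs (c z)) = g z"
              using g2(2) g0[OF z] g(1)[OF z] by (simp add: distrib_right)
          qed
          then show ?thesis by blast
        qed
      qed (simp add: P_def)
    qed
    then obtain g where "\<And>x. P g x (g x)" by blast
    then have g: "g x * pj (c x) = g x" "g x * pr (bs E) = 0" "f * pr (bs (c x)) = g x * df (c x)"
      "(z, x) \<in> r - Id ==> g x * pr (bs (c z)) = g z" if "x \<in> ?I" for x z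
      using that unfolding P_def by blast+
    have gs: "g x * pr (bs (c x)) = g x" if "x \<in> ?I" for x
    proof -
      have "g x * pj (c x) * pr (bs (c x)) = g x * pj (c x)" by (simp add: mult.assoc okD(2)[OF okc[OF that]])
      then show ?thesis using g(1)[OF that] by simp
    qed
    define G where "G = glue ?I (\<lambda>y. bs (c y)) g"
    have cmp: "compat ?I (\<lambda>y. bs (c y)) g"
      unfolding compat_def
    proof (intro ballI)
      fix y z b assume yz: "y \<in> ?I" "z \<in> ?I" "b \<in> bs (c y) \<inter> bs (c z)"
      have *: "app (g y) (bas b) = app (g z) (bas b)"
        if "(y, z) \<in> r - Id" "z \<in> ?I" "b \<in> bs (c y)" for y z
        using arg_cong[OF g(4)[OF that(2,1)], of "\<lambda>h. app h (bas b)"] that(3) by (simp add: pr_bas)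
      show "app (g y) (bas b) = app (g z) (bas b)"
      proof (cases "y = z")
        case False
        then show ?thesis using lin[of y z] *[of y z] *[of z y] yz fld by auto
      qed simp
    qed
    have G: "G * pr (bs (c x)) = g x" if "x \<in> ?I" for x
      unfolding G_def using glue_pr[OF cmp that] gs[OF that] by simp
    have bU: "bs ?U = (\<Union>x\<in>?I. bs (c x))" unfolding bs_Uni by simp
    have Gs: "G * pr (bs ?U) = G" unfolding G_def bU by (rule glue_supp)
    have "G * pj ?U = G"
    proof (rule Uni_eqI[of _ "c ` ?I"])
      show "G * pj ?U * pr (bs ?U) = G * pj ?U" by (simp add: mult.assoc okD(2)[OF okU])
      fix Z assume "Z \<in> c ` ?I"
      then obtain x where x: "x \<in> ?I" "Z = c x" by blast
      have "G * pj ?U * pr (bs (c x)) = G * pr (bs (c x)) * pj (c x)"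
        by (simp add: mult.assoc subD(2)[OF cU[OF x(1)] okc[OF x(1)]] okD(1)[OF okc[OF x(1)]])
      then show "G * pj ?U * pr (bs Z) = G * pr (bs Z)" using x G[OF x(1)] g(1)[OF x(1)] by simp
    qed (rule Gs)
    moreover have "G * pr (bs E) = 0" unfolding G_def by (rule glue_pr_zero) (use g(2) in auto)
    moreover have "f = G * df ?U"
    proof (rule Uni_eqI[of _ "c ` ?I"])
      have "f * pj ?U * pr (bs ?U) = f * pj ?U" by (simp add: mult.assoc okD(2)[OF okU])
      then show "f * pr (bs ?U) = f" using f by simp
      show "G * df ?U * pr (bs ?U) = G * df ?U" by (simp add: mult.assoc okD(10)[OF okU])
      fix Z assume "Z \<in> c ` ?I"
      then obtain x where x: "x \<in> ?I" "Z = c x" by blast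
      have "G * df ?U * pr (bs (c x)) = G * pr (bs (c x)) * df (c x)"
        by (simp add: mult.assoc subD(4)[OF cU[OF x(1)] okc[OF x(1)]] okD(9)[OF okc[OF x(1)]])
      then show "f * pr (bs Z) = G * df ?U * pr (bs Z)" using x G[OF x(1)] g(3)[OF x(1)] by simp
    qed
    ultimately show "\<exists>g. g * pj ?U = g \<and> g * pr (bs E) = 0 \<and> f = g * df ?U" by blast
  qed
qed

end

section \<open>Test complexes and saturated extensions\<close>

context universe_ring
begin

lemma small_vs:
  assumes "sml A" shows "sml (vs A)"
proof (rule small_functions[OF assms small_corner, of _ lookup])
  show "lookup x a \<in> {a. a * e = a}" if "x \<in> vs A" for x a
    using that unfolding vs_iff by (simp flip: lookup_rscale)
  show "x = y" if "x \<in> vs A" "y \<in> vs A" "\<And>a. a \<in> A ==> lookup x a = lookup y a" for x y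
  proof (rule poly_mapping_eqI)
    fix a
    show "lookup x a = lookup y a"
    proof (cases "a \<in> A")
      case False
      then have "a \<notin> keys x" "a \<notin> keys y" using that(1,2) unfolding vs_iff by blast+
      then show ?thesis by (simp add: in_keys_iff)
    qed (rule that(3))
  qed
qed

text \<open>A matrix is determined by its columns over \<open>B\<close>, and each column is one of a
  small set of vectors over \<open>A\<close>.\<close>

lemma small_lin:
  assumes "sml A" "sml B" shows "sml {f. pr A * f = f \<and> f * pr B = f}"
proof (rule small_functions[OF assms(2) small_vs[OF assms(1)], of _ "\<lambda>f b. app f (bas b)"])
  show "app f (bas b) \<in> vs A" if "f \<in> {f. pr A * f = f \<and> f * pr B = f}" for f b
    using that pr_absorb_left by blast
  fix f g assume f: "f \<in> {f. pr A * f = f \<and> f * pr B = f}" and g: "g \<in> {f. pr A * f = f \<and> f * pr B = f}"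
    and eq: "\<And>b. b \<in> B ==> app f (bas b) = app g (bas b)"
  have z: "app h (bas b) = 0" if "h * pr B = h" "b \<notin> B" for h b
    using arg_cong[OF that(1), of "\<lambda>h. app h (bas b)"] that(2) by (simp add: pr_bas)
  show "f = g"
  proof (rule lin_eq_basI)
    show "f * eps = f" "g * eps = g" using f g pr_absorb_eps(2) by blast+
    show "app f (bas b) = app g (bas b)" for b
      by (cases "b \<in> B") (use eq z f g in auto)
  qed
qed

text \<open>A fixed countably infinite set of labels. Countable bases can be relabelled into it with
  degrees kept, so the complexes supported there form a small set that represents all countably
  supported ones.\<close>

definition core :: "'v set" where
  "core = range (SOME f :: nat => 'v. inj f)"

lemma core: "countable core" "infinite core"
proof -
  obtain f :: "nat => 'v" where "inj f" using infinite_countable_subset[OF infinite_universe] by blast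
  then have "inj (SOME f :: nat => 'v. inj f)" by (rule someI[where P = inj])
  then show "countable core" "infinite core" unfolding core_def by (auto simp: finite_image_iff)
qed

definition tests :: "('v, 'k) dgc set" where
  "tests = {S. ok S \<and> bs S \<subseteq> UNIV \<times> core}"

lemma small_base: "sml ((UNIV :: int set) \<times> core)"
  by (rule small_countable) (use core in simp)

lemma testsD:
  assumes "S \<in> tests" shows "ok S" "sml (bs S)" "countable (bs S)"
proof -
  show "ok S" using assms unfolding tests_def by blast
  have s: "bs S \<subseteq> UNIV \<times> core" using assms unfolding tests_def by blast
  then show "sml (bs S)" using small_subset small_base by blast
  have "countable ((UNIV :: int set) \<times> core)" using core by simp
  then show "countable (bs S)" using s countable_subset by blast
qed

lemma small_tests: "sml tests"
proof (rule small_inj_image[where f = "\<lambda>S. (bs S, pj S, df S)"])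
  let ?B = "(UNIV :: int set) \<times> core"
  let ?L = "{f. pr ?B * f = f \<and> f * pr ?B = f}"
  show "sml ((\<lambda>S. (bs S, pj S, df S)) ` tests)"
  proof (rule small_subset)
    show "sml (Pow ?B \<times> ?L \<times> ?L)"
      by (intro small_Times small_Pow small_lin small_base)
    show "(\<lambda>S. (bs S, pj S, df S)) ` tests \<subseteq> Pow ?B \<times> ?L \<times> ?L"
    proof (rule image_subsetI)
      fix S assume "S \<in> tests"
      then have S: "ok S" "bs S \<subseteq> ?B" unfolding tests_def by auto
      then show "(bs S, pj S, df S) \<in> Pow ?B \<times> ?L \<times> ?L"
        using pr_mono_left[OF okD(1)[OF S(1)] S(2)] pr_mono_right[OF okD(2)[OF S(1)] S(2)]
          pr_mono_left[OF okD(9)[OF S(1)] S(2)] pr_mono_right[OF okD(10)[OF S(1)] S(2)] by blast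
    qed
  qed
  show "inj_on (\<lambda>S. (bs S, pj S, df S)) tests"
    by (rule inj_onI) (auto intro: dgm.equality)
qed

definition dies :: "('v, 'k) dgc => ('v, 'k) dgc => (int \<times> 'v, 'k) lin => bool" where
  "dies S C f \<longleftrightarrow> (\<exists>C'. Kext C C' \<and> null S C' f)"

text \<open>Indices of an arbitrary type are coded by elements of \<open>'v\<close>, the type of the
  tags.\<close>

lemma Kext_amalgam_gen:
  fixes D :: "'j => ('v, 'k) dgc"
  assumes C: "ok C" "sml (bs C)" and J: "sml J" and D: "\<And>i. i \<in> J ==> Kext C (D i)"
  shows "\<exists>C'. Kext C C' \<and> (\<forall>i\<in>J. \<exists>j. hom (D i) C' j \<and> j * pr (bs C) = pj C)"
proof -
  obtain f x where f: "bij_betw (f :: 'j => 'v) J (elts x)" using small_inject[OF J] by blast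
  let ?g = "inv_into J f"
  have g: "?g y \<in> J" if "y \<in> elts x" for y using f that by (metis bij_betw_imp_surj_on inv_into_into)
  have fg: "?g (f i) = i" "f i \<in> elts x" if "i \<in> J" for i
    using f that by (auto simp: bij_betw_def)
  obtain C' where C': "Kext C C'" "\<And>y. y \<in> elts x ==> \<exists>j. hom (D (?g y)) C' j \<and> j * pr (bs C) = pj C"
    using Kext_amalgam[OF C small_elts[of x], of "\<lambda>y. D (?g y)"] D g by blast
  have "\<exists>j. hom (D i) C' j \<and> j * pr (bs C) = pj C" if "i \<in> J" for i
    using C'(2)[OF fg(2)[OF that]] unfolding fg(1)[OF that] .
  then show ?thesis using C'(1) by blast
qed

text \<open>The homotopy over \<open>D\<close> is pushed along \<open>j\<close>, and
  \<open>j\<close> fixes the values of \<open>k\<close> because these lie in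
  \<open>C\<close>.\<close>

lemma null_over:
  assumes "null S D k" "hom D C' j" "j * pr (bs C) = pj C" "hom S C k" "ok C"
  shows "null S C' k"
proof -
  have "pr (bs C) * (pj C * k) = pj C * k" by (rule okr[OF assms(5)])
  then have k: "pr (bs C) * k = k" unfolding homD(2)[OF assms(4)] .
  have "j * pr (bs C) * k = k" unfolding assms(3) by (rule homD(2)[OF assms(4)])
  then have "j * k = k" unfolding mult.assoc k .
  then show ?thesis using null_comp_left[OF assms(1,2)] by simp
qed

text \<open>The tests and their maps to \<open>C\<close> form a small set, so a killing extension
  can be chosen for every map that dies and all choices amalgamated at once. The larger complex may
  receive new maps that die, hence the iteration that follows.\<close>

lemma kill_step:
  assumes C: "ok C" "sml (bs C)"
  shows "\<exists>C'. Kext C C' \<and> (\<forall>S\<in>tests. \<forall>k. hom S C k \<and> dies S C k --> null S C' k)"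
proof -
  let ?J = "{(S, k). S \<in> tests \<and> hom S C k \<and> dies S C k}"
  let ?L = "{f. pr (bs C) * f = f \<and> f * pr ((UNIV :: int set) \<times> core) = f}"
  have "?J \<subseteq> tests \<times> ?L"
  proof (rule subsetI)
    fix p assume "p \<in> ?J"
    then obtain S k where p: "p = (S, k)" and S: "S \<in> tests" "hom S C k" by blast
    have "pr (bs C) * (pj C * k) = pj C * k" by (simp add: okr[OF C(1)])
    moreover have "k * pj S * pr (bs S) = k * pj S" by (simp add: mult.assoc okr[OF testsD(1)[OF S(1)]])
    ultimately have 1: "pr (bs C) * k = k" "k * pr (bs S) = k" using homD(1,2)[OF S(2)] by simp_all
    have "bs S \<subseteq> UNIV \<times> core" using S(1) unfolding tests_def by blast
    then show "p \<in> tests \<times> ?L" using p S(1) 1 pr_mono_right[OF 1(2)] by blast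
  qed
  then have J: "sml ?J" using small_subset small_Times[OF small_tests small_lin[OF C(2) small_base]] by blast
  define D where "D = (\<lambda>(S, k). SOME C'. Kext C C' \<and> null S C' k)"
  have D: "Kext C (D (S, k)) \<and> null S (D (S, k)) k" if "dies S C k" for S k
    unfolding D_def prod.case using that unfolding dies_def by (rule someI_ex)
  obtain C' where C': "Kext C C'" "\<And>p. p \<in> ?J ==> \<exists>j. hom (D p) C' j \<and> j * pr (bs C) = pj C"
    using Kext_amalgam_gen[OF C J, of D] D by blast
  have "null S C' k" if h: "S \<in> tests" "hom S C k" "dies S C k" for S k
  proof -
    obtain j where "hom (D (S, k)) C' j" "j * pr (bs C) = pj C"
      using C'(2)[of "(S, k)"] h by blast
    then show ?thesis using null_over[OF conjunct2[OF D[OF h(3)]] _ _ h(2) C(1)] by blast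
  qed
  then show ?thesis using C'(1) by blast
qed

definition saturated :: "('v, 'k) dgc => bool" where
  "saturated U \<longleftrightarrow> (\<forall>S\<in>tests. \<forall>k. hom S U k \<and> dies S U k --> null S U k)"

text \<open>
  In a tower of length \<open>\<omega>\<^sub>1\<close> every map from a test complex to the union lands in some stage,
  as its image is generated by countably many elements.
\<close>

lemma saturation:
  assumes C: "ok C" "sml (bs C)"
  shows "\<exists>U. Kext C U \<and> saturated U"
proof -
  \<comment> \<open>The well-order of type omega_1, as the cardinal successor of the natural
    numbers; it lives on the type \<open>nat set\<close>.\<close>
  define r :: "nat set rel" where "r = cardSuc natLeq"
  let ?I = "Field r"
  have nat: "Card_order natLeq" "infinite (Field natLeq)" using natLeq_Card_order Field_natLeq by auto
  have card: "Card_order r" "infinite ?I"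
    unfolding r_def using cardSuc_Card_order[OF nat(1)] cardSuc_finite[OF nat(1)] nat(2) by auto
  then have wo: "Well_order r" using Card_order_wo_rel wo_rel_def by blast
  have wf: "wf (r - Id)" using wo unfolding well_order_on_def by blast
  have fld: "y \<in> ?I" if "(y, x) \<in> r - Id" for x y using that by (auto simp: Field_def)
  have tr: "(x, z) \<in> r - Id" if "(x, y) \<in> r - Id" "(y, z) \<in> r - Id" for x y z
    using wo that unfolding well_order_on_def linear_order_on_def partial_order_on_def preorder_on_def
    by (auto dest: transD antisymD)
  have lin: "(y, z) \<in> r - Id \<or> (z, y) \<in> r - Id" if "y \<in> Field r" "z \<in> Field r" "y \<noteq> z" for y z
    using wo that unfolding well_order_on_def linear_order_on_def total_on_def by blast
  \<comment> \<open>The indices of the tower are subsets of the natural numbers, so every set of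
    indices is small.\<close>
  have smlI: "sml A" for A :: "nat set set"
    by (rule small_subset[OF small_Pow[OF small_countable[of UNIV]]]) auto
  define P where "P c x y \<longleftrightarrow> (x \<in> ?I --> Kext (below C c r x) y \<and>
    (\<forall>S\<in>tests. \<forall>k. hom S (below C c r x) k \<and> dies S (below C c r x) k --> null S y k))" for c x y
  have "\<exists>c. \<forall>x. P c x (c x)"
  proof (rule dependent_wf_choice[OF wf])
    fix c c' :: "nat set => ('v, 'k) dgc" and x y
    assume "\<And>z. (z, x) \<in> r - Id ==> c z = c' z"
    then have "c ` {y. (y, x) \<in> r - Id} = c' ` {y. (y, x) \<in> r - Id}" by (intro image_cong) auto
    then show "P c x y = P c' x y" unfolding P_def below_def by simp
  next
    fix x c assume IH: "\<And>y. (y, x) \<in> r - Id ==> P c y (c y)"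
    have K: "Kext (below C c r y) (c y)" if "(y, x) \<in> r - Id" for y
      using IH[OF that] fld[OF that] unfolding P_def by blast
    have ch: "chn (insert C (c ` {y. (y, x) \<in> r - Id}))"
    proof (rule tower_chain(2)[OF wo C(1)])
      show "{y. (y, x) \<in> r - Id} \<subseteq> Field r" using fld by blast
      show "z \<in> {y. (y, x) \<in> r - Id}" if "y \<in> {y. (y, x) \<in> r - Id}" "(z, y) \<in> r - Id" for y z
        using tr that by blast
      show "Kext (below C c r y) (c y)" if "y \<in> {y. (y, x) \<in> r - Id}" for y using K that by blast
    qed
    have "ok (below C c r x)" unfolding below_def by (rule ok_Uni[OF ch])
    moreover have "sml (bs (below C c r x))"
      unfolding below_def
    proof (rule small_Uni)
      show "sml (insert C (c ` {y. (y, x) \<in> r - Id}))"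
        using small_Un[OF small_countable[of "{C}"] small_image[OF smlI]] by simp
      show "sml (bs Z)" if "Z \<in> insert C (c ` {y. (y, x) \<in> r - Id})" for Z
        using that C(2) KextD(4)[OF K] by blast
    qed
    ultimately show "\<exists>y. P c x y" unfolding P_def using kill_step by blast
  qed
  then obtain c where "\<And>x. P c x (c x)" by blast
  then have K: "Kext (below C c r x) (c x)"
    and kill: "S \<in> tests ==> hom S (below C c r x) k ==> dies S (below C c r x) k ==> null S (c x) k"
    if "x \<in> ?I" for x S k
    using that unfolding P_def by blast+
  let ?D = "below C c r" and ?U = "Uni (c ` ?I)"
  have ne: "?I \<noteq> {}" using card(2) by auto
  have chI: "chn (insert C (c ` ?I))" by (rule tower_chain(2)[OF wo C(1) _ _ K]) (use fld in auto)
  then have chU: "chn (c ` ?I)" unfolding chn_def by blast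
  have chD: "chn (insert C (c ` {y. (y, x) \<in> r - Id}))" for x
    using chI unfolding chn_def using fld[of _ x] by blast
  have okc: "ok (c x)" and okDx: "ok (?D x)" and Dc: "sub (?D x) (c x)" if "x \<in> ?I" for x
    using KextD[OF K[OF that]] by auto
  have cU: "sub (c x) ?U" if "x \<in> ?I" for x using sub_Uni[OF chU] that by blast
  have cD: "sub (c y) (?D x)" if "(y, x) \<in> r - Id" for x y
    unfolding below_def using sub_Uni[OF chD[of x]] that by blast
  have CD: "sub C (?D x)" for x unfolding below_def using sub_Uni[OF chD[of x]] by blast
  have DU: "sub (?D x) ?U" if "x \<in> ?I" for x using sub_trans[OF Dc cU] that by blast
  have CU: "sub C ?U" using ne sub_trans[OF CD DU] by blast
  have DD: "sub (?D x) (?D y)" if "x \<in> ?I" "y \<in> ?I" "x = y \<or> (x, y) \<in> r - Id" for x y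
    using that sub_refl[OF okDx] sub_trans[OF Dc cD] by blast
  have smU: "sml (bs ?U)" by (rule small_Uni) (use small_image[OF smlI] KextD(4)[OF K] in auto)
  have okU: "ok ?U" by (rule ok_Uni[OF chU])
  have smD: "sml (bs (?D x))" if "x \<in> ?I" for x using KextD(3)[OF K[OF that]] .
  \<comment> \<open>Cutting the tower at an intermediate place shows that the union extends it too.
    Therefore a map that dies over the union already dies over that place.\<close>
  have KD: "Kext (?D x) ?U" if x: "x \<in> ?I" for x
  proof -
    have "rta (?D x) ?U"
    proof (rule tower_rta[OF wo C(1) ne K okDx[OF x] CD DU[OF x]])
      show "sub (c y) (?D x) \<or> sub (?D x) (?D y)" if y: "y \<in> ?I" for y
        using cD[of y x] DD[OF x y] lin[OF x y] by blast
    qed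
    then show ?thesis unfolding Kext_def using okDx x okU smD smU DU by blast
  qed
  have "rta C ?U" by (rule tower_rta[OF wo C(1) ne K C(1) sub_refl[OF C(1)] CU]) (use CD in auto)
  then have KC: "Kext C ?U" unfolding Kext_def using C okU smU CU by blast
  have "saturated ?U"
    unfolding saturated_def
  proof (intro ballI allI impI)
    fix S k assume S: "S \<in> tests" and k: "hom S ?U k \<and> dies S ?U k"
    \<comment> \<open>The basis elements met by the map: countably many, since \<open>bs S\<close>
      is countable and every column has finite support.\<close>
    let ?K = "\<Union>b\<in>bs S. keys (app k (bas b))"
    have cK: "countable ?K" using testsD(3)[OF S] by (intro countable_UN) (auto intro: countable_finite)
    have "pr (bs ?U) * (pj ?U * k) = pj ?U * k" by (simp add: okr[OF okU])
    then have pk: "pr (bs ?U) * k = k" using homD(2) k by metis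
    have "?K \<subseteq> (\<Union>x\<in>?I. bs (?D x))"
    proof
      fix z assume "z \<in> ?K"
      then obtain b where "z \<in> keys (app k (bas b))" by blast
      then have "z \<in> bs ?U" using pk unfolding pr_absorb_left vs_iff by blast
      then obtain x where x: "x \<in> ?I" "z \<in> bs (c x)" unfolding bs_Uni by blast
      \<comment> \<open>An infinite cardinal order has no last element, so the complexes strictly
        below some index exhaust the union as well.\<close>
      obtain y where y: "y \<in> ?I" "x \<noteq> y" "(x, y) \<in> r" using infinite_Card_order_limit[OF card x(1)] by blast
      then have "z \<in> bs (?D y)" using subD(1)[OF cD[of x y] okc[OF x(1)]] x(2) by blast
      then show "z \<in> (\<Union>x\<in>?I. bs (?D x))" using y(1) by blast
    qed
    moreover have "relChain r (\<lambda>x. bs (?D x))"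
      unfolding relChain_def
    proof (intro allI impI)
      fix x y assume xy: "(x, y) \<in> r"
      then have "x \<in> ?I" "y \<in> ?I" by (auto simp: Field_def)
      then show "bs (?D x) \<subseteq> bs (?D y)" using DD[of x y] xy subD(1)[OF _ okDx] by blast
    qed
    moreover have "(card_of ?K, natLeq) \<in> ordLeq" 
    proof -
      obtain f :: "int \<times> 'v => nat" where "inj_on f ?K" using cK unfolding countable_def by blast
      then have "(card_of ?K, card_of (UNIV :: nat set)) \<in> ordLeq"
        unfolding card_of_ordLeq[symmetric] by blast
      then show ?thesis using ordLeq_ordIso_trans card_of_nat by blast
    qed
    \<comment> \<open>Regularity of omega_1: a countable subset of an increasing union of this
      length lies in one member.\<close>
    ultimately obtain x where x: "x \<in> ?I" "?K \<subseteq> bs (?D x)"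
      using cardSuc_UNION[OF nat, of "\<lambda>x. bs (?D x)" ?K] unfolding r_def by blast
    have ke: "k * eps = k" using pr_absorb_eps(1)[OF pk] .
    have "k * pj S * pr (bs S) = k * pj S" by (simp add: mult.assoc okr[OF testsD(1)[OF S]])
    then have ks: "k * pr (bs S) = k" using homD(1) k by metis
    have kD: "pr (bs (?D x)) * k = k"
    proof (rule pr_absorb_leftI[OF ke])
      fix b
      show "app k (bas b) \<in> vs (bs (?D x))"
      proof (cases "b \<in> bs S")
        case True
        then show ?thesis using x(2) pk unfolding pr_absorb_left vs_iff by blast
      next
        case False
        then have "app k (bas b) = 0" using arg_cong[OF ks, of "\<lambda>h. app h (bas b)"] by (simp add: pr_bas)
        then show ?thesis by simp
      qed
    qed
    have sD: "sub (?D x) ?U" by (rule DU[OF x(1)])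
    have homk: "hom S ?U k" using k by blast
    have "pj ?U * (pr (bs (?D x)) * k) = pj (?D x) * k" "df ?U * (pr (bs (?D x)) * k) = df (?D x) * k"
      by (simp_all add: subr[OF sD okDx[OF x(1)]])
    then have "pj (?D x) * k = k" "df (?D x) * k = df ?U * k" unfolding kD using homD(2)[OF homk] by simp_all
    then have "hom S (?D x) k" unfolding hom_def using homD[OF homk] by simp
    moreover have "dies S (?D x) k" using k Kext_trans[OF KD[OF x(1)]] unfolding dies_def by blast
    ultimately have "null S (c x) k" using kill[OF x(1) S] by blast
    then show "null S ?U k" using null_sub cU[OF x(1)] okc[OF x(1)] by blast
  qed
  then show ?thesis using KC by blast
qed

section \<open>Test complexes detect contractibility\<close>

text \<open>Columns have finite support, so closing \<open>{b}\<close> under the supports of the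
  columns of \<open>pj D\<close> and \<open>df D\<close> adds finitely many elements for each one
  present and ends after countably many rounds.\<close>

lemma countable_closure:
  assumes D: "ok D" and b: "b \<in> bs D"
  shows "\<exists>K. countable K \<and> b \<in> K \<and> K \<subseteq> bs D \<and>
    pr K * (pj D * pr K) = pj D * pr K \<and> pr K * (df D * pr K) = df D * pr K"
proof -
  let ?n = "\<lambda>x. keys (app (pj D) (bas x)) \<union> keys (app (df D) (bas x))"
  define K where "K = rec_nat {b} (\<lambda>_ A. A \<union> (\<Union>x\<in>A. ?n x))"
  have K0: "K 0 = {b}" and KS: "K (Suc n) = K n \<union> (\<Union>x\<in>K n. ?n x)" for n unfolding K_def by simp_all
  have nb: "?n x \<subseteq> bs D" for x
    using app_okr(5,6)[OF D, of "bas x"] unfolding vs_iff by blast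
  have "countable (?n x)" for x by (rule countable_finite) simp
  then have cK: "countable (K n)" for n by (induction n) (simp_all add: K0 KS)
  have sK: "K n \<subseteq> bs D" for n
  proof (induction n)
    case (Suc n)
    then show ?case unfolding KS using nb by blast
  qed (use b in \<open>simp add: K0\<close>)
  have close: "?n x \<subseteq> (\<Union>n. K n)" if "x \<in> (\<Union>n. K n)" for x
  proof -
    obtain n where "x \<in> K n" using \<open>x \<in> (\<Union>n. K n)\<close> by blast
    then have "?n x \<subseteq> K (Suc n)" unfolding KS by blast
    then show ?thesis by blast
  qed
  have *: "pr (\<Union>n. K n) * (f * pr (\<Union>n. K n)) = f * pr (\<Union>n. K n)"
    if f: "f * eps = f" "\<And>x. keys (app f (bas x)) \<subseteq> ?n x" for f
  proof (rule pr_absorb_leftI)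
    fix x
    have "rscale (app f (bas x)) e = app f (bas x)" by (simp flip: app_rscale)
    then show "app (f * pr (\<Union>n. K n)) (bas x) \<in> vs (\<Union>n. K n)"
      using f(2)[of x] close[of x] by (cases "x \<in> (\<Union>n. K n)") (auto simp: pr_bas vs_iff)
  qed (simp add: mult.assoc)
  show ?thesis
  proof (intro exI conjI)
    show "countable (\<Union>n. K n)" using cK by blast
    show "b \<in> (\<Union>n. K n)" using K0 by blast
    show "(\<Union>n. K n) \<subseteq> bs D" using sK by blast
    show "pr (\<Union>n. K n) * (pj D * pr (\<Union>n. K n)) = pj D * pr (\<Union>n. K n)"
      "pr (\<Union>n. K n) * (df D * pr (\<Union>n. K n)) = df D * pr (\<Union>n. K n)"
      by (rule *; use okD[OF D] in auto)+
  qed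
qed

text \<open>\<open>r\<close> and \<open>r'\<close> are the matrices of a bijection from
  \<open>K\<close> to a part of the test basis and of its inverse; they carry a countably supported
  complex to a test.\<close>

lemma partial_reloc:
  assumes K: "countable K"
  shows "\<exists>r r' B. r' * r = pr K \<and> r * r' = pr B \<and> B \<subseteq> UNIV \<times> core \<and> dg 0 r \<and> dg 0 r' \<and>
    r * pr K = r \<and> pr K * r' = r' \<and> pr B * r = r \<and> r' * pr B = r'"
proof -
  have "snd ` K \<lesssim> core"
  proof -
    have "snd ` K \<lesssim> (UNIV :: nat set)" using K unfolding lepoll_def countable_def
      by (metis K countableE countable_image subset_UNIV)
    moreover have "(UNIV :: nat set) \<lesssim> core" using core(2) infinite_le_lepoll by blast
    ultimately show ?thesis using lepoll_trans by blast
  qed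
  then obtain \<phi> where \<phi>: "inj_on \<phi> (snd ` K)" "\<phi> ` snd ` K \<subseteq> core" unfolding lepoll_def by blast
  define h where "h = (\<lambda>(n :: int, x). (n, \<phi> x))"
  have hi: "inj_on h K" using \<phi>(1) unfolding h_def inj_on_def by force
  have h2: "h ` K \<subseteq> UNIV \<times> core" using \<phi>(2) unfolding h_def by force
  have h3: "fst (h p) = fst p" for p unfolding h_def by (simp add: case_prod_unfold)
  define r where "r = ext (\<lambda>i. if i \<in> K then bas (h i) else 0)"
  define r' where "r' = ext (\<lambda>j. if j \<in> h ` K then bas (inv_into K h j) else 0)"
  have rb: "app r (bas i) = (if i \<in> K then bas (h i) else 0)" for i unfolding r_def app_ext_bas by simp
  have rb': "app r' (bas j) = (if j \<in> h ` K then bas (inv_into K h j) else 0)" for j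
    unfolding r'_def app_ext_bas by simp
  have re: "r * eps = r" "r' * eps = r'" unfolding r_def r'_def by simp_all
  show ?thesis
  proof (intro exI conjI)
    show "h ` K \<subseteq> UNIV \<times> core" by (rule h2)
    show "r' * r = pr K"
      by (rule lin_eq_basI) (auto simp: mult.assoc re rb rb' pr_bas hi)
    show "r * r' = pr (h ` K)"
      by (rule lin_eq_basI) (auto simp: mult.assoc re rb rb' pr_bas hi)
    show "r * pr K = r" "r' * pr (h ` K) = r'"
      by (rule pr_absorb_rightI; simp add: re rb rb')+
    show "pr (h ` K) * r = r"
      by (rule pr_absorb_leftI[OF re(1)]) (auto simp: rb)
    show "pr K * r' = r'"
      by (rule pr_absorb_leftI[OF re(2)]) (auto simp: rb' hi)
    show "dg 0 r"
      unfolding r_def by (rule dg_ext) (auto simp: mem_Times_iff h3)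
    show "dg 0 r'"
      unfolding r'_def
    proof (rule dg_ext)
      fix n x
      have "fst (inv_into K h (n, x)) = n" if "(n, x) \<in> h ` K"
        using f_inv_into_f[OF that] h3 by (metis fst_conv)
      then show "(if (n, x) \<in> h ` K then bas (inv_into K h (n, x)) else 0) \<in> vs (lev (n + 0))"
        by (auto simp: mem_Times_iff)
    qed
  qed
qed

text \<open>
  A contraction is built by extending a partial contraction over the countable closure of one more
  basis element; the obstruction is a map from a test complex.
\<close>

lemma extend_contraction:
  assumes D: "ok D" and test: "\<And>S k. S \<in> tests ==> hom S D k ==> null S D k"
    and B: "B \<subseteq> bs D" "pr B * (pj D * pr B) = pj D * pr B" "pr B * (df D * pr B) = df D * pr B"
    and s: "pj D * s = s" "s * (pj D * pr B) = s" "dg (- 1) s" "pj D * pr B = df D * s + s * (df D * pr B)"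
    and b: "b \<in> bs D"
  shows "\<exists>B' s'. insert b B \<subseteq> B' \<and> B' \<subseteq> bs D \<and> pr B' * (pj D * pr B') = pj D * pr B' \<and>
    pr B' * (df D * pr B') = df D * pr B' \<and> pj D * s' = s' \<and> s' * (pj D * pr B') = s' \<and> dg (- 1) s' \<and>
    pj D * pr B' = df D * s' + s' * (df D * pr B') \<and> s' * pr B = s"
proof -
  obtain K where K: "countable K" "b \<in> K" "K \<subseteq> bs D" "pr K * (pj D * pr K) = pj D * pr K"
    "pr K * (df D * pr K) = df D * pr K"
    using countable_closure[OF D b] by blast
  define B' where "B' = B \<union> K"
  define p where "p = pj D"
  define d where "d = df D"
  define u where "u = pr B"
  define v where "v = pr B'"
  \<comment> \<open>\<open>K - B\<close> is the basis of the quotient of the enlarged part of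
    \<open>D\<close> by the old one, and it is countable.\<close>
  define c where "c = pr (K - B)"
  have eps: "p * eps = p" "d * eps = d" "eps * p = p" "eps * d = d" using okD[OF D] unfolding p_def d_def by auto
  have uv: "u * v = u" "v * u = u" "u * u = u" "v * v = v" "c * c = c" "c * u = 0" "u * c = 0"
    "v * c = c" "c * v = c"
    unfolding u_def v_def c_def B'_def by (simp_all add: Int_absorb1 Int_absorb2 Int_Diff inf.absorb1 inf.absorb2 Diff_Int_distrib)
      (auto intro!: arg_cong[where f = pr] simp flip: pr_empty)
  have vsum: "v = u + c"
  proof -
    have "c = v - u" unfolding c_def v_def u_def B'_def
      by (subst pr_Diff[symmetric]) (auto intro!: arg_cong[where f = pr])
    then show ?thesis by simp
  qed
  have pp: "p * p = p" "p * d = d" "d * p = d" "d * d = 0" unfolding p_def d_def using okD[OF D] by auto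
  \<comment> \<open>The union of two basis sets whose spans are invariant under \<open>f\<close> has
    an invariant span again.\<close>
  have closed: "v * (f * v) = f * v" if f: "f * eps = f" "u * (f * u) = f * u" "pr K * (f * pr K) = f * pr K" for f
  proof (rule lin_eq_basI)
    fix x
    consider "x \<in> B" | "x \<in> K" | "x \<notin> B'" unfolding B'_def by blast
    then show "app (v * (f * v)) (bas x) = app (f * v) (bas x)"
    proof cases
      case 1
      then have "app (f * u) (bas x) = app f (bas x)" unfolding u_def by (simp add: pr_bas)
      moreover have "v * (f * u) = f * u"
      proof -
        have "v * (u * (f * u)) = u * (f * u)" using uv(2) by (simp add: mult.assoc[symmetric])
        then show ?thesis unfolding f(2) .
      qed
      then have "app v (app (f * u) (bas x)) = app (f * u) (bas x)" by (metis app_lin_simps(5))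
      ultimately have "app v (app f (bas x)) = app f (bas x)" by simp
      then show ?thesis using 1 unfolding v_def B'_def by (simp add: pr_bas)
    next
      case 2
      have "v * pr K = pr K" unfolding v_def B'_def by (simp add: Int_absorb1)
      then have "v * (pr K * (f * pr K)) = pr K * (f * pr K)" by (simp add: mult.assoc[symmetric])
      then have "v * (f * pr K) = f * pr K" unfolding f(3) .
      then have "app v (app (f * pr K) (bas x)) = app (f * pr K) (bas x)" by (metis app_lin_simps(5))
      then have "app v (app f (bas x)) = app f (bas x)" using 2 by (simp add: pr_bas)
      then show ?thesis using 2 unfolding v_def B'_def by (simp add: pr_bas)
    qed (simp add: v_def pr_bas)
  qed (simp_all add: mult.assoc v_def)
  have pv: "v * (p * v) = p * v" and dv: "v * (d * v) = d * v"
    using closed[OF eps(1)] closed[OF eps(2)] B(2,3) K(4,5) unfolding p_def d_def u_def by auto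
  have pu: "u * (p * u) = p * u" and du: "u * (d * u) = d * u" using B(2,3) unfolding p_def d_def u_def by auto
  have cu: "c * (p * u) = 0" "c * (d * u) = 0"
  proof -
    have "c * (u * (p * u)) = 0" "c * (u * (d * u)) = 0" using uv(6) by (simp_all add: mult.assoc[symmetric])
    then show "c * (p * u) = 0" "c * (d * u) = 0" unfolding pu du by auto
  qed
  have s': "p * s = s" "s * (p * u) = s" "p * u = d * s + s * (d * u)" using s(1,2,4) unfolding p_def d_def u_def by auto
  note R = uv uv[THEN mult_rule] pp pp[THEN mult_rule] pv du pu dv
    pv[THEN mult_rule, unfolded mult.assoc] dv[THEN mult_rule, unfolded mult.assoc]
    pu[THEN mult_rule, unfolded mult.assoc] du[THEN mult_rule, unfolded mult.assoc]
    cu cu[THEN mult_rule, unfolded mult.assoc] s'(1) s'(1)[THEN mult_rule] s'(2) s'(2)[THEN mult_rule, unfolded mult.assoc]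
  have vc: "v * (p * c) = p * c" "v * (d * c) = d * c"
  proof -
    have "v * (p * v) * c = p * v * c" "v * (d * v) * c = d * v * c" using pv dv by auto
    then show "v * (p * c) = p * c" "v * (d * c) = d * c" by (simp_all only: mult.assoc uv)
  qed
  have cc: "c * (p * c) = p * c - u * (p * c)" "c * (d * c) = d * c - u * (d * c)"
    using vc unfolding vsum by (simp_all add: distrib_right algebra_simps)
  \<comment> \<open>The old contraction \<open>s\<close> is extended to \<open>B'\<close> for the
    time being without regard to the contraction equation.\<close>
  define t where "t = s * (p * v)"
  \<comment> \<open>The defect of \<open>t\<close>. It is a cochain map into \<open>D\<close> that
    vanishes on \<open>B\<close>, so it lives on the quotient with basis
    \<open>K - B\<close>.\<close>
  define k where "k = p * v - d * t - t * (d * v)"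
  have t: "p * t = t" "t * u = s" "t * (p * v) = t"
    unfolding t_def by (simp_all add: mult.assoc R)
  have su: "s * u = s"
  proof -
    have "s * (p * u) * u = s * (p * u)" by (simp only: mult.assoc uv)
    then show ?thesis unfolding s'(2) .
  qed
  have tdu: "t * (d * u) = s * (d * u)"
  proof -
    have "t * (u * (d * u)) = s * (d * u)" by (simp add: mult.assoc[symmetric] t(2))
    then show ?thesis unfolding du .
  qed
  have tv: "t * v = t" unfolding t_def by (simp add: mult.assoc R)
  note T = t t[THEN mult_rule] t(3)[THEN mult_rule, unfolded mult.assoc] tdu tv tv[THEN mult_rule]
  have ku: "k * u = 0" unfolding k_def using s'(3) by (simp add: left_diff_distrib mult.assoc R T)
  have kv: "k * v = k" unfolding k_def by (simp add: left_diff_distrib mult.assoc R T)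
  have kpv: "k * (p * v) = k" unfolding k_def by (simp add: left_diff_distrib mult.assoc R T)
  have pk: "p * k = k" unfolding k_def by (simp add: right_diff_distrib R T)
  have dk: "d * k = k * (d * v)" unfolding k_def by (simp add: left_diff_distrib right_diff_distrib mult.assoc R T)
  have kc: "k * c = k" using kv ku unfolding vsum by (simp add: distrib_left)
  have dgs: "dg 0 p" "dg 1 d" "dg 0 u" "dg 0 v" "dg 0 c" "dg (- 1) s" "dg (- 1) t" "dg 0 k"
  proof -
    show *: "dg 0 p" "dg 1 d" "dg 0 u" "dg 0 v" "dg 0 c" "dg (- 1) s"
      unfolding p_def d_def u_def v_def c_def using okD(7,8)[OF D] s(3) by auto
    show **: "dg (- 1) t" unfolding t_def using dg_mult[OF *(6) dg_mult[OF *(1,4) refl] refl] by simp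
    show "dg 0 k" unfolding k_def
      using dg_mult[OF *(1,4) refl] dg_mult[OF *(2) ** refl] dg_mult[OF ** dg_mult[OF *(2,4) refl] refl]
      by (auto intro!: dg_diff)
  qed
  obtain r r' A where r: "r' * r = c" "r * r' = pr A" "A \<subseteq> UNIV \<times> core" "dg 0 r" "dg 0 r'"
    "r * c = r" "c * r' = r'" "pr A * r = r" "r' * pr A = r'"
    using partial_reloc[of "K - B"] K(1) unfolding c_def by blast
  \<comment> \<open>The quotient complex, compressed to \<open>K - B\<close> and relabelled into the
    test basis.\<close>
  define S where "S = \<lparr>bs = A, pj = r * (p * r'), df = r * (d * r')\<rparr>"
  note rr = r(1,2,6-9) r(1,2,6-9)[THEN mult_rule]
  have cpcp: "c * (p * (c * (p * c))) = c * (p * c)" "c * (p * (c * (d * c))) = c * (d * c)"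
    "c * (d * (c * (p * c))) = c * (d * c)" "c * (d * (c * (d * c))) = 0"
    unfolding cc by (simp_all add: right_diff_distrib R cc)
  have mid: "r * (f * (c * (g * r'))) = r * (h * r')" if "c * (f * (c * (g * c))) = c * (h * c)" for f g h
  proof -
    have "r * (c * (f * (c * (g * c)))) * r' = r * (c * (h * c)) * r'" using that by simp
    then show ?thesis by (simp add: mult.assoc rr)
  qed
  have mid0: "r * (d * (c * (d * r'))) = 0" using mid[of d d 0] cpcp(4) by simp
  have S: "S \<in> tests"
    unfolding tests_def ok_def S_def
    using r(3) dg_mult[OF r(4) dg_mult[OF dgs(1) r(5) refl] refl] dg_mult[OF r(4) dg_mult[OF dgs(2) r(5) refl] refl]
    by (simp add: mult.assoc rr mid[OF cpcp(1)] mid[OF cpcp(2)] mid[OF cpcp(3)] mid0)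
  have kcp: "k * (c * (p * c)) = k * c" "k * (c * (d * c)) = d * (k * c)"
  proof -
    have "k * (u * z) = 0" for z using ku by (simp add: mult.assoc[symmetric])
    then have "k * (c * (p * c)) = k * (p * c)" "k * (c * (d * c)) = k * (d * c)"
      unfolding cc by (simp_all add: right_diff_distrib)
    moreover have "k * (p * v) * c = k * c" "k * (d * v) * c = d * k * c" using kpv dk by auto
    ultimately show "k * (c * (p * c)) = k * c" "k * (c * (d * c)) = d * (k * c)"
      by (simp_all only: mult.assoc uv)
  qed
  have "hom S D (k * r')"
    unfolding hom_def S_def p_def[symmetric] d_def[symmetric]
  proof (intro conjI, simp_all only: dgm.simps)
    have "k * (c * (p * c)) * r' = k * c * r'" "k * (c * (d * c)) * r' = d * (k * c) * r'" using kcp by auto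
    then have *: "k * (c * (p * r')) = k * r'" "k * (c * (d * r')) = d * (k * r')"
      by (simp_all only: mult.assoc rr)
    show "k * r' * (r * (p * r')) = k * r'" using * by (simp add: mult.assoc rr)
    show "d * (k * r') = k * r' * (r * (d * r'))" using * by (simp add: mult.assoc rr)
    show "p * (k * r') = k * r'" using pk by (simp add: mult.assoc[symmetric])
    show "dg 0 (k * r')" using dg_mult[OF dgs(8) r(5) refl] by simp
  qed
  then have "null S D (k * r')" by (rule test[OF S])
  \<comment> \<open>The assumption on tests makes the defect null-homotopic. Adding this homotopy
    repairs \<open>t\<close>, and since it vanishes over \<open>B\<close> the old values of the
    contraction are kept.\<close>
  then obtain a0 where a0: "a0 * (r * (p * r')) = a0" "p * a0 = a0" "dg (- 1) a0"
    "k * r' = d * a0 + a0 * (r * (d * r'))"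
    unfolding null_def S_def p_def d_def by auto
  define a where "a = a0 * r"
  have a: "p * a = a" "dg (- 1) a" "a * c = a"
    unfolding a_def using a0(2) dg_mult[OF a0(3) r(4) refl] r(6) by (simp_all add: mult.assoc[symmetric]) (simp add: mult.assoc)
  have ka: "k = d * a + a * (d * c)"
  proof -
    have "k = k * r' * r" using kc r(1) by (simp add: mult.assoc)
    also have "\<dots> = d * a + a * (d * c)" unfolding a0(4) a_def by (simp add: distrib_right mult.assoc rr)
    finally show ?thesis .
  qed
  define s1 where "s1 = t + a * (p * v)"
  have ac: "a * (c * z) = a * z" for z using a(3) by (simp add: mult.assoc[symmetric])
  have apu: "a * (p * u) = 0" "a * (d * u) = 0" using ac[of "p * u"] ac[of "d * u"] cu by auto
  have "p * s1 = s1" unfolding s1_def using a(1) by (simp add: distrib_left t mult.assoc[symmetric])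
  moreover have "s1 * (p * v) = s1" unfolding s1_def by (simp add: distrib_right mult.assoc R T)
  moreover have "dg (- 1) s1" unfolding s1_def
    using dgs(7) dg_mult[OF a(2) dg_mult[OF dgs(1,4) refl] refl] by (auto intro: dg_add)
  moreover have "p * v = d * s1 + s1 * (d * v)"
  proof -
    have "a * (d * (c * (p * v))) = a * (d * v)"
    proof -
      have "a * (d * (v * (p * v))) = a * (d * (u * (p * v))) + a * (d * (c * (p * v)))"
        by (subst (1) vsum) (simp add: distrib_right distrib_left)
      moreover have "a * (d * (u * (p * v))) = 0" using apu(2) by (simp add: mult.assoc[symmetric])
      moreover have "a * (d * (v * (p * v))) = a * (d * v)" by (simp add: R)
      ultimately show ?thesis by simp
    qed
    moreover have "k = k * (p * v)" using kpv by simp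
    ultimately have "k = d * (a * (p * v)) + a * (d * v)"
      by (subst ka) (metis (no_types, lifting) ka distrib_right mult.assoc)
    moreover have "d * s1 + s1 * (d * v) = (p * v - k) + d * (a * (p * v)) + a * (d * v)"
      unfolding s1_def k_def by (simp add: distrib_left distrib_right mult.assoc R)
    ultimately show ?thesis by simp
  qed
  moreover have "s1 * u = s" unfolding s1_def by (simp add: distrib_right t mult.assoc uv apu)
  moreover have "insert b B \<subseteq> B'" "B' \<subseteq> bs D" unfolding B'_def using K B(1) by auto
  ultimately show ?thesis using pv dv unfolding p_def d_def v_def u_def by blast
qed

text \<open>Zorn's lemma for partial contractions, each defined over a basis set with invariant
  span. Chains are glued, and a maximal one is total because it could otherwise be extended over one
  more basis element.\<close>

lemma tests_contractible:
  assumes D: "ok D" and test: "\<And>S k. S \<in> tests ==> hom S D k ==> null S D k"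
  shows "null D D (pj D)"
proof -
  define G where "G = {(B, s). B \<subseteq> bs D \<and> pr B * (pj D * pr B) = pj D * pr B \<and>
    pr B * (df D * pr B) = df D * pr B \<and> pj D * s = s \<and> s * (pj D * pr B) = s \<and> dg (- 1) s \<and>
    pj D * pr B = df D * s + s * (df D * pr B)}"
  define le where "le x y \<longleftrightarrow> fst x \<subseteq> fst y \<and> snd y * pr (fst x) = snd x" for x y :: "(int \<times> 'v) set \<times> (int \<times> 'v, 'k) lin"
  have GD: "s * pr B = s" if "(B, s) \<in> G" for B s
  proof -
    have a: "s * (pj D * pr B) = s" using that unfolding G_def by blast
    have "s * (pj D * pr B) * pr B = s * (pj D * pr B)" by (simp add: mult.assoc)
    then show ?thesis unfolding a .
  qed
  have "\<exists>m\<in>G. \<forall>a\<in>G. le m a --> a = m"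
  proof (rule predicate_Zorn)
    show "partial_order_on G (relation_of le G)"
    proof (rule partial_order_on_relation_ofI)
      show "le a a" if "a \<in> G" for a using that GD unfolding le_def by (cases a) auto
      show "le a c" if "a \<in> G" "b \<in> G" "c \<in> G" "le a b" "le b c" for a b c
      proof -
        have "snd c * pr (fst b) * pr (fst a) = snd c * pr (fst a)"
          using that(4) unfolding le_def by (simp add: mult.assoc inf.absorb2)
        then show ?thesis using that unfolding le_def by auto
      qed
      show "a = b" if "a \<in> G" "b \<in> G" "le a b" "le b a" for a b
        using that GD unfolding le_def by (cases a, cases b) auto
    qed
  next
    fix F assume F: "F \<in> Chains (relation_of le G)"
    then have FG: "F \<subseteq> G" and lin: "\<And>x y. x \<in> F ==> y \<in> F ==> le x y \<or> le y x"
      unfolding Chains_def relation_of_def by auto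
    let ?B = "\<Union>x\<in>F. fst x" and ?s = "glue F fst snd"
    have x: "fst x \<subseteq> bs D" "pr (fst x) * (pj D * pr (fst x)) = pj D * pr (fst x)"
      "pr (fst x) * (df D * pr (fst x)) = df D * pr (fst x)" "pj D * snd x = snd x"
      "snd x * (pj D * pr (fst x)) = snd x" "dg (- 1) (snd x)"
      "pj D * pr (fst x) = df D * snd x + snd x * (df D * pr (fst x))" "snd x * pr (fst x) = snd x" if "x \<in> F" for x
    proof -
      have "(fst x, snd x) \<in> G" using that FG by auto
      note * = this GD[OF this]
      show "fst x \<subseteq> bs D" "pr (fst x) * (pj D * pr (fst x)) = pj D * pr (fst x)"
        "pr (fst x) * (df D * pr (fst x)) = df D * pr (fst x)" "pj D * snd x = snd x"
        "snd x * (pj D * pr (fst x)) = snd x" "dg (- 1) (snd x)"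
        "pj D * pr (fst x) = df D * snd x + snd x * (df D * pr (fst x))" "snd x * pr (fst x) = snd x"
        using * unfolding G_def by blast+
    qed
    have le_bas: "app (snd x) (bas b) = app (snd y) (bas b)" if "le x y" "b \<in> fst x" for x y b
      using arg_cong[OF conjunct2[OF that(1)[unfolded le_def]], of "\<lambda>f. app f (bas b)"] that(2) by (simp add: pr_bas)
    have cmp: "compat F fst snd"
      unfolding compat_def using lin le_bas by (metis IntD1 IntD2)
    have s: "?s * pr (fst x) = snd x" if "x \<in> F" for x using glue_pr[OF cmp that] x(8)[OF that] by simp
    have sB: "?s * pr ?B = ?s" by (rule glue_supp)
    have Bx: "pr ?B * pr (fst x) = pr (fst x)" if "x \<in> F" for x
    proof -
      have "?B \<inter> fst x = fst x" using that by blast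
      then show ?thesis by simp
    qed
    have cl: "pr ?B * (f * pr ?B) = f * pr ?B"
      if f: "\<And>x. x \<in> F ==> pr (fst x) * (f * pr (fst x)) = f * pr (fst x)" for f
    proof (rule pr_UN_eqI[of _ fst F])
      fix x assume xF: "x \<in> F"
      have "pr ?B * (pr (fst x) * (f * pr (fst x))) = pr (fst x) * (f * pr (fst x))"
        by (simp only: mult.assoc[symmetric] Bx[OF xF])
      then show "pr ?B * (f * pr ?B) * pr (fst x) = f * pr ?B * pr (fst x)"
        unfolding f[OF xF] by (simp only: mult.assoc Bx[OF xF])
    qed (simp_all add: mult.assoc)
    have c1: "pr ?B * (pj D * pr ?B) = pj D * pr ?B" by (rule cl) (rule x(2))
    have c2: "pr ?B * (df D * pr ?B) = df D * pr ?B" by (rule cl) (rule x(3))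
    have sf: "?s * (f * pr (fst x)) = snd x * (f * pr (fst x))"
      if "x \<in> F" "pr (fst x) * (f * pr (fst x)) = f * pr (fst x)" for x f
    proof -
      have "?s * (pr (fst x) * (f * pr (fst x))) = snd x * (f * pr (fst x))"
        by (simp only: mult.assoc[symmetric] s[OF that(1)])
      then show ?thesis unfolding that(2) .
    qed
    have "pj D * ?s = ?s"
      by (rule pr_UN_eqI[of _ fst F]) (simp_all only: mult.assoc sB s x(4))
    moreover have "?s * (pj D * pr ?B) = ?s"
    proof (rule pr_UN_eqI[of _ fst F])
      show "?s * (pj D * pr ?B) * pr (fst y) = ?s * pr (fst y)" if "y \<in> F" for y
        by (simp only: mult.assoc Bx[OF that] sf[OF that x(2)[OF that]] s[OF that] x(5)[OF that])
    qed (simp_all add: mult.assoc sB)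
    moreover have "dg (- 1) ?s" by (rule dg_glue) (rule x(6))
    moreover have "pj D * pr ?B = df D * ?s + ?s * (df D * pr ?B)"
    proof (rule pr_UN_eqI[of _ fst F])
      show "pj D * pr ?B * pr (fst y) = (df D * ?s + ?s * (df D * pr ?B)) * pr (fst y)" if "y \<in> F" for y
        by (simp only: distrib_right mult.assoc Bx[OF that] sf[OF that x(3)[OF that]] s[OF that] x(7)[OF that, symmetric])
    qed (simp_all only: distrib_right mult.assoc sB, simp_all)
    ultimately have "(?B, ?s) \<in> G" unfolding G_def using x(1) c1 c2 by blast
    moreover have "le x (?B, ?s)" if "x \<in> F" for x unfolding le_def using that s by auto
    ultimately show "\<exists>u\<in>G. \<forall>a\<in>F. le a u" by blast
  qed
  then obtain B s where m: "(B, s) \<in> G" "\<And>a. a \<in> G ==> le (B, s) a ==> a = (B, s)" by (metis surj_pair)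
  note g = m(1)[unfolded G_def, simplified]
  have "bs D \<subseteq> B"
  proof
    fix b assume b: "b \<in> bs D"
    obtain B' s' where B': "insert b B \<subseteq> B'" "(B', s') \<in> G" "s' * pr B = s"
      using extend_contraction[OF D test, of B s b] g b unfolding G_def by blast
    then have "(B', s') = (B, s)" using m(2)[of "(B', s')"] unfolding le_def by auto
    then show "b \<in> B" using B'(1) by blast
  qed
  then have "B = bs D" using g by blast
  then show ?thesis unfolding null_def using g okD[OF D] by (intro exI[of _ s]) auto
qed

end

section \<open>Mapping cocones\<close>

context universe_ring
begin

text \<open>Two distinct labels, which keep the two summands of a cocone apart.\<close>

definition tags :: "'v \<times> 'v" where
  "tags = (SOME (s, t). s \<noteq> t)"

lemma tags: "fst tags \<noteq> snd tags"
proof -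
  have "\<exists>s t :: 'v. s \<noteq> t"
  proof (rule ccontr)
    assume "\<not> ?thesis"
    then have "(UNIV :: 'v set) \<subseteq> {undefined}" by auto
    then show False using infinite_universe finite_subset by blast
  qed
  then have "\<exists>p :: 'v \<times> 'v. (case p of (s, t) => s \<noteq> t)" by auto
  then have "case tags of (s, t) => s \<noteq> t" unfolding tags_def by (rule someI_ex)
  then show ?thesis by (simp add: case_prod_unfold)
qed

text \<open>Degree \<open>n\<close> of the cocone of a map from \<open>A\<close> to \<open>B\<close>
  is made of degree \<open>n\<close> of \<open>A\<close> and degree \<open>n - 1\<close> of
  \<open>B\<close>, so the second block is moved up by one. Below, \<open>j1\<close> and
  \<open>j2\<close> are the block inclusions, \<open>k1\<close> and \<open>k2\<close> the block
  projections, while \<open>sg\<close> and \<open>sg'\<close> raise and lower the degree.\<close>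

definition h1 :: "int \<times> 'v => int \<times> 'v" where "h1 = tagm 0 (fst tags)"
definition h2 :: "int \<times> 'v => int \<times> 'v" where "h2 = tagm 1 (snd tags)"
definition hs :: "int \<times> 'v => int \<times> 'v" where "hs = (\<lambda>(n, x). (n + 1, x))"

definition j1 :: "(int \<times> 'v, 'k) lin" where "j1 = reloc h1"
definition j2 :: "(int \<times> 'v, 'k) lin" where "j2 = reloc h2"
definition k1 :: "(int \<times> 'v, 'k) lin" where "k1 = coreloc h1"
definition k2 :: "(int \<times> 'v, 'k) lin" where "k2 = coreloc h2"
definition sg :: "(int \<times> 'v, 'k) lin" where "sg = reloc hs"
definition sg' :: "(int \<times> 'v, 'k) lin" where "sg' = coreloc hs"

lemma hs_bij: "inj hs" "range hs = UNIV"
proof -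
  show "inj hs" unfolding hs_def by (auto simp: inj_def)
  have "p = hs (fst p - 1, snd p)" for p unfolding hs_def by (cases p) simp
  then show "range hs = UNIV" by blast
qed

lemma blk [simp]:
  "k1 * j1 = eps" "k2 * j2 = eps" "k1 * j2 = 0" "k2 * j1 = 0" "sg' * sg = eps" "sg * sg' = eps"
  "j1 * eps = j1" "j2 * eps = j2" "eps * k1 = k1" "eps * k2 = k2" "sg * eps = sg" "eps * sg' = sg'"
  "eps * j1 = j1" "eps * j2 = j2" "k1 * eps = k1" "k2 * eps = k2" "eps * sg = sg" "sg' * eps = sg'"
proof -
  have "range h1 \<inter> range h2 = {}" unfolding h1_def h2_def tagm_def using tags by auto
  then show "k1 * j2 = 0" "k2 * j1 = 0"
    unfolding k1_def k2_def j1_def j2_def by (auto intro!: coreloc_reloc_disjoint)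
  show "k1 * j1 = eps" "k2 * j2 = eps" "sg' * sg = eps"
    unfolding k1_def k2_def j1_def j2_def sg_def sg'_def
    by (rule coreloc_reloc; simp add: h1_def h2_def hs_bij)+
  show "sg * sg' = eps" unfolding sg_def sg'_def reloc_coreloc[OF hs_bij(1)] hs_bij(2) eps_def ..
  show "j1 * eps = j1" "j2 * eps = j2" "eps * k1 = k1" "eps * k2 = k2" "sg * eps = sg" "eps * sg' = sg'"
    "eps * j1 = j1" "eps * j2 = j2" "k1 * eps = k1" "k2 * eps = k2" "eps * sg = sg" "sg' * eps = sg'"
    unfolding j1_def j2_def k1_def k2_def sg_def sg'_def by simp_all
qed

lemmas blkr = blk blk[THEN mult_rule]

lemma dg_blk: "dg 0 j1" "dg 1 j2" "dg 0 k1" "dg (- 1) k2" "dg 1 sg" "dg (- 1) sg'"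
proof -
  have "fst (hs (n, x)) = n + 1" for n x by (simp add: hs_def)
  then show "dg 1 sg" "dg (- 1) sg'" unfolding sg_def sg'_def by (auto intro!: dg_reloc dg_coreloc hs_bij(1))
  show "dg 0 j1" "dg 1 j2" "dg 0 k1" "dg (- 1) k2"
    unfolding j1_def j2_def k1_def k2_def h1_def h2_def using dg_tagm[of 0] dg_tagm[of 1] by auto
qed

lemma blk_pr:
  "pr (h1 ` B) * j1 = j1 * pr B" "pr (h2 ` B) * j2 = j2 * pr B" "pr (hs ` B) * sg = sg * pr B"
  "k1 * pr (h1 ` B) = pr B * k1" "k2 * pr (h2 ` B) = pr B * k2" "sg' * pr (hs ` B) = pr B * sg'"
  unfolding j1_def j2_def k1_def k2_def sg_def sg'_def
  by (simp_all add: pr_reloc coreloc_pr h1_def h2_def hs_bij)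

definition shf :: "('v, 'k) dgc => ('v, 'k) dgc" where
  "shf X = \<lparr>bs = hs ` bs X, pj = sg * pj X * sg', df = - (sg * df X * sg')\<rparr>"

lemma ok_shf: assumes X: "ok X" shows "ok (shf X)"
proof -
  note R = okr[OF X] blkr blk_pr blk_pr[THEN mult_rule]
  have "dg 0 (sg * pj X * sg')" "dg 1 (sg * df X * sg')"
    using dg_mult[OF dg_mult[OF dg_blk(5) okD(7)[OF X] refl] dg_blk(6) refl]
      dg_mult[OF dg_mult[OF dg_blk(5) okD(8)[OF X] refl] dg_blk(6) refl] by simp_all
  then show ?thesis unfolding ok_def shf_def by (simp add: mult.assoc R dg_uminus)
qed

definition cocn :: "('v, 'k) dgc => ('v, 'k) dgc => (int \<times> 'v, 'k) lin => ('v, 'k) dgc" where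
  "cocn A B g = \<lparr>bs = h1 ` bs A \<union> h2 ` bs B, pj = j1 * pj A * k1 + j2 * pj B * k2,
     df = j1 * df A * k1 + j2 * g * k1 - j2 * df B * k2\<rparr>"

lemma ok_cocn:
  assumes A: "ok A" and B: "ok B" and g: "hom A B g" shows "ok (cocn A B g)"
proof -
  note R = okr[OF A] okr[OF B] blkr blk_pr blk_pr[THEN mult_rule] homD(1-3)[OF g] homD(1-3)[OF g, THEN mult_rule]
  have a: "pr (h1 ` bs A) * (j1 * pj A * k1) = j1 * pj A * k1" "(j1 * pj A * k1) * pr (h1 ` bs A) = j1 * pj A * k1"
    "pr (h2 ` bs B) * (j2 * pj B * k2) = j2 * pj B * k2" "(j2 * pj B * k2) * pr (h2 ` bs B) = j2 * pj B * k2"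
    by (simp_all add: mult.assoc R)
  let ?H = "h1 ` bs A \<union> h2 ` bs B"
  have s: "h1 ` bs A \<subseteq> ?H" "h2 ` bs B \<subseteq> ?H" by auto
  have b: "pr ?H * (j1 * pj A * k1) = j1 * pj A * k1" "(j1 * pj A * k1) * pr ?H = j1 * pj A * k1"
    "pr ?H * (j2 * pj B * k2) = j2 * pj B * k2" "(j2 * pj B * k2) * pr ?H = j2 * pj B * k2"
    using pr_mono_left[OF a(1) s(1)] pr_mono_right[OF a(2) s(1)]
      pr_mono_left[OF a(3) s(2)] pr_mono_right[OF a(4) s(2)] by auto
  have d: "dg 0 (j1 * pj A * k1)" "dg 0 (j2 * pj B * k2)" "dg 1 (j1 * df A * k1)" "dg 1 (j2 * g * k1)" "dg 1 (j2 * df B * k2)"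
    using dg_mult[OF dg_mult[OF dg_blk(1) okD(7)[OF A] refl] dg_blk(3) refl]
      dg_mult[OF dg_mult[OF dg_blk(2) okD(7)[OF B] refl] dg_blk(4) refl]
      dg_mult[OF dg_mult[OF dg_blk(1) okD(8)[OF A] refl] dg_blk(3) refl]
      dg_mult[OF dg_mult[OF dg_blk(2) homD(4)[OF g] refl] dg_blk(3) refl]
      dg_mult[OF dg_mult[OF dg_blk(2) okD(8)[OF B] refl] dg_blk(4) refl] by simp_all
  show ?thesis
    unfolding ok_def
  proof (intro conjI)
    show "pr (bs (cocn A B g)) * pj (cocn A B g) = pj (cocn A B g)"
      "pj (cocn A B g) * pr (bs (cocn A B g)) = pj (cocn A B g)"
      unfolding cocn_def using b by (simp_all add: distrib_left distrib_right)
    show "dg 0 (pj (cocn A B g))" "dg 1 (df (cocn A B g))"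
      unfolding cocn_def using d by (auto intro: dg_add dg_diff)
  qed (simp_all add: cocn_def algebra_simps R)
qed

lemma small_cocn: "sml (bs A) ==> sml (bs B) ==> sml (bs (cocn A B g))"
  unfolding cocn_def by (simp add: small_Un small_image)

text \<open>Neither relabelling the basis nor the sign of the differential affects total acyclicity.
  Shifts in both directions are instances.\<close>

lemma TA_conj:
  assumes X: "ok X" and T: "TA X" and Y: "pj Y = a * pj X * b" "df Y = - (a * df X * b)"
    and ab: "a * b = eps" "b * a = eps" "b * eps = b" "eps * b = b"
  shows "TA Y"
  unfolding TA_def'
proof (intro conjI allI impI)
  note T = T[unfolded TA_def'] and R = ab ab[THEN mult_rule] okr[OF X]
  have c: "b * pj Y = pj X * b" "b * df Y = - (df X * b)" "pj Y * a = a * pj X" "df Y * a = - (a * df X)"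
    unfolding Y by (simp_all add: mult.assoc R)
  {
    fix x assume x: "app (pj Y) x = x \<and> app (df Y) x = 0"
    have "app (pj X) (app b x) = app b x" "app (df X) (app b x) = 0"
      using app_cong[OF c(1), of x] app_cong[OF c(2), of x] x by simp_all
    then obtain y where y: "app (pj X) y = y" "app b x = app (df X) y" using T by blast
    have abY: "a * b * pj Y = pj Y" unfolding Y by (simp add: mult.assoc ab(1)[THEN mult_rule] mult_rule[OF ab(2)] mult_rule[OF okD(13)[OF X]])
    have "app a (app b x) = x" using app_cong[OF abY, of x] x by simp
    then have "x = app (df Y) (- app a y)" unfolding y(2) using app_cong[OF c(4), of y] by simp
    moreover have "app (pj Y) (- app a y) = - app a y" using app_cong[OF c(3), of y] y(1) by simp
    ultimately show "\<exists>y. app (pj Y) y = y \<and> x = app (df Y) y" by blast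
  }
  fix f assume f: "f * pj Y = f \<and> f * df Y = 0"
  have "f * a * pj X = f * pj Y * a" "f * a * df X = - (f * df Y * a)" using c(3,4) by (simp_all add: mult.assoc)
  then have "f * a * pj X = f * a \<and> f * a * df X = 0" using f by simp
  then obtain g where g: "g * pj X = g" "f * a = g * df X" using T by blast
  have "f * pj Y = f * a * pj X * b" unfolding Y by (simp add: mult.assoc)
  then have "f = g * df X * b" using f g(2) by (simp add: mult.assoc okr[OF X])
  then have "f = - (g * b) * df Y" using c(2) by (simp add: mult.assoc)
  moreover have "- (g * b) * pj Y = - (g * b)" using c(1) g(1) by (simp add: mult.assoc mult.assoc[symmetric, of g "pj X"])
  ultimately show "\<exists>g. g * pj Y = g \<and> f = g * df Y" by blast
qed

lemma TA_shf: "ok X ==> TA X ==> TA (shf X)"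
  by (rule TA_conj[of X _ sg sg']) (simp_all add: shf_def)

lemma cocn_proj: "ok A ==> ok B ==> hom A B g ==> hom (cocn A B g) A (pj A * k1)"
proof -
  assume A: "ok A" and B: "ok B" and g: "hom A B g"
  have "dg 0 (pj A * k1)" using dg_mult[OF okD(7)[OF A] dg_blk(3) refl] by simp
  then show ?thesis unfolding hom_def cocn_def by (simp add: algebra_simps okr[OF A] blkr)
qed

text \<open>The weak universal property of the cocone: a null-homotopy \<open>s\<close> of
  \<open>g * a\<close> serves as the second component of a lift of \<open>a\<close>.\<close>

lemma cocn_hom:
  assumes A: "ok A" and B: "ok B" and g: "hom A B g" and a: "hom W A a"
    and s: "s * pj W = s" "pj B * s = s" "dg (- 1) s" "g * a = df B * s + s * df W"
  shows "hom W (cocn A B g) (j1 * a + j2 * s)"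
proof -
  have "dg 0 (j1 * a + j2 * s)"
    using dg_mult[OF dg_blk(1) homD(4)[OF a] refl] dg_mult[OF dg_blk(2) s(3) refl] by (auto intro: dg_add)
  moreover have "df (cocn A B g) * (j1 * a + j2 * s) = (j1 * a + j2 * s) * df W"
  proof -
    have e: "eps * a = a" "eps * s = s"
      using homD(2)[OF a] s(2) okD(13)[OF A] okD(13)[OF B] by (metis mult.assoc)+
    have "df (cocn A B g) * (j1 * a + j2 * s) = j1 * (df A * a) + j2 * (g * a) - j2 * (df B * s)"
      unfolding cocn_def by (simp add: algebra_simps blkr e)
    also have "\<dots> = (j1 * a + j2 * s) * df W"
      unfolding s(4) homD(3)[OF a] by (simp add: algebra_simps)
    finally show ?thesis .
  qed
  moreover have "(j1 * a + j2 * s) * pj W = j1 * a + j2 * s"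
    using homD(1)[OF a] s(1) by (simp add: distrib_right mult.assoc)
  moreover have "pj (cocn A B g) * (j1 * a + j2 * s) = j1 * a + j2 * s"
  proof -
    have e: "eps * a = a" "eps * s = s"
      using homD(2)[OF a] s(2) okD(13)[OF A] okD(13)[OF B] by (metis mult.assoc)+
    show ?thesis unfolding cocn_def using homD(2)[OF a] s(2) by (simp add: algebra_simps blkr e)
  qed
  ultimately show ?thesis unfolding hom_def by blast
qed

text \<open>The cocone of the projection from the cocone of \<open>h\<close> is homotopy equivalent to a shift of the target of \<open>h\<close>.\<close>

lemma TA_cocn_proj:
  assumes S: "ok S" and T: "ok T" "TA T" and h: "hom S T h"
  shows "TA (cocn (cocn S T h) S (pj S * k1))"
proof -
  let ?Z = "cocn S T h"
  let ?F = "pj S * k1"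
  let ?C = "cocn ?Z S ?F"
  have Z: "ok ?Z" by (rule ok_cocn[OF S T(1) h])
  have F: "hom ?Z S ?F" by (rule cocn_proj[OF S T(1) h])
  have C: "ok ?C" by (rule ok_cocn[OF Z S F])
  note R = okr[OF S] okr[OF T(1)] blkr homD(1-3)[OF h] homD(1-3)[OF h, THEN mult_rule]
  \<comment> \<open>\<open>T\<close> sits inside as the second block of the inner cocone. In the map
    back, the term with \<open>h\<close> accounts for the outer copy of \<open>S\<close>.\<close>
  let ?a = "j1 * (j2 * (pj T * sg'))"
  let ?b = "sg * (pj T * (k2 * k1)) - sg * (h * k2)"
  have dga: "dg 0 ?a" using dg_mult[OF dg_blk(1) dg_mult[OF dg_blk(2) dg_mult[OF okD(7)[OF T(1)] dg_blk(6) refl] refl] refl] by simp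
  have dgb: "dg 0 ?b"
    using dg_mult[OF dg_blk(5) dg_mult[OF okD(7)[OF T(1)] dg_mult[OF dg_blk(4,3) refl] refl] refl]
      dg_mult[OF dg_blk(5) dg_mult[OF homD(4)[OF h] dg_blk(4) refl] refl] by (auto intro: dg_diff)
  have a: "hom (shf T) ?C ?a"
    unfolding hom_def using dga by (simp add: cocn_def shf_def algebra_simps R)
  have b: "hom ?C (shf T) ?b"
    unfolding hom_def using dgb by (simp add: cocn_def shf_def algebra_simps R)
  have "null ?C ?C (?a * ?b - pj ?C)"
    unfolding null_def
  proof (intro exI conjI)
    \<comment> \<open>The homotopy cancels the outer, shifted copy of \<open>S\<close> against the
      inner one.\<close>
    let ?s = "- (j1 * (j1 * (pj S * k2)))"
    show "dg (- 1) ?s"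
      using dg_mult[OF dg_blk(1) dg_mult[OF dg_blk(1) dg_mult[OF okD(7)[OF S] dg_blk(4) refl] refl] refl]
      by (auto intro: dg_uminus)
    show "?s * pj ?C = ?s" "pj ?C * ?s = ?s" "?a * ?b - pj ?C = df ?C * ?s + ?s * df ?C"
      by (simp_all add: cocn_def algebra_simps R)
  qed
  then show ?thesis by (rule TA_retract[OF ok_shf[OF T(1)] C a b _ TA_shf[OF T]])
qed

text \<open>The summand \<open>X\<close> cancels against the part of \<open>U\<close> over
  \<open>X\<close>, so the cocone is homotopy equivalent to a shift of
  \<open>quo X U\<close>.\<close>

lemma TA_cocn_incl:
  assumes K: "Kext X U" shows "TA (cocn X U (pj X))"
proof -
  note k = KextD[OF K]
  let ?C = "cocn X U (pj X)"
  let ?Q = "quo X U"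
  have h: "hom X U (pj X)" by (rule hom_incl[OF k(5,1)])
  have C: "ok ?C" by (rule ok_cocn[OF k(1,2) h])
  have Q: "ok ?Q" "TA ?Q" using ok_quo[OF k(1,2,5)] TA_quo[OF k(1,2,5,6)] by auto
  define q where "q = pr (- bs X)"
  define u where "u = pr (bs X)"
  define pQ where "pQ = pj U - pj X"
  have Qe: "pj ?Q = pQ" "df ?Q = q * df U" unfolding quo_def q_def pQ_def by simp_all
  have qf: "q * pj U = pQ" "pj U * q = pQ" "q * df X = 0" "q * pj X = 0" "pj X * q = 0"
    unfolding q_def pQ_def using quo_facts[OF k(1,2,5)] by auto
  have qe: "q = eps - u" unfolding q_def u_def by (rule pr_Compl)
  have uf: "u * pj X = pj X" "pj X * u = pj X" "u * df X = df X" "df X * u = df X" "pj U * u = pj X" "u * pj U = pj X" "df U * u = df X"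
    unfolding u_def using okD[OF k(1)] subD[OF k(5,1)] by auto
  have pQ: "pQ * pQ = pQ" "pQ * pj X = 0" "pj X * pQ = 0" "pj U * pQ = pQ" "pQ * pj U = pQ" "pQ * df X = 0"
    "df X * pQ = 0" "eps * pQ = pQ" "pQ * eps = pQ"
    unfolding pQ_def using okr[OF k(1)] okr[OF k(2)] subr[OF k(5,1)]
    by (simp_all add: algebra_simps) (metis okD(5)[OF k(1)] subD(6)[OF k(5,1)] mult.assoc right_minus_eq)
  \<comment> \<open>In block form, \<open>df U\<close> has the diagonal entries \<open>df X\<close>
    and \<open>dQ\<close> and the off-diagonal entry \<open>th\<close> from the complement into
    \<open>X\<close>.\<close>
  define th where "th = u * df U * pQ"
  define dQ where "dQ = pQ * df U * pQ"
  have dU: "df U = df X + th + dQ"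
  proof -
    have pUs: "pj U = pj X + pQ" unfolding pQ_def by simp
    have "df U = pj U * (df U * pj U)" using okD[OF k(2)] by simp
    also have "\<dots> = pj X * df U * pj X + pj X * df U * pQ + pQ * df U * pj X + pQ * df U * pQ"
      unfolding pUs by (simp add: algebra_simps)
    also have "pj X * df U * pj X = df X" using subr[OF k(5,1)] okr[OF k(1)] by (simp add: mult.assoc)
    also have "pQ * df U * pj X = 0" using subr[OF k(5,1)] pQ by (simp add: mult.assoc)
    also have "pj X * df U * pQ = th"
    proof -
      have "pj X * df U = u * (pj U * df U)" using uf(6) by (simp add: mult.assoc[symmetric])
      then show ?thesis unfolding th_def using okD(4)[OF k(2)] by (simp add: mult.assoc)
    qed
    finally show ?thesis unfolding dQ_def by simp
  qed
  have th: "th * pQ = th" "pj X * th = th" "pQ * th = 0" "th * pj X = 0" "th * df X = 0" "th * th = 0"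
  proof -
    show "th * pQ = th" unfolding th_def by (simp add: mult.assoc pQ)
    have "u * df U = u * (pj U * df U)" using okD(4)[OF k(2)] by simp
    then have *: "u * df U = pj X * df U" using uf(6) by (simp add: mult.assoc[symmetric])
    show "pj X * th = th" unfolding th_def * by (simp add: mult.assoc okr[OF k(1)])
    show "pQ * th = 0" unfolding th_def * by (simp add: mult.assoc mult_rule[OF pQ(2)])
    show "th * pj X = 0" "th * df X = 0" unfolding th_def by (simp_all add: mult.assoc pQ)
    show "th * th = 0" unfolding th_def * by (simp add: mult.assoc mult_rule[OF pQ(2)])
  qed
  have dQ: "dQ * pQ = dQ" "pQ * dQ = dQ" "dQ * pj X = 0" "pj X * dQ = 0" "dQ * df X = 0" "df X * dQ = 0" "dQ * th = 0"
  proof -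
    show "dQ * pQ = dQ" "pQ * dQ = dQ" "dQ * pj X = 0" "pj X * dQ = 0" "dQ * df X = 0" "df X * dQ = 0"
      unfolding dQ_def by (simp_all add: mult.assoc pQ pQ[THEN mult_rule])
    have "dQ * (pj X * th) = 0" using \<open>dQ * pj X = 0\<close> by (simp add: mult.assoc[symmetric])
    then show "dQ * th = 0" unfolding th(2) .
  qed
  have dQ': "df ?Q = dQ"
  proof -
    have "q * df U = q * (pj U * df U)" using okD(4)[OF k(2)] by simp
    then have "q * df U = pQ * df U" using qf(1) by (simp add: mult.assoc[symmetric])
    also have "\<dots> = dQ" unfolding dU by (simp add: distrib_left pQ th dQ)
    finally show ?thesis unfolding Qe .
  qed
  have xt: "df X * th = - (th * dQ)" and dd: "dQ * dQ = 0"
  proof -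
    have dQdQ: "dQ * dQ = 0" using okD(6)[OF Q(1)] unfolding dQ' .
    have "(df X + th + dQ) * (df X + th + dQ) = 0" using okD(6)[OF k(2)] unfolding dU .
    then have "df X * th + th * dQ = 0"
      by (simp add: distrib_left distrib_right th dQ okD[OF k(1)] dQdQ)
    then show "df X * th = - (th * dQ)" by (simp add: add_eq_0_iff)
    show "dQ * dQ = 0" by (rule dQdQ)
  qed
  have pU: "pj U = pj X + pQ" unfolding pQ_def by simp
  have e: "eps * th = th" "eps * dQ = dQ"
  proof -
    have "eps * (pj X * th) = pj X * th" "eps * (pQ * dQ) = pQ * dQ"
      by (simp_all add: okr[OF k(1)] mult_rule[OF pQ(8)])
    then show "eps * th = th" "eps * dQ = dQ" unfolding th(2) dQ(2) by auto
  qed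
  note R = okr[OF k(1)] blkr pQ pQ[THEN mult_rule] th th[THEN mult_rule] dQ dQ[THEN mult_rule]
    xt xt[THEN mult_rule] dd dd[THEN mult_rule] e e[THEN mult_rule]
  have Ce: "pj ?C = j1 * pj X * k1 + j2 * (pj X + pQ) * k2"
    "df ?C = j1 * df X * k1 + j2 * pj X * k1 - j2 * (df X + th + dQ) * k2"
    unfolding cocn_def using pU dU by simp_all
  have Se: "pj (shf ?Q) = sg * pQ * sg'" "df (shf ?Q) = - (sg * dQ * sg')"
    unfolding shf_def using Qe(1) dQ' by simp_all
  have dg: "dg 0 pQ" "dg 1 th"
    unfolding th_def pQ_def u_def
    using okD(7)[OF k(1)] okD(7,8)[OF k(2)]
      dg_mult[OF dg_mult[OF dg_pr okD(8)[OF k(2)] refl] dg_diff[OF okD(7)[OF k(2)] okD(7)[OF k(1)]] refl]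
    by (auto intro: dg_diff)
  \<comment> \<open>The term with \<open>th\<close> makes the inclusion of the shifted quotient
    commute with the differentials.\<close>
  let ?a = "j1 * (th * sg') + j2 * (pQ * sg')"
  let ?b = "sg * (pQ * k2)"
  have a: "hom (shf ?Q) ?C ?a"
    unfolding hom_def Ce Se
    using dg_mult[OF dg_blk(1) dg_mult[OF dg(2) dg_blk(6) refl] refl]
      dg_mult[OF dg_blk(2) dg_mult[OF dg(1) dg_blk(6) refl] refl]
    by (auto simp: algebra_simps R intro: dg_add)
  have b: "hom ?C (shf ?Q) ?b"
    unfolding hom_def Ce Se
    using dg_mult[OF dg_blk(5) dg_mult[OF dg(1) dg_blk(4) refl] refl]
    by (auto simp: algebra_simps R)
  have "null ?C ?C (?a * ?b - pj ?C)"
    unfolding null_def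
  proof (intro exI conjI)
    let ?s = "- (j1 * (pj X * k2))"
    show "dg (- 1) ?s"
      using dg_mult[OF dg_blk(1) dg_mult[OF okD(7)[OF k(1)] dg_blk(4) refl] refl] by (auto intro: dg_uminus)
    show "?s * pj ?C = ?s" "pj ?C * ?s = ?s" "?a * ?b - pj ?C = df ?C * ?s + ?s * df ?C"
      unfolding Ce by (simp_all add: algebra_simps R)
  qed
  then show ?thesis by (rule TA_retract[OF ok_shf[OF Q(1)] C a b _ TA_shf[OF Q]])
qed

section \<open>A weakly terminal totally acyclic complex over a complex\<close>

text \<open>
  Two maps \<open>h : S \<rightarrow> C\<close> and \<open>h' : S \<rightarrow> C'\<close> into extensions of \<open>X\<close> by totally acyclic complexes define
  morphisms from \<open>S\<close> to \<open>X\<close> in the Verdier quotient. The relation expresses what equality of these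
  morphisms means for maps into common extensions.
\<close>

definition vrel where
  "vrel X S C h C' h' \<longleftrightarrow> (\<forall>E j j'. Kext X E \<and> hom C E j \<and> hom C' E j' \<and> j * pr (bs X) = pj X \<and> j' * pr (bs X) = pj X -->
     (\<exists>T g l. ok T \<and> sml (bs T) \<and> TA T \<and> hom S T g \<and> hom T E l \<and> null S E (j * h - j' * h' - l * g)))"

text \<open>Set-many fractions represent all morphisms from \<open>S\<close> to \<open>X\<close> in
  the Verdier quotient. The construction of the extension uses the hypothesis on Hom-sets in this
  form.\<close>

definition small_fractions where
  "small_fractions X S \<longleftrightarrow> (\<exists>(J :: 'v set) D h. sml J \<and> (\<forall>i\<in>J. Kext X (D i) \<and> hom S (D i) (h i)) \<and>
     (\<forall>C k. Kext X C \<and> hom S C k --> (\<exists>i\<in>J. vrel X S C k (D i) (h i))))"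

text \<open>The representatives for all tests are amalgamated into one \<open>C\<close>. Any map
  from a test to a larger \<open>E\<close> then differs, up to homotopy, from one with values in
  \<open>C\<close> by a map through a totally acyclic complex, and attaching a cone kills that
  map.\<close>

lemma realise_fractions:
  assumes X: "ok X" "sml (bs X)" and sf: "\<And>S. S \<in> tests ==> small_fractions X S"
  shows "\<exists>C. Kext X C \<and> (\<forall>E. Kext C E --> (\<forall>S\<in>tests. \<forall>k. hom S E k --> (\<exists>h. hom S C h \<and> dies S E (k - h))))"
proof -
  have "\<forall>S\<in>tests. \<exists>(J :: 'v set) D h. sml J \<and> (\<forall>i\<in>J. Kext X (D i) \<and> hom S (D i) (h i)) \<and>
     (\<forall>C k. Kext X C \<and> hom S C k --> (\<exists>i\<in>J. vrel X S C k (D i) (h i)))"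
    using sf unfolding small_fractions_def by blast
  then obtain J D h where J: "\<And>S. S \<in> tests ==> sml (J S :: 'v set)"
    "\<And>S i. S \<in> tests ==> i \<in> J S ==> Kext X (D S i) \<and> hom S (D S i) (h S i)"
    "\<And>S C k. S \<in> tests ==> Kext X C ==> hom S C k ==> \<exists>i\<in>J S. vrel X S C k (D S i) (h S i)"
    by metis
  let ?I = "Sigma tests J"
  have "sml ?I" by (rule small_Sigma[OF small_tests J(1)])
  then obtain C where C: "Kext X C"
    "\<And>p. p \<in> ?I ==> \<exists>j. hom (case p of (S, i) => D S i) C j \<and> j * pr (bs X) = pj X"
  proof -
    have "Kext X (case p of (S, i) => D S i)" if "p \<in> ?I" for p using that J(2) by auto
    then show thesis using Kext_amalgam_gen[OF X \<open>sml ?I\<close>, of "\<lambda>(S, i). D S i"] that by blast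
  qed
  note c = KextD[OF C(1)]
  have "\<exists>f. hom S C f \<and> dies S E (k - f)" if E: "Kext C E" and S: "S \<in> tests" and k: "hom S E k" for E S k
  proof -
    note ee = KextD[OF E]
    have XE: "Kext X E" by (rule Kext_trans[OF C(1) E])
    obtain i where i: "i \<in> J S" "vrel X S E k (D S i) (h S i)" using J(3)[OF S XE k] by blast
    obtain j where j: "hom (D S i) C j" "j * pr (bs X) = pj X" using C(2)[of "(S, i)"] S i(1) by auto
    have "hom (D S i) E j" by (rule hom_sub[OF j(1) ee(5,1)])
    moreover have "pj E * pr (bs X) = pj X" using subD(2)[OF KextD(5,1)[OF XE]] .
    ultimately obtain T g l where T: "ok T" "sml (bs T)" "TA T" "hom S T g" "hom T E l"
      "null S E (pj E * k - j * h S i - l * g)"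
      using i(2) XE hom_id[OF ee(2)] j(2) unfolding vrel_def by blast
    obtain E' where E': "Kext E E'" "null T E' l" using Kext_cone[OF ee(2,4) T(1,2,3,5)] by blast
    have "null S E' (k - j * h S i - l * g)"
      using null_sub[OF T(6) KextD(5,1)[OF E'(1)]] homD(2)[OF k] by simp
    moreover have "null S E' (l * g)" by (rule null_comp_right[OF E'(2) T(4)])
    ultimately have "null S E' (k - j * h S i)" using null_add by fastforce
    moreover have "hom S C (j * h S i)" using hom_comp[OF _ j(1)] J(2)[OF S i(1)] by blast
    ultimately show ?thesis using E'(1) unfolding dies_def by blast
  qed
  then show ?thesis using C(1) by blast
qed

text \<open>Connecting maps raise the degree by one, so saturation has to be applied to shifted
  tests too.\<close>

lemma shf_tests: "S \<in> tests ==> shf S \<in> tests"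
  unfolding tests_def using ok_shf by (auto simp: shf_def hs_def)

lemma local_extension:
  assumes X: "ok X" "sml (bs X)" and sf: "\<And>S. S \<in> tests ==> small_fractions X S"
  shows "\<exists>U. Kext X U \<and> (\<forall>T u. ok T \<and> sml (bs T) \<and> TA T \<and> hom T X u --> null T U u)"
proof -
  obtain C where C: "Kext X C"
    "\<And>E S k. Kext C E ==> S \<in> tests ==> hom S E k ==> \<exists>h. hom S C h \<and> dies S E (k - h)"
    using realise_fractions[OF X sf] by blast
  obtain U where U: "Kext C U" "saturated U" using saturation KextD(2,4)[OF C(1)] by blast
  have "null T U u" if T: "ok T" "sml (bs T)" "TA T" and uX: "hom T X u" for T u
  proof -
    have XU: "Kext X U" by (rule Kext_trans[OF C(1) U(1)])
    note ku = KextD[OF XU]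
    have u: "hom T U u" by (rule hom_sub[OF uX ku(5,1)])
    \<comment> \<open>The cone makes \<open>u\<close> null-homotopic; the further extension to
      \<open>W\<close> restores saturation.\<close>
    obtain U' where U': "Kext U U'" "null T U' u" using Kext_cone[OF ku(2,4) T u] by blast
    obtain W where W: "Kext U' W" "saturated W" using saturation KextD(2,4)[OF U'(1)] by blast
    have UW: "Kext U W" by (rule Kext_trans[OF U'(1) W(1)])
    note kw = KextD[OF UW]
    have nW: "null T W u" using null_sub[OF U'(2)] KextD(5,1)[OF W(1)] by blast
    let ?Q = "quo U W"
    define q where "q = pr (- bs U)"
    have Q: "ok ?Q" by (rule ok_quo[OF kw(1,2,5)])
    note qf = quo_facts[OF kw(1,2,5), folded q_def]
    have Qe: "pj ?Q = q * pj W" "df ?Q = q * df W" unfolding quo_def q_def using quo_facts(1)[OF kw(1,2,5)] by simp_all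
    have qq: "q * q = q" "eps * q = q" "q * eps = q" unfolding q_def by simp_all
    have pqW: "pj W * q = q * pj W" using qf(1,2) by simp
    have qdq: "q * (df W * q) = q * df W" using qf(3) unfolding qf(6) by (simp add: right_diff_distrib)
    have inU: "pj U * f = f" "df W * f = df U * f" if "pj W * f = f" "q * f = 0" for f
    proof -
      have "(pj W - pj U) * f = 0" using that unfolding qf(2)[symmetric] by (simp add: mult.assoc)
      then show 1: "pj U * f = f" using that(1) by (simp add: left_diff_distrib)
      have "df W * (pj U * f) = df U * (pj U * f)" by (simp add: subr[OF kw(5,1)] okr[OF kw(1)])
      then show "df W * f = df U * f" unfolding 1 .
    qed
    have test: "null S ?Q k" if S: "S \<in> tests" and k: "hom S ?Q k" for S k
    proof -
      note oS = testsD(1)[OF S]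
      have qk: "q * k = k" "pj W * k = k"
      proof -
        have 1: "q * pj W * k = k" using homD(2)[OF k] unfolding Qe .
        have "q * (q * pj W * k) = q * pj W * k" by (simp add: mult.assoc[symmetric] qq)
        then show "q * k = k" unfolding 1 .
        have "pj W * (q * pj W * k) = q * pj W * k"
          using pqW[THEN mult_rule] by (simp add: mult.assoc okr[OF kw(2)])
        then show "pj W * k = k" unfolding 1 .
      qed
      \<comment> \<open>The connecting map: \<open>k\<close> commutes with the differentials only
        modulo \<open>U\<close>, and its defect in \<open>W\<close> has values in \<open>U\<close>,
        one degree higher.\<close>
      define m where "m = df W * k - k * df S"
      have m: "pj W * m = m" "q * m = 0"
      proof -
        show "pj W * m = m" unfolding m_def using mult_rule[OF qk(2)] by (simp add: right_diff_distrib okr[OF kw(2)])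
        have "q * (df W * k) = k * df S" using homD(3)[OF k] unfolding Qe by (simp add: mult.assoc)
        then show "q * m = 0" unfolding m_def using mult_rule[OF qk(1)] by (simp add: right_diff_distrib)
      qed
      note mU = inU[OF m]
      have kS: "k * pj S = k" by (rule homD(1)[OF k])
      have dm: "df U * m = - (m * df S)"
        unfolding mU(2)[symmetric] unfolding m_def
        by (simp add: algebra_simps okr[OF kw(2)] okr[OF oS])
      have mS: "m * pj S = m" unfolding m_def by (simp add: left_diff_distrib mult.assoc okr[OF oS] kS)
      have dgm: "dg 1 m" unfolding m_def
        using dg_mult[OF okD(8)[OF kw(2)] homD(4)[OF k] refl] dg_mult[OF homD(4)[OF k] okD(8)[OF oS] refl]
        by (auto intro: dg_diff)
      have hm: "hom (shf S) U (m * sg')"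
        unfolding hom_def shf_def using dg_mult[OF dgm dg_blk(6) refl] mU(1) mS dm
        by (simp add: mult.assoc blkr mult_rule[OF mS] mult_rule[OF mU(1)] mult_rule[OF dm] okr[OF oS])
      \<comment> \<open>Over \<open>W\<close> the shifted \<open>k\<close> itself is a null-homotopy
        of the connecting map, so saturation yields a null-homotopy inside \<open>U\<close>.\<close>
      have "null (shf S) W (m * sg')"
        unfolding null_def
      proof (intro exI[of _ "k * sg'"] conjI)
        show "dg (- 1) (k * sg')" using dg_mult[OF homD(4)[OF k] dg_blk(6) refl] by simp
        show "k * sg' * pj (shf S) = k * sg'" unfolding shf_def by (simp add: mult.assoc blkr okr[OF oS] mult_rule[OF kS])
        show "pj W * (k * sg') = k * sg'" by (rule mult_rule[OF qk(2)])
        show "m * sg' = df W * (k * sg') + k * sg' * df (shf S)"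
          unfolding m_def shf_def by (simp add: algebra_simps blkr okr[OF oS])
      qed
      then have "dies (shf S) U (m * sg')" using UW unfolding dies_def by blast
      then have "null (shf S) U (m * sg')" using U(2) hm shf_tests[OF S] unfolding saturated_def by blast
      then obtain a' where a': "a' * pj (shf S) = a'" "pj U * a' = a'" "dg (- 1) a'"
        "m * sg' = df U * a' + a' * df (shf S)" unfolding null_def by blast
      define a where "a = a' * sg"
      have aS: "a * pj S = a"
      proof -
        have "a' * pj (shf S) * sg * pj S = a' * pj (shf S) * sg" unfolding shf_def by (simp add: mult.assoc blkr okr[OF oS])
        then show ?thesis unfolding a'(1) a_def .
      qed
      have aU: "pj U * a = a" unfolding a_def by (rule mult_rule[OF a'(2)])
      have dga: "dg 0 a" unfolding a_def using dg_mult[OF a'(3) dg_blk(5) refl] by simp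
      have am: "m = df U * a - a * df S"
      proof -
        have "m = m * pj S" using mS by simp
        also have "\<dots> = m * sg' * sg * pj S" by (simp add: mult.assoc blkr okr[OF oS])
        also have "\<dots> = df U * a - a * df S"
          unfolding a'(4) a_def shf_def using aS unfolding a_def
          by (simp add: algebra_simps blkr okr[OF oS])
        finally show ?thesis .
      qed
      have aW: "pj W * a = a" "df W * a = df U * a"
      proof -
        have "pj W * (pj U * a) = pj U * a" "df W * (pj U * a) = df U * (pj U * a)"
          by (simp_all add: subr[OF kw(5,1)] okr[OF kw(1)])
        then show "pj W * a = a" "df W * a = df U * a" unfolding aU by auto
      qed
      \<comment> \<open>Corrected by \<open>a\<close>, which has values in \<open>U\<close>, the map
        \<open>k\<close> lifts to a cochain map to \<open>W\<close>.\<close>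
      have k1W: "hom S W (k - a)"
        unfolding hom_def
      proof (intro conjI)
        show "(k - a) * pj S = k - a" using kS aS by (simp add: left_diff_distrib)
        show "pj W * (k - a) = k - a" using qk(2) aW(1) by (simp add: right_diff_distrib)
        show "dg 0 (k - a)" using homD(4)[OF k] dga by (rule dg_diff)
        have "df W * k - df W * a = k * df S - a * df S" using am unfolding m_def aW(2) by (simp add: algebra_simps)
        then show "df W * (k - a) = (k - a) * df S" by (simp add: left_diff_distrib right_diff_distrib)
      qed
      obtain f where f: "hom S C f" "dies S W (k - a - f)" using C(2)[OF Kext_trans[OF U(1) UW] S k1W] by blast
      have fU: "hom S U f" using hom_sub[OF f(1)] KextD(5,1)[OF U(1)] by blast
      have "hom S W (k - a - f)" by (rule hom_diff[OF k1W hom_sub[OF fU kw(5,1)]])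
      then have "null S W (k - a - f)" using W(2) S f(2) unfolding saturated_def by blast
      then obtain t where t: "t * pj S = t" "pj W * t = t" "dg (- 1) t" "k - a - f = df W * t + t * df S"
        unfolding null_def by blast
      have qz: "q * y = 0" if "pj U * y = y" for y
      proof -
        have "q * (pj U * y) = 0" using qf(4) by (simp add: mult.assoc[symmetric])
        then show ?thesis unfolding that .
      qed
      \<comment> \<open>Both \<open>a\<close> and \<open>f\<close> have values in \<open>U\<close>
        and disappear in the quotient; the null-homotopic difference is all that is left.\<close>
      have "k = q * (k - a - f)" using qk(1) qz[OF aU] qz[OF homD(2)[OF fU]] by (simp add: right_diff_distrib)
      also have "\<dots> = df ?Q * (q * t) + (q * t) * df S"
        unfolding t(4) Qe using qdq[THEN mult_rule] by (simp add: distrib_left mult.assoc mult_rule[OF qdq])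
      finally have 1: "k = df ?Q * (q * t) + (q * t) * df S" .
      have "pj ?Q * (q * t) = q * t"
        unfolding Qe using t(2) pqW[THEN mult_rule] by (simp add: mult.assoc mult_rule[OF qq(1)])
      moreover have "dg (- 1) (q * t)" using dg_mult[OF dg_pr t(3) refl] unfolding q_def by simp
      ultimately show ?thesis unfolding null_def using 1 t(1)
        by (intro exI[of _ "q * t"]) (simp add: mult.assoc)
    qed
    have "null ?Q ?Q (pj ?Q)" by (rule tests_contractible[OF Q test])
    then obtain w where w: "w * pj ?Q = w" "pj ?Q * w = w" "dg (- 1) w" "pj ?Q = df ?Q * w + w * df ?Q"
      unfolding null_def by blast
    obtain s where s: "s * pj T = s" "pj W * s = s" "dg (- 1) s" "u = df W * s + s * df T"
      using nW unfolding null_def by blast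
    \<comment> \<open>As \<open>u\<close> has values in \<open>U\<close>, the image of
      \<open>s\<close> in the quotient commutes with the differentials up to sign. The contraction
      \<open>w\<close> turns it into the boundary of \<open>rh\<close>.\<close>
    define s1 where "s1 = q * s"
    define rh where "rh = w * s1"
    have qu: "q * u = 0"
    proof -
      have "q * (pj U * u) = 0" using qf(4) by (simp add: mult.assoc[symmetric])
      then show ?thesis unfolding homD(2)[OF u] .
    qed
    have ds1: "df ?Q * s1 + s1 * df T = 0"
    proof -
      have "df ?Q * s1 + s1 * df T = q * (df W * s + s * df T)"
        unfolding Qe s1_def using mult_rule[OF qdq] by (simp add: distrib_left mult.assoc)
      then show ?thesis using qu s(4) by simp
    qed
    have ps1: "pj ?Q * s1 = s1"
      unfolding Qe s1_def using s(2) pqW[THEN mult_rule] by (simp add: mult.assoc mult_rule[OF qq(1)])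
    have qrh: "pj ?Q * rh = rh" "q * rh = rh" "pj W * rh = rh"
    proof -
      show 1: "pj ?Q * rh = rh" unfolding rh_def by (rule mult_rule[OF w(2)])
      have "q * (q * pj W * rh) = q * pj W * rh" by (simp add: mult.assoc[symmetric] qq)
      then show "q * rh = rh" using 1 unfolding Qe by simp
      have "pj W * (q * pj W * rh) = q * pj W * rh"
        using pqW[THEN mult_rule] by (simp add: mult.assoc okr[OF kw(2)])
      then show "pj W * rh = rh" using 1 unfolding Qe by simp
    qed
    have drh: "df ?Q * rh = s1 + rh * df T"
    proof -
      have "df ?Q * rh = (pj ?Q - w * df ?Q) * s1" unfolding rh_def using w(4) by (simp add: mult.assoc[symmetric])
      also have "\<dots> = s1 - w * (df ?Q * s1)" using ps1 by (simp add: left_diff_distrib mult.assoc)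
      also have "df ?Q * s1 = - (s1 * df T)" using ds1 by (simp add: add_eq_0_iff2)
      finally show ?thesis unfolding rh_def by (simp add: mult.assoc)
    qed
    \<comment> \<open>Subtracting the boundary of \<open>rh\<close> does not disturb the equation
      for \<open>u\<close> and moves the homotopy into \<open>U\<close>.\<close>
    define s2 where "s2 = s - (df W * rh - rh * df T)"
    have s2: "pj W * s2 = s2" "q * s2 = 0"
    proof -
      show "pj W * s2 = s2" unfolding s2_def using s(2) mult_rule[OF qrh(3)] by (simp add: right_diff_distrib okr[OF kw(2)])
      have "q * (df W * rh) = df ?Q * rh" unfolding Qe by (simp add: mult.assoc)
      then have "q * s2 = s1 - (df ?Q * rh - rh * df T)"
        unfolding s2_def s1_def using mult_rule[OF qrh(2)] by (simp add: right_diff_distrib)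
      then show "q * s2 = 0" unfolding drh by simp
    qed
    have s2U: "pj U * s2 = s2" "df W * s2 = df U * s2" using inU[OF s2] by auto
    have rT: "rh * pj T = rh" unfolding rh_def s1_def using s(1) by (simp add: mult.assoc)
    have sT: "s2 * pj T = s2"
      unfolding s2_def using s(1) rT by (simp add: left_diff_distrib mult.assoc okr[OF T(1)])
    have "u = df U * s2 + s2 * df T"
      unfolding s2U(2)[symmetric] unfolding s(4) s2_def by (simp add: algebra_simps okr[OF kw(2)] okr[OF T(1)])
    moreover have "dg (- 1) s2"
    proof -
      have "dg (- 2) rh" unfolding rh_def s1_def q_def using dg_mult[OF w(3) dg_mult[OF dg_pr s(3) refl] refl] by simp
      then show ?thesis unfolding s2_def
        using dg_mult[OF okD(8)[OF kw(2)] \<open>dg (- 2) rh\<close> refl] dg_mult[OF \<open>dg (- 2) rh\<close> okD(8)[OF T(1)] refl] s(3)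
        by (auto intro!: dg_diff)
    qed
    ultimately show ?thesis unfolding null_def using s2U(1) sT by blast
  qed
  then show ?thesis using Kext_trans[OF C(1) U(1)] by blast
qed

end

section \<open>Free resolutions\<close>

context universe_ring
begin

lemma lev_eqI:
  assumes "f * eps = f" "g * eps = g" "\<And>n. f * pr (lev n) = g * pr (lev n)" shows "f = g"
proof (rule pr_UN_eqI[of f lev UNIV g])
  have "(\<Union>n. lev n) = (UNIV :: (int \<times> 'a) set)" by auto
  then show "f * pr (\<Union>n. lev n) = f" "g * pr (\<Union>n. lev n) = g" using assms unfolding eps_def by simp_all
qed (rule assms(3))

lemma int_le_diff: "n \<le> m ==> \<exists>k. n = m - int k"
  by (rule exI[of _ "nat (m - n)"]) simp

lemma lev_glue:
  assumes "\<And>n. F n * pr (lev n) = F n" shows "glue UNIV lev F * pr (lev n) = F n"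
proof -
  have "compat UNIV lev F" unfolding compat_def by auto
  then show ?thesis using glue_pr[of UNIV lev F n] assms by simp
qed

lemma dg_lev: "dg k f ==> f * pr (lev n) = pr (lev (n + k)) * f"
  unfolding dg_def by blast

definition submod :: "((int \<times> 'v) \<Rightarrow>\<^sub>0 'k) set => bool" where
  "submod N \<longleftrightarrow> 0 \<in> N \<and> (\<forall>x\<in>N. \<forall>y\<in>N. x + y \<in> N) \<and> (\<forall>x\<in>N. \<forall>a. rscale x a \<in> N)"

lemma submod_sum: "submod N ==> (\<And>i. i \<in> A ==> f i \<in> N) ==> sum f A \<in> N"
  unfolding submod_def by (induction A rule: infinite_finite_induct) auto

lemma submod_app:
  assumes "submod N" "f * eps = f" "\<And>i. app f (bas i) \<in> N" shows "app f x \<in> N"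
proof -
  have "(\<Sum>i\<in>keys x. rscale (app f (bas i)) (lookup x i)) \<in> N"
    by (rule submod_sum[OF assms(1)]) (use assms(1,3) in \<open>auto simp: submod_def\<close>)
  then show ?thesis using app_expand[OF assms(2) finite_keys subset_refl, of x] by simp
qed

lemma submod_kernel: "submod {x \<in> vs B. app f x = 0}"
  unfolding submod_def by simp

text \<open>Every element of \<open>N\<close> becomes a generator: the basis consists of codes of
  these elements, which exist because \<open>N\<close> is small.\<close>

lemma free_cover:
  assumes B: "sml B" and N: "submod N" "N \<subseteq> vs ({n + 1} \<times> B)"
  shows "\<exists>(B' :: 'v set) d. sml B' \<and> dg 1 d \<and> d * pr ({n} \<times> B') = d \<and> (\<forall>x. app d x \<in> N) \<and>
    (\<forall>y\<in>N. \<exists>x\<in>vs ({n} \<times> B'). app d x = y)"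
proof -
  have "sml ({n + 1} \<times> B)" by (rule small_Times[OF small_countable B]) simp
  then have "sml N" using small_subset[OF small_vs N(2)] by blast
  then obtain f x where f: "bij_betw (f :: _ => 'v) N (elts x)" using small_inject by blast
  define v where "v = (\<lambda>(m, c). if m = n \<and> c \<in> elts x then inv_into N f c else 0)"
  have vN: "v i \<in> N" for i
  proof -
    obtain m c where i: "i = (m, c)" by force
    have "0 \<in> N" using N(1) unfolding submod_def by blast
    moreover have "inv_into N f c \<in> N" if "c \<in> elts x"
      using f that unfolding bij_betw_def by (simp add: inv_into_into)
    ultimately show ?thesis unfolding v_def i by simp
  qed
  then have ve: "rscale (v i) e = v i" for i
    using subsetD[OF N(2) vN[of i]] unfolding vs_iff by blast
  have b: "app (ext v) (bas i) = v i" for i unfolding app_ext_bas by (rule ve)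
  show ?thesis
  proof (intro exI conjI allI ballI)
    show "sml (elts x)" by simp
    show "dg 1 (ext v)"
    proof (rule dg_ext)
      fix m c
      show "v (m, c) \<in> vs (lev (m + 1))"
      proof (cases "m = n")
        case True
        have "v (m, c) \<in> vs ({n + 1} \<times> B)" by (rule subsetD[OF N(2) vN])
        moreover have "{n + 1} \<times> B \<subseteq> lev (m + 1)" using True by auto
        ultimately show ?thesis by (rule vs_mono[rotated])
      qed (simp add: v_def)
    qed
    have "v i = 0" if "i \<notin> {n} \<times> elts x" for i using that by (cases i) (auto simp: v_def)
    then show "ext v * pr ({n} \<times> elts x) = ext v"
      by (intro pr_absorb_rightI) (simp_all only: b ext_eps)
    show "app (ext v) y \<in> N" for y by (rule submod_app[OF N(1)]) (simp_all add: b vN)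
    fix y assume y: "y \<in> N"
    then have "f y \<in> elts x" "inv_into N f (f y) = y" using f by (auto simp: bij_betw_def)
    then have "v (n, f y) = y" unfolding v_def by simp
    then have "app (ext v) (bas (n, f y)) = y" by (simp only: b)
    moreover have "bas (n, f y) \<in> vs ({n} \<times> elts x)" using \<open>f y \<in> elts x\<close> by simp
    ultimately show "\<exists>x\<in>vs ({n} \<times> elts x). app (ext v) x = y" by blast
  qed
qed

text \<open>The module resolved is the free module on \<open>B0\<close> modulo the relations
  \<open>N0\<close>. The last clause is the comparison property: a map in degree -1 that respects
  the relations extends to a cochain map. The top degree is -1 because an acyclic \<open>T\<close>
  has its cycles in degree 0 as the image of degree -1.\<close>

lemma free_resolution:
  assumes B0: "sml B0" and N0: "submod N0" "N0 \<subseteq> vs ({- 1} \<times> B0)"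
  shows "\<exists>X. ok X \<and> sml (bs X) \<and> pr (lev (- 1)) * pj X = pr ({- 1} \<times> B0) \<and>
    (\<forall>x. app (pr (lev (- 1)) * df X) x \<in> N0) \<and>
    (\<forall>T f. ok T \<and> dg 0 f \<and> f * pj T = f \<and> pr ({- 1} \<times> B0) * f = f \<and> (\<forall>x. app (f * df T) x \<in> N0) -->
       (\<exists>u. hom T X u \<and> pr (lev (- 1)) * u = f))"
proof -
  \<comment> \<open>A stage of the recursion holds the basis \<open>B\<close> in degree
    \<open>- 1 - k\<close> and the submodule \<open>N\<close> to be covered by the next
    differential; that next submodule is the kernel of the differential just built.\<close>
  define P where "P k x \<longleftrightarrow> (case x of (B, N, d) => sml (B :: 'v set) \<and> submod N \<and> N \<subseteq> vs ({- 1 - int k} \<times> B) \<and>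
    (k = 0 --> B = B0 \<and> N = N0))" for k :: nat and x :: "'v set \<times> ((int \<times> 'v) \<Rightarrow>\<^sub>0 'k) set \<times> (int \<times> 'v, 'k) lin"
  define Q where "Q k x y \<longleftrightarrow> (case x of (B, N, d) => case y of (B', N', d') => dg 1 d' \<and>
    d' * pr ({- 2 - int k} \<times> B') = d' \<and> (\<forall>x. app d' x \<in> N) \<and> (\<forall>y\<in>N. \<exists>x\<in>vs ({- 2 - int k} \<times> B'). app d' x = y) \<and>
    N' = {x \<in> vs ({- 2 - int k} \<times> B'). app d' x = 0})"
    for k :: nat and x y :: "'v set \<times> ((int \<times> 'v) \<Rightarrow>\<^sub>0 'k) set \<times> (int \<times> 'v, 'k) lin"
  have "\<exists>g. \<forall>k. P k (g k) \<and> Q k (g k) (g (Suc k))"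
  proof (rule dependent_nat_choice)
    have "P 0 (B0, N0, 0)" unfolding P_def using B0 N0 by simp
    then show "\<exists>x. P 0 x" by blast
    fix x k assume "P k x"
    then obtain B N d where x: "x = (B, N, d)" "sml B" "submod N" "N \<subseteq> vs ({- 1 - int k} \<times> B)"
      unfolding P_def by (cases x) auto
    have "- 2 - int k + 1 = - 1 - int k" by simp
    then obtain B' d' where d': "sml (B' :: 'v set)" "dg 1 d'" "d' * pr ({- 2 - int k} \<times> B') = d'" "\<forall>x. app d' x \<in> N"
      "\<forall>y\<in>N. \<exists>x\<in>vs ({- 2 - int k} \<times> B'). app d' x = y"
      using free_cover[OF x(2,3), of "- 2 - int k"] x(4) by metis
    let ?N' = "{x \<in> vs ({- 2 - int k} \<times> B'). app d' x = 0}"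
    have "P (Suc k) (B', ?N', d')"
    proof -
      have "- 1 - int (Suc k) = - 2 - int k" by simp
      then show ?thesis unfolding P_def using d'(1) submod_kernel by auto
    qed
    moreover have "Q k x (B', ?N', d')" unfolding Q_def x(1) using d' by simp
    ultimately show "\<exists>y. P (Suc k) y \<and> Q k x y" by blast
  qed
  then obtain g where g: "\<And>k. P k (g k)" "\<And>k. Q k (g k) (g (Suc k))" by blast
  define B where "B k = fst (g k)" for k
  define N where "N k = fst (snd (g k))" for k
  define d where "d k = snd (snd (g k))" for k
  have gk: "g k = (B k, N k, d k)" for k unfolding B_def N_def d_def by simp
  have BN: "sml (B k)" "submod (N k)" "N k \<subseteq> vs ({- 1 - int k} \<times> B k)" "B 0 = B0" "N 0 = N0" for k
    using g(1)[of k] g(1)[of 0] unfolding P_def gk by auto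
  have dk: "dg 1 (d (Suc k))" "d (Suc k) * pr ({- 2 - int k} \<times> B (Suc k)) = d (Suc k)"
    "\<And>x. app (d (Suc k)) x \<in> N k" "\<And>y. y \<in> N k ==> \<exists>x\<in>vs ({- 2 - int k} \<times> B (Suc k)). app (d (Suc k)) x = y"
    "N (Suc k) = {x \<in> vs ({- 2 - int k} \<times> B (Suc k)). app (d (Suc k)) x = 0}" for k
    using g(2)[of k] unfolding Q_def gk by auto
  \<comment> \<open>The differential leaving degree \<open>n\<close> was built at stage
    \<open>- 1 - n\<close>; degree -1 is the top, where it is 0.\<close>
  define D where "D n = (if n < - 1 then d (nat (- 1 - n)) else 0)" for n :: int
  define A where "A = {(n :: int, x). n < 0 \<and> x \<in> B (nat (- 1 - n))}"
  define X where "X = \<lparr>bs = A, pj = pr A, df = glue UNIV lev D\<rparr>"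
  have Asub: "pr ({- 1 - int k} \<times> B k) = pr (lev (- 1 - int k)) * pr A" for k
  proof -
    have "lev (- 1 - int k) \<inter> A = {- 1 - int k} \<times> B k" unfolding A_def by auto
    then show ?thesis by simp
  qed
  have DS: "D (- 2 - int k) = d (Suc k)" for k
  proof -
    have "nat (- 1 - (- 2 - int k)) = Suc k" by simp
    then show ?thesis unfolding D_def by simp
  qed
  have Dn: "D n * pr (lev n) = D n" "dg 1 (D n)" "pr A * D n = D n" "D n * pr A = D n" for n
  proof -
    have "D n * pr (lev n) = D n \<and> dg 1 (D n) \<and> pr A * D n = D n \<and> D n * pr A = D n"
    proof (cases "n < - 1")
      case True
      then obtain k where n: "n = - 2 - int k" using int_le_diff[of n "- 2"] by auto
      have "pr ({- 2 - int k} \<times> B (Suc k)) = pr (lev (- 2 - int k)) * pr A" using Asub[of "Suc k"] by simp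
      then have *: "d (Suc k) * (pr (lev n) * pr A) = d (Suc k)" using dk(2)[of k] unfolding n by simp
      have "pr (lev n) * pr A * pr (lev n) = pr (lev n) * pr A" "pr (lev n) * pr A * pr A = pr (lev n) * pr A"
        by (simp_all add: inf_commute inf_left_commute)
      then have 1: "d (Suc k) * pr (lev n) = d (Suc k)" "d (Suc k) * pr A = d (Suc k)"
      proof -
        let ?e = "pr (lev n) * pr A"
        have "d (Suc k) * ?e * pr (lev n) = d (Suc k) * ?e" "d (Suc k) * ?e * pr A = d (Suc k) * ?e"
          using \<open>?e * pr (lev n) = ?e\<close> \<open>?e * pr A = ?e\<close> by (simp_all only: mult.assoc)
        then show "d (Suc k) * pr (lev n) = d (Suc k)" "d (Suc k) * pr A = d (Suc k)" unfolding * .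
      qed
      have "pr A * d (Suc k) = d (Suc k)"
        unfolding pr_absorb_left
      proof
        fix x
        have "app (d (Suc k)) x \<in> vs ({- 1 - int k} \<times> B k)" using dk(3) BN(3) by blast
        moreover have "{- 1 - int k} \<times> B k \<subseteq> A" unfolding A_def by auto
        ultimately show "app (d (Suc k)) x \<in> vs A" using vs_mono by blast
      qed
      then show ?thesis using 1 dk(1)[of k] n DS[of k] by simp
    qed (simp add: D_def)
    then show "D n * pr (lev n) = D n" "dg 1 (D n)" "pr A * D n = D n" "D n * pr A = D n" by auto
  qed
  have Dl: "df X * pr (lev n) = D n" for n unfolding X_def using lev_glue[of D] Dn(1) by simp
  have dgX: "dg 1 (df X)" unfolding X_def using Dn(2) by (simp add: dg_glue)
  have Xe: "df X * eps = df X" "bs X = A" "pj X = pr A" unfolding X_def by simp_all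
  have prA: "pr A * pr (lev n) = pr (lev n) * pr A" for n by (simp add: inf_commute)
  have okX: "ok X"
    unfolding ok_def
  proof (intro conjI)
    show "pj X * df X = df X" unfolding X_def using Dn(3) by (simp add: pr_glue)
    show "df X * pj X = df X"
    proof (rule lev_eqI)
      fix n
      have "df X * pj X * pr (lev n) = df X * pr (lev n) * pr A" unfolding Xe by (simp add: mult.assoc inf_commute)
      then show "df X * pj X * pr (lev n) = df X * pr (lev n)" unfolding Dl Dn(4) .
    qed (simp_all add: mult.assoc Xe)
    show "df X * df X = 0"
    proof (rule lev_eqI)
      fix n
      have 1: "df X * df X * pr (lev n) = D (n + 1) * D n"
      proof -
        have "df X * df X * pr (lev n) = df X * (pr (lev (n + 1)) * D n)"
          using Dl[of n] dg_lev[OF Dn(2), of n n] Dn(1)[of n] by (simp add: mult.assoc)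
        then show ?thesis by (simp add: Dl mult.assoc[symmetric])
      qed
      have "D (n + 1) * D n = 0"
      proof (cases "n < - 2")
        case True
        then obtain k where n: "n = - 3 - int k" using int_le_diff[of n "- 3"] by auto
        have "D n = d (Suc (Suc k))" "D (n + 1) = d (Suc k)"
        proof -
          have e: "n = - 2 - int (Suc k)" and e': "n + 1 = - 2 - int k" using n by simp_all
          show "D n = d (Suc (Suc k))" unfolding e by (rule DS)
          show "D (n + 1) = d (Suc k)" unfolding e' by (rule DS)
        qed
        moreover have "d (Suc k) * d (Suc (Suc k)) = 0"
          by (rule lin_eqI) (use dk(3)[of "Suc k"] dk(5)[of k] in auto)
        ultimately show ?thesis by simp
      qed (simp add: D_def)
      then show "df X * df X * pr (lev n) = 0 * pr (lev n)" using 1 by simp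
    qed (simp_all add: mult.assoc Xe)
  qed (simp_all add: Xe dgX)
  have small: "sml (bs X)"
  proof -
    have "A = (\<Union>n\<in>{n. n < 0}. {n} \<times> B (nat (- 1 - n)))" unfolding A_def by auto
    moreover have "sml (\<Union>n\<in>{n :: int. n < 0}. {n} \<times> B (nat (- 1 - n)))"
      by (intro small_UN small_Times BN(1) small_countable) auto
    ultimately show ?thesis unfolding Xe by simp
  qed
  have top: "pr (lev (- 1)) * pj X = pr ({- 1} \<times> B0)" using Asub[of 0] BN(4) unfolding Xe by simp
  have "app (pr (lev (- 1)) * df X) x \<in> N0" for x
  proof -
    have "pr (lev (- 1)) * df X = df X * pr (lev (- 2))" using dg_lev[OF dgX, of "- 2"] by simp
    then have "pr (lev (- 1)) * df X = d (Suc 0)" using Dl[of "- 2"] DS[of 0] by simp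
    then show ?thesis using dk(3)[of 0 x] BN(5) by simp
  qed
  moreover have "\<exists>u. hom T X u \<and> pr (lev (- 1)) * u = f"
    if T: "ok T" and f: "dg 0 f" "f * pj T = f" "pr ({- 1} \<times> B0) * f = f" "\<forall>x. app (f * df T) x \<in> N0" for T f
  proof -
    \<comment> \<open>\<open>h\<close> is the component of the lift in degree
      \<open>- 1 - k\<close>. The invariant that \<open>h * df T\<close> falls into the submodule
      covered next is what permits the next lifting.\<close>
    define P' where "P' k h \<longleftrightarrow> dg 0 h \<and> h * pj T = h \<and> pr ({- 1 - int k} \<times> B k) * h = h \<and>
      (\<forall>x. app (h * df T) x \<in> N k) \<and> (k = 0 --> h = f)" for k h
    have "\<exists>h. \<forall>k. P' k (h k) \<and> d (Suc k) * h (Suc k) = h k * df T"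
    proof (rule dependent_nat_choice)
      have "P' 0 f" unfolding P'_def using f BN(4,5) by simp
      then show "\<exists>h. P' 0 h" by blast
      fix h k assume "P' k h"
      then have h: "dg 0 h" "h * pj T = h" "pr ({- 1 - int k} \<times> B k) * h = h" "\<And>x. app (h * df T) x \<in> N k"
        unfolding P'_def by auto
      let ?L = "{- 2 - int k} \<times> B (Suc k)"
      have "\<forall>b. \<exists>v\<in>vs ?L. app (d (Suc k)) v = app (h * df T) (bas b)" using dk(4) h(4) by blast
      then obtain v0 where v0: "\<And>b. v0 b \<in> vs ?L" "\<And>b. app (d (Suc k)) (v0 b) = app (h * df T) (bas b)" by metis
      \<comment> \<open>Lifts are chosen for all basis vectors but kept only in the degree where
        they belong, which makes the map homogeneous; in the other degrees the vector to be lifted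
        is 0.\<close>
      define v where "v b = (if fst b = - 2 - int k then v0 b else 0)" for b :: "int \<times> 'v"
      have v: "v b \<in> vs ?L" for b unfolding v_def using v0(1) by simp
      have dgh: "dg 1 (h * df T)" using dg_mult[OF h(1) okD(8)[OF T] refl] by simp
      have dv: "app (d (Suc k)) (v b) = app (h * df T) (bas b)" for b
      proof (cases "fst b = - 2 - int k")
        case False
        have "bas b \<in> vs (lev (fst b))" by (simp add: mem_Times_iff)
        then have 1: "app (h * df T) (bas b) \<in> vs (lev (fst b + 1))" by (rule dg_vs[OF dgh])
        have "app (h * df T) (bas b) \<in> vs ({- 1 - int k} \<times> B k)" using h(4) BN(3) by blast
        then have "keys (app (h * df T) (bas b)) \<subseteq> {- 1 - int k} \<times> B k \<inter> lev (fst b + 1)"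
          using 1 unfolding vs_iff by blast
        moreover have "{- 1 - int k} \<times> B k \<inter> lev (fst b + 1) = {}" using False by auto
        ultimately have "keys (app (h * df T) (bas b)) = {}" by blast
        then show ?thesis using False by (simp add: v_def)
      qed (simp add: v_def v0(2))
      have ve: "app (ext v) (bas b) = v b" for b using app_ext_bas'[OF v] .
      have dh: "d (Suc k) * (ext v * pj T) = h * df T"
      proof -
        have "d (Suc k) * ext v = h * df T"
        proof (rule lin_eq_basI)
          show "h * df T * eps = h * df T" by (simp add: mult.assoc okD(12)[OF T])
        qed (use ve dv in \<open>simp_all add: mult.assoc\<close>)
        then show ?thesis by (metis mult.assoc okD(5)[OF T])
      qed
      have pL: "pr ?L * (ext v * pj T) = ext v * pj T"
      proof -
        have "pr ?L * ext v = ext v" by (rule pr_absorb_leftI) (simp_all add: ve v)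
        then show ?thesis by (simp add: mult.assoc[symmetric])
      qed
      have "P' (Suc k) (ext v * pj T)"
        unfolding P'_def
      proof (intro conjI allI)
        have "dg 0 (ext v)"
        proof (rule dg_ext)
          fix n x
          show "v (n, x) \<in> vs (lev (n + 0))"
          proof (cases "n = - 2 - int k")
            case True
            have "?L \<subseteq> lev n" using True by auto
            then have "v (n, x) \<in> vs (lev n)" by (rule vs_mono[OF _ v])
            then show ?thesis by simp
          qed (simp add: v_def)
        qed
        then show "dg 0 (ext v * pj T)" using dg_mult[OF _ okD(7)[OF T]] by force
        show "ext v * pj T * pj T = ext v * pj T" by (simp add: mult.assoc okD(3)[OF T])
        show "pr ({- 1 - int (Suc k)} \<times> B (Suc k)) * (ext v * pj T) = ext v * pj T" using pL by simp
        fix x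
        have "app (ext v * pj T) y \<in> vs ?L" for y using pL unfolding pr_absorb_left by blast
        moreover have "app (d (Suc k)) (app (ext v * pj T) (app (df T) x)) = 0"
          using app_cong[OF dh, of "app (df T) x"] app_okr(4)[OF T] by simp
        ultimately show "app (ext v * pj T * df T) x \<in> N (Suc k)" unfolding dk(5) by simp
      qed simp
      then show "\<exists>h'. P' (Suc k) h' \<and> d (Suc k) * h' = h * df T" using dh by blast
    qed
    then obtain h where h: "\<And>k. P' k (h k)" "\<And>k. d (Suc k) * h (Suc k) = h k * df T" by blast
    have h': "dg 0 (h k)" "h k * pj T = h k" "pr ({- 1 - int k} \<times> B k) * h k = h k" "h 0 = f" for k
      using h(1)[of k] h(1)[of 0] unfolding P'_def by auto
    define F where "F n = (if n < 0 then h (nat (- 1 - n)) else 0)" for n :: int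
    have Fk: "F (- 1 - int k) = h k" for k
    proof -
      have "nat (- 1 - (- 1 - int k)) = k" by simp
      then show ?thesis unfolding F_def by simp
    qed
    have F: "F n * pr (lev n) = F n" "dg 0 (F n)" "F n * pj T = F n" "pr A * F n = F n" "pr (lev n) * F n = F n" for n
    proof -
      have "F n * pr (lev n) = F n \<and> dg 0 (F n) \<and> F n * pj T = F n \<and> pr A * F n = F n \<and> pr (lev n) * F n = F n"
      proof (cases "n < 0")
        case True
        then obtain k where n: "n = - 1 - int k" using int_le_diff[of n "- 1"] by auto
        have s: "{- 1 - int k} \<times> B k \<subseteq> A" "{- 1 - int k} \<times> B k \<subseteq> lev n" unfolding A_def n by auto
        have "pr A * h k = h k" "pr (lev n) * h k = h k"
          using pr_mono_left[OF h'(3) s(1)] pr_mono_left[OF h'(3) s(2)] by auto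
        then show ?thesis using h'(1,2)[of k] dg_lev[OF h'(1), of k n] unfolding n Fk by simp
      qed (simp add: F_def)
      then show "F n * pr (lev n) = F n" "dg 0 (F n)" "F n * pj T = F n" "pr A * F n = F n" "pr (lev n) * F n = F n" by auto
    qed
    define u where "u = glue UNIV lev F"
    have ul: "u * pr (lev n) = F n" for n unfolding u_def by (rule lev_glue[OF F(1)])
    have ue: "u * eps = u" "eps * u = u" unfolding u_def by simp_all
    have ud: "dg 0 u" unfolding u_def using F(2) by (simp add: dg_glue)
    have "hom T X u"
      unfolding hom_def
    proof (intro conjI ud)
      show "u * pj T = u"
      proof (rule lev_eqI)
        fix n
        have "u * pj T * pr (lev n) = u * pr (lev n) * pj T"
          using dg_lev[OF okD(7)[OF T], of n] by (simp add: mult.assoc)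
        then show "u * pj T * pr (lev n) = u * pr (lev n)" unfolding ul F(3) .
      qed (simp_all add: mult.assoc ue okD(11)[OF T])
      show "pj X * u = u" unfolding Xe u_def using F(4) by (simp add: pr_glue)
      show "df X * u = u * df T"
      proof (rule lev_eqI)
        fix n
        have 1: "df X * u * pr (lev n) = D n * F n"
        proof -
          have "df X * u * pr (lev n) = df X * (pr (lev n) * F n)" using F(5) ul by (simp add: mult.assoc)
          then show ?thesis by (simp add: Dl mult.assoc[symmetric])
        qed
        have 2: "u * df T * pr (lev n) = F (n + 1) * df T"
        proof -
          have "u * df T * pr (lev n) = u * pr (lev (n + 1)) * df T"
            using dg_lev[OF okD(8)[OF T], of n] by (simp add: mult.assoc)
          then show ?thesis unfolding ul .
        qed
        have "D n * F n = F (n + 1) * df T"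
        proof (cases "n < - 1")
          case True
          then obtain k where n: "n = - 2 - int k" using int_le_diff[of n "- 2"] by auto
          have "D n = d (Suc k)" "F n = h (Suc k)" "F (n + 1) = h k"
          proof -
            have e: "n = - 1 - int (Suc k)" and e': "n + 1 = - 1 - int k" using n by simp_all
            show "D n = d (Suc k)" unfolding n by (rule DS)
            show "F n = h (Suc k)" unfolding e by (rule Fk)
            show "F (n + 1) = h k" unfolding e' by (rule Fk)
          qed
          then show ?thesis using h(2) by simp
        qed (simp add: D_def F_def)
        then show "df X * u * pr (lev n) = u * df T * pr (lev n)" using 1 2 by simp
      qed (simp_all add: mult.assoc ue okD(12)[OF T])
    qed
    moreover have "pr (lev (- 1)) * u = f" using dg_lev[OF ud, of "- 1"] ul[of "- 1"] Fk[of 0] h'(4) by simp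
    ultimately show ?thesis by blast
  qed
  ultimately show ?thesis using okX small top by blast
qed

text \<open>\<open>T\<close> is the cocone of the inclusion of a resolution \<open>X\<close> into
  \<open>U\<close>. The map \<open>f\<close> lifts to a map from \<open>W\<close> to
  \<open>X\<close>, which is null-homotopic in \<open>U\<close>; the null-homotopy provides the
  further lift to the cocone.\<close>

theorem inner_precover:
  assumes sf: "\<And>X S. ok X ==> sml (bs X) ==> S \<in> tests ==> small_fractions X S"
    and B: "sml B" and N: "submod N" "N \<subseteq> vs ({- 1} \<times> B)"
  shows "\<exists>T th. ok T \<and> sml (bs T) \<and> TA T \<and> dg 0 th \<and> th * pj T = th \<and> pr ({- 1} \<times> B) * th = th \<and>
    (\<forall>x. app (th * df T) x \<in> N) \<and>
    (\<forall>W f. ok W \<and> sml (bs W) \<and> TA W \<and> dg 0 f \<and> f * pj W = f \<and> pr ({- 1} \<times> B) * f = f \<and>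
       (\<forall>x. app (f * df W) x \<in> N) --> (\<exists>w. hom W T w \<and> f = th * w))"
proof -
  obtain X where X: "ok X" "sml (bs X)" "pr (lev (- 1)) * pj X = pr ({- 1} \<times> B)"
    "\<And>x. app (pr (lev (- 1)) * df X) x \<in> N"
    and lift: "\<And>T f. ok T ==> dg 0 f ==> f * pj T = f ==> pr ({- 1} \<times> B) * f = f ==> (\<forall>x. app (f * df T) x \<in> N) ==>
       \<exists>u. hom T X u \<and> pr (lev (- 1)) * u = f"
    using free_resolution[OF B N] by metis
  obtain U where U: "Kext X U" "\<And>T u. ok T ==> sml (bs T) ==> TA T ==> hom T X u ==> null T U u"
    using local_extension[OF X(1,2) sf[OF X(1,2)]] by blast
  note ku = KextD[OF U(1)]
  let ?T = "cocn X U (pj X)"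
  have h: "hom X U (pj X)" by (rule hom_incl[OF ku(5,1)])
  have T: "ok ?T" "sml (bs ?T)" "TA ?T"
    using ok_cocn[OF ku(1,2) h] small_cocn ku(3,4) TA_cocn_incl[OF U(1)] by auto
  let ?th = "pr (lev (- 1)) * (pj X * k1)"
  have pk: "hom ?T X (pj X * k1)" by (rule cocn_proj[OF ku(1,2) h])
  show ?thesis
  proof (rule exI[of _ ?T], rule exI[of _ ?th], intro conjI allI impI)
    show "dg 0 ?th" using dg_mult[OF dg_pr homD(4)[OF pk]] by force
    show "?th * pj ?T = ?th" using homD(1)[OF pk] by (simp add: mult.assoc)
    show "pr ({- 1} \<times> B) * ?th = ?th"
      unfolding X(3)[symmetric] by (simp add: mult.assoc okr[OF X(1)] dg_lev[OF okD(7)[OF X(1)], of "- 1", simplified, THEN mult_rule, symmetric])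
        (simp add: mult.assoc[symmetric] X(3))
    fix x
    have "?th * df ?T = pr (lev (- 1)) * df X * (pj X * k1)" using homD(3)[OF pk] by (simp add: mult.assoc)
    then show "app (?th * df ?T) x \<in> N" using X(4) by simp
  next
    fix W f
    assume W: "ok W \<and> sml (bs W) \<and> TA W \<and> dg 0 f \<and> f * pj W = f \<and> pr ({- 1} \<times> B) * f = f \<and>
       (\<forall>x. app (f * df W) x \<in> N)"
    then obtain u where u: "hom W X u" "pr (lev (- 1)) * u = f" using lift[of W f] by blast
    then obtain s where s: "s * pj W = s" "pj U * s = s" "dg (- 1) s" "u = df U * s + s * df W"
      using U(2)[of W u] W unfolding null_def by blast
    have "hom W ?T (j1 * u + j2 * s)"
      by (rule cocn_hom[OF ku(1,2) h u(1) s(1,2,3)]) (use s(4) homD(2)[OF u(1)] in simp)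
    moreover have "?th * (j1 * u + j2 * s) = f"
    proof -
      have "?th * (j1 * u + j2 * s) = pr (lev (- 1)) * (pj X * u)"
        by (simp add: distrib_left mult.assoc blkr okr[OF X(1)] mult_rule[OF okD(11)[OF X(1)]])
      then show ?thesis using homD(2)[OF u(1)] u(2) by simp
    qed
    ultimately show "\<exists>w. hom W ?T w \<and> f = ?th * w" by metis
  qed (use T in auto)
qed

end

section \<open>Embedding a ring with carrier into a type of class ring\<close>

text \<open>
  The product of all ring structures on the type \<^typ>\<open>'r\<close> is a type of class \<open>ring\<close>. A ring on \<^typ>\<open>'r\<close> is
  the corner of this product cut out by a central idempotent. This makes type class reasoning
  available for coefficients that are only given as a carrier set.
\<close>

definition base_ring :: "('r, 'q) ring_scheme => 'r ring" where
  "base_ring R = \<lparr>carrier = carrier R, mult = mult R, one = one R, zero = zero R, add = add R\<rparr>"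

lemma base_ring_simps [simp]:
  "carrier (base_ring R) = carrier R" "mult (base_ring R) = mult R" "one (base_ring R) = one R"
  "zero (base_ring R) = zero R" "add (base_ring R) = add R"
  unfolding base_ring_def by simp_all

lemma ring_base_ring: assumes "Ring.ring R" shows "Ring.ring (base_ring R)"
proof -
  interpret R: Ring.ring R by (rule assms)
  show ?thesis
  proof (rule ringI)
    show "abelian_group (base_ring R)"
    proof (rule abelian_groupI, unfold base_ring_simps)
      show "\<exists>y\<in>carrier R. y \<oplus>\<^bsub>R\<^esub> x = \<zero>\<^bsub>R\<^esub>" if "x \<in> carrier R" for x
        using that R.l_neg R.a_inv_closed by blast
    qed (fact R.a_closed R.zero_closed R.a_assoc R.a_comm R.l_zero)+
    show "Group.monoid (base_ring R)"
      by (rule monoidI, unfold base_ring_simps)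
        (fact R.m_closed R.one_closed R.m_assoc R.l_one R.r_one)+
  qed (simp_all add: R.l_distr R.r_distr)
qed

text \<open>At records that are not rings the value is pinned to \<open>undefined\<close>, so that
  elements are determined by their components at ring structures.\<close>

typedef 'r rprod = "{f :: 'r ring => 'r. \<forall>\<rho>. if Ring.ring \<rho> then f \<rho> \<in> carrier \<rho> else f \<rho> = undefined}"
  by (rule exI[of _ "\<lambda>\<rho>. if Ring.ring \<rho> then \<zero>\<^bsub>\<rho>\<^esub> else undefined"])
    (auto intro: Ring.ring.ring_simprules)

setup_lifting type_definition_rprod

instantiation rprod :: (type) ring
begin

lift_definition zero_rprod :: "'a rprod" is "\<lambda>\<rho>. if Ring.ring \<rho> then \<zero>\<^bsub>\<rho>\<^esub> else undefined"
  by (auto intro: Ring.ring.ring_simprules)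
lift_definition plus_rprod :: "'a rprod => 'a rprod => 'a rprod"
  is "\<lambda>f g \<rho>. if Ring.ring \<rho> then f \<rho> \<oplus>\<^bsub>\<rho>\<^esub> g \<rho> else undefined"
  by (auto intro: Ring.ring.ring_simprules)
lift_definition uminus_rprod :: "'a rprod => 'a rprod"
  is "\<lambda>f \<rho>. if Ring.ring \<rho> then \<ominus>\<^bsub>\<rho>\<^esub> f \<rho> else undefined"
  by (auto intro: Ring.ring.ring_simprules)
lift_definition minus_rprod :: "'a rprod => 'a rprod => 'a rprod"
  is "\<lambda>f g \<rho>. if Ring.ring \<rho> then f \<rho> \<ominus>\<^bsub>\<rho>\<^esub> g \<rho> else undefined"
  by (auto intro: Ring.ring.ring_simprules)
lift_definition times_rprod :: "'a rprod => 'a rprod => 'a rprod"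
  is "\<lambda>f g \<rho>. if Ring.ring \<rho> then f \<rho> \<otimes>\<^bsub>\<rho>\<^esub> g \<rho> else undefined"
  by (auto intro: Ring.ring.ring_simprules)

instance
proof
  fix a b c :: "'a rprod"
  show "a + b + c = a + (b + c)" "a + b = b + a" "0 + a = a" "- a + a = 0"
    "a * b * c = a * (b * c)" "(a + b) * c = a * c + b * c" "a * (b + c) = a * b + a * c"
    by (transfer, rule HOL.ext, simp add: Ring.ring.ring_simprules)+
  show "a - b = a + - b" by (transfer, rule HOL.ext) (simp add: a_minus_def)
qed

end

text \<open>All components other than that of \<open>R\<close> are zero, which makes the image of
  the unit of \<open>R\<close> the central idempotent of this factor.\<close>

lift_definition emb :: "('r, 'q) ring_scheme => 'r => 'r rprod"
  is "\<lambda>R a \<rho>. if Ring.ring \<rho> then (if \<rho> = base_ring R \<and> a \<in> carrier R then a else \<zero>\<^bsub>\<rho>\<^esub>) else undefined"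
  by (auto intro: Ring.ring.ring_simprules)

lift_definition val :: "('r, 'q) ring_scheme => 'r rprod => 'r" is "\<lambda>R f. f (base_ring R)" .

context Ring.ring
begin

lemma val_simps [simp]:
  "val R x \<in> carrier R" "val R (x + y) = val R x \<oplus> val R y" "val R (x * y) = val R x \<otimes> val R y" "val R 0 = \<zero>"
proof -
  note b = ring_base_ring[OF ring_axioms]
  have *: "Rep_rprod y (base_ring R) \<in> carrier R" for y
  proof -
    have "Rep_rprod y (base_ring R) \<in> carrier (base_ring R)" using Rep_rprod[of y] b by (simp only: mem_Collect_eq if_True)
    then show ?thesis by simp
  qed
  show "val R x \<in> carrier R" unfolding val.rep_eq by (rule *)
  show "val R (x + y) = val R x \<oplus> val R y" "val R (x * y) = val R x \<otimes> val R y" "val R 0 = \<zero>"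
    unfolding val.rep_eq plus_rprod.rep_eq times_rprod.rep_eq zero_rprod.rep_eq using b by simp_all
qed

lemma val_emb [simp]: "a \<in> carrier R ==> val R (emb R a) = a"
  unfolding val.rep_eq emb.rep_eq using ring_base_ring[OF ring_axioms] by simp

text \<open>Multiplication by the idempotent of one factor keeps that component and makes all others
  zero, from either side; this also shows centrality.\<close>

lemma emb_times: "x * emb R \<one> = emb R (val R x)" "emb R \<one> * x = emb R (val R x)"
proof -
  have z: "a \<otimes>\<^bsub>\<rho>\<^esub> \<zero>\<^bsub>\<rho>\<^esub> = \<zero>\<^bsub>\<rho>\<^esub>" "\<zero>\<^bsub>\<rho>\<^esub> \<otimes>\<^bsub>\<rho>\<^esub> a = \<zero>\<^bsub>\<rho>\<^esub>" if "Ring.ring \<rho>" "a \<in> carrier \<rho>" for \<rho> :: "'a ring" and a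
  proof -
    interpret r: Ring.ring \<rho> by (rule that(1))
    show "a \<otimes>\<^bsub>\<rho>\<^esub> \<zero>\<^bsub>\<rho>\<^esub> = \<zero>\<^bsub>\<rho>\<^esub>" "\<zero>\<^bsub>\<rho>\<^esub> \<otimes>\<^bsub>\<rho>\<^esub> a = \<zero>\<^bsub>\<rho>\<^esub>" using that(2) by simp_all
  qed
  have c: "Rep_rprod x \<rho> \<in> carrier \<rho>" if "Ring.ring \<rho>" for \<rho> using Rep_rprod[of x] that by simp
  have v: "val R x \<in> carrier R" "Rep_rprod x (base_ring R) = val R x" by (simp_all add: val.rep_eq[symmetric])
  have "Rep_rprod (x * emb R \<one>) \<rho> = Rep_rprod (emb R (val R x)) \<rho> \<and>
    Rep_rprod (emb R \<one> * x) \<rho> = Rep_rprod (emb R (val R x)) \<rho>" for \<rho>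
  proof (cases "Ring.ring \<rho>")
    case True
    show ?thesis
    proof (cases "\<rho> = base_ring R")
      case base: True
      then show ?thesis using True v by (simp add: times_rprod.rep_eq emb.rep_eq)
    qed (use True z[OF True c[OF True]] in \<open>simp add: times_rprod.rep_eq emb.rep_eq\<close>)
  qed (simp add: times_rprod.rep_eq emb.rep_eq)
  then show "x * emb R \<one> = emb R (val R x)" "emb R \<one> * x = emb R (val R x)"
    unfolding Rep_rprod_inject[symmetric] by auto
qed

lemma emb_mult: "a \<in> carrier R ==> b \<in> carrier R ==> emb R a * emb R b = emb R (a \<otimes> b)"
proof -
  assume ab: "a \<in> carrier R" "b \<in> carrier R"
  have 1: "emb R b * emb R \<one> = emb R b" using ab by (simp add: emb_times)
  have "emb R a * emb R b * emb R \<one> = emb R a * emb R b" by (simp only: mult.assoc 1)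
  then show ?thesis unfolding emb_times(1) using ab by simp
qed

lemma emb_add: "a \<in> carrier R ==> b \<in> carrier R ==> emb R a + emb R b = emb R (a \<oplus> b)"
proof -
  assume ab: "a \<in> carrier R" "b \<in> carrier R"
  have 1: "emb R a * emb R \<one> = emb R a" "emb R b * emb R \<one> = emb R b" using ab by (simp_all add: emb_times)
  have "(emb R a + emb R b) * emb R \<one> = emb R a + emb R b" by (simp only: distrib_right 1)
  then show ?thesis unfolding emb_times(1) using ab by simp
qed

end

section \<open>Right modules\<close>

abbreviation el :: "('r, 'a) cochain => int => 'a set" where "el X n \<equiv> carrier (Ob X n)"

lemma right_moduleI:
  assumes "Ring.ring R" "\<zero>\<^bsub>M\<^esub> \<in> carrier M"
    "\<And>x y. x \<in> carrier M ==> y \<in> carrier M ==> x \<oplus>\<^bsub>M\<^esub> y \<in> carrier M"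
    "\<And>x y z. x \<in> carrier M ==> y \<in> carrier M ==> z \<in> carrier M ==> (x \<oplus>\<^bsub>M\<^esub> y) \<oplus>\<^bsub>M\<^esub> z = x \<oplus>\<^bsub>M\<^esub> (y \<oplus>\<^bsub>M\<^esub> z)"
    "\<And>x y. x \<in> carrier M ==> y \<in> carrier M ==> x \<oplus>\<^bsub>M\<^esub> y = y \<oplus>\<^bsub>M\<^esub> x"
    "\<And>x. x \<in> carrier M ==> \<zero>\<^bsub>M\<^esub> \<oplus>\<^bsub>M\<^esub> x = x"
    "\<And>x. x \<in> carrier M ==> \<exists>y\<in>carrier M. y \<oplus>\<^bsub>M\<^esub> x = \<zero>\<^bsub>M\<^esub>"
    "\<And>a x. a \<in> carrier R ==> x \<in> carrier M ==> a \<odot>\<^bsub>M\<^esub> x \<in> carrier M"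
    "\<And>a b x. a \<in> carrier R ==> b \<in> carrier R ==> x \<in> carrier M ==> (a \<oplus>\<^bsub>R\<^esub> b) \<odot>\<^bsub>M\<^esub> x = a \<odot>\<^bsub>M\<^esub> x \<oplus>\<^bsub>M\<^esub> b \<odot>\<^bsub>M\<^esub> x"
    "\<And>a x y. a \<in> carrier R ==> x \<in> carrier M ==> y \<in> carrier M ==> a \<odot>\<^bsub>M\<^esub> (x \<oplus>\<^bsub>M\<^esub> y) = a \<odot>\<^bsub>M\<^esub> x \<oplus>\<^bsub>M\<^esub> a \<odot>\<^bsub>M\<^esub> y"
    "\<And>a b x. a \<in> carrier R ==> b \<in> carrier R ==> x \<in> carrier M ==> (a \<otimes>\<^bsub>R\<^esub> b) \<odot>\<^bsub>M\<^esub> x = b \<odot>\<^bsub>M\<^esub> (a \<odot>\<^bsub>M\<^esub> x)"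
    "\<And>x. x \<in> carrier M ==> \<one>\<^bsub>R\<^esub> \<odot>\<^bsub>M\<^esub> x = x"
  shows "right_module R M"
proof -
  have "abelian_group M" by (rule abelian_groupI) (use assms(2-7) in auto)
  then show ?thesis using assms(1,8-12) by (intro right_module.intro right_module_axioms.intro)
qed

lemma mod_homD:
  assumes "f \<in> mod_hom R M N"
  shows "x \<in> carrier M ==> f x \<in> carrier N"
    "x \<in> carrier M ==> y \<in> carrier M ==> f (x \<oplus>\<^bsub>M\<^esub> y) = f x \<oplus>\<^bsub>N\<^esub> f y"
    "a \<in> carrier R ==> x \<in> carrier M ==> f (a \<odot>\<^bsub>M\<^esub> x) = a \<odot>\<^bsub>N\<^esub> f x"
  using assms unfolding mod_hom_def by auto

lemma mod_homI:
  assumes "\<And>x. x \<in> carrier M ==> f x \<in> carrier N"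
    "\<And>x y. x \<in> carrier M ==> y \<in> carrier M ==> f (x \<oplus>\<^bsub>M\<^esub> y) = f x \<oplus>\<^bsub>N\<^esub> f y"
    "\<And>a x. a \<in> carrier R ==> x \<in> carrier M ==> f (a \<odot>\<^bsub>M\<^esub> x) = a \<odot>\<^bsub>N\<^esub> f x"
  shows "f \<in> mod_hom R M N"
  using assms unfolding mod_hom_def by auto

lemma mod_hom_zero:
  assumes "f \<in> mod_hom R M N" "right_module R M" "right_module R N"
  shows "f \<zero>\<^bsub>M\<^esub> = \<zero>\<^bsub>N\<^esub>"
proof -
  interpret M: right_module R M by fact
  interpret N: right_module R N by fact
  have "f \<zero>\<^bsub>M\<^esub> \<oplus>\<^bsub>N\<^esub> f \<zero>\<^bsub>M\<^esub> = f \<zero>\<^bsub>M\<^esub>"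
    using mod_homD(2)[OF assms(1), of "\<zero>\<^bsub>M\<^esub>" "\<zero>\<^bsub>M\<^esub>"] by simp
  then show ?thesis using mod_homD(1)[OF assms(1), of "\<zero>\<^bsub>M\<^esub>"] N.add.l_cancel_one' by auto
qed

lemma mod_hom_uminus:
  assumes "f \<in> mod_hom R M N" "right_module R M" "right_module R N" "x \<in> carrier M"
  shows "f (\<ominus>\<^bsub>M\<^esub> x) = \<ominus>\<^bsub>N\<^esub> f x"
proof -
  interpret M: right_module R M by fact
  interpret N: right_module R N by fact
  have "f (\<ominus>\<^bsub>M\<^esub> x) \<oplus>\<^bsub>N\<^esub> f x = f (\<ominus>\<^bsub>M\<^esub> x \<oplus>\<^bsub>M\<^esub> x)" using mod_homD(2)[OF assms(1)] assms(4) by simp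
  also have "\<dots> = \<zero>\<^bsub>N\<^esub>" using mod_hom_zero[OF assms(1-3)] assms(4) by (simp add: M.M.l_neg)
  finally show ?thesis using mod_homD(1)[OF assms(1)] assms(4) N.minus_equality by simp
qed

lemma mod_hom_comp: "f \<in> mod_hom R M N ==> g \<in> mod_hom R N K ==> (\<lambda>x. g (f x)) \<in> mod_hom R M K"
  by (rule mod_homI) (simp_all add: mod_homD)

lemma mod_hom_cong: "f \<in> mod_hom R M N ==> (\<And>x. x \<in> carrier M ==> g x = f x) ==>
    right_module R M ==> g \<in> mod_hom R M N"
  unfolding mod_hom_def
  by (auto simp: right_module.smult_closed abelian_groupE(1) right_module.axioms(2) abelian_group.axioms)

definition rmiso where
  "rmiso R M N f \<longleftrightarrow> f \<in> mod_hom R M N \<and> bij_betw f (carrier M) (carrier N)"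

lemma rmiso_inv:
  assumes "rmiso R M N f" "right_module R M" shows "rmiso R N M (inv_into (carrier M) f)"
proof -
  interpret M: right_module R M by fact
  let ?g = "inv_into (carrier M) f"
  have f: "f \<in> mod_hom R M N" "bij_betw f (carrier M) (carrier N)" using assms(1) unfolding rmiso_def by auto
  have g: "?g y \<in> carrier M" "f (?g y) = y" if "y \<in> carrier N" for y
    using f(2) that by (auto simp: bij_betw_def inv_into_into f_inv_into_f)
  have gf: "?g (f x) = x" if "x \<in> carrier M" for x using f(2) that by (simp add: bij_betw_def)
  have "?g \<in> mod_hom R N M"
  proof (rule mod_homI)
    show "?g y \<in> carrier M" if "y \<in> carrier N" for y using g that by blast
    show "?g (x \<oplus>\<^bsub>N\<^esub> y) = ?g x \<oplus>\<^bsub>M\<^esub> ?g y" if "x \<in> carrier N" "y \<in> carrier N" for x y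
      using mod_homD(2)[OF f(1) g(1)[OF that(1)] g(1)[OF that(2)]] g that
        gf[of "?g x \<oplus>\<^bsub>M\<^esub> ?g y"] by simp
    show "?g (a \<odot>\<^bsub>N\<^esub> x) = a \<odot>\<^bsub>M\<^esub> ?g x" if "a \<in> carrier R" "x \<in> carrier N" for a x
      using mod_homD(3)[OF f(1) that(1) g(1)[OF that(2)]] g that
        gf[of "a \<odot>\<^bsub>M\<^esub> ?g x"] M.smult_closed by simp
  qed
  then show ?thesis unfolding rmiso_def using bij_betw_inv_into[OF f(2)] by blast
qed

text \<open>Modules of vectors live on another type, whereas the objects of \<open>Mod-R\<close>
  have their carriers in \<open>'v\<close>; the structure is transported along an injective
  coding.\<close>

definition copy_module :: "('r, 'a) module => ('a => 'b) => ('r, 'b) module" where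
  "copy_module M f = (let g = inv_into (carrier M) f in
     \<lparr>carrier = f ` carrier M, mult = undefined, one = undefined, zero = f \<zero>\<^bsub>M\<^esub>,
      add = (\<lambda>x y. f (g x \<oplus>\<^bsub>M\<^esub> g y)), smult = (\<lambda>a x. f (a \<odot>\<^bsub>M\<^esub> g x))\<rparr>)"

lemma copy_module:
  assumes "right_module R M" "inj_on f (carrier M)"
  shows "right_module R (copy_module M f)" "rmiso R M (copy_module M f) f"
proof -
  interpret M: right_module R M by fact
  have g [simp]: "inv_into (carrier M) f (f x) = x" if "x \<in> carrier M" for x using assms(2) that by simp
  let ?N = "copy_module M f"
  have N: "carrier ?N = f ` carrier M" "\<zero>\<^bsub>?N\<^esub> = f \<zero>\<^bsub>M\<^esub>"
    "\<And>x y. x \<in> carrier M ==> y \<in> carrier M ==> f x \<oplus>\<^bsub>?N\<^esub> f y = f (x \<oplus>\<^bsub>M\<^esub> y)"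
    "\<And>a x. x \<in> carrier M ==> a \<odot>\<^bsub>?N\<^esub> f x = f (a \<odot>\<^bsub>M\<^esub> x)"
    unfolding copy_module_def Let_def by simp_all
  show "right_module R ?N"
  proof (rule right_moduleI)
    show "\<exists>y\<in>carrier ?N. y \<oplus>\<^bsub>?N\<^esub> x = \<zero>\<^bsub>?N\<^esub>" if x: "x \<in> carrier ?N" for x
    proof -
      obtain z where z: "z \<in> carrier M" "x = f z" using x N(1) by auto
      then have "f (\<ominus>\<^bsub>M\<^esub> z) \<oplus>\<^bsub>?N\<^esub> x = \<zero>\<^bsub>?N\<^esub>" by (simp add: N M.M.l_neg)
      then show ?thesis using z(1) N(1) by (intro bexI[of _ "f (\<ominus>\<^bsub>M\<^esub> z)"]) auto
    qed
    show "x \<oplus>\<^bsub>?N\<^esub> y = y \<oplus>\<^bsub>?N\<^esub> x" if xy: "x \<in> carrier ?N" "y \<in> carrier ?N" for x y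
    proof -
      obtain u v where "u \<in> carrier M" "x = f u" "v \<in> carrier M" "y = f v" using xy N(1) by auto
      then show ?thesis using M.M.a_comm[of u v] by (simp add: N)
    qed
  qed (auto simp: N M.M.a_assoc M.smult_closed M.smult_add_scalar M.smult_add_vector M.smult_assoc
      M.smult_one M.R.ring_axioms)
  show "rmiso R M ?N f"
    unfolding rmiso_def using assms(2) by (auto intro!: mod_homI simp: N bij_betw_def)
qed

section \<open>Complexes of projective modules and their matrix models\<close>

locale ring_setting = set_universe elts + R?: Ring.ring R
  for elts :: "'v => 'v set" and R :: "('r, 'q) ring_scheme" (structure) +
  assumes small_R: "small elts (carrier R)"
begin

abbreviation ee :: "'r rprod" where "ee \<equiv> emb R \<one>"

end

text \<open>The corner at \<open>ee\<close> consists of embedded elements of \<open>R\<close>, so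
  smallness of the carrier is inherited.\<close>

sublocale ring_setting \<subseteq> universe_ring elts ee
proof
  show "ee * ee = ee" by (simp add: emb_times)
  show "ee * x = x * ee" for x by (simp add: emb_times)
  have "{a. a * ee = a} \<subseteq> emb R ` carrier R"
  proof
    fix a assume "a \<in> {a. a * ee = a}"
    then have "a = emb R (val R a)" by (simp add: emb_times)
    then show "a \<in> emb R ` carrier R" by (metis image_eqI val_simps(1))
  qed
  then show "small elts {a. a * ee = a}" using small_subset small_image small_R by blast
qed

section \<open>Free modules over the given ring, evaluation and projectivity\<close>

context ring_setting
begin

type_synonym ('w, 's) vec = "(int \<times> 'w) \<Rightarrow>\<^sub>0 's rprod"

text \<open>Scalars act through their embedding into the product ring. On vectors fixed by
  \<open>ee\<close> every coefficient acts like its component at \<open>R\<close>, as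
  \<open>rscale_val\<close> shows.\<close>

definition Vmod :: "('v, 'r) vec set => ('r, ('v, 'r) vec) module" where
  "Vmod P = \<lparr>carrier = P, mult = undefined, one = undefined, zero = 0, add = (+),
     smult = (\<lambda>a x. rscale x (emb R a))\<rparr>"

lemma Vmod_simps [simp]:
  "carrier (Vmod P) = P" "\<zero>\<^bsub>Vmod P\<^esub> = 0" "x \<oplus>\<^bsub>Vmod P\<^esub> y = x + y" "a \<odot>\<^bsub>Vmod P\<^esub> x = rscale x (emb R a)"
  unfolding Vmod_def by simp_all

lemma right_module_Vmod:
  assumes "0 \<in> P" "\<And>x y. x \<in> P ==> y \<in> P ==> x + y \<in> P" "\<And>x a. x \<in> P ==> rscale x a \<in> P"
    "\<And>x. x \<in> P ==> - x \<in> P" "\<And>x. x \<in> P ==> rscale x ee = x"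
  shows "right_module R (Vmod P)"
proof (rule right_moduleI)
  show "\<exists>y\<in>carrier (Vmod P). y \<oplus>\<^bsub>Vmod P\<^esub> x = \<zero>\<^bsub>Vmod P\<^esub>" if "x \<in> carrier (Vmod P)" for x
    using that assms(4) by (intro bexI[of _ "- x"]) auto
  show "(a \<oplus> b) \<odot>\<^bsub>Vmod P\<^esub> x = a \<odot>\<^bsub>Vmod P\<^esub> x \<oplus>\<^bsub>Vmod P\<^esub> b \<odot>\<^bsub>Vmod P\<^esub> x"
    if "a \<in> carrier R" "b \<in> carrier R" for a b x using emb_add[OF that] by (simp flip: rscale_simps)
  show "(a \<otimes> b) \<odot>\<^bsub>Vmod P\<^esub> x = b \<odot>\<^bsub>Vmod P\<^esub> (a \<odot>\<^bsub>Vmod P\<^esub> x)"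
    if "a \<in> carrier R" "b \<in> carrier R" for a b x using emb_mult[OF that] by simp
qed (use assms in \<open>auto simp: algebra_simps R.ring_axioms\<close>)

lemma right_module_vs: "right_module R (Vmod (vs B))"
proof (rule right_module_Vmod)
  show "rscale x ee = x" if "x \<in> vs B" for x using that unfolding vs_iff by blast
qed simp_all

lemma rscale_val: "rscale x ee = x ==> rscale x a = rscale x (emb R (val R a))"
  by (metis emb_times(2) rscale_simps(3))

lemma idem_Vmod:
  assumes "q * eps = q" "x \<in> {x. app q x = x}"
  shows "rscale x ee = x"
proof -
  have "app (q * eps) x = app q x" using assms(1) by simp
  then show ?thesis using assms(2) by simp
qed

lemma right_module_idem: "q * eps = q ==> right_module R (Vmod {x. app q x = x})"
  by (rule right_module_Vmod) (auto dest: idem_Vmod)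

text \<open>Basis elements that do not come from the module are sent to zero.\<close>

definition ev :: "('r, 'v) module => ('v, 'r) vec => 'v" where
  "ev M x = finsum M (\<lambda>i. val R (lookup x i) \<odot>\<^bsub>M\<^esub> snd i) (keys x \<inter> (UNIV \<times> carrier M))"

lemma ev:
  assumes "right_module R M"
  shows "ev M x \<in> carrier M" "ev M (x + y) = ev M x \<oplus>\<^bsub>M\<^esub> ev M y"
    "ev M (rscale x a) = val R a \<odot>\<^bsub>M\<^esub> ev M x" "m \<in> carrier M ==> ev M (bas (n, m)) = m"
proof -
  interpret M: right_module R M by fact
  let ?C = "(UNIV :: int set) \<times> carrier M"
  let ?t = "\<lambda>x i. val R (lookup x i) \<odot>\<^bsub>M\<^esub> snd i"
  have sz: "\<zero> \<odot>\<^bsub>M\<^esub> m = \<zero>\<^bsub>M\<^esub>" if "m \<in> carrier M" for m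
  proof -
    have "\<zero> \<odot>\<^bsub>M\<^esub> m \<oplus>\<^bsub>M\<^esub> \<zero> \<odot>\<^bsub>M\<^esub> m = \<zero> \<odot>\<^bsub>M\<^esub> m" using M.smult_add_scalar[of \<zero> \<zero> m] that by simp
    then show ?thesis using M.smult_closed[of \<zero> m] that M.M.add.l_cancel_one' by auto
  qed
  have zs: "a \<odot>\<^bsub>M\<^esub> \<zero>\<^bsub>M\<^esub> = \<zero>\<^bsub>M\<^esub>" if "a \<in> carrier R" for a
  proof -
    have "a \<odot>\<^bsub>M\<^esub> \<zero>\<^bsub>M\<^esub> \<oplus>\<^bsub>M\<^esub> a \<odot>\<^bsub>M\<^esub> \<zero>\<^bsub>M\<^esub> = a \<odot>\<^bsub>M\<^esub> \<zero>\<^bsub>M\<^esub>"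
      using M.smult_add_vector[of a "\<zero>\<^bsub>M\<^esub>" "\<zero>\<^bsub>M\<^esub>"] that by simp
    then show ?thesis using M.smult_closed[of a "\<zero>\<^bsub>M\<^esub>"] that M.M.add.l_cancel_one' by auto
  qed
  have tc: "?t x i \<in> carrier M" if "i \<in> ?C" for x i using that M.smult_closed by auto
  have ext: "ev M x = finsum M (?t x) (A \<inter> ?C)" if A: "finite A" "keys x \<subseteq> A" for x A
    unfolding ev_def
  proof (rule M.M.add.finprod_mono_neutral_cong_left)
    show "finite (A \<inter> ?C)" using A by simp
    show "keys x \<inter> ?C \<subseteq> A \<inter> ?C" using A by blast
    show "?t x i = \<zero>\<^bsub>M\<^esub>" if "i \<in> A \<inter> ?C - keys x \<inter> ?C" for i
    proof -
      have "lookup x i = 0" using that by (auto simp: in_keys_iff)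
      then show ?thesis using sz that by auto
    qed
    show "?t x \<in> A \<inter> ?C \<rightarrow> carrier M" using tc by blast
  qed simp
  show c: "ev M x \<in> carrier M" for x unfolding ev_def by (rule M.M.finsum_closed) (use tc in blast)
  show "ev M (x + y) = ev M x \<oplus>\<^bsub>M\<^esub> ev M y"
  proof -
    let ?A = "keys x \<union> keys y"
    have "ev M (x + y) = finsum M (\<lambda>i. ?t x i \<oplus>\<^bsub>M\<^esub> ?t y i) (?A \<inter> ?C)"
      unfolding ext[of ?A "x + y", OF _ keys_add, simplified]
      by (rule M.M.finsum_cong') (use tc M.smult_add_scalar in \<open>auto simp: lookup_add\<close>)
    also have "\<dots> = finsum M (?t x) (?A \<inter> ?C) \<oplus>\<^bsub>M\<^esub> finsum M (?t y) (?A \<inter> ?C)"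
      by (rule M.M.finsum_addf) (use tc in blast)+
    also have "\<dots> = ev M x \<oplus>\<^bsub>M\<^esub> ev M y" using ext[of ?A x] ext[of ?A y] by simp
    finally show ?thesis .
  qed
  show "ev M (rscale x a) = val R a \<odot>\<^bsub>M\<^esub> ev M x"
  proof -
    have k: "keys (rscale x a) \<subseteq> keys x" by (auto simp: in_keys_iff)
    have s: "finsum M (\<lambda>i. b \<odot>\<^bsub>M\<^esub> f i) A = b \<odot>\<^bsub>M\<^esub> finsum M f A"
      if "finite A" "b \<in> carrier R" "f \<in> A \<rightarrow> carrier M" for A f b
      using that(1,3)
    proof (induction A rule: finite_induct)
      case empty
      then show ?case using zs that(2) by simp
    next
      case (insert i A)
      then have fi: "f i \<in> carrier M" "f \<in> A \<rightarrow> carrier M" by auto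
      have "finsum M (\<lambda>i. b \<odot>\<^bsub>M\<^esub> f i) (insert i A) = b \<odot>\<^bsub>M\<^esub> f i \<oplus>\<^bsub>M\<^esub> finsum M (\<lambda>i. b \<odot>\<^bsub>M\<^esub> f i) A"
        using insert fi that(2) M.smult_closed by (intro M.M.finsum_insert) auto
      also have "\<dots> = b \<odot>\<^bsub>M\<^esub> (f i \<oplus>\<^bsub>M\<^esub> finsum M f A)"
        using insert fi that(2) M.smult_add_vector M.M.finsum_closed by simp
      also have "f i \<oplus>\<^bsub>M\<^esub> finsum M f A = finsum M f (insert i A)"
        using insert fi by (intro M.M.finsum_insert[symmetric]) auto
      finally show ?case .
    qed
    have "ev M (rscale x a) = finsum M (\<lambda>i. val R a \<odot>\<^bsub>M\<^esub> ?t x i) (keys x \<inter> ?C)"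
      unfolding ext[OF finite_keys k]
      by (rule M.M.finsum_cong') (use tc M.smult_closed M.smult_assoc in auto)
    also have "\<dots> = val R a \<odot>\<^bsub>M\<^esub> ev M x" unfolding ev_def by (rule s) (use tc in auto)
    finally show ?thesis .
  qed
  show "ev M (bas (n, m)) = m" if m: "m \<in> carrier M"
  proof -
    have "keys (bas (n, m)) \<subseteq> {(n, m)}" unfolding bas_def by simp
    then have "ev M (bas (n, m)) = finsum M (?t (bas (n, m))) ({(n, m)} \<inter> ?C)" by (intro ext) auto
    also have "{(n, m)} \<inter> ?C = {(n, m)}" using m by blast
    also have "finsum M (?t (bas (n, m))) {(n, m)} = ?t (bas (n, m)) (n, m)"
      by (subst M.M.finsum_insert) (use tc m in auto)
    also have "\<dots> = m" using m M.smult_one by (simp add: bas_def)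
    finally show ?thesis .
  qed
qed

text \<open>The target is a module with a carrier, which puts it out of reach of
  \<open>lin_eq_basI\<close>; instead the basis expansion of \<open>x\<close> is evaluated term by
  term.\<close>

lemma vec_agree:
  assumes M: "right_module R M"
    and u: "\<And>x. u x \<in> carrier M" "\<And>x y. u (x + y) = u x \<oplus>\<^bsub>M\<^esub> u y" "\<And>x a. u (rscale x a) = val R a \<odot>\<^bsub>M\<^esub> u x"
    and v: "\<And>x. v x \<in> carrier M" "\<And>x y. v (x + y) = v x \<oplus>\<^bsub>M\<^esub> v y" "\<And>x a. v (rscale x a) = val R a \<odot>\<^bsub>M\<^esub> v x"
    and b: "\<And>i. u (bas i) = v (bas i)" and x: "rscale x ee = x"
  shows "u x = v x"
proof -
  interpret M: right_module R M by fact
  have z: "u 0 = \<zero>\<^bsub>M\<^esub>" "v 0 = \<zero>\<^bsub>M\<^esub>"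
    using u(2)[of 0 0] v(2)[of 0 0] u(1)[of 0] v(1)[of 0] M.M.add.l_cancel_one' by auto
  have S: "u (\<Sum>i\<in>A. rscale (bas i) (lookup x i)) = v (\<Sum>i\<in>A. rscale (bas i) (lookup x i))" if "finite A" for A
    using that by (induction A rule: finite_induct) (simp_all add: z u(2,3) v(2,3) b del: rscale_bas)
  have "x = (\<Sum>i\<in>keys x. rscale (bas i) (lookup x i))"
    using app_expand[of eps "keys x" x] x by simp
  then show ?thesis by (rule ssubst[where P = "\<lambda>w. u w = v w"]) (rule S[OF finite_keys])
qed

text \<open>The image of an idempotent is a retract of a free module, and on the free module lifts
  are chosen for the basis vectors.\<close>

lemma projective_idem:
  assumes q: "q * q = q" "q * eps = q" and M: "M \<in> Modules elts R"
    and \<phi>: "rmiso R M (Vmod {x. app q x = x}) \<phi>"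
  shows "projective elts R M"
  unfolding projective_def
proof (intro conjI M ballI impI)
  fix A B p f
  assume A: "A \<in> Modules elts R" and B: "B \<in> Modules elts R" and p: "p \<in> mod_hom R A B" and f: "f \<in> mod_hom R M B"
    and onto: "p ` carrier A = carrier B"
  have rA: "right_module R A" and rB: "right_module R B" and rM: "right_module R M"
    using A B M unfolding Modules_def by auto
  let ?\<psi> = "inv_into (carrier M) \<phi>"
  have \<psi>: "?\<psi> \<in> mod_hom R (Vmod {x. app q x = x}) M" using rmiso_inv[OF \<phi> rM] unfolding rmiso_def by blast
  have qq: "app q (app q x) = app q x" for x using app_cong[OF q(1), of x] by simp
  let ?v = "\<lambda>x. f (?\<psi> (app q x))"
  have v: "?v x \<in> carrier B" "?v (x + y) = ?v x \<oplus>\<^bsub>B\<^esub> ?v y" "?v (rscale x a) = val R a \<odot>\<^bsub>B\<^esub> ?v x" for x y a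
  proof -
    have c: "app q x \<in> {x. app q x = x}" for x using qq by simp
    have mc: "?\<psi> (app q x) \<in> carrier M" for x using mod_homD(1)[OF \<psi>] c by simp
    show "?v x \<in> carrier B" using mod_homD(1)[OF f mc] .
    show "?v (x + y) = ?v x \<oplus>\<^bsub>B\<^esub> ?v y" using mod_homD(2)[OF \<psi>] c mod_homD(2)[OF f mc mc] by simp
    have "rscale (app q x) a = rscale (app q x) (emb R (val R a))" by (rule rscale_val[OF idem_Vmod[OF q(2) c]])
    then show "?v (rscale x a) = val R a \<odot>\<^bsub>B\<^esub> ?v x"
      using mod_homD(3)[OF \<psi>] c mod_homD(3)[OF f val_simps(1) mc] by simp
  qed
  have "\<forall>i. \<exists>a\<in>carrier A. p a = ?v (bas i)" using v(1) onto by (metis imageE)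
  then obtain a where a: "\<And>i. a i \<in> carrier A" "\<And>i. p (a i) = ?v (bas i)" by metis
  \<comment> \<open>The chosen lifts serve as labels of basis vectors, and \<open>ev A\<close> turns
    the labels back into elements. The degree 0 is arbitrary, since \<open>ev\<close> ignores
    it.\<close>
  define L where "L = ext (\<lambda>i. bas (0 :: int, a i))"
  have Lb: "app L (bas i) = bas (0, a i)" for i unfolding L_def by (simp add: app_ext_bas)
  let ?h = "\<lambda>x. ev A (app L (\<phi> x))"
  have u: "p (ev A (app L (x + y))) = p (ev A (app L x)) \<oplus>\<^bsub>B\<^esub> p (ev A (app L y))"
    "p (ev A (app L x)) \<in> carrier B" "p (ev A (app L (rscale x b))) = val R b \<odot>\<^bsub>B\<^esub> p (ev A (app L x))" for x y b
    using mod_homD[OF p] ev[OF rA] by simp_all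
  have agree: "p (ev A (app L x)) = ?v x" if "rscale x ee = x" for x
    by (rule vec_agree[OF rB u(2,1,3) v _ that]) (simp add: Lb ev(4)[OF rA a(1)] a(2))
  have ph: "\<phi> \<in> mod_hom R M (Vmod {x. app q x = x})" "inj_on \<phi> (carrier M)"
    using \<phi> unfolding rmiso_def bij_betw_def by auto
  have hh: "?h \<in> mod_hom R M A"
    by (rule mod_homI) (use ev[OF rA] mod_homD[OF ph(1)] in simp_all)
  have hp: "p (?h x) = f x" if x: "x \<in> carrier M" for x
  proof -
    have c: "\<phi> x \<in> {x. app q x = x}" using mod_homD(1)[OF ph(1) x] by simp
    have "p (?h x) = ?v (\<phi> x)" by (rule agree[OF idem_Vmod[OF q(2) c]])
    also have "\<dots> = f x" using c ph(2) x by simp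
    finally show ?thesis .
  qed
  show "\<exists>h\<in>mod_hom R M A. \<forall>x\<in>carrier M. p (h x) = f x"
    by (rule bexI[OF _ hh]) (rule ballI, rule hp)
qed

lemma projective_free:
  assumes "sml K"
  shows "\<exists>(P :: ('r, 'v) module) c. projective elts R P \<and> rmiso R (Vmod (vs K)) P c"
proof -
  obtain c x where c: "bij_betw (c :: _ => 'v) (vs K) (elts x)" using small_inject[OF small_vs[OF assms]] by blast
  let ?P = "copy_module (Vmod (vs K)) c"
  have inj: "inj_on c (carrier (Vmod (vs K)))" using c unfolding bij_betw_def by simp
  have P: "right_module R ?P" "rmiso R (Vmod (vs K)) ?P c" using copy_module[OF right_module_vs inj] by auto
  have "carrier ?P = elts x" using P(2) c unfolding rmiso_def bij_betw_def by auto
  then have M: "?P \<in> Modules elts R" unfolding Modules_def using P(1) by simp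
  have i: "rmiso R ?P (Vmod (vs K)) (inv_into (vs K) c)" using rmiso_inv[OF P(2) right_module_vs] by simp
  have "projective elts R ?P"
    by (rule projective_idem[of "pr K", OF _ _ M]) (use i in \<open>simp_all add: vs_def\<close>)
  then show ?thesis using P(2) by blast
qed

text \<open>The basis consists of the elements of \<open>M\<close>, so \<open>ev M\<close> is the
  canonical surjection from a free module, and projectivity splits it. The degree \<open>n\<close>
  merely labels this basis.\<close>

lemma projective_split:
  assumes M: "projective elts R M"
  shows "\<exists>\<sigma>. \<sigma> \<in> mod_hom R M (Vmod (vs ({n} \<times> carrier M))) \<and> (\<forall>x\<in>carrier M. ev M (\<sigma> x) = x)"
proof -
  have MM: "M \<in> Modules elts R" using M unfolding projective_def by blast
  then have rM: "right_module R M" and sM: "sml (carrier M)" unfolding Modules_def by auto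
  let ?P = "vs ({n} \<times> carrier M)"
  have "sml ({n} \<times> carrier M)" by (intro small_Times small_countable sM) simp
  then obtain A c where pA: "projective elts R A" and A: "rmiso R (Vmod ?P) A c" using projective_free by blast
  have AM: "A \<in> Modules elts R" using pA unfolding projective_def by blast
  let ?c' = "inv_into ?P c"
  have c': "?c' \<in> mod_hom R A (Vmod ?P)" "bij_betw ?c' (carrier A) ?P"
    using rmiso_inv[OF A right_module_vs] unfolding rmiso_def by auto
  let ?p = "\<lambda>y. ev M (?c' y)"
  have p: "?p \<in> mod_hom R A M"
    by (rule mod_homI) (use ev[OF rM] mod_homD[OF c'(1)] in simp_all)
  have onto: "?p ` carrier A = carrier M"
  proof
    show "?p ` carrier A \<subseteq> carrier M" using mod_homD(1)[OF p] by blast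
    show "carrier M \<subseteq> ?p ` carrier A"
    proof
      fix m assume m: "m \<in> carrier M"
      then have "bas (n, m) \<in> ?c' ` carrier A" using c'(2) unfolding bij_betw_def by simp
      then obtain y where y: "bas (n, m) = ?c' y" "y \<in> carrier A" by (elim imageE)
      then have "m = ?p y" using ev(4)[OF rM m, of n] by simp
      then show "m \<in> ?p ` carrier A" by (rule image_eqI) (rule y(2))
    qed
  qed
  have i: "(\<lambda>x. x) \<in> mod_hom R M M" by (rule mod_homI) auto
  obtain h where h: "h \<in> mod_hom R M A" "\<forall>x\<in>carrier M. ?p (h x) = x"
    using conjunct2[OF M[unfolded projective_def], rule_format, OF AM MM p i onto] by (elim bexE)
  show ?thesis
    by (rule exI[of _ "\<lambda>x. ?c' (h x)"]) (intro conjI h(2) mod_hom_comp[OF h(1) c'(1)])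
qed

section \<open>Matrix models of complexes of modules\<close>

definition Vn :: "('v, 'r rprod) dgc => int => ('v, 'r) vec set" where
  "Vn T n = {x. app (pj T) x = x \<and> x \<in> vs (lev n)}"

definition icx :: "('v, 'r rprod) dgc => ('r, ('v, 'r) vec) cochain" where
  "icx T = \<lparr>Ob = (\<lambda>n. Vmod (Vn T n)), diff = (\<lambda>n. app (df T))\<rparr>"

definition siso where
  "siso X Y \<phi> \<longleftrightarrow> (\<forall>n. rmiso R (Ob X n) (Ob Y n) (\<phi> n) \<and>
     (\<forall>x\<in>el X n. diff Y n (\<phi> n x) = \<phi> (n + 1) (diff X n x)))"

text \<open>The dictionary between modules and matrices: \<open>\<phi>\<close> identifies
  \<open>X\<close> with the complex that the idempotent and the differential of \<open>T\<close> cut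
  out of the free module.\<close>

definition model where
  "model X T \<phi> \<longleftrightarrow> is_complex R X \<and> ok T \<and> sml (bs T) \<and> siso X (icx T) \<phi>"

lemma Vn_idem: "ok T ==> Vn T n = {x. app (pj T * pr (lev n)) x = x}"
proof -
  assume T: "ok T"
  have c: "pj T * pr (lev n) = pr (lev n) * pj T" using dg_lev[OF okD(7)[OF T], of n] by simp
  have "app (pj T) x = x \<and> x \<in> vs (lev n)" if "app (pj T * pr (lev n)) x = x" for x
  proof -
    have "app (pj T) (app (pj T * pr (lev n)) x) = app (pj T * pr (lev n)) x" by (simp add: app_okr(1)[OF T])
    moreover have "app (pr (lev n) * pj T) x = x" using that unfolding c .
    then have "x \<in> vs (lev n)" by (metis app_lin_simps(5) vs_pr)
    ultimately show ?thesis unfolding that by blast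
  qed
  then show ?thesis unfolding Vn_def by (auto simp: vs_def)
qed

lemma right_module_Vn: "ok T ==> right_module R (Vmod (Vn T n))"
proof -
  assume T: "ok T"
  have "pj T * pr (lev n) * eps = pj T * pr (lev n)" by (simp add: mult.assoc)
  then show ?thesis unfolding Vn_idem[OF T] by (rule right_module_idem)
qed

lemma Vn_e: "ok T ==> x \<in> Vn T n ==> rscale x ee = x"
  unfolding Vn_def vs_iff by blast

lemma Vn_df: "ok T ==> x \<in> Vn T n ==> app (df T) x \<in> Vn T (n + 1)"
  unfolding Vn_def using dg_vs[OF okD(8)] app_okr(2) by auto

lemma Vn_pr: "ok T ==> app (pr (lev n)) (app (pj T) x) \<in> Vn T n"
proof -
  assume T: "ok T"
  have c: "pj T * pr (lev n) = pr (lev n) * pj T" using dg_lev[OF okD(7)[OF T], of n] by simp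
  have "app (pj T * pr (lev n)) (app (pj T) x) = app (pr (lev n) * pj T) (app (pj T) x)" unfolding c ..
  then have "app (pj T) (app (pr (lev n)) (app (pj T) x)) = app (pr (lev n)) (app (pj T) x)"
    by (simp add: app_okr(1)[OF T])
  then show ?thesis unfolding Vn_def by simp
qed

lemma modelD:
  assumes "model X T \<phi>"
  shows "is_complex R X" "ok T" "sml (bs T)" "x \<in> el X n ==> \<phi> n x \<in> Vn T n"
    "x \<in> el X n ==> y \<in> el X n ==> \<phi> n (x \<oplus>\<^bsub>Ob X n\<^esub> y) = \<phi> n x + \<phi> n y"
    "a \<in> carrier R ==> x \<in> el X n ==> \<phi> n (a \<odot>\<^bsub>Ob X n\<^esub> x) = rscale (\<phi> n x) (emb R a)"
    "x \<in> el X n ==> app (df T) (\<phi> n x) = \<phi> (n + 1) (diff X n x)"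
    "v \<in> Vn T n ==> \<exists>x\<in>el X n. \<phi> n x = v" "inj_on (\<phi> n) (el X n)"
    "\<phi> n \<in> mod_hom R (Ob X n) (Vmod (Vn T n))"
    "right_module R (Ob X n)" "diff X n \<in> mod_hom R (Ob X n) (Ob X (n + 1))"
    "rmiso R (Ob X n) (Vmod (Vn T n)) (\<phi> n)"
proof -
  show *: "is_complex R X" "ok T" "sml (bs T)" using assms unfolding model_def by auto
  have s: "siso X (icx T) \<phi>" using assms unfolding model_def by blast
  then show i: "rmiso R (Ob X n) (Vmod (Vn T n)) (\<phi> n)" for n unfolding siso_def icx_def by simp
  then show h: "\<phi> n \<in> mod_hom R (Ob X n) (Vmod (Vn T n))" for n unfolding rmiso_def by blast
  have b: "bij_betw (\<phi> n) (el X n) (Vn T n)" using i[of n] unfolding rmiso_def by simp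
  show "x \<in> el X n ==> \<phi> n x \<in> Vn T n"
    "x \<in> el X n ==> y \<in> el X n ==> \<phi> n (x \<oplus>\<^bsub>Ob X n\<^esub> y) = \<phi> n x + \<phi> n y"
    "a \<in> carrier R ==> x \<in> el X n ==> \<phi> n (a \<odot>\<^bsub>Ob X n\<^esub> x) = rscale (\<phi> n x) (emb R a)"
    using mod_homD[OF h[of n]] by simp_all
  show "x \<in> el X n ==> app (df T) (\<phi> n x) = \<phi> (n + 1) (diff X n x)"
    using s unfolding siso_def icx_def by simp
  show "inj_on (\<phi> n) (el X n)" using b unfolding bij_betw_def by blast
  show "\<exists>x\<in>el X n. \<phi> n x = v" if "v \<in> Vn T n"
  proof -
    have "v \<in> \<phi> n ` el X n" using b that unfolding bij_betw_def by simp
    then show ?thesis by blast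
  qed
  show "right_module R (Ob X n)" "diff X n \<in> mod_hom R (Ob X n) (Ob X (n + 1))"
    using *(1) unfolding is_complex_def by auto
qed

lemma model_minus:
  assumes "model X T \<phi>" "x \<in> el X n" "y \<in> el X n"
  shows "\<phi> n (x \<ominus>\<^bsub>Ob X n\<^esub> y) = \<phi> n x - \<phi> n y" "\<phi> n (\<ominus>\<^bsub>Ob X n\<^esub> y) = - \<phi> n y" "\<phi> n \<zero>\<^bsub>Ob X n\<^esub> = 0"
proof -
  note m = modelD[OF assms(1)]
  interpret M: right_module R "Ob X n" by (rule m)
  show z: "\<phi> n \<zero>\<^bsub>Ob X n\<^esub> = 0" using m(5)[of "\<zero>\<^bsub>Ob X n\<^esub>" n "\<zero>\<^bsub>Ob X n\<^esub>"] by simp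
  have "\<phi> n (\<ominus>\<^bsub>Ob X n\<^esub> y) + \<phi> n y = 0"
    using m(5)[of "\<ominus>\<^bsub>Ob X n\<^esub> y" n y] assms(3) z by (simp add: M.M.l_neg)
  then show u: "\<phi> n (\<ominus>\<^bsub>Ob X n\<^esub> y) = - \<phi> n y" by (simp add: add_eq_0_iff2)
  show "\<phi> n (x \<ominus>\<^bsub>Ob X n\<^esub> y) = \<phi> n x - \<phi> n y"
    using m(5)[of x n "\<ominus>\<^bsub>Ob X n\<^esub> y"] assms(2,3) u unfolding a_minus_def by simp
qed

lemma model_zero: "model X T \<phi> ==> \<phi> n \<zero>\<^bsub>Ob X n\<^esub> = 0"
proof -
  assume m: "model X T \<phi>"
  interpret M: right_module R "Ob X n" by (rule modelD[OF m])
  show ?thesis by (rule model_minus(3)[OF m M.zero_closed M.zero_closed])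
qed

lemma model_small: "model X T \<phi> ==> sml (el X n)"
proof -
  assume m: "model X T \<phi>"
  note d = modelD[OF m]
  have "\<phi> n ` el X n \<subseteq> vs (bs T)"
    using d(4) app_okr(5)[OF d(2)] unfolding Vn_def by (metis (mono_tags, lifting) image_subsetI mem_Collect_eq)
  then show ?thesis using small_inj_image[OF _ d(9)] small_subset[OF small_vs[OF d(3)]] by blast
qed

lemma model_KProj:
  fixes X :: "('r, 'v) cochain"
  assumes m: "model X T \<phi>" shows "X \<in> KProj elts R" "Ob X n \<in> Modules elts R" "X \<in> KMod elts R"
proof -
  note d = modelD[OF m]
  show M: "Ob X n \<in> Modules elts R" for n unfolding Modules_def using d(11) model_small[OF m] by blast
  have q: "pj T * pr (lev n) * (pj T * pr (lev n)) = pj T * pr (lev n)" "pj T * pr (lev n) * eps = pj T * pr (lev n)" for n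
  proof -
    have c: "pr (lev n) * pj T = pj T * pr (lev n)" using dg_lev[OF okD(7)[OF d(2)], of n] by simp
    have "pj T * pr (lev n) * (pj T * pr (lev n)) = pj T * (pr (lev n) * pj T) * pr (lev n)" by (simp add: mult.assoc)
    also have "\<dots> = pj T * pr (lev n)" unfolding c by (simp add: mult.assoc okr[OF d(2)])
    finally show "pj T * pr (lev n) * (pj T * pr (lev n)) = pj T * pr (lev n)" .
    show "pj T * pr (lev n) * eps = pj T * pr (lev n)" by (simp add: mult.assoc)
  qed
  have "projective elts R (Ob X n)" for n
    by (rule projective_idem[OF q M]) (use d(13) Vn_idem[OF d(2)] in simp)
  then show "X \<in> KProj elts R" "X \<in> KMod elts R" unfolding KProj_def KMod_def using d(1) M by auto
qed

text \<open>The vectors over a small basis form a small set, so each term can be coded by elements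
  of \<open>'v\<close>.\<close>

lemma model_exists:
  assumes T: "ok T" "sml (bs T)"
  shows "\<exists>(X :: ('r, 'v) cochain) \<phi>. model X T \<phi>"
proof -
  have "sml (Vn T n)" for n
  proof -
    have "Vn T n \<subseteq> vs (bs T)" using app_okr(5)[OF T(1)] unfolding Vn_def by (metis (mono_tags, lifting) mem_Collect_eq subsetI)
    then show ?thesis using small_subset[OF small_vs[OF T(2)]] by blast
  qed
  then have "\<forall>n. \<exists>c x. bij_betw (c :: _ => 'v) (Vn T n) (elts x)" using small_inject by blast
  then obtain c where c: "\<And>n. inj_on (c n :: _ => 'v) (Vn T n)" unfolding bij_betw_def by metis
  let ?M = "\<lambda>n. copy_module (Vmod (Vn T n)) (c n)"
  let ?\<phi> = "\<lambda>n. inv_into (Vn T n) (c n)"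
  have M: "right_module R (?M n)" "rmiso R (Vmod (Vn T n)) (?M n) (c n)" for n
    using copy_module[OF right_module_Vn[OF T(1)], of "c n" n] c by auto
  have i: "rmiso R (?M n) (Vmod (Vn T n)) (?\<phi> n)" for n using rmiso_inv[OF M(2) right_module_Vn[OF T(1)]] by simp
  have ci: "c n \<in> mod_hom R (Vmod (Vn T n)) (?M n)" "?\<phi> n \<in> mod_hom R (?M n) (Vmod (Vn T n))" for n
    using M(2) i unfolding rmiso_def by auto
  have cc: "?\<phi> n (c n v) = v" if "v \<in> Vn T n" for n v using c that by simp
  define X where "X = \<lparr>Ob = ?M, diff = (\<lambda>n y. c (n + 1) (app (df T) (?\<phi> n y)))\<rparr>"
  have v: "?\<phi> n y \<in> Vn T n" if "y \<in> carrier (?M n)" for n y using mod_homD(1)[OF ci(2) that] by simp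
  have d: "(\<lambda>y. app (df T) (?\<phi> n y)) \<in> mod_hom R (?M n) (Vmod (Vn T (n + 1)))" for n
    by (rule mod_hom_comp[OF ci(2)]) (auto intro!: mod_homI Vn_df[OF T(1)])
  have "is_complex R X"
    unfolding is_complex_def
  proof (intro allI conjI ballI)
    fix n
    show "right_module R (Ob X n)" unfolding X_def using M by simp
    show "diff X n \<in> mod_hom R (Ob X n) (Ob X (n + 1))" unfolding X_def using mod_hom_comp[OF d ci(1)] by simp
    fix y assume y: "y \<in> el X n"
    have "diff X (n + 1) (diff X n y) = c (n + 1 + 1) 0"
      using y v[of y n] Vn_df[OF T(1), of "?\<phi> n y" n] unfolding X_def by (simp add: cc app_okr(4)[OF T(1)])
    also have "\<dots> = \<zero>\<^bsub>Ob X (n + 1 + 1)\<^esub>"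
      using mod_hom_zero[OF ci(1) right_module_Vn[OF T(1)] M(1)] unfolding X_def by simp
    finally show "diff X (n + 1) (diff X n y) = \<zero>\<^bsub>Ob X (n + 1 + 1)\<^esub>" .
  qed
  moreover have "siso X (icx T) ?\<phi>"
    unfolding siso_def icx_def using i v Vn_df[OF T(1)] by (auto simp: X_def cc)
  ultimately have "model X T ?\<phi>" unfolding model_def using T by blast
  then show ?thesis by blast
qed

text \<open>\<open>h\<close> is extended to the whole free module through the projection onto degree
  \<open>n\<close>. Linearity over all coefficients follows from linearity over \<open>R\<close>,
  because the values of \<open>h\<close> are fixed by \<open>ee\<close>.\<close>

lemma lin_of:
  assumes m: "model X T \<phi>"
    and h: "\<And>x y. x \<in> el X n ==> y \<in> el X n ==> h (x \<oplus>\<^bsub>Ob X n\<^esub> y) = h x + h y"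
      "\<And>a x. a \<in> carrier R ==> x \<in> el X n ==> h (a \<odot>\<^bsub>Ob X n\<^esub> x) = rscale (h x) (emb R a)"
      "\<And>x. x \<in> el X n ==> rscale (h x) ee = h x"
  shows "\<exists>L. L * pj T = L \<and> L * pr (lev n) = L \<and> (\<forall>x\<in>el X n. app L (\<phi> n x) = h x) \<and>
    (\<forall>y. \<exists>x\<in>el X n. app L y = h x)"
proof -
  note d = modelD[OF m]
  let ?\<psi> = "inv_into (el X n) (\<phi> n)"
  have \<psi>: "?\<psi> \<in> mod_hom R (Vmod (Vn T n)) (Ob X n)" using rmiso_inv[OF d(13,11)] unfolding rmiso_def by blast
  let ?q = "\<lambda>x. app (pr (lev n)) (app (pj T) x)"
  have q: "?q x \<in> Vn T n" for x by (rule Vn_pr[OF d(2)])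
  let ?g = "\<lambda>x. h (?\<psi> (?q x))"
  have c: "?\<psi> (?q x) \<in> el X n" for x using mod_homD(1)[OF \<psi>] q by simp
  have g: "?g (x + y) = ?g x + ?g y" for x y
    using mod_homD(2)[OF \<psi>, of "?q x" "?q y"] q h(1)[OF c c] by simp
  have g': "?g (rscale x a) = rscale (?g x) a" for x a
  proof -
    have "rscale (?q x) a = rscale (?q x) (emb R (val R a))" by (rule rscale_val[OF Vn_e[OF d(2) q]])
    then have "?g (rscale x a) = h (val R a \<odot>\<^bsub>Ob X n\<^esub> ?\<psi> (?q x))"
      using mod_homD(3)[OF \<psi>, of "val R a" "?q x"] q by simp
    also have "\<dots> = rscale (?g x) (emb R (val R a))" by (rule h(2)[OF val_simps(1) c])
    also have "\<dots> = rscale (?g x) a" by (rule rscale_val[OF h(3)[OF c], symmetric])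
    finally show ?thesis .
  qed
  have L: "app (Lin ?g) = ?g" by (rule app_Lin[OF g g'])
  show ?thesis
  proof (intro exI[of _ "Lin ?g"] conjI ballI allI)
    show "Lin ?g * pj T = Lin ?g" by (rule lin_eqI) (simp add: L app_okr(1)[OF d(2)])
    show "Lin ?g * pr (lev n) = Lin ?g"
    proof (rule lin_eqI)
      fix x
      have "pr (lev n) * pj T * pr (lev n) = pr (lev n) * pj T"
        using dg_lev[OF okD(7)[OF d(2)], of n] by (simp add: mult.assoc)
      then have "?q (app (pr (lev n)) x) = ?q x" by (metis app_lin_simps(5))
      then show "app (Lin ?g * pr (lev n)) x = app (Lin ?g) x" by (simp add: L)
    qed
    show "app (Lin ?g) (\<phi> n x) = h x" if x: "x \<in> el X n" for x
    proof -
      have "?q (\<phi> n x) = \<phi> n x" using d(4)[OF x] unfolding Vn_def vs_def by simp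
      then show ?thesis unfolding L using d(9) x by simp
    qed
    show "\<exists>x\<in>el X n. app (Lin ?g) y = h x" for y unfolding L using c by blast
  qed
qed

text \<open>\<open>pj T\<close> sends each basis vector into the image of a term of
  \<open>X\<close>, so the elements of \<open>X\<close> detect maps that absorb
  \<open>pj T\<close>.\<close>

lemma model_eqI:
  assumes m: "model X T \<phi>" and F: "F * pj T = F" "G * pj T = G"
    and e: "\<And>n x. x \<in> el X n ==> app F (\<phi> n x) = app G (\<phi> n x)"
  shows "F = G"
proof (rule lin_eq_basI)
  note d = modelD[OF m]
  have "F * pj T * eps = F * pj T" "G * pj T * eps = G * pj T" by (simp_all add: mult.assoc okD(11)[OF d(2)])
  then show "F * eps = F" "G * eps = G" using F by simp_all
  fix i :: "int \<times> 'v"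
  have "bas i \<in> vs (lev (fst i))" by (simp add: mem_Times_iff)
  then have "app (pj T) (bas i) \<in> vs (lev (fst i + 0))" by (rule dg_vs[OF okD(7)[OF d(2)]])
  then have "app (pj T) (bas i) \<in> Vn T (fst i)" unfolding Vn_def by (simp add: app_okr(1)[OF d(2)])
  then obtain x where "x \<in> el X (fst i)" "\<phi> (fst i) x = app (pj T) (bas i)" using d(8) by blast
  then have "app F (app (pj T) (bas i)) = app G (app (pj T) (bas i))" using e by metis
  then have "app (F * pj T) (bas i) = app (G * pj T) (bas i)" by simp
  then show "app F (bas i) = app G (bas i)" unfolding F .
qed

lemma dg_single:
  assumes "L * pr (lev n) = L" "pr (lev (n + k)) * L = L" shows "dg k L"
  unfolding dg_def
proof
  fix m
  show "L * pr (lev m) = pr (lev (m + k)) * L"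
  proof (cases "m = n")
    case False
    have d: "lev n \<inter> lev m = {}" "lev (m + k) \<inter> lev (n + k) = {}" using False by auto
    have "L * pr (lev n) * pr (lev m) = 0" "pr (lev (m + k)) * (pr (lev (n + k)) * L) = 0"
      unfolding mult.assoc pr_pr d by simp_all
    then show ?thesis unfolding assms by simp
  qed (simp add: assms)
qed

lemma glue_lev_absorb:
  assumes "\<And>n. F n * pr (lev n) = F n" "\<And>n. F n * q = F n" "dg 0 q" "q * eps = q"
  shows "glue UNIV lev F * q = glue UNIV lev F"
proof (rule lev_eqI)
  fix n
  have "glue UNIV lev F * q * pr (lev n) = glue UNIV lev F * pr (lev n) * q"
    using dg_lev[OF assms(3), of n] by (simp add: mult.assoc)
  then show "glue UNIV lev F * q * pr (lev n) = glue UNIV lev F * pr (lev n)"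
    unfolding lev_glue[of F, OF assms(1)] assms(2) .
qed (simp_all add: mult.assoc assms(4))

lemma glue_left_absorb:
  assumes "\<And>n. F n * pr (lev n) = F n" "\<And>n. q * F n = F n"
  shows "q * glue UNIV lev F = glue UNIV lev F"
proof (rule lev_eqI)
  show "q * glue UNIV lev F * pr (lev n) = glue UNIV lev F * pr (lev n)" for n
    using assms(2) by (simp add: mult.assoc lev_glue[of F, OF assms(1)])
qed (simp_all add: mult.assoc)

text \<open>The degree \<open>k\<close> is left open because 0 serves for cochain maps and -1 for
  homotopies.\<close>

lemma fam_to_lin:
  assumes m: "model X T \<phi>" and m': "model Y U \<chi>"
    and f: "\<And>n. f n \<in> mod_hom R (Ob X n) (Ob Y (n + k))"
  shows "\<exists>F. dg k F \<and> F * pj T = F \<and> pj U * F = F \<and>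
    (\<forall>n. \<forall>x\<in>el X n. app F (\<phi> n x) = \<chi> (n + k) (f n x))"
proof -
  note d = modelD[OF m] and d' = modelD[OF m']
  have "\<exists>L. L * pj T = L \<and> L * pr (lev n) = L \<and> (\<forall>x\<in>el X n. app L (\<phi> n x) = \<chi> (n + k) (f n x)) \<and>
    (\<forall>y. \<exists>x\<in>el X n. app L y = \<chi> (n + k) (f n x))" for n
  proof (rule lin_of[OF m])
    fix x y a assume x: "x \<in> el X n" and y: "y \<in> el X n"
    show "\<chi> (n + k) (f n (x \<oplus>\<^bsub>Ob X n\<^esub> y)) = \<chi> (n + k) (f n x) + \<chi> (n + k) (f n y)"
      using x y mod_homD[OF f] d'(5) by simp
    show "\<chi> (n + k) (f n (a \<odot>\<^bsub>Ob X n\<^esub> x)) = rscale (\<chi> (n + k) (f n x)) (emb R a)" if "a \<in> carrier R"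
      using x that mod_homD[OF f] d'(6) by simp
    show "rscale (\<chi> (n + k) (f n x)) ee = \<chi> (n + k) (f n x)"
      using Vn_e[OF d'(2) d'(4)] mod_homD(1)[OF f x] by simp
  qed
  then obtain L where L: "\<And>n. L n * pj T = L n" "\<And>n. L n * pr (lev n) = L n"
    "\<And>n x. x \<in> el X n ==> app (L n) (\<phi> n x) = \<chi> (n + k) (f n x)"
    "\<And>n y. \<exists>x\<in>el X n. app (L n) y = \<chi> (n + k) (f n x)" by metis
  have LV: "app (L n) y \<in> Vn U (n + k)" for n y using L(4)[of n y] d'(4) mod_homD(1)[OF f] by auto
  have L5: "pj U * L n = L n" "pr (lev (n + k)) * L n = L n" for n
    using LV unfolding Vn_def by (auto intro!: lin_eqI simp: vs_def)
  let ?F = "glue UNIV lev L"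
  have G: "?F * pr (lev n) = L n" for n by (rule lev_glue[OF L(2)])
  show ?thesis
  proof (intro exI[of _ ?F] conjI allI ballI)
    show "dg k ?F" by (rule dg_glue) (rule dg_single[OF L(2) L5(2)])
    show "?F * pj T = ?F" by (rule glue_lev_absorb[of L, OF L(2,1) okD(7,11)[OF d(2)]])
    show "pj U * ?F = ?F" by (rule glue_left_absorb[of L, OF L(2) L5(1)])
    fix n x assume x: "x \<in> el X n"
    have "app ?F (\<phi> n x) = app (?F * pr (lev n)) (\<phi> n x)" using d(4)[OF x] unfolding Vn_def vs_def by simp
    then show "app ?F (\<phi> n x) = \<chi> (n + k) (f n x)" unfolding G using L(3)[OF x] by simp
  qed
qed

lemma lin_to_fam:
  assumes m: "model X T \<phi>" and m': "model Y U \<chi>" and F: "dg k F" "pj U * F = F"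
  shows "\<exists>f. (\<forall>n. f n \<in> mod_hom R (Ob X n) (Ob Y (n + k)) \<and>
    (\<forall>x\<in>el X n. \<chi> (n + k) (f n x) = app F (\<phi> n x)))"
proof -
  note d = modelD[OF m] and d' = modelD[OF m']
  let ?i = "\<lambda>n. inv_into (el Y n) (\<chi> n)"
  have i: "?i n \<in> mod_hom R (Vmod (Vn U n)) (Ob Y n)" for n using rmiso_inv[OF d'(13,11)] unfolding rmiso_def by blast
  have FV: "app F v \<in> Vn U (n + k)" if "v \<in> Vn T n" for n v
    using dg_vs[OF F(1)] that app_cong[OF F(2), of v] unfolding Vn_def by auto
  have F': "app F \<in> mod_hom R (Vmod (Vn T n)) (Vmod (Vn U (n + k)))" for n
    by (rule mod_homI) (auto simp: FV)
  show ?thesis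
  proof (intro exI[of _ "\<lambda>n x. ?i (n + k) (app F (\<phi> n x))"] allI conjI ballI)
    show "(\<lambda>x. ?i (n + k) (app F (\<phi> n x))) \<in> mod_hom R (Ob X n) (Ob Y (n + k))" for n
      by (rule mod_hom_comp[OF mod_hom_comp[OF d(10) F'] i])
    show "\<chi> (n + k) (?i (n + k) (app F (\<phi> n x))) = app F (\<phi> n x)" if "x \<in> el X n" for n x
    proof (rule f_inv_into_f)
      obtain y where "y \<in> el Y (n + k)" "\<chi> (n + k) y = app F (\<phi> n x)"
        using d'(8)[OF FV[OF d(4)[OF \<open>x \<in> el X n\<close>]]] by blast
      then show "app F (\<phi> n x) \<in> \<chi> (n + k) ` el Y (n + k)" by (intro image_eqI[of _ _ y]) simp_all
    qed
  qed
qed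

definition rep where
  "rep X \<phi> \<chi> f F \<longleftrightarrow> (\<forall>n. \<forall>x\<in>el X n. app F (\<phi> n x) = \<chi> n (f n x))"

lemma cochain_to_hom:
  assumes m: "model X T \<phi>" and m': "model Y U \<chi>" and f: "f \<in> cochain_maps R X Y"
  shows "\<exists>F. hom T U F \<and> rep X \<phi> \<chi> f F"
proof -
  note d = modelD[OF m] and d' = modelD[OF m']
  have fn: "f n \<in> mod_hom R (Ob X n) (Ob Y (n + 0))" for n using f unfolding cochain_maps_def by simp
  have fd: "diff Y n (f n x) = f (n + 1) (diff X n x)" if "x \<in> el X n" for n x
    using f that unfolding cochain_maps_def by blast
  obtain F where F: "dg 0 F" "F * pj T = F" "pj U * F = F"
    "\<And>n x. x \<in> el X n ==> app F (\<phi> n x) = \<chi> (n + 0) (f n x)" using fam_to_lin[OF m m' fn] by metis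
  have "df U * F = F * df T"
  proof (rule model_eqI[OF m])
    show "df U * F * pj T = df U * F" by (simp add: mult.assoc F(2))
    show "F * df T * pj T = F * df T" by (simp add: mult.assoc okD(5)[OF d(2)])
    fix n x assume x: "x \<in> el X n"
    have "app (df U) (app F (\<phi> n x)) = \<chi> (n + 1) (diff Y n (f n x))"
      using F(4)[OF x] d'(7)[OF mod_homD(1)[OF fn x]] by simp
    also have "\<dots> = app F (\<phi> (n + 1) (diff X n x))"
      using fd[OF x] F(4)[OF mod_homD(1)[OF d(12) x]] by simp
    finally show "app (df U * F) (\<phi> n x) = app (F * df T) (\<phi> n x)" using d(7)[OF x] by simp
  qed
  then have "hom T U F" unfolding hom_def using F by blast
  then show ?thesis using F(4) unfolding rep_def by auto
qed

lemma hom_to_cochain: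
  assumes m: "model X T \<phi>" and m': "model Y U \<chi>" and F: "hom T U F"
  shows "\<exists>f\<in>cochain_maps R X Y. rep X \<phi> \<chi> f F"
proof -
  note d = modelD[OF m] and d' = modelD[OF m']
  obtain f where f: "\<And>n. f n \<in> mod_hom R (Ob X n) (Ob Y (n + 0))"
    "\<And>n x. x \<in> el X n ==> \<chi> (n + 0) (f n x) = app F (\<phi> n x)"
    using lin_to_fam[OF m m' homD(4,2)[OF F]] by metis
  have fc: "f n x \<in> el Y n" if "x \<in> el X n" for n x using mod_homD(1)[OF f(1) that] by simp
  have "diff Y n (f n x) = f (n + 1) (diff X n x)" if x: "x \<in> el X n" for n x
  proof (rule inj_onD[OF d'(9)])
    have dx: "diff X n x \<in> el X (n + 1)" by (rule mod_homD(1)[OF d(12) x])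
    show "diff Y n (f n x) \<in> el Y (n + 1)" by (rule mod_homD(1)[OF d'(12) fc[OF x]])
    show "f (n + 1) (diff X n x) \<in> el Y (n + 1)" by (rule fc[OF dx])
    have "\<chi> (n + 1) (diff Y n (f n x)) = app (df U * F) (\<phi> n x)" using d'(7)[OF fc[OF x]] f(2)[OF x] by simp
    also have "\<dots> = app F (\<phi> (n + 1) (diff X n x))" unfolding homD(3)[OF F] using d(7)[OF x] by simp
    also have "\<dots> = \<chi> (n + 1) (f (n + 1) (diff X n x))" using f(2)[OF dx] by simp
    finally show "\<chi> (n + 1) (diff Y n (f n x)) = \<chi> (n + 1) (f (n + 1) (diff X n x))" .
  qed
  then have "f \<in> cochain_maps R X Y" unfolding cochain_maps_def using f(1) by simp
  moreover have "rep X \<phi> \<chi> f F" unfolding rep_def using f(2) by simp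
  ultimately show ?thesis by blast
qed

lemma homotopy_iff_null:
  assumes m: "model X T \<phi>" and m': "model Y U \<chi>" and f: "f \<in> cochain_maps R X Y" "g \<in> cochain_maps R X Y"
    and F: "hom T U F" "rep X \<phi> \<chi> f F" and G: "hom T U G" "rep X \<phi> \<chi> g G"
  shows "(f, g) \<in> homotopy_rel R X Y \<longleftrightarrow> null T U (F - G)"
proof -
  note d = modelD[OF m] and d' = modelD[OF m']
  have fc: "f n x \<in> el Y n" "g n x \<in> el Y n" if "x \<in> el X n" for n x
  proof -
    have "f n \<in> mod_hom R (Ob X n) (Ob Y n)" "g n \<in> mod_hom R (Ob X n) (Ob Y n)"
      using f unfolding cochain_maps_def by simp_all
    then show "f n x \<in> el Y n" "g n x \<in> el Y n" using mod_homD(1)[OF _ that] by auto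
  qed
  have FG: "app (F - G) (\<phi> n x) = \<chi> n (f n x \<ominus>\<^bsub>Ob Y n\<^esub> g n x)" if x: "x \<in> el X n" for n x
    using F(2) G(2) x model_minus(1)[OF m' fc[OF x]] unfolding rep_def by simp
  have dY: "\<chi> n (diff Y (n - 1) y) = app (df U) (\<chi> (n - 1) y)" "diff Y (n - 1) y \<in> el Y n"
    if "y \<in> el Y (n - 1)" for n y
    using d'(7)[OF that] mod_homD(1)[OF d'(12) that] by simp_all
  show ?thesis
  proof
    assume "(f, g) \<in> homotopy_rel R X Y"
    then obtain s where s: "\<And>n. s n \<in> mod_hom R (Ob X n) (Ob Y (n - 1))"
      "\<And>n x. x \<in> el X n ==>
         f n x \<ominus>\<^bsub>Ob Y n\<^esub> g n x = diff Y (n - 1) (s n x) \<oplus>\<^bsub>Ob Y n\<^esub> s (n + 1) (diff X n x)"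
      unfolding homotopy_rel_def by blast
    have s': "s n \<in> mod_hom R (Ob X n) (Ob Y (n + - 1))" for n using s(1)[of n] by simp
    obtain S where S: "dg (- 1) S" "S * pj T = S" "pj U * S = S"
      "\<And>n x. x \<in> el X n ==> app S (\<phi> n x) = \<chi> (n + - 1) (s n x)" using fam_to_lin[OF m m' s'] by metis
    have "F - G = df U * S + S * df T"
    proof (rule model_eqI[OF m])
      show "(F - G) * pj T = F - G" using homD(1)[OF F(1)] homD(1)[OF G(1)] by (simp add: left_diff_distrib)
      show "(df U * S + S * df T) * pj T = df U * S + S * df T"
        by (simp add: distrib_right mult.assoc S(2) okD(5)[OF d(2)])
      fix n x assume x: "x \<in> el X n"
      have dx: "diff X n x \<in> el X (n + 1)" by (rule mod_homD(1)[OF d(12) x])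
      have sx: "s n x \<in> el Y (n - 1)" "s (n + 1) (diff X n x) \<in> el Y n"
        using mod_homD(1)[OF s(1) x] mod_homD(1)[OF s(1) dx] by simp_all
      have "\<chi> n (f n x \<ominus>\<^bsub>Ob Y n\<^esub> g n x) = app (df U) (\<chi> (n - 1) (s n x)) + \<chi> n (s (n + 1) (diff X n x))"
        unfolding s(2)[OF x] using d'(5)[OF dY(2)[OF sx(1)] sx(2)] dY(1)[OF sx(1)] by simp
      also have "\<dots> = app (df U * S + S * df T) (\<phi> n x)" using S(4)[OF x] S(4)[OF dx] d(7)[OF x] by simp
      finally show "app (F - G) (\<phi> n x) = app (df U * S + S * df T) (\<phi> n x)" using FG[OF x] by simp
    qed
    then show "null T U (F - G)" unfolding null_def using S by blast
  next
    assume "null T U (F - G)"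
    then obtain S where S: "S * pj T = S" "pj U * S = S" "dg (- 1) S" "F - G = df U * S + S * df T"
      unfolding null_def by blast
    obtain s where s: "\<And>n. s n \<in> mod_hom R (Ob X n) (Ob Y (n + - 1))"
      "\<And>n x. x \<in> el X n ==> \<chi> (n + - 1) (s n x) = app S (\<phi> n x)"
      using lin_to_fam[OF m m' S(3,2)] by metis
    have "f n x \<ominus>\<^bsub>Ob Y n\<^esub> g n x = diff Y (n - 1) (s n x) \<oplus>\<^bsub>Ob Y n\<^esub> s (n + 1) (diff X n x)"
      if x: "x \<in> el X n" for n x
    proof (rule inj_onD[OF d'(9)])
      interpret M: right_module R "Ob Y n" by (rule d')
      have dx: "diff X n x \<in> el X (n + 1)" by (rule mod_homD(1)[OF d(12) x])
      have sx: "s n x \<in> el Y (n - 1)" "s (n + 1) (diff X n x) \<in> el Y n"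
        using mod_homD(1)[OF s(1) x] mod_homD(1)[OF s(1) dx] by simp_all
      show "f n x \<ominus>\<^bsub>Ob Y n\<^esub> g n x \<in> el Y n"
        "diff Y (n - 1) (s n x) \<oplus>\<^bsub>Ob Y n\<^esub> s (n + 1) (diff X n x) \<in> el Y n"
        using fc[OF x] dY(2)[OF sx(1)] sx(2) by simp_all
      have "app (F - G) (\<phi> n x) = app (df U) (\<chi> (n - 1) (s n x)) + \<chi> n (s (n + 1) (diff X n x))"
        unfolding S(4) using s(2)[OF x] s(2)[OF dx] d(7)[OF x] by simp
      also have "\<dots> = \<chi> n (diff Y (n - 1) (s n x) \<oplus>\<^bsub>Ob Y n\<^esub> s (n + 1) (diff X n x))"
        using d'(5)[OF dY(2)[OF sx(1)] sx(2)] dY(1)[OF sx(1)] by simp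
      finally show "\<chi> n (f n x \<ominus>\<^bsub>Ob Y n\<^esub> g n x) = \<chi> n (diff Y (n - 1) (s n x) \<oplus>\<^bsub>Ob Y n\<^esub> s (n + 1) (diff X n x))"
        using FG[OF x] by simp
    qed
    then show "(f, g) \<in> homotopy_rel R X Y"
      unfolding homotopy_rel_def using f s(1) by auto
  qed
qed

end

section \<open>Total acyclicity in the matrix model\<close>

context ring_setting
begin

text \<open>The elements of each term form the basis in that degree. A splitting
  \<open>\<sigma> n\<close> composed with the evaluation is an idempotent whose image is a copy of
  the term, and the differential is transported to it.\<close>

lemma KProj_model:
  assumes X: "X \<in> KProj elts R"
  shows "\<exists>T \<phi>. model X T \<phi>"
proof -
  let ?M = "\<lambda>n. Ob X n"
  let ?B = "\<lambda>n. {n} \<times> carrier (?M n)"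
  have cX: "is_complex R X" and pX: "projective elts R (?M n)" for n using X unfolding KProj_def by auto
  have rM: "right_module R (?M n)" and dX: "diff X n \<in> mod_hom R (?M n) (?M (n + 1))"
    and ddX: "x \<in> carrier (?M n) ==> diff X (n + 1) (diff X n x) = \<zero>\<^bsub>?M (n + 1 + 1)\<^esub>" for n x
    using cX unfolding is_complex_def by auto
  have sM: "sml (carrier (?M n))" for n using pX[of n] unfolding projective_def Modules_def by blast
  have "\<forall>n. \<exists>\<sigma>. \<sigma> \<in> mod_hom R (?M n) (Vmod (vs (?B n))) \<and> (\<forall>x\<in>carrier (?M n). ev (?M n) (\<sigma> x) = x)"
    using projective_split[OF pX] by blast
  then obtain \<sigma> where \<sigma>: "\<And>n. \<sigma> n \<in> mod_hom R (?M n) (Vmod (vs (?B n)))"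
    "\<And>n x. x \<in> carrier (?M n) ==> ev (?M n) (\<sigma> n x) = x" by metis
  have \<sigma>c: "\<sigma> n x \<in> vs (?B n)" if "x \<in> carrier (?M n)" for n x using mod_homD(1)[OF \<sigma>(1) that] by simp
  have \<sigma>z: "\<sigma> n \<zero>\<^bsub>?M n\<^esub> = 0" for n
  proof -
    interpret M: right_module R "?M n" by (rule rM)
    show ?thesis using mod_homD(2)[OF \<sigma>(1), of "\<zero>\<^bsub>?M n\<^esub>" n "\<zero>\<^bsub>?M n\<^esub>"] by simp
  qed
  have lin: "app (Lin (\<lambda>x. u (ev (?M n) x)) * pr (?B n)) x = u (ev (?M n) (app (pr (?B n)) x))"
    if u: "u \<in> mod_hom R (?M n) (Vmod (vs (?B m)))" for u n m x
  proof -
    have "app (Lin (\<lambda>x. u (ev (?M n) x))) = (\<lambda>x. u (ev (?M n) x))"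
    proof (rule app_Lin)
      show "u (ev (?M n) (x + y)) = u (ev (?M n) x) + u (ev (?M n) y)" for x y
        using mod_homD(2)[OF u] ev(1,2)[OF rM] by simp
      show "u (ev (?M n) (rscale x a)) = rscale (u (ev (?M n) x)) a" for x a
      proof -
        have "u (ev (?M n) x) \<in> vs (?B m)" using mod_homD(1)[OF u ev(1)[OF rM]] by simp
        then have "rscale (u (ev (?M n) x)) ee = u (ev (?M n) x)" unfolding vs_iff by blast
        then have "rscale (u (ev (?M n) x)) a = rscale (u (ev (?M n) x)) (emb R (val R a))" by (rule rscale_val)
        then show ?thesis using mod_homD(3)[OF u val_simps(1) ev(1)[OF rM]] ev(3)[OF rM] by simp
      qed
    qed
    then show ?thesis by simp
  qed
  \<comment> \<open>The factor \<open>pr (?B n)\<close> selects the labels of degree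
    \<open>n\<close>; the evaluation alone would accept them in every degree.\<close>
  define A where "A n = Lin (\<lambda>x. \<sigma> n (ev (?M n) x)) * pr (?B n)" for n
  define D where "D n = Lin (\<lambda>x. \<sigma> (n + 1) (diff X n (ev (?M n) x))) * pr (?B n)" for n
  have d\<sigma>: "(\<lambda>x. \<sigma> (n + 1) (diff X n x)) \<in> mod_hom R (?M n) (Vmod (vs (?B (n + 1))))" for n
    by (rule mod_hom_comp[OF dX \<sigma>(1)])
  let ?w = "\<lambda>n x. ev (?M n) (app (pr (?B n)) x)"
  have appA: "app (A n) x = \<sigma> n (?w n x)" for n x unfolding A_def by (rule lin[OF \<sigma>(1)])
  have appD: "app (D n) x = \<sigma> (n + 1) (diff X n (?w n x))" for n x unfolding D_def by (rule lin[OF d\<sigma>])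
  have wc: "?w n x \<in> carrier (?M n)" for n x by (rule ev(1)[OF rM])
  have w\<sigma>: "?w n (\<sigma> n x) = x" if "x \<in> carrier (?M n)" for n x
    using \<sigma>c[OF that] \<sigma>(2)[OF that] unfolding vs_def by simp
  have dc: "diff X n x \<in> carrier (?M (n + 1))" if "x \<in> carrier (?M n)" for n x by (rule mod_homD(1)[OF dX that])
  have A\<sigma>: "app (A n) (\<sigma> n x) = \<sigma> n x" and D\<sigma>: "app (D n) (\<sigma> n x) = \<sigma> (n + 1) (diff X n x)"
    if "x \<in> carrier (?M n)" for n x
    unfolding appA appD w\<sigma>[OF that] by simp_all
  have "app (A n) (app (A n) x) = app (A n) x" "app (D n) (app (A n) x) = app (D n) x"
    "app (A (n + 1)) (app (D n) x) = app (D n) x" "app (D (n + 1)) (app (D n) x) = 0" for n x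
  proof -
    show "app (A n) (app (A n) x) = app (A n) x" unfolding appA[of n x] by (rule A\<sigma>[OF wc])
    show "app (D n) (app (A n) x) = app (D n) x" unfolding appA[of n x] appD[of n x] by (rule D\<sigma>[OF wc])
    show "app (A (n + 1)) (app (D n) x) = app (D n) x" unfolding appD[of n x] by (rule A\<sigma>[OF dc[OF wc]])
    show "app (D (n + 1)) (app (D n) x) = 0"
      unfolding appD[of n x] D\<sigma>[OF dc[OF wc]] ddX[OF wc] by (rule \<sigma>z)
  qed
  then have m: "A n * A n = A n" "D n * A n = D n" "A (n + 1) * D n = D n" "D (n + 1) * D n = 0" for n
    by (auto intro!: lin_eqI)
  have B: "A n * pr (?B n) = A n" "pr (?B n) * A n = A n" "D n * pr (?B n) = D n" "pr (?B (n + 1)) * D n = D n" for n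
  proof -
    show "A n * pr (?B n) = A n" "D n * pr (?B n) = D n" unfolding A_def D_def by (simp_all add: mult.assoc)
    show "pr (?B n) * A n = A n" unfolding pr_absorb_left appA using \<sigma>c[OF wc] by blast
    show "pr (?B (n + 1)) * D n = D n" unfolding pr_absorb_left appD using \<sigma>c[OF dc[OF wc]] by blast
  qed
  have Bl: "?B n \<subseteq> lev n" for n by auto
  have l: "A n * pr (lev n) = A n" "pr (lev n) * A n = A n" "D n * pr (lev n) = D n" "pr (lev (n + 1)) * D n = D n" for n
    using pr_mono_right[OF B(1) Bl] pr_mono_left[OF B(2) Bl] pr_mono_right[OF B(3) Bl] pr_mono_left[OF B(4) Bl] by auto
  let ?U = "\<Union>n. ?B n"
  have BU: "?B n \<subseteq> ?U" for n by blast
  define p where "p = glue UNIV lev A"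
  define d where "d = glue UNIV lev D"
  have pl: "p * pr (lev n) = A n" "d * pr (lev n) = D n" for n
    unfolding p_def d_def by (rule lev_glue, rule l)+
  have pd: "p * L = A n * L" "d * L = D n * L" if "pr (lev n) * L = L" for n L
  proof -
    have "p * (pr (lev n) * L) = A n * L" "d * (pr (lev n) * L) = D n * L" unfolding mult.assoc[symmetric] pl by simp_all
    then show "p * L = A n * L" "d * L = D n * L" unfolding that by simp_all
  qed
  have dgs: "dg 0 p" "dg 1 d"
    unfolding p_def d_def by (rule dg_glue, rule dg_single[OF l(1)], simp add: l, rule dg_glue, rule dg_single[OF l(3,4)])
  have e: "p * eps = p" "d * eps = d" unfolding p_def d_def glue_def by simp_all
  define T where "T = \<lparr>bs = ?U, pj = p, df = d\<rparr>"
  have T: "ok T" unfolding ok_def T_def dgm.select_convs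
  proof (intro conjI dgs)
    show "pr ?U * p = p" unfolding p_def by (rule glue_left_absorb[OF l(1) pr_mono_left[OF B(2) BU]])
    show "p * pr ?U = p" unfolding p_def by (rule glue_lev_absorb[OF l(1) pr_mono_right[OF B(1) BU]]) simp_all
    show "p * p = p"
      by (rule lev_eqI) (simp_all add: mult.assoc e pl pd(1)[OF l(2)] m)
    show "p * d = d"
      by (rule lev_eqI) (simp_all add: mult.assoc e pl pd(1)[OF l(4)] m)
    show "d * p = d"
      by (rule lev_eqI) (simp_all add: mult.assoc e pl pd(2)[OF l(2)] m)
    show "d * d = 0"
      by (rule lev_eqI) (simp_all add: mult.assoc e pl pd(2)[OF l(4)] m)
  qed
  have s: "sml (bs T)" unfolding T_def dgm.select_convs by (intro small_UN small_Times small_countable sM) simp_all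
  have \<sigma>V: "\<sigma> n x \<in> Vn T n" if x: "x \<in> carrier (?M n)" for n x
  proof -
    have v: "\<sigma> n x \<in> vs (lev n)" by (rule vs_mono[OF Bl \<sigma>c[OF x]])
    then have "app p (\<sigma> n x) = app (p * pr (lev n)) (\<sigma> n x)" unfolding vs_def by simp
    also have "\<dots> = \<sigma> n x" unfolding pl by (rule A\<sigma>[OF x])
    finally show ?thesis unfolding Vn_def T_def using v by simp
  qed
  have V\<sigma>: "v = \<sigma> n (?w n v)" if v: "v \<in> Vn T n" for n v
  proof -
    have "app p v = app (p * pr (lev n)) v" using v unfolding Vn_def vs_def by simp
    then show ?thesis using v unfolding pl appA unfolding Vn_def T_def by simp
  qed
  have bij: "bij_betw (\<sigma> n) (carrier (?M n)) (Vn T n)" for n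
    unfolding bij_betw_def
  proof
    show "inj_on (\<sigma> n) (carrier (?M n))" by (rule inj_on_inverseI[where g = "ev (?M n)"]) (rule \<sigma>(2))
    show "\<sigma> n ` carrier (?M n) = Vn T n"
    proof
      show "\<sigma> n ` carrier (?M n) \<subseteq> Vn T n" using \<sigma>V by blast
      show "Vn T n \<subseteq> \<sigma> n ` carrier (?M n)"
      proof
        fix v assume "v \<in> Vn T n"
        then show "v \<in> \<sigma> n ` carrier (?M n)" using V\<sigma> wc by (intro image_eqI[of _ _ "?w n v"]) auto
      qed
    qed
  qed
  have "siso X (icx T) \<sigma>"
    unfolding siso_def icx_def rmiso_def
  proof (intro allI conjI ballI)
    fix n
    show "\<sigma> n \<in> mod_hom R (Ob X n) (Ob \<lparr>Ob = \<lambda>n. Vmod (Vn T n), diff = \<lambda>n. app (df T)\<rparr> n)"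
      by (rule mod_homI) (use \<sigma>V mod_homD[OF \<sigma>(1)[of n]] in simp_all)
    show "bij_betw (\<sigma> n) (el X n) (carrier (Ob \<lparr>Ob = \<lambda>n. Vmod (Vn T n), diff = \<lambda>n. app (df T)\<rparr> n))"
      using bij by simp
    fix x assume x: "x \<in> carrier (?M n)"
    have "app d (\<sigma> n x) = app (d * pr (lev n)) (\<sigma> n x)" using vs_mono[OF Bl \<sigma>c[OF x]] unfolding vs_def by simp
    also have "\<dots> = \<sigma> (n + 1) (diff X n x)" unfolding pl by (rule D\<sigma>[OF x])
    finally show "diff \<lparr>Ob = \<lambda>n. Vmod (Vn T n), diff = \<lambda>n. app (df T)\<rparr> n (\<sigma> n x) = \<sigma> (n + 1) (diff X n x)"
      unfolding T_def by simp
  qed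
  then have "model X T \<sigma>" unfolding model_def using cX T s by blast
  then show ?thesis by blast
qed

text \<open>Acyclicity of matrices speaks of arbitrary vectors, acyclicity of complexes of
  homogeneous ones. A vector has finitely many homogeneous parts, which are bounded one at a
  time.\<close>

lemma levelwise_exact:
  assumes T: "ok T" and ex: "\<And>n v. v \<in> Vn T n ==> app (df T) v = 0 ==> \<exists>u. app (pj T) u = u \<and> v = app (df T) u"
    and A: "finite A"
  shows "x \<in> vs {i. fst i \<in> A} ==> app (pj T) x = x ==> app (df T) x = 0 ==> \<exists>y. app (pj T) y = y \<and> x = app (df T) y"
  using A
proof (induction A arbitrary: x rule: finite_induct)
  case empty
  then show ?case by (intro exI[of _ 0]) simp
next
  case (insert n A)
  have c: "pj T * pr (lev n) = pr (lev n) * pj T" "df T * pr (lev n) = pr (lev (n + 1)) * df T"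
    using dg_lev[OF okD(7)[OF T], of n] dg_lev[OF okD(8)[OF T], of n] by simp_all
  let ?v = "app (pr (lev n)) x"
  have pv: "app (pj T) ?v = ?v" using app_cong[OF c(1), of x] insert.prems(2) by simp
  have dv: "app (df T) ?v = 0" using app_cong[OF c(2), of x] insert.prems(3) by simp
  have xe: "rscale x ee = x" using insert.prems(1) unfolding vs_iff by blast
  have "x - ?v = app (pr (- lev n)) x" unfolding pr_Compl using xe by simp
  also have "\<dots> = app (pr (- lev n)) (app (pr {i. fst i \<in> insert n A}) x)" using insert.prems(1) unfolding vs_def by simp
  also have "\<dots> = app (pr (- lev n \<inter> {i. fst i \<in> insert n A})) x" by (rule app_pr_pr)
  finally have "x - ?v \<in> vs (- lev n \<inter> {i. fst i \<in> insert n A})" by simp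
  then have x': "x - ?v \<in> vs {i. fst i \<in> A}" by (rule vs_mono[rotated]) auto
  have "\<exists>y. app (pj T) y = y \<and> x - ?v = app (df T) y"
    by (rule insert.IH[OF x']) (simp_all add: insert.prems pv dv)
  then obtain y where y: "app (pj T) y = y" "x - ?v = app (df T) y" by blast
  have "?v \<in> Vn T n" unfolding Vn_def using pv by simp
  from ex[OF this dv] obtain u where u: "app (pj T) u = u" "?v = app (df T) u" by blast
  have "x = app (df T) (y + u)" using y(2) unfolding app_add u(2)[symmetric] by (simp add: algebra_simps)
  then show ?case using y(1) u(1) by (intro exI[of _ "y + u"]) simp
qed

lemma TA_if_totally_acyclic:
  fixes X :: "('r, 'v) cochain"
  assumes m: "model X T \<phi>" and X: "totally_acyclic elts R X" shows "TA T"
  unfolding TA_def'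
proof (intro conjI allI impI)
  note d = modelD[OF m]
  have ac: "acyclic_complex X" and ha: "\<And>P. projective elts R P ==> Hom_acyclic R X P"
    using X unfolding totally_acyclic_def by auto
  have dc: "diff X n x \<in> el X (n + 1)" if "x \<in> el X n" for n x by (rule mod_homD(1)[OF d(12) that])
  note phz = model_zero[OF m]
  {
    fix n v assume v: "v \<in> Vn T n" "app (df T) v = 0"
    obtain x where x: "x \<in> el X n" "\<phi> n x = v" using d(8)[OF v(1)] by blast
    have "diff X n x = \<zero>\<^bsub>Ob X (n + 1)\<^esub>"
    proof (rule inj_onD[OF d(9)])
      interpret M: right_module R "Ob X (n + 1)" by (rule d)
      show "\<phi> (n + 1) (diff X n x) = \<phi> (n + 1) \<zero>\<^bsub>Ob X (n + 1)\<^esub>" using d(7)[OF x(1)] x(2) v(2) phz by simp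
      show "\<zero>\<^bsub>Ob X (n + 1)\<^esub> \<in> el X (n + 1)" by simp
    qed (rule dc[OF x(1)])
    moreover have "{x \<in> el X (n - 1 + 1). diff X (n - 1 + 1) x = \<zero>\<^bsub>Ob X (n - 1 + 1 + 1)\<^esub>}
        = diff X (n - 1) ` el X (n - 1)" using ac unfolding acyclic_complex_def by (rule spec)
    then have "{x \<in> el X n. diff X n x = \<zero>\<^bsub>Ob X (n + 1)\<^esub>} = diff X (n - 1) ` el X (n - 1)" by simp
    ultimately have "x \<in> diff X (n - 1) ` el X (n - 1)" using x(1) by blast
    then obtain y where y: "y \<in> el X (n - 1)" "x = diff X (n - 1) y" by blast
    have "app (pj T) (\<phi> (n - 1) y) = \<phi> (n - 1) y" using d(4)[OF y(1)] unfolding Vn_def by simp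
    moreover have "v = app (df T) (\<phi> (n - 1) y)" using d(7)[OF y(1)] x(2) y(2) by simp
    ultimately have "\<exists>u. app (pj T) u = u \<and> v = app (df T) u" by blast
  } note ex = this
  show "\<exists>y. app (pj T) y = y \<and> x = app (df T) y" if x: "app (pj T) x = x \<and> app (df T) x = 0" for x
  proof (rule levelwise_exact[OF d(2) ex])
    show "finite (fst ` keys x)" by simp
    have "rscale x ee = x" using app_okr(5)[OF d(2), of x] x unfolding vs_iff by simp
    then show "x \<in> vs {i. fst i \<in> fst ` keys x}" unfolding vs_iff by auto
  qed (use x in auto)
  show "\<exists>g. g * pj T = g \<and> f = g * df T" if f: "f * pj T = f \<and> f * df T = 0" for f
  proof -
    have fx: "app f x = app f (app (pj T) x)" for x using app_cong[OF conjunct1[OF f], of x] by simp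
    have f0: "app f (app (df T) x) = 0" for x using app_cong[OF conjunct2[OF f], of x] by simp
    have "f * pj T * eps = f * pj T" by (simp add: mult.assoc okD(11)[OF d(2)])
    then have fe: "rscale (app f x) ee = app f x" for x
      using f app_cong[OF eps_central[of f], of x] by (metis app_eps app_lin_simps(5))
    \<comment> \<open>The values of \<open>f\<close> are supported on a small set, so
      \<open>f\<close> can be read as a map to a small free module, and this has a projective copy
      on \<open>'v\<close>.\<close>
    define K where "K = (\<Union>y\<in>app f ` vs (bs T). keys y)"
    have "sml K" unfolding K_def
      by (intro small_UN small_image small_vs d(3) small_countable) (simp add: countable_finite)
    then obtain P :: "('r, 'v) module" and c where P: "projective elts R P" "rmiso R (Vmod (vs K)) P c"
      using projective_free by blast
    note rV = right_module_vs
    have rP: "right_module R P" using P(1) unfolding projective_def Modules_def by blast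
    have c: "c \<in> mod_hom R (Vmod (vs K)) P" using P(2) unfolding rmiso_def by blast
    let ?c' = "inv_into (vs K) c"
    have c': "?c' \<in> mod_hom R P (Vmod (vs K))" using rmiso_inv[OF P(2) rV] unfolding rmiso_def by simp
    have cc: "?c' (c v) = v" if "v \<in> vs K" for v using P(2) that unfolding rmiso_def bij_betw_def by simp
    have fK: "app f x \<in> vs K" for x
    proof -
      have "app f x \<in> app f ` vs (bs T)" unfolding fx[of x] using app_okr(5)[OF d(2)] by blast
      then show ?thesis unfolding vs_iff K_def using fe by blast
    qed
    \<comment> \<open>Exactness of Hom is available degree by degree, and the solutions are glued
      afterwards. The index \<open>n - 2\<close> matches the form in which
      \<open>Hom_acyclic\<close> is stated, with the middle term at the second of three
      degrees.\<close>
    have "\<exists>L. L * pj T = L \<and> L * pr (lev n) = L \<and>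
      (\<forall>x\<in>el X (n - 1). app L (\<phi> n (diff X (n - 1) x)) = app f (\<phi> (n - 1) x))" for n
    proof -
      have af: "app f \<in> mod_hom R (Vmod (Vn T n)) (Vmod (vs K))" for n by (rule mod_homI) (simp_all add: fK)
      let ?h = "\<lambda>x. c (app f (\<phi> (n - 1) x))"
      have h: "?h \<in> mod_hom R (Ob X (n - 2 + 1)) P"
        using mod_hom_comp[OF mod_hom_comp[OF d(10) af] c] by simp
      have "\<forall>x\<in>el X (n - 2). ?h (diff X (n - 2) x) = \<zero>\<^bsub>P\<^esub>"
      proof
        fix x assume x: "x \<in> el X (n - 2)"
        have "?h (diff X (n - 2) x) = c 0" using d(7)[OF x] f0[of "\<phi> (n - 2) x"] by simp
        then show "?h (diff X (n - 2) x) = \<zero>\<^bsub>P\<^esub>" using mod_hom_zero[OF c rV rP] by simp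
      qed
      then have "\<exists>g\<in>mod_hom R (Ob X (n - 2 + 1 + 1)) P. \<forall>x\<in>el X (n - 2 + 1). ?h x = g (diff X (n - 2 + 1) x)"
        by (rule iffD1[OF bspec[OF spec[OF ha[OF P(1), unfolded Hom_acyclic_def]] h]])
      then obtain g where g: "g \<in> mod_hom R (Ob X n) P" "\<forall>x\<in>el X (n - 1). ?h x = g (diff X (n - 1) x)" by auto
      let ?u = "\<lambda>x. ?c' (g x)"
      have u: "?u \<in> mod_hom R (Ob X n) (Vmod (vs K))" by (rule mod_hom_comp[OF g(1) c'])
      have "\<exists>L. L * pj T = L \<and> L * pr (lev n) = L \<and> (\<forall>x\<in>el X n. app L (\<phi> n x) = ?u x) \<and>
        (\<forall>y. \<exists>x\<in>el X n. app L y = ?u x)"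
      proof (rule lin_of[OF m])
        show "rscale (?u x) ee = ?u x" if "x \<in> el X n" for x
          using mod_homD(1)[OF u that] unfolding Vmod_simps vs_iff by blast
      qed (use mod_homD[OF u] in simp_all)
      then obtain L where L: "L * pj T = L" "L * pr (lev n) = L" "\<And>x. x \<in> el X n ==> app L (\<phi> n x) = ?u x" by blast
      have "app L (\<phi> n (diff X (n - 1) x)) = app f (\<phi> (n - 1) x)" if x: "x \<in> el X (n - 1)" for x
      proof -
        have "diff X (n - 1) x \<in> el X n" using dc[OF x] by simp
        then have "app L (\<phi> n (diff X (n - 1) x)) = ?c' (?h x)" using L(3) bspec[OF g(2) x] by simp
        then show ?thesis using cc[OF fK] by simp
      qed
      then show ?thesis using L(1,2) by blast
    qed
    then obtain L where L: "\<And>n. L n * pj T = L n" "\<And>n. L n * pr (lev n) = L n"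
      "\<And>n x. x \<in> el X (n - 1) ==> app (L n) (\<phi> n (diff X (n - 1) x)) = app f (\<phi> (n - 1) x)" by metis
    let ?G = "glue UNIV lev L"
    have G: "?G * pj T = ?G" by (rule glue_lev_absorb[of L, OF L(2,1) okD(7,11)[OF d(2)]])
    have "f = ?G * df T"
    proof (rule model_eqI[OF m])
      show "f * pj T = f" using f by blast
      show "?G * df T * pj T = ?G * df T" by (simp add: mult.assoc okD(5)[OF d(2)])
      fix n x assume x: "x \<in> el X n"
      have "app ?G (\<phi> (n + 1) (diff X n x)) = app (?G * pr (lev (n + 1))) (\<phi> (n + 1) (diff X n x))"
        using d(4)[OF dc[OF x]] unfolding Vn_def vs_def by simp
      also have "\<dots> = app (L (n + 1)) (\<phi> (n + 1) (diff X n x))" unfolding lev_glue[of L, OF L(2)] ..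
      also have "\<dots> = app f (\<phi> n x)" using L(3)[of x "n + 1"] x by simp
      finally show "app f (\<phi> n x) = app (?G * df T) (\<phi> n x)" using d(7)[OF x] by simp
    qed
    then show ?thesis using G by blast
  qed
qed

text \<open>For the condition on Hom, a projective \<open>P\<close> is treated as a retract of a
  free module: a map to \<open>P\<close> is composed with the splitting, solved with free values,
  and evaluated back.\<close>

lemma totally_acyclic_if_TA:
  fixes X :: "('r, 'v) cochain"
  assumes m: "model X T \<phi>" and t: "TA T" shows "totally_acyclic elts R X"
  unfolding totally_acyclic_def
proof (intro conjI allI impI)
  note d = modelD[OF m] and t1 = conjunct1[OF t[unfolded TA_def'], rule_format]
    and t2 = conjunct2[OF t[unfolded TA_def'], rule_format]
  have dc: "diff X n x \<in> el X (n + 1)" if "x \<in> el X n" for n x by (rule mod_homD(1)[OF d(12) that])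
  show cX: "is_complex R X" by (rule d)
  show "projective elts R (Ob X n)" for n using model_KProj(1)[OF m] unfolding KProj_def by blast
  have dd: "diff X (n + 1) (diff X n x) = \<zero>\<^bsub>Ob X (n + 1 + 1)\<^esub>" if "x \<in> el X n" for n x
    using cX that unfolding is_complex_def by blast
  note phz = model_zero[OF m]
  have "\<exists>z\<in>el X n. x = diff X n z" if x: "x \<in> el X (n + 1)" "diff X (n + 1) x = \<zero>\<^bsub>Ob X (n + 1 + 1)\<^esub>" for n x
  proof -
    have "app (pj T) (\<phi> (n + 1) x) = \<phi> (n + 1) x" using d(4)[OF x(1)] unfolding Vn_def by simp
    moreover have "app (df T) (\<phi> (n + 1) x) = 0" using d(7)[OF x(1)] x(2) phz by simp
    ultimately obtain y where y: "app (pj T) y = y" "\<phi> (n + 1) x = app (df T) y" using t1 by blast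
    have "app (pr (lev n)) y \<in> Vn T n" using Vn_pr[OF d(2), of n y] y(1) by simp
    then obtain z where z: "z \<in> el X n" "\<phi> n z = app (pr (lev n)) y" using d(8) by blast
    have "\<phi> (n + 1) (diff X n z) = app (df T * pr (lev n)) y" using d(7)[OF z(1)] z(2) by simp
    also have "\<dots> = app (pr (lev (n + 1))) (\<phi> (n + 1) x)" unfolding dg_lev[OF okD(8)[OF d(2)]] y(2) by simp
    also have "\<dots> = \<phi> (n + 1) x" using d(4)[OF x(1)] unfolding Vn_def vs_def by simp
    finally have "x = diff X n z" using d(9) x(1) dc[OF z(1)] unfolding inj_on_def by metis
    then show ?thesis using z(1) by blast
  qed
  then show "acyclic_complex X" unfolding acyclic_complex_def using dc dd by auto
  fix P :: "('r, 'v) module" assume P: "projective elts R P"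
  then have rP: "right_module R P" unfolding projective_def Modules_def by blast
  show "Hom_acyclic R X P" unfolding Hom_acyclic_def
  proof (intro allI ballI iffI)
    fix n f assume f: "f \<in> mod_hom R (Ob X (n + 1)) P"
    {
      assume "\<exists>g\<in>mod_hom R (Ob X (n + 1 + 1)) P. \<forall>x\<in>el X (n + 1). f x = g (diff X (n + 1) x)"
      then obtain g where g: "g \<in> mod_hom R (Ob X (n + 1 + 1)) P" "\<forall>x\<in>el X (n + 1). f x = g (diff X (n + 1) x)" by blast
      fix x assume x: "x \<in> el X n"
      show "f (diff X n x) = \<zero>\<^bsub>P\<^esub>" using bspec[OF g(2) dc[OF x]] dd[OF x] mod_hom_zero[OF g(1) d(11) rP] by simp
    }
    assume f0: "\<forall>x\<in>el X n. f (diff X n x) = \<zero>\<^bsub>P\<^esub>"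
    obtain \<sigma> where \<sigma>: "\<sigma> \<in> mod_hom R P (Vmod (vs ({0} \<times> carrier P)))" "\<forall>x\<in>carrier P. ev P (\<sigma> x) = x"
      using projective_split[OF P] by blast
    let ?h = "\<lambda>x. \<sigma> (f x)"
    have h: "?h \<in> mod_hom R (Ob X (n + 1)) (Vmod (vs ({0} \<times> carrier P)))" by (rule mod_hom_comp[OF f \<sigma>(1)])
    note rV = right_module_vs
    have "\<exists>L. L * pj T = L \<and> L * pr (lev (n + 1)) = L \<and> (\<forall>x\<in>el X (n + 1). app L (\<phi> (n + 1) x) = ?h x) \<and>
      (\<forall>y. \<exists>x\<in>el X (n + 1). app L y = ?h x)"
    proof (rule lin_of[OF m])
      show "rscale (?h x) ee = ?h x" if "x \<in> el X (n + 1)" for x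
        using mod_homD(1)[OF h that] unfolding Vmod_simps vs_iff by blast
    qed (use mod_homD[OF h] in simp_all)
    then obtain L where L: "L * pj T = L" "L * pr (lev (n + 1)) = L"
      "\<And>x. x \<in> el X (n + 1) ==> app L (\<phi> (n + 1) x) = ?h x" by blast
    have "L * df T = 0"
    proof (rule model_eqI[OF m])
      show "L * df T * pj T = L * df T" by (simp add: mult.assoc okD(5)[OF d(2)])
      fix k x assume x: "x \<in> el X k"
      have "app L (\<phi> (k + 1) (diff X k x)) = 0"
      proof (cases "k = n")
        case True
        have "?h (diff X n x) = 0" using bspec[OF f0] x True mod_hom_zero[OF \<sigma>(1) rP rV] by simp
        then show ?thesis using L(3)[of "diff X n x"] dc[OF x] True by simp
      next
        case False
        have "app L (\<phi> (k + 1) (diff X k x)) = app (L * pr (lev (n + 1))) (app (pr (lev (k + 1))) (\<phi> (k + 1) (diff X k x)))"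
          unfolding L(2) using d(4)[OF dc[OF x]] unfolding Vn_def vs_def by simp
        also have "\<dots> = app (L * pr (lev (n + 1) \<inter> lev (k + 1))) (\<phi> (k + 1) (diff X k x))" by simp
        also have "lev (n + 1) \<inter> lev (k + 1) = {}" using False by auto
        finally show ?thesis by simp
      qed
      then show "app (L * df T) (\<phi> k x) = app 0 (\<phi> k x)" using d(7)[OF x] by simp
    qed simp
    then obtain G where G: "G * pj T = G" "L = G * df T" using t2 L(1) by blast
    let ?g = "\<lambda>y. ev P (app G (\<phi> (n + 1 + 1) y))"
    have gh: "?g \<in> mod_hom R (Ob X (n + 1 + 1)) P"
      by (rule mod_homI) (use ev[OF rP] mod_homD[OF d(10)[of "n + 1 + 1"]] in simp_all)
    have gf: "f x = ?g (diff X (n + 1) x)" if x: "x \<in> el X (n + 1)" for x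
    proof -
      have "?g (diff X (n + 1) x) = ev P (app L (\<phi> (n + 1) x))" unfolding G(2) using d(7)[OF x] by simp
      also have "\<dots> = f x" using L(3)[OF x] \<sigma>(2) mod_homD(1)[OF f x] by simp
      finally show ?thesis ..
    qed
    show "\<exists>g\<in>mod_hom R (Ob X (n + 1 + 1)) P. \<forall>x\<in>el X (n + 1). f x = g (diff X (n + 1) x)"
      by (rule bexI[OF _ gh]) (rule ballI, rule gf)
  qed
qed

end

section \<open>Homotopy classes and cones\<close>

lemma smult_zero:
  assumes "right_module R M" "a \<in> carrier R" shows "a \<odot>\<^bsub>M\<^esub> \<zero>\<^bsub>M\<^esub> = \<zero>\<^bsub>M\<^esub>"
proof -
  interpret M: right_module R M by fact
  have "a \<odot>\<^bsub>M\<^esub> \<zero>\<^bsub>M\<^esub> \<oplus>\<^bsub>M\<^esub> a \<odot>\<^bsub>M\<^esub> \<zero>\<^bsub>M\<^esub> = a \<odot>\<^bsub>M\<^esub> \<zero>\<^bsub>M\<^esub>"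
    using M.smult_add_vector[OF assms(2) M.M.zero_closed M.M.zero_closed] by simp
  then show ?thesis using M.smult_closed[OF assms(2) M.M.zero_closed] M.M.add.l_cancel_one' by auto
qed

lemma mod_hom_add:
  assumes "f \<in> mod_hom R M N" "g \<in> mod_hom R M N" "right_module R N"
  shows "(\<lambda>x. f x \<oplus>\<^bsub>N\<^esub> g x) \<in> mod_hom R M N"
proof -
  interpret N: right_module R N by fact
  note f = mod_homD[OF assms(1)] and g = mod_homD[OF assms(2)]
  show ?thesis
    by (rule mod_homI) (simp_all add: f g N.M.a_ac N.smult_add_vector)
qed

lemma mod_hom_neg:
  assumes "f \<in> mod_hom R M N" "right_module R N"
  shows "(\<lambda>x. \<ominus>\<^bsub>N\<^esub> f x) \<in> mod_hom R M N"
proof -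
  interpret N: right_module R N by fact
  note f = mod_homD[OF assms(1)]
  have "(\<lambda>x. a \<odot>\<^bsub>N\<^esub> x) (\<ominus>\<^bsub>N\<^esub> y) = \<ominus>\<^bsub>N\<^esub> (a \<odot>\<^bsub>N\<^esub> y)" if a: "a \<in> carrier R" and y: "y \<in> carrier N" for a y
  proof -
    note z = smult_zero[OF assms(2) a]
    have "a \<odot>\<^bsub>N\<^esub> (\<ominus>\<^bsub>N\<^esub> y) \<oplus>\<^bsub>N\<^esub> a \<odot>\<^bsub>N\<^esub> y = \<zero>\<^bsub>N\<^esub>"
      using N.smult_add_vector[OF a, of "\<ominus>\<^bsub>N\<^esub> y" y] y z by (simp add: N.M.l_neg)
    then show ?thesis using N.smult_closed[OF a] y N.M.minus_equality by simp
  qed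
  then show ?thesis
    by (intro mod_homI) (simp_all add: f N.M.minus_add)
qed

lemma is_complexD:
  assumes "is_complex R X"
  shows "right_module R (Ob X n)" "diff X n \<in> mod_hom R (Ob X n) (Ob X (n + 1))"
    "x \<in> el X n ==> diff X n x \<in> el X (n + 1)"
    "x \<in> el X n ==> diff X (n + 1) (diff X n x) = \<zero>\<^bsub>Ob X (n + 1 + 1)\<^esub>"
proof -
  show *: "right_module R (Ob X n)" "diff X n \<in> mod_hom R (Ob X n) (Ob X (n + 1))"
    "x \<in> el X n ==> diff X (n + 1) (diff X n x) = \<zero>\<^bsub>Ob X (n + 1 + 1)\<^esub>"
    using assms unfolding is_complex_def by auto
  show "x \<in> el X n ==> diff X n x \<in> el X (n + 1)" by (rule mod_homD(1)[OF *(2)])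
qed

lemma cochain_mapsD:
  assumes "f \<in> cochain_maps R X Y"
  shows "f n \<in> mod_hom R (Ob X n) (Ob Y n)" "x \<in> el X n ==> diff Y n (f n x) = f (n + 1) (diff X n x)"
    "x \<in> el X n ==> f n x \<in> el Y n"
proof -
  show *: "f n \<in> mod_hom R (Ob X n) (Ob Y n)" using assms unfolding cochain_maps_def by simp
  show "x \<in> el X n ==> diff Y n (f n x) = f (n + 1) (diff X n x)" using assms unfolding cochain_maps_def by simp
  show "x \<in> el X n ==> f n x \<in> el Y n" by (rule mod_homD(1)[OF *])
qed

lemma cochain_mapsI:
  "(\<And>n. f n \<in> mod_hom R (Ob X n) (Ob Y n)) ==>
   (\<And>n x. x \<in> el X n ==> diff Y n (f n x) = f (n + 1) (diff X n x)) ==> f \<in> cochain_maps R X Y"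
  unfolding cochain_maps_def by simp

lemma cochain_maps_comp:
  assumes f: "f \<in> cochain_maps R X Y" and g: "g \<in> cochain_maps R Y Z"
  shows "(\<lambda>n x. g n (f n x)) \<in> cochain_maps R X Z"
proof (rule cochain_mapsI)
  show "(\<lambda>x. g n (f n x)) \<in> mod_hom R (Ob X n) (Ob Z n)" for n
    by (rule mod_hom_comp[OF cochain_mapsD(1)[OF f] cochain_mapsD(1)[OF g]])
qed (simp add: cochain_mapsD[OF f] cochain_mapsD[OF g])

lemma cochain_maps_id: "(\<lambda>n x. x) \<in> cochain_maps R X X"
  by (rule cochain_mapsI) (auto intro!: mod_homI)

section \<open>Homotopy as an equivalence relation compatible with composition\<close>

definition homotopy where
  "homotopy R X Y f g s \<longleftrightarrow> (\<forall>n. s n \<in> mod_hom R (Ob X n) (Ob Y (n - 1)) \<and>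
     (\<forall>x\<in>el X n. f n x \<ominus>\<^bsub>Ob Y n\<^esub> g n x = diff Y (n - 1) (s n x) \<oplus>\<^bsub>Ob Y n\<^esub> s (n + 1) (diff X n x)))"

lemma homotopy_rel_iff:
  "(f, g) \<in> homotopy_rel R X Y \<longleftrightarrow> f \<in> cochain_maps R X Y \<and> g \<in> cochain_maps R X Y \<and> (\<exists>s. homotopy R X Y f g s)"
  unfolding homotopy_rel_def homotopy_def by auto

lemma homotopyD:
  assumes "homotopy R X Y f g s"
  shows "s n \<in> mod_hom R (Ob X n) (Ob Y (n - 1))"
    "x \<in> el X n ==> f n x \<ominus>\<^bsub>Ob Y n\<^esub> g n x = diff Y (n - 1) (s n x) \<oplus>\<^bsub>Ob Y n\<^esub> s (n + 1) (diff X n x)"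
    "x \<in> el X n ==> s n x \<in> el Y (n - 1)"
proof -
  show *: "s n \<in> mod_hom R (Ob X n) (Ob Y (n - 1))" using assms unfolding homotopy_def by blast
  show "x \<in> el X n ==> f n x \<ominus>\<^bsub>Ob Y n\<^esub> g n x = diff Y (n - 1) (s n x) \<oplus>\<^bsub>Ob Y n\<^esub> s (n + 1) (diff X n x)"
    using assms unfolding homotopy_def by blast
  show "x \<in> el X n ==> s n x \<in> el Y (n - 1)" by (rule mod_homD(1)[OF *])
qed

lemma is_complex_diff_pred:
  assumes "is_complex R Y" "y \<in> el Y (n - 1)"
  shows "diff Y (n - 1) y \<in> el Y n"
  using is_complexD(3)[OF assms] by simp

lemma homotopy_refl:
  assumes X: "is_complex R X" and Y: "is_complex R Y" and f: "f \<in> cochain_maps R X Y"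
  shows "(f, f) \<in> homotopy_rel R X Y"
proof -
  have "homotopy R X Y f f (\<lambda>n x. \<zero>\<^bsub>Ob Y (n - 1)\<^esub>)"
    unfolding homotopy_def
  proof (intro allI conjI ballI)
    fix n
    interpret M: right_module R "Ob Y (n - 1)" by (rule is_complexD[OF Y])
    interpret N: right_module R "Ob Y n" by (rule is_complexD[OF Y])
    note z = smult_zero[OF is_complexD(1)[OF Y], of _ "n - 1"]
    show "(\<lambda>x. \<zero>\<^bsub>Ob Y (n - 1)\<^esub>) \<in> mod_hom R (Ob X n) (Ob Y (n - 1))" by (rule mod_homI) (simp_all add: z)
    fix x assume x: "x \<in> el X n"
    have "diff Y (n - 1) \<in> mod_hom R (Ob Y (n - 1)) (Ob Y n)" using is_complexD(2)[OF Y, of "n - 1"] by simp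
    then have "diff Y (n - 1) \<zero>\<^bsub>Ob Y (n - 1)\<^esub> = \<zero>\<^bsub>Ob Y n\<^esub>" by (rule mod_hom_zero[OF _ is_complexD(1)[OF Y] is_complexD(1)[OF Y]])
    moreover have "f n x \<ominus>\<^bsub>Ob Y n\<^esub> f n x = \<zero>\<^bsub>Ob Y n\<^esub>" using cochain_mapsD(3)[OF f x] by (simp add: N.M.minus_eq N.M.r_neg)
    ultimately show "f n x \<ominus>\<^bsub>Ob Y n\<^esub> f n x = diff Y (n - 1) \<zero>\<^bsub>Ob Y (n - 1)\<^esub> \<oplus>\<^bsub>Ob Y n\<^esub> \<zero>\<^bsub>Ob Y (n + 1 - 1)\<^esub>" by simp
  qed
  then show ?thesis unfolding homotopy_rel_iff using f by blast
qed

lemma homotopy_sym: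
  assumes X: "is_complex R X" and Y: "is_complex R Y" and fg: "(f, g) \<in> homotopy_rel R X Y"
  shows "(g, f) \<in> homotopy_rel R X Y"
proof -
  obtain s where s: "homotopy R X Y f g s" and f: "f \<in> cochain_maps R X Y" and g: "g \<in> cochain_maps R X Y"
    using fg unfolding homotopy_rel_iff by blast
  have "homotopy R X Y g f (\<lambda>n x. \<ominus>\<^bsub>Ob Y (n - 1)\<^esub> s n x)"
    unfolding homotopy_def
  proof (intro allI conjI ballI)
    fix n
    show "(\<lambda>x. \<ominus>\<^bsub>Ob Y (n - 1)\<^esub> s n x) \<in> mod_hom R (Ob X n) (Ob Y (n - 1))"
      by (rule mod_hom_neg[OF homotopyD(1)[OF s] is_complexD(1)[OF Y]])
    interpret N: right_module R "Ob Y n" by (rule is_complexD[OF Y])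
    fix x assume x: "x \<in> el X n"
    have sx: "s n x \<in> el Y (n - 1)" "s (n + 1) (diff X n x) \<in> el Y n"
      using homotopyD(3)[OF s x] homotopyD(3)[OF s is_complexD(3)[OF X x]] by simp_all
    have dY: "diff Y (n - 1) \<in> mod_hom R (Ob Y (n - 1)) (Ob Y n)" using is_complexD(2)[OF Y, of "n - 1"] by simp
    have a: "diff Y (n - 1) (s n x) \<in> el Y n" by (rule mod_homD(1)[OF dY sx(1)])
    have fx: "f n x \<in> el Y n" "g n x \<in> el Y n" using cochain_mapsD(3)[OF f x] cochain_mapsD(3)[OF g x] .
    have "g n x \<ominus>\<^bsub>Ob Y n\<^esub> f n x = \<ominus>\<^bsub>Ob Y n\<^esub> (f n x \<ominus>\<^bsub>Ob Y n\<^esub> g n x)"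
      using fx by (simp add: N.M.minus_eq N.M.minus_add N.M.a_comm)
    also have "\<dots> = \<ominus>\<^bsub>Ob Y n\<^esub> diff Y (n - 1) (s n x) \<oplus>\<^bsub>Ob Y n\<^esub> \<ominus>\<^bsub>Ob Y n\<^esub> s (n + 1) (diff X n x)"
      unfolding homotopyD(2)[OF s x] using N.M.minus_add[OF a sx(2)] .
    also have "\<ominus>\<^bsub>Ob Y n\<^esub> diff Y (n - 1) (s n x) = diff Y (n - 1) (\<ominus>\<^bsub>Ob Y (n - 1)\<^esub> s n x)"
      by (rule mod_hom_uminus[OF dY is_complexD(1)[OF Y] is_complexD(1)[OF Y] sx(1), symmetric])
    finally show "g n x \<ominus>\<^bsub>Ob Y n\<^esub> f n x = diff Y (n - 1) (\<ominus>\<^bsub>Ob Y (n - 1)\<^esub> s n x) \<oplus>\<^bsub>Ob Y n\<^esub>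
        \<ominus>\<^bsub>Ob Y (n + 1 - 1)\<^esub> s (n + 1) (diff X n x)" by simp
  qed
  then show ?thesis unfolding homotopy_rel_iff using f g by blast
qed

lemma homotopy_trans:
  assumes X: "is_complex R X" and Y: "is_complex R Y"
    and fg: "(f, g) \<in> homotopy_rel R X Y" and gh: "(g, h) \<in> homotopy_rel R X Y"
  shows "(f, h) \<in> homotopy_rel R X Y"
proof -
  obtain s where s: "homotopy R X Y f g s" and f: "f \<in> cochain_maps R X Y" and g: "g \<in> cochain_maps R X Y"
    using fg unfolding homotopy_rel_iff by blast
  obtain t where t: "homotopy R X Y g h t" and h: "h \<in> cochain_maps R X Y"
    using gh unfolding homotopy_rel_iff by blast
  have "homotopy R X Y f h (\<lambda>n x. s n x \<oplus>\<^bsub>Ob Y (n - 1)\<^esub> t n x)"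
    unfolding homotopy_def
  proof (intro allI conjI ballI)
    fix n
    show "(\<lambda>x. s n x \<oplus>\<^bsub>Ob Y (n - 1)\<^esub> t n x) \<in> mod_hom R (Ob X n) (Ob Y (n - 1))"
      by (rule mod_hom_add[OF homotopyD(1)[OF s] homotopyD(1)[OF t] is_complexD(1)[OF Y]])
    interpret N: right_module R "Ob Y n" by (rule is_complexD[OF Y])
    fix x assume x: "x \<in> el X n"
    have sx: "s n x \<in> el Y (n - 1)" "s (n + 1) (diff X n x) \<in> el Y n"
      "t n x \<in> el Y (n - 1)" "t (n + 1) (diff X n x) \<in> el Y n"
      using homotopyD(3)[OF s x] homotopyD(3)[OF s is_complexD(3)[OF X x]]
        homotopyD(3)[OF t x] homotopyD(3)[OF t is_complexD(3)[OF X x]] by simp_all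
    have dY: "diff Y (n - 1) \<in> mod_hom R (Ob Y (n - 1)) (Ob Y n)" using is_complexD(2)[OF Y, of "n - 1"] by simp
    have a: "diff Y (n - 1) (s n x) \<in> el Y n" "diff Y (n - 1) (t n x) \<in> el Y n"
      using mod_homD(1)[OF dY sx(1)] mod_homD(1)[OF dY sx(3)] .
    have fx: "f n x \<in> el Y n" "g n x \<in> el Y n" "h n x \<in> el Y n"
      using cochain_mapsD(3)[OF f x] cochain_mapsD(3)[OF g x] cochain_mapsD(3)[OF h x] .
    have g0: "\<ominus>\<^bsub>Ob Y n\<^esub> g n x \<oplus>\<^bsub>Ob Y n\<^esub> (g n x \<oplus>\<^bsub>Ob Y n\<^esub> \<ominus>\<^bsub>Ob Y n\<^esub> h n x) = \<ominus>\<^bsub>Ob Y n\<^esub> h n x"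
      using fx by (simp add: N.M.r_neg1)
    have "f n x \<ominus>\<^bsub>Ob Y n\<^esub> h n x = (f n x \<ominus>\<^bsub>Ob Y n\<^esub> g n x) \<oplus>\<^bsub>Ob Y n\<^esub> (g n x \<ominus>\<^bsub>Ob Y n\<^esub> h n x)"
      using fx g0 by (simp add: N.M.minus_eq N.M.a_assoc)
    also have "\<dots> = (diff Y (n - 1) (s n x) \<oplus>\<^bsub>Ob Y n\<^esub> diff Y (n - 1) (t n x)) \<oplus>\<^bsub>Ob Y n\<^esub>
        (s (n + 1) (diff X n x) \<oplus>\<^bsub>Ob Y n\<^esub> t (n + 1) (diff X n x))"
      unfolding homotopyD(2)[OF s x] homotopyD(2)[OF t x] using a sx by (simp add: N.M.a_ac)
    also have "diff Y (n - 1) (s n x) \<oplus>\<^bsub>Ob Y n\<^esub> diff Y (n - 1) (t n x) = diff Y (n - 1) (s n x \<oplus>\<^bsub>Ob Y (n - 1)\<^esub> t n x)"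
      by (rule mod_homD(2)[OF dY sx(1,3), symmetric])
    finally show "f n x \<ominus>\<^bsub>Ob Y n\<^esub> h n x = diff Y (n - 1) (s n x \<oplus>\<^bsub>Ob Y (n - 1)\<^esub> t n x) \<oplus>\<^bsub>Ob Y n\<^esub>
        (s (n + 1) (diff X n x) \<oplus>\<^bsub>Ob Y (n + 1 - 1)\<^esub> t (n + 1) (diff X n x))" by simp
  qed
  then show ?thesis unfolding homotopy_rel_iff using f h by blast
qed

lemma homotopy_left:
  assumes X: "is_complex R X" and Y: "is_complex R Y" and Z: "is_complex R Z"
    and fg: "(f, g) \<in> homotopy_rel R X Y" and h: "h \<in> cochain_maps R Y Z"
  shows "(\<lambda>n x. h n (f n x), \<lambda>n x. h n (g n x)) \<in> homotopy_rel R X Z"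
proof -
  obtain s where s: "homotopy R X Y f g s" and f: "f \<in> cochain_maps R X Y" and g: "g \<in> cochain_maps R X Y"
    using fg unfolding homotopy_rel_iff by blast
  have "homotopy R X Z (\<lambda>n x. h n (f n x)) (\<lambda>n x. h n (g n x)) (\<lambda>n x. h (n - 1) (s n x))"
    unfolding homotopy_def
  proof (intro allI conjI ballI)
    fix n
    show "(\<lambda>x. h (n - 1) (s n x)) \<in> mod_hom R (Ob X n) (Ob Z (n - 1))"
      by (rule mod_hom_comp[OF homotopyD(1)[OF s] cochain_mapsD(1)[OF h]])
    interpret N: right_module R "Ob Y n" by (rule is_complexD[OF Y])
    fix x assume x: "x \<in> el X n"
    have sx: "s n x \<in> el Y (n - 1)" "s (n + 1) (diff X n x) \<in> el Y n"
      using homotopyD(3)[OF s x] homotopyD(3)[OF s is_complexD(3)[OF X x]] by simp_all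
    have a: "diff Y (n - 1) (s n x) \<in> el Y n" by (rule is_complex_diff_pred[OF Y sx(1)])
    have fx: "f n x \<in> el Y n" "g n x \<in> el Y n" using cochain_mapsD(3)[OF f x] cochain_mapsD(3)[OF g x] .
    note hn = cochain_mapsD(1)[OF h, of n]
    have "h n (f n x) \<ominus>\<^bsub>Ob Z n\<^esub> h n (g n x) = h n (f n x \<ominus>\<^bsub>Ob Y n\<^esub> g n x)"
      unfolding a_minus_def using mod_homD(2)[OF hn] mod_hom_uminus[OF hn is_complexD(1)[OF Y] is_complexD(1)[OF Z]] fx by simp
    also have "\<dots> = h n (diff Y (n - 1) (s n x)) \<oplus>\<^bsub>Ob Z n\<^esub> h n (s (n + 1) (diff X n x))"
      unfolding homotopyD(2)[OF s x] by (rule mod_homD(2)[OF hn a sx(2)])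
    also have "h n (diff Y (n - 1) (s n x)) = diff Z (n - 1) (h (n - 1) (s n x))"
      using cochain_mapsD(2)[OF h sx(1)] by simp
    finally show "h n (f n x) \<ominus>\<^bsub>Ob Z n\<^esub> h n (g n x) = diff Z (n - 1) (h (n - 1) (s n x)) \<oplus>\<^bsub>Ob Z n\<^esub>
        h (n + 1 - 1) (s (n + 1) (diff X n x))" by simp
  qed
  then show ?thesis unfolding homotopy_rel_iff using cochain_maps_comp[OF f h] cochain_maps_comp[OF g h] by blast
qed

lemma homotopy_right:
  assumes X: "is_complex R X" and Y: "is_complex R Y" and Z: "is_complex R Z"
    and fg: "(f, g) \<in> homotopy_rel R Y Z" and h: "h \<in> cochain_maps R X Y"
  shows "(\<lambda>n x. f n (h n x), \<lambda>n x. g n (h n x)) \<in> homotopy_rel R X Z"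
proof -
  obtain s where s: "homotopy R Y Z f g s" and f: "f \<in> cochain_maps R Y Z" and g: "g \<in> cochain_maps R Y Z"
    using fg unfolding homotopy_rel_iff by blast
  have "homotopy R X Z (\<lambda>n x. f n (h n x)) (\<lambda>n x. g n (h n x)) (\<lambda>n x. s n (h n x))"
    unfolding homotopy_def
  proof (intro allI conjI ballI)
    show "(\<lambda>x. s n (h n x)) \<in> mod_hom R (Ob X n) (Ob Z (n - 1))" for n
      by (rule mod_hom_comp[OF cochain_mapsD(1)[OF h] homotopyD(1)[OF s]])
    show "f n (h n x) \<ominus>\<^bsub>Ob Z n\<^esub> g n (h n x) = diff Z (n - 1) (s n (h n x)) \<oplus>\<^bsub>Ob Z n\<^esub> s (n + 1) (h (n + 1) (diff X n x))"
      if x: "x \<in> el X n" for n x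
      using homotopyD(2)[OF s cochain_mapsD(3)[OF h x]] cochain_mapsD(2)[OF h x] by simp
  qed
  then show ?thesis unfolding homotopy_rel_iff using cochain_maps_comp[OF h f] cochain_maps_comp[OF h g] by blast
qed

lemma Kclass_eq_iff:
  assumes X: "is_complex R X" and Y: "is_complex R Y" and f: "f \<in> cochain_maps R X Y" and g: "g \<in> cochain_maps R X Y"
  shows "Kclass R X Y f = Kclass R X Y g \<longleftrightarrow> (f, g) \<in> homotopy_rel R X Y"
proof
  assume "Kclass R X Y f = Kclass R X Y g"
  moreover have "g \<in> Kclass R X Y g" unfolding Kclass_def using homotopy_refl[OF X Y g] by blast
  ultimately show "(f, g) \<in> homotopy_rel R X Y" unfolding Kclass_def by blast
next
  assume fg: "(f, g) \<in> homotopy_rel R X Y"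
  show "Kclass R X Y f = Kclass R X Y g"
    unfolding Kclass_def using homotopy_trans[OF X Y fg] homotopy_trans[OF X Y homotopy_sym[OF X Y fg]] by auto
qed

lemma Kclass_in_KHom: "f \<in> cochain_maps R X Y ==> Kclass R X Y f \<in> KHom R X Y"
  unfolding KHom_def Kclass_def by (rule quotientI)

lemma KHomE:
  assumes "F \<in> KHom R X Y" obtains f where "f \<in> cochain_maps R X Y" "F = Kclass R X Y f"
  using assms unfolding KHom_def Kclass_def by (elim quotientE) simp

lemma Kclass_self: "is_complex R X ==> is_complex R Y ==> f \<in> cochain_maps R X Y ==> f \<in> Kclass R X Y f"
  unfolding Kclass_def using homotopy_refl by blast

lemma Kclass_memD: "g \<in> Kclass R X Y f ==> (f, g) \<in> homotopy_rel R X Y \<and> g \<in> cochain_maps R X Y"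
  unfolding Kclass_def homotopy_rel_def by auto

text \<open>\<open>Kcomp\<close> is a union over all representatives; compatibility of homotopy with
  composition makes every pair contribute the same class.\<close>

lemma Kcomp_Kclass:
  assumes X: "is_complex R X" and Y: "is_complex R Y" and Z: "is_complex R Z"
    and f: "f \<in> cochain_maps R X Y" and g: "g \<in> cochain_maps R Y Z"
  shows "Kcomp R X Z (Kclass R Y Z g) (Kclass R X Y f) = Kclass R X Z (\<lambda>n x. g n (f n x))"
proof -
  have "Kclass R X Z (\<lambda>n x. g' n (f' n x)) = Kclass R X Z (\<lambda>n x. g n (f n x))"
    if g': "g' \<in> Kclass R Y Z g" and f': "f' \<in> Kclass R X Y f" for f' g'
  proof -
    note g' = Kclass_memD[OF g'] and f' = Kclass_memD[OF f']
    have "(\<lambda>n x. g n (f n x), \<lambda>n x. g' n (f' n x)) \<in> homotopy_rel R X Z"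
      by (rule homotopy_trans[OF X Z homotopy_left[OF X Y Z _ g] homotopy_right[OF X Y Z]]) (use f' g' in auto)
    then show ?thesis
      using Kclass_eq_iff[OF X Z cochain_maps_comp[OF f g] cochain_maps_comp[of f' R X Y g' Z]] f' g' by auto
  qed
  then show ?thesis unfolding Kcomp_def using Kclass_self[OF X Y f] Kclass_self[OF Y Z g] by blast
qed

section \<open>Cones, shifts and factorisation through cones\<close>

lemma minus_zero_module:
  assumes "right_module R M" shows "\<ominus>\<^bsub>M\<^esub> \<zero>\<^bsub>M\<^esub> = \<zero>\<^bsub>M\<^esub>"
proof -
  interpret M: right_module R M by fact
  show ?thesis using M.M.minus_equality[of "\<zero>\<^bsub>M\<^esub>" "\<zero>\<^bsub>M\<^esub>"] by simp
qed

lemma right_module_mod_sum: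
  assumes "right_module R M" "right_module R N" shows "right_module R (mod_sum M N)"
proof -
  interpret M: right_module R M by fact
  interpret N: right_module R N by fact
  show ?thesis
  proof (rule right_moduleI)
    show "\<exists>y\<in>carrier (mod_sum M N). y \<oplus>\<^bsub>mod_sum M N\<^esub> x = \<zero>\<^bsub>mod_sum M N\<^esub>" if "x \<in> carrier (mod_sum M N)" for x
    proof -
      have "fst x \<in> carrier M" "snd x \<in> carrier N" using that unfolding mod_sum_def by auto
      then show ?thesis unfolding mod_sum_def
        by (intro bexI[of _ "(\<ominus>\<^bsub>M\<^esub> fst x, \<ominus>\<^bsub>N\<^esub> snd x)"]) (simp_all add: case_prod_unfold M.M.l_neg N.M.l_neg)
    qed
  qed (auto simp: mod_sum_def M.R.ring_axioms M.M.a_ac N.M.a_ac M.smult_closed N.smult_closed M.smult_add_scalar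
      N.smult_add_scalar M.smult_add_vector N.smult_add_vector M.smult_assoc N.smult_assoc M.smult_one N.smult_one)
qed

lemma mod_sum_homs:
  "fst \<in> mod_hom R (mod_sum M N) M" "snd \<in> mod_hom R (mod_sum M N) N"
  "f \<in> mod_hom R P M ==> g \<in> mod_hom R P N ==> (\<lambda>p. (f p, g p)) \<in> mod_hom R P (mod_sum M N)"
  unfolding mod_sum_def by (auto intro!: mod_homI simp: mod_homD)

lemma mod_sum_carrier: "(x, y) \<in> carrier (mod_sum M N) \<longleftrightarrow> x \<in> carrier M \<and> y \<in> carrier N"
  "p \<in> carrier (mod_sum M N) \<longleftrightarrow> fst p \<in> carrier M \<and> snd p \<in> carrier N"
  unfolding mod_sum_def by (auto simp: mem_Times_iff)

lemma cone_simps: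
  "Ob (cone X Y f) n = mod_sum (Ob X (n + 1)) (Ob Y n)"
  "diff (cone X Y f) n p = (\<ominus>\<^bsub>Ob X (n + 1 + 1)\<^esub> diff X (n + 1) (fst p), diff Y n (snd p) \<ominus>\<^bsub>Ob Y (n + 1)\<^esub> f (n + 1) (fst p))"
  unfolding cone_def by (simp_all add: case_prod_unfold)

lemma shift_simps:
  "Ob (shift (- 1) X) n = Ob X (n + 1)" "diff (shift (- 1) X) n x = \<ominus>\<^bsub>Ob X (n + 1 + 1)\<^esub> diff X (n + 1) x"
  unfolding shift_def by simp_all

lemma is_complex_shift:
  assumes X: "is_complex R X" shows "is_complex R (shift (- 1) X)"
  unfolding is_complex_def
proof (intro allI conjI ballI)
  fix n
  note d = is_complexD[OF X]
  show "right_module R (Ob (shift (- 1) X) n)" unfolding shift_simps(1) by (rule d)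
  have h: "(\<lambda>x. \<ominus>\<^bsub>Ob X (n + 1 + 1)\<^esub> diff X (n + 1) x) \<in> mod_hom R (Ob X (n + 1)) (Ob X (n + 1 + 1))"
    by (rule mod_hom_neg[OF d(2,1)])
  show "diff (shift (- 1) X) n \<in> mod_hom R (Ob (shift (- 1) X) n) (Ob (shift (- 1) X) (n + 1))"
    unfolding shift_simps(1) by (rule mod_hom_cong[OF h _ d(1)]) (rule shift_simps(2))
  fix x assume "x \<in> carrier (Ob (shift (- 1) X) n)"
  then have x: "x \<in> el X (n + 1)" unfolding shift_simps(1) .
  show "diff (shift (- 1) X) (n + 1) (diff (shift (- 1) X) n x) = \<zero>\<^bsub>Ob (shift (- 1) X) (n + 1 + 1)\<^esub>"
    unfolding shift_simps mod_hom_uminus[OF d(2,1,1) d(3)[OF x]] d(4)[OF x] minus_zero_module[OF d(1)] ..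
qed

lemma is_complex_cone:
  assumes X: "is_complex R X" and Y: "is_complex R Y" and f: "f \<in> cochain_maps R X Y"
  shows "is_complex R (cone X Y f)"
  unfolding is_complex_def
proof (intro allI conjI ballI)
  fix n
  note d = is_complexD[OF X] and e = is_complexD[OF Y] and fm = cochain_mapsD[OF f]
  show M: "right_module R (Ob (cone X Y f) n)" for n unfolding cone_simps by (rule right_module_mod_sum[OF d(1) e(1)])
  note h1 = mod_hom_comp[OF mod_sum_homs(1)[of R "Ob X (n + 1)" "Ob Y n"]] and h2 = mod_hom_comp[OF mod_sum_homs(2)[of R "Ob X (n + 1)" "Ob Y n"]]
  have "diff (cone X Y f) n = (\<lambda>p. (\<ominus>\<^bsub>Ob X (n + 1 + 1)\<^esub> diff X (n + 1) (fst p),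
      diff Y n (snd p) \<oplus>\<^bsub>Ob Y (n + 1)\<^esub> \<ominus>\<^bsub>Ob Y (n + 1)\<^esub> f (n + 1) (fst p)))"
    by (rule HOL.ext) (simp add: cone_simps a_minus_def)
  also have "\<dots> \<in> mod_hom R (mod_sum (Ob X (n + 1)) (Ob Y n)) (mod_sum (Ob X (n + 1 + 1)) (Ob Y (n + 1)))"
    by (intro mod_sum_homs(3) mod_hom_neg mod_hom_add h1 h2 d(1,2) e(1,2) fm(1))
  finally show "diff (cone X Y f) n \<in> mod_hom R (Ob (cone X Y f) n) (Ob (cone X Y f) (n + 1))" unfolding cone_simps .
  fix p assume "p \<in> carrier (Ob (cone X Y f) n)"
  then have p: "fst p \<in> el X (n + 1)" "snd p \<in> el Y n" unfolding cone_simps mod_sum_carrier(2) by auto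
  interpret A: right_module R "Ob X (n + 1 + 1 + 1)" by (rule d)
  interpret B: right_module R "Ob Y (n + 1)" by (rule e)
  interpret C: right_module R "Ob Y (n + 1 + 1)" by (rule e)
  let ?x = "fst p" and ?y = "snd p"
  have dx: "diff X (n + 1) ?x \<in> el X (n + 1 + 1)" by (rule d(3)[OF p(1)])
  have fx: "f (n + 1) ?x \<in> el Y (n + 1)" by (rule fm(3)[OF p(1)])
  have fdx: "f (n + 1 + 1) (diff X (n + 1) ?x) \<in> el Y (n + 1 + 1)" by (rule fm(3)[OF dx])
  have 1: "\<ominus>\<^bsub>Ob X (n + 1 + 1 + 1)\<^esub> diff X (n + 1 + 1) (\<ominus>\<^bsub>Ob X (n + 1 + 1)\<^esub> diff X (n + 1) ?x) = \<zero>\<^bsub>Ob X (n + 1 + 1 + 1)\<^esub>"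
    unfolding mod_hom_uminus[OF d(2,1,1) dx] d(4)[OF p(1)] minus_zero_module[OF d(1)] ..
  have 3: "diff Y (n + 1) (diff Y n ?y \<ominus>\<^bsub>Ob Y (n + 1)\<^esub> f (n + 1) ?x) = \<ominus>\<^bsub>Ob Y (n + 1 + 1)\<^esub> f (n + 1 + 1) (diff X (n + 1) ?x)"
    unfolding a_minus_def mod_homD(2)[OF e(2) e(3)[OF p(2)] B.M.a_inv_closed[OF fx]] e(4)[OF p(2)]
      mod_hom_uminus[OF e(2,1,1) fx] fm(2)[OF p(1)] by (rule C.M.l_zero[OF C.M.a_inv_closed[OF fdx]])
  have 4: "f (n + 1 + 1) (\<ominus>\<^bsub>Ob X (n + 1 + 1)\<^esub> diff X (n + 1) ?x) = \<ominus>\<^bsub>Ob Y (n + 1 + 1)\<^esub> f (n + 1 + 1) (diff X (n + 1) ?x)"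
    by (rule mod_hom_uminus[OF fm(1) d(1) e(1) dx])
  have 2: "diff Y (n + 1) (diff Y n ?y \<ominus>\<^bsub>Ob Y (n + 1)\<^esub> f (n + 1) ?x) \<ominus>\<^bsub>Ob Y (n + 1 + 1)\<^esub>
      f (n + 1 + 1) (\<ominus>\<^bsub>Ob X (n + 1 + 1)\<^esub> diff X (n + 1) ?x) = \<zero>\<^bsub>Ob Y (n + 1 + 1)\<^esub>"
    unfolding 3 4 unfolding a_minus_def by (rule C.M.r_neg[OF C.M.a_inv_closed[OF fdx]])
  show "diff (cone X Y f) (n + 1) (diff (cone X Y f) n p) = \<zero>\<^bsub>Ob (cone X Y f) (n + 1 + 1)\<^esub>"
    unfolding cone_simps fst_conv snd_conv 1 2 by (simp add: mod_sum_def)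
qed

lemma cone_inj_map:
  assumes X: "is_complex R X" and Y: "is_complex R Y" and f: "f \<in> cochain_maps R X Y"
  shows "cone_inj X \<in> cochain_maps R Y (cone X Y f)"
proof (rule cochain_mapsI)
  note d = is_complexD[OF X] and e = is_complexD[OF Y] and fm = cochain_mapsD[OF f]
  fix n
  interpret A: right_module R "Ob X (n + 1)" by (rule d)
  interpret C: right_module R "Ob X (n + 1 + 1)" by (rule d)
  interpret B: right_module R "Ob Y (n + 1)" by (rule e)
  show "cone_inj X n \<in> mod_hom R (Ob Y n) (Ob (cone X Y f) n)"
    unfolding cone_simps by (rule mod_homI) (auto simp: cone_inj_def mod_sum_def smult_zero[OF d(1)])
  fix y assume y: "y \<in> el Y n"
  have z: "diff X (n + 1) \<zero>\<^bsub>Ob X (n + 1)\<^esub> = \<zero>\<^bsub>Ob X (n + 1 + 1)\<^esub>" "f (n + 1) \<zero>\<^bsub>Ob X (n + 1)\<^esub> = \<zero>\<^bsub>Ob Y (n + 1)\<^esub>"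
    by (rule mod_hom_zero[OF d(2,1,1)], rule mod_hom_zero[OF fm(1) d(1) e(1)])
  show "diff (cone X Y f) n (cone_inj X n y) = cone_inj X (n + 1) (diff Y n y)"
    unfolding cone_simps cone_inj_def fst_conv snd_conv z using e(3)[OF y]
    by (simp add: a_minus_def minus_zero_module[OF d(1)] minus_zero_module[OF e(1)])
qed

lemma cone_proj_map: "cone_proj \<in> cochain_maps R (cone X Y f) (shift (- 1) X)"
proof (rule cochain_mapsI)
  show "cone_proj n \<in> mod_hom R (Ob (cone X Y f) n) (Ob (shift (- 1) X) n)" for n
    unfolding cone_simps shift_simps cone_proj_def by (rule mod_sum_homs)
qed (simp add: cone_simps shift_simps cone_proj_def)

lemma homotopy_cong:
  assumes X: "is_complex R X" and Y: "is_complex R Y" and f: "f \<in> cochain_maps R X Y" "g \<in> cochain_maps R X Y"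
    and e: "\<And>n x. x \<in> el X n ==> f n x = g n x"
  shows "(f, g) \<in> homotopy_rel R X Y"
proof -
  obtain s where "homotopy R X Y f f s" using homotopy_refl[OF X Y f(1)] unfolding homotopy_rel_iff by blast
  then have "homotopy R X Y f g s" unfolding homotopy_def using e by simp
  then show ?thesis unfolding homotopy_rel_iff using f by blast
qed

lemma Kclass_id_iso: "is_complex R X ==> Kclass R X X (\<lambda>n x. x) \<in> Kisos R X X"
proof -
  assume X: "is_complex R X"
  have "Kcomp R X X (Kclass R X X (\<lambda>n x. x)) (Kclass R X X (\<lambda>n x. x)) = Kclass R X X (\<lambda>n x. x)"
    by (rule Kcomp_Kclass[OF X X X cochain_maps_id cochain_maps_id])
  then show ?thesis unfolding Kisos_def using Kclass_in_KHom[OF cochain_maps_id] by blast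
qed

text \<open>The differential of the shift has the opposite sign, so the shifted homotopy has to
  change its sign too.\<close>

lemma homotopy_shift:
  assumes X: "is_complex R X" and a: "(\<lambda>n x. x, a) \<in> homotopy_rel R X X"
  shows "(\<lambda>n x. x, \<lambda>n. a (n + 1)) \<in> homotopy_rel R (shift (- 1) X) (shift (- 1) X)"
proof -
  note d = is_complexD[OF X]
  obtain s where s: "homotopy R X X (\<lambda>n x. x) a s" and am: "a \<in> cochain_maps R X X" using a unfolding homotopy_rel_iff by blast
  note am = cochain_mapsD[OF am]
  have "(\<lambda>n. a (n + 1)) \<in> cochain_maps R (shift (- 1) X) (shift (- 1) X)"
  proof (rule cochain_mapsI, unfold shift_simps)
    fix n x assume x: "x \<in> el X (n + 1)"
    show "\<ominus>\<^bsub>Ob X (n + 1 + 1)\<^esub> diff X (n + 1) (a (n + 1) x) = a (n + 1 + 1) (\<ominus>\<^bsub>Ob X (n + 1 + 1)\<^esub> diff X (n + 1) x)"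
      unfolding am(2)[OF x] by (rule mod_hom_uminus[OF am(1) d(1,1) d(3)[OF x], symmetric])
  qed (rule am(1))
  moreover have "homotopy R (shift (- 1) X) (shift (- 1) X) (\<lambda>n x. x) (\<lambda>n. a (n + 1)) (\<lambda>n x. \<ominus>\<^bsub>Ob X n\<^esub> s (n + 1) x)"
    unfolding homotopy_def
  proof (intro allI conjI ballI)
    fix n
    have sh: "s (n + 1) \<in> mod_hom R (Ob X (n + 1)) (Ob X n)" for n using homotopyD(1)[OF s, of "n + 1"] by simp
    show "(\<lambda>x. \<ominus>\<^bsub>Ob X n\<^esub> s (n + 1) x) \<in> mod_hom R (Ob (shift (- 1) X) n) (Ob (shift (- 1) X) (n - 1))"
      using mod_hom_neg[OF sh d(1)] by (simp add: shift_simps)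
    fix x assume "x \<in> carrier (Ob (shift (- 1) X) n)"
    then have x: "x \<in> el X (n + 1)" unfolding shift_simps .
    interpret N: right_module R "Ob X (n + 1)" by (rule d)
    have sx: "s (n + 1) x \<in> el X n" by (rule mod_homD(1)[OF sh x])
    have "diff (shift (- 1) X) (n - 1) (\<ominus>\<^bsub>Ob X n\<^esub> s (n + 1) x) = \<ominus>\<^bsub>Ob X (n + 1)\<^esub> diff X n (\<ominus>\<^bsub>Ob X n\<^esub> s (n + 1) x)"
      by (simp add: shift_simps)
    also have "\<dots> = diff X n (s (n + 1) x)"
      unfolding mod_hom_uminus[OF d(2,1,1) sx] using d(3)[OF sx] by simp
    finally have 1: "diff (shift (- 1) X) (n - 1) (\<ominus>\<^bsub>Ob X n\<^esub> s (n + 1) x) = diff X n (s (n + 1) x)" .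
    have "\<ominus>\<^bsub>Ob X (n + 1)\<^esub> s (n + 1 + 1) (diff (shift (- 1) X) n x) = s (n + 1 + 1) (diff X (n + 1) x)"
      unfolding shift_simps mod_hom_uminus[OF sh d(1,1) d(3)[OF x]] using mod_homD(1)[OF sh d(3)[OF x]] by simp
    then show "x \<ominus>\<^bsub>Ob (shift (- 1) X) n\<^esub> a (n + 1) x = diff (shift (- 1) X) (n - 1) (\<ominus>\<^bsub>Ob X n\<^esub> s (n + 1) x)
        \<oplus>\<^bsub>Ob (shift (- 1) X) n\<^esub> \<ominus>\<^bsub>Ob X (n + 1)\<^esub> s (n + 1 + 1) (diff (shift (- 1) X) n x)"
      unfolding 1 using homotopyD(2)[OF s x] by (simp add: shift_simps)
  qed
  ultimately show ?thesis unfolding homotopy_rel_iff using cochain_maps_id by blast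
qed

text \<open>Each shifted representative of the identity is homotopic to the identity of the shift,
  hence all of them give the same composite class.\<close>

lemma Kshift_id:
  assumes X: "is_complex R X" and W: "is_complex R W" and h: "h \<in> cochain_maps R W (shift (- 1) X)"
  shows "Kcomp R W (shift (- 1) X) (Kshift (- 1) (Kclass R X X (\<lambda>n x. x))) (Kclass R W (shift (- 1) X) h)
    = Kclass R W (shift (- 1) X) h"
proof -
  let ?S = "shift (- 1) X"
  note S = is_complex_shift[OF X]
  have c: "Kclass R W ?S (\<lambda>n x. g n (f n x)) = Kclass R W ?S h"
    if g: "g \<in> Kshift (- 1) (Kclass R X X (\<lambda>n x. x))" and f: "f \<in> Kclass R W ?S h" for f g
  proof -
    obtain a where a: "a \<in> Kclass R X X (\<lambda>n x. x)" "g = (\<lambda>n. a (n + 1))" using g unfolding Kshift_def by auto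
    have g: "(\<lambda>n x. x, g) \<in> homotopy_rel R ?S ?S" unfolding a(2) by (rule homotopy_shift[OF X]) (use a Kclass_memD in blast)
    note f = Kclass_memD[OF f]
    have "(\<lambda>n x. f n x, \<lambda>n x. g n (f n x)) \<in> homotopy_rel R W ?S"
      using homotopy_right[OF W S S g] f by blast
    then have hr: "(h, \<lambda>n x. g n (f n x)) \<in> homotopy_rel R W ?S" using homotopy_trans[OF W S] f by blast
    then have m: "(\<lambda>n x. g n (f n x)) \<in> cochain_maps R W ?S" unfolding homotopy_rel_iff by blast
    show ?thesis by (rule iffD2[OF Kclass_eq_iff[OF W S h m] hr, symmetric])
  qed
  have "(\<lambda>n x. x) \<in> Kclass R X X (\<lambda>n x. x)" by (rule Kclass_self[OF X X cochain_maps_id])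
  then have "(\<lambda>n x. x) \<in> Kshift (- 1) (Kclass R X X (\<lambda>n x. x))" unfolding Kshift_def by (rule rev_image_eqI) simp
  then show ?thesis unfolding Kcomp_def using c Kclass_self[OF W S h] by blast
qed

definition zmap where "zmap Y n x = \<zero>\<^bsub>Ob Y n\<^esub>"

lemma zmap: "is_complex R X ==> is_complex R Y ==> zmap Y \<in> cochain_maps R X Y"
proof (rule cochain_mapsI)
  assume X: "is_complex R X" and Y: "is_complex R Y"
  fix n
  interpret N: right_module R "Ob Y n" by (rule is_complexD[OF Y])
  show "zmap Y n \<in> mod_hom R (Ob X n) (Ob Y n)"
    by (rule mod_homI) (simp_all add: zmap_def smult_zero[OF is_complexD(1)[OF Y]])
  show "diff Y n (zmap Y n x) = zmap Y (n + 1) (diff X n x)" for x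
    unfolding zmap_def by (rule mod_hom_zero[OF is_complexD(2,1,1)[OF Y]])
qed

text \<open>The homotopy from \<open>k\<close> after \<open>f\<close> to zero supplies the component
  on the shifted summand; its sign is forced by the term \<open>- f\<close> in the differential of
  the cone.\<close>

lemma cone_extension:
  assumes X: "is_complex R X" and Y: "is_complex R Y" and E: "is_complex R E"
    and f: "f \<in> cochain_maps R X Y" and k: "k \<in> cochain_maps R Y E"
    and kf: "(\<lambda>n x. k n (f n x), zmap E) \<in> homotopy_rel R X E"
  shows "\<exists>l\<in>cochain_maps R (cone X Y f) E. (k, \<lambda>n y. l n (cone_inj X n y)) \<in> homotopy_rel R Y E"
proof -
  note d = is_complexD[OF X] and e = is_complexD[OF Y] and c = is_complexD[OF E]
    and fm = cochain_mapsD[OF f] and km = cochain_mapsD[OF k]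
  obtain s where s: "homotopy R X E (\<lambda>n x. k n (f n x)) (zmap E) s" using kf unfolding homotopy_rel_iff by blast
  have sh: "s (n + 1) \<in> mod_hom R (Ob X (n + 1)) (Ob E n)" for n using homotopyD(1)[OF s, of "n + 1"] by simp
  define l where "l n p = k n (snd p) \<oplus>\<^bsub>Ob E n\<^esub> \<ominus>\<^bsub>Ob E n\<^esub> s (n + 1) (fst p)" for n p
  have lm: "l \<in> cochain_maps R (cone X Y f) E"
  proof (rule cochain_mapsI)
    fix n
    have "(\<lambda>p. k n (snd p) \<oplus>\<^bsub>Ob E n\<^esub> \<ominus>\<^bsub>Ob E n\<^esub> s (n + 1) (fst p)) \<in> mod_hom R (mod_sum (Ob X (n + 1)) (Ob Y n)) (Ob E n)"
      by (intro mod_hom_add mod_hom_neg mod_hom_comp[OF mod_sum_homs(1) sh] mod_hom_comp[OF mod_sum_homs(2) km(1)] c(1))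
    then show "l n \<in> mod_hom R (Ob (cone X Y f) n) (Ob E n)" unfolding cone_simps l_def .
    fix p assume "p \<in> carrier (Ob (cone X Y f) n)"
    then have p: "fst p \<in> el X (n + 1)" "snd p \<in> el Y n" unfolding cone_simps mod_sum_carrier(2) by auto
    let ?x = "fst p" and ?y = "snd p"
    interpret A: right_module R "Ob E n" by (rule c)
    interpret B: right_module R "Ob E (n + 1)" by (rule c)
    interpret D: right_module R "Ob Y (n + 1)" by (rule e)
    have dx: "diff X (n + 1) ?x \<in> el X (n + 1 + 1)" by (rule d(3)[OF p(1)])
    have fx: "f (n + 1) ?x \<in> el Y (n + 1)" by (rule fm(3)[OF p(1)])
    have sx: "s (n + 1) ?x \<in> el E n" by (rule mod_homD(1)[OF sh p(1)])
    have dy: "diff Y n ?y \<in> el Y (n + 1)" by (rule e(3)[OF p(2)])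
    let ?a = "k (n + 1) (diff Y n ?y)" and ?b = "diff E n (s (n + 1) ?x)" and ?g = "s (n + 1 + 1) (diff X (n + 1) ?x)"
      and ?t = "k (n + 1) (f (n + 1) ?x)"
    have cl: "?a \<in> el E (n + 1)" "?b \<in> el E (n + 1)" "?g \<in> el E (n + 1)" "?t \<in> el E (n + 1)"
      by (rule km(3)[OF dy], rule c(3)[OF sx], rule mod_homD(1)[OF sh dx], rule km(3)[OF fx])
    have t: "?t = ?b \<oplus>\<^bsub>Ob E (n + 1)\<^esub> ?g"
      using homotopyD(2)[OF s p(1)] cl(4) by (simp add: zmap_def a_minus_def minus_zero_module[OF c(1)])
    have "l (n + 1) (diff (cone X Y f) n p) = ?a \<oplus>\<^bsub>Ob E (n + 1)\<^esub> \<ominus>\<^bsub>Ob E (n + 1)\<^esub> ?t \<oplus>\<^bsub>Ob E (n + 1)\<^esub> ?g"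
      unfolding l_def cone_simps fst_conv snd_conv a_minus_def mod_homD(2)[OF km(1) dy D.M.a_inv_closed[OF fx]]
        mod_hom_uminus[OF km(1) e(1) c(1) fx] mod_hom_uminus[OF sh d(1) c(1) dx] using cl(3) by simp
    also have "\<dots> = ?a \<oplus>\<^bsub>Ob E (n + 1)\<^esub> \<ominus>\<^bsub>Ob E (n + 1)\<^esub> ?b"
      unfolding t using cl(1-3) by (simp add: B.M.minus_add B.M.a_assoc B.M.l_neg)
    also have "\<dots> = diff E n (l n p)"
      unfolding l_def mod_homD(2)[OF c(2) km(3)[OF p(2)] A.M.a_inv_closed[OF sx]] mod_hom_uminus[OF c(2,1,1) sx] km(2)[OF p(2)] ..
    finally show "diff E n (l n p) = l (n + 1) (diff (cone X Y f) n p)" by simp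
  qed
  have "(k, \<lambda>n y. l n (cone_inj X n y)) \<in> homotopy_rel R Y E"
  proof (rule homotopy_cong[OF Y E k cochain_maps_comp[OF cone_inj_map[OF X Y f] lm]])
    fix n y assume y: "y \<in> el Y n"
    interpret A: right_module R "Ob E n" by (rule c)
    have "s (n + 1) \<zero>\<^bsub>Ob X (n + 1)\<^esub> = \<zero>\<^bsub>Ob E n\<^esub>" by (rule mod_hom_zero[OF sh d(1) c(1)])
    then show "k n y = l n (cone_inj X n y)" unfolding l_def cone_inj_def
      using km(3)[OF y] by (simp add: minus_zero_module[OF c(1)])
  qed
  then show ?thesis using lm by blast
qed

text \<open>The triangle of \<open>f\<close> is only isomorphic to the cone triangle of some
  \<open>f'\<close>. So the null-homotopy is carried along the isomorphisms, \<open>k\<close> is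
  extended over the cone of \<open>f'\<close>, and the totally acyclic term replaces that
  cone.\<close>

lemma Mor_tac_factor:
  assumes F: "Kclass R Z S f \<in> Mor_tac elts R Z S" and f: "f \<in> cochain_maps R Z S"
    and E: "is_complex R E" and k: "k \<in> cochain_maps R S E"
    and kf: "(\<lambda>n x. k n (f n x), zmap E) \<in> homotopy_rel R Z E"
  shows "\<exists>W g l. totally_acyclic elts R W \<and> g \<in> cochain_maps R S W \<and> l \<in> cochain_maps R W E \<and>
    (k, \<lambda>n x. l n (g n x)) \<in> homotopy_rel R S E"
proof -
  obtain W G H where W: "totally_acyclic elts R W" and tri: "exact_triangle elts R Z S W (Kclass R Z S f) G H"
    using F unfolding Mor_tac_def by blast
  have cZ: "is_complex R Z" and cS: "is_complex R S" and cW: "is_complex R W" and G: "G \<in> KHom R S W"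
    using tri unfolding exact_triangle_def KMod_def by auto
  obtain X Y f' \<alpha> \<beta> \<gamma> where XY: "X \<in> KMod elts R" "Y \<in> KMod elts R" and f': "f' \<in> cochain_maps R X Y"
    and iso: "\<alpha> \<in> Kisos R Z X" "\<beta> \<in> Kisos R S Y" "\<gamma> \<in> Kisos R W (cone X Y f')"
    and eq: "Kcomp R Z Y \<beta> (Kclass R Z S f) = Kcomp R Z Y (Kclass R X Y f') \<alpha>"
      "Kcomp R S (cone X Y f') \<gamma> G = Kcomp R S (cone X Y f') (Kclass R Y (cone X Y f') (cone_inj X)) \<beta>"
    using tri unfolding exact_triangle_def by (elim conjE bexE) (rule that; assumption)
  have X: "is_complex R X" and Y: "is_complex R Y" using XY unfolding KMod_def by auto
  let ?C = "cone X Y f'"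
  note C = is_complex_cone[OF X Y f'] and inj = cone_inj_map[OF X Y f']
  obtain \<alpha>' where a0: "\<alpha> \<in> KHom R Z X" "\<alpha>' \<in> KHom R X Z" "Kcomp R X X \<alpha> \<alpha>' = Kclass R X X (\<lambda>n x. x)"
    using iso(1) unfolding Kisos_def by blast
  obtain \<beta>' where b0: "\<beta> \<in> KHom R S Y" "\<beta>' \<in> KHom R Y S" "Kcomp R S S \<beta>' \<beta> = Kclass R S S (\<lambda>n x. x)"
    using iso(2) unfolding Kisos_def by blast
  have c0: "\<gamma> \<in> KHom R W ?C" using iso(3) unfolding Kisos_def by blast
  obtain a where a: "a \<in> cochain_maps R Z X" "\<alpha> = Kclass R Z X a" using KHomE[OF a0(1)] .
  obtain a' where a': "a' \<in> cochain_maps R X Z" "\<alpha>' = Kclass R X Z a'" using KHomE[OF a0(2)] .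
  obtain b where b: "b \<in> cochain_maps R S Y" "\<beta> = Kclass R S Y b" using KHomE[OF b0(1)] .
  obtain b' where b': "b' \<in> cochain_maps R Y S" "\<beta>' = Kclass R Y S b'" using KHomE[OF b0(2)] .
  obtain c where c: "c \<in> cochain_maps R W ?C" "\<gamma> = Kclass R W ?C c" using KHomE[OF c0] .
  obtain g where g: "g \<in> cochain_maps R S W" "G = Kclass R S W g" using KHomE[OF G] .
  have aa: "(\<lambda>n x. x, \<lambda>n x. a n (a' n x)) \<in> homotopy_rel R X X"
    using a0(3) unfolding a(2) a'(2) Kcomp_Kclass[OF X cZ X a'(1) a(1)]
    using Kclass_eq_iff[OF X X cochain_maps_id cochain_maps_comp[OF a'(1) a(1)]] by simp
  have bb: "(\<lambda>n x. b' n (b n x), \<lambda>n x. x) \<in> homotopy_rel R S S"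
    using b0(3) unfolding b(2) b'(2) Kcomp_Kclass[OF cS Y cS b(1) b'(1)]
    using Kclass_eq_iff[OF cS cS cochain_maps_comp[OF b(1) b'(1)] cochain_maps_id] by simp
  have fb: "(\<lambda>n x. f' n (a n x), \<lambda>n x. b n (f n x)) \<in> homotopy_rel R Z Y"
    using eq(1) unfolding a(2) b(2) Kcomp_Kclass[OF cZ cS Y f b(1)] Kcomp_Kclass[OF cZ X Y a(1) f']
    using Kclass_eq_iff[OF cZ Y cochain_maps_comp[OF a(1) f'] cochain_maps_comp[OF f b(1)]] by simp
  have gc: "(\<lambda>n x. cone_inj X n (b n x), \<lambda>n x. c n (g n x)) \<in> homotopy_rel R S ?C"
    using eq(2) unfolding c(2) g(2) b(2) Kcomp_Kclass[OF cS cW C g(1) c(1)] Kcomp_Kclass[OF cS Y C b(1) inj]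
    using Kclass_eq_iff[OF cS C cochain_maps_comp[OF b(1) inj] cochain_maps_comp[OF g(1) c(1)]] by simp
  note kb = cochain_maps_comp[OF b'(1) k] and fa = cochain_maps_comp[OF a'(1) f]
  \<comment> \<open>Up to homotopy \<open>f'\<close> is \<open>f\<close> conjugated by the
    isomorphisms, so \<open>k\<close> after \<open>b'\<close> annihilates it.\<close>
  have "(\<lambda>n x. f' n x, \<lambda>n x. b n (f n (a' n x))) \<in> homotopy_rel R X Y"
    by (rule homotopy_trans[OF X Y homotopy_left[OF X X Y aa f'] homotopy_right[OF X cZ Y fb a'(1)]])
  from homotopy_left[OF X Y E this kb]
  have 1: "(\<lambda>n x. k n (b' n (f' n x)), \<lambda>n x. k n (b' n (b n (f n (a' n x))))) \<in> homotopy_rel R X E" .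
  have 2: "(\<lambda>n x. k n (b' n (b n (f n (a' n x)))), \<lambda>n x. k n (f n (a' n x))) \<in> homotopy_rel R X E"
    by (rule homotopy_left[OF X cS E homotopy_right[OF X cS cS bb fa] k])
  have 3: "(\<lambda>n x. k n (f n (a' n x)), zmap E) \<in> homotopy_rel R X E"
    using homotopy_right[OF X cZ E kf a'(1)] unfolding zmap_def .
  have "(\<lambda>n x. k n (b' n (f' n x)), zmap E) \<in> homotopy_rel R X E"
    by (rule homotopy_trans[OF X E 1 homotopy_trans[OF X E 2 3]])
  then obtain l where l: "l \<in> cochain_maps R ?C E" "(\<lambda>n y. k n (b' n y), \<lambda>n y. l n (cone_inj X n y)) \<in> homotopy_rel R Y E"
    using cone_extension[OF X Y E f' kb] by blast
  have k1: "(k, \<lambda>n x. k n (b' n (b n x))) \<in> homotopy_rel R S E"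
    using homotopy_left[OF cS cS E homotopy_sym[OF cS cS bb] k] .
  have k2: "(\<lambda>n x. k n (b' n (b n x)), \<lambda>n x. l n (cone_inj X n (b n x))) \<in> homotopy_rel R S E"
    by (rule homotopy_right[OF cS Y E l(2) b(1)])
  have k3: "(\<lambda>n x. l n (cone_inj X n (b n x)), \<lambda>n x. l n (c n (g n x))) \<in> homotopy_rel R S E"
    by (rule homotopy_left[OF cS C E gc l(1)])
  have "(k, \<lambda>n x. l n (c n (g n x))) \<in> homotopy_rel R S E"
    by (rule homotopy_trans[OF cS E k1 homotopy_trans[OF cS E k2 k3]])
  then show ?thesis using W g(1) cochain_maps_comp[OF c(1) l(1)] by blast
qed

section \<open>From small Hom-sets to small sets of fractions\<close>

context universe_ring
begin

text \<open>The inverse of \<open>shf\<close>; it converts cocones into cones.\<close>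

definition ushf :: "('v, 'k) dgc => ('v, 'k) dgc" where
  "ushf X = \<lparr>bs = hs -` bs X, pj = sg' * pj X * sg, df = - (sg' * df X * sg)\<rparr>"

lemma ok_ushf: assumes X: "ok X" shows "ok (ushf X)"
proof -
  have i: "hs ` (hs -` bs X) = bs X" using hs_bij(2) by (simp add: surj_image_vimage_eq)
  have E: "pr (hs -` bs X) * sg' = sg' * pr (bs X)" "sg * pr (hs -` bs X) = pr (bs X) * sg"
    using blk_pr(6)[of "hs -` bs X"] blk_pr(3)[of "hs -` bs X"] unfolding i by simp_all
  note R = okr[OF X] blkr E E[THEN mult_rule]
  have "dg 0 (sg' * pj X * sg)" "dg 1 (sg' * df X * sg)"
    using dg_mult[OF dg_mult[OF dg_blk(6) okD(7)[OF X] refl] dg_blk(5) refl]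
      dg_mult[OF dg_mult[OF dg_blk(6) okD(8)[OF X] refl] dg_blk(5) refl] by simp_all
  then show ?thesis unfolding ok_def ushf_def by (simp add: mult.assoc R dg_uminus)
qed

lemma small_ushf: "sml (bs X) ==> sml (bs (ushf X))"
proof -
  assume "sml (bs X)"
  then have "sml (hs ` (hs -` bs X))" by (rule small_subset) blast
  then show ?thesis unfolding ushf_def dgm.select_convs by (rule small_inj_image) (rule inj_on_subset[OF hs_bij(1) subset_UNIV])
qed

lemma TA_ushf: "ok X ==> TA X ==> TA (ushf X)"
  by (rule TA_conj[of X _ sg' sg]) (simp_all add: ushf_def)

lemma sg_app: "rscale x e = x ==> app sg (app sg' x) = x" "rscale x e = x ==> app sg' (app sg x) = x"
  using app_cong[OF blk(6), of x] app_cong[OF blk(5), of x] by (simp_all del: blk)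

lemma blk_app: "rscale x e = x ==> app k1 (app j1 x) = x" "rscale x e = x ==> app k2 (app j2 x) = x"
    "app k1 (app j2 x) = 0" "app k2 (app j1 x) = 0"
  using app_cong[OF blk(1), of x] app_cong[OF blk(2), of x]
    app_cong[OF blk(3), of x] app_cong[OF blk(4), of x] by (simp_all del: blk)

text \<open>The apex of the fraction from \<open>S\<close> to \<open>X\<close> defined by a map \<open>S \<rightarrow> C\<close> is the cocone of
  \<open>S \<rightarrow> C \<rightarrow> C/X\<close>.\<close>

definition roof_apex where
  "roof_apex X C S h = cocn S (quo X C) (pr (- bs X) * h)"

text \<open>On a pair of \<open>s\<close> in \<open>S\<close> and \<open>t\<close> in the complement
  of \<open>X\<close> this is the component in \<open>X\<close> of \<open>h s - d t\<close>, with
  \<open>d\<close> the differential of \<open>C\<close>; the boundary term is what makes it a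
  cochain map.\<close>

definition roof_leg where
  "roof_leg X C h = pr (bs X) * h * k1 - pr (bs X) * df C * pr (- bs X) * k2"

text \<open>Seen in \<open>C\<close>, the leg to \<open>X\<close> is homotopic to \<open>h\<close>
  after the leg to \<open>S\<close>, the homotopy being the inclusion of the complement of
  \<open>X\<close>. In this sense the roof stands for the fraction given by
  \<open>h\<close>.\<close>

lemma roof_leg:
  assumes K: "Kext X C" and S: "ok S" and h: "hom S C h"
  shows "hom S (quo X C) (pr (- bs X) * h)" "hom (roof_apex X C S h) X (roof_leg X C h)"
    "null (roof_apex X C S h) C (h * (pj S * k1) - roof_leg X C h)"
proof -
  note k = KextD[OF K]
  note s = subD[OF k(5,1)] and q = quo_facts[OF k(1,2,5)]
  note R = okr[OF k(1)] okr[OF k(2)] okr[OF S] homD(1-3)[OF h] homD(1-3)[OF h, THEN mult_rule] s(2-9) s(2-9)[THEN mult_rule]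
    q q[THEN mult_rule] blkr
  have e: "eps * h = h"
    using mult_rule[OF okD(13)[OF k(2)], of h] homD(2)[OF h] by simp
  have c: "pr (- bs X) = eps - pr (bs X)" by (rule pr_Compl)
  have dq: "pr (- bs X) * df C * pr (- bs X) = pr (- bs X) * df C"
    unfolding mult.assoc q(6) by (simp add: right_diff_distrib q(3))
  show hT: "hom S (quo X C) (pr (- bs X) * h)"
    unfolding hom_def quo_def dgm.select_convs
  proof (intro conjI)
    have "(pj C - pj X) * (pr (- bs X) * h) = (pj C - pj X) * h"
      using mult_rule[OF q(2), of h] q(5) mult_rule[OF q(5), of h] by (simp add: left_diff_distrib)
    also have "\<dots> = pr (- bs X) * (pj C * h)" using mult_rule[OF q(1), of h] by simp
    finally show "(pj C - pj X) * (pr (- bs X) * h) = pr (- bs X) * h" unfolding homD(2)[OF h] .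
    show "pr (- bs X) * df C * (pr (- bs X) * h) = pr (- bs X) * h * df S"
      using mult_rule[OF dq, of h] homD(3)[OF h] by (simp add: mult.assoc)
    show "dg 0 (pr (- bs X) * h)" using dg_mult[OF dg_pr homD(4)[OF h]] by simp
  qed (simp add: mult.assoc homD(1)[OF h])
  have p: "pr (bs X) * pr (bs X) = pr (bs X)" "pr (bs X) * pr (- bs X) = 0" by simp_all
  have L: "pr (bs X) * df C = df X + pr (bs X) * df C * pr (- bs X)"
    unfolding mult.assoc q(6) right_diff_distrib using okD(9)[OF k(1)] by simp
  have L2: "pr (bs X) * df C * df C = 0" by (simp add: mult.assoc okD(6)[OF k(2)])
  let ?th = "pr (bs X) * df C * pr (- bs X)"
  have t1: "df X * (pr (bs X) * h) + ?th * h = pr (bs X) * h * df S"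
  proof -
    have "pr (bs X) * df C * h = df X * h + ?th * h" using arg_cong[OF L, of "\<lambda>f. f * h"] by (simp add: distrib_right)
    moreover have "df X * (pr (bs X) * h) = df X * h" by (rule mult_rule[OF okD(10)[OF k(1)]])
    ultimately show ?thesis using homD(3)[OF h] by (simp add: mult.assoc)
  qed
  have t2: "df X * ?th + ?th * (pr (- bs X) * df C) = 0"
  proof -
    have "pr (bs X) * df C * df C = (df X + ?th) * df C" using L by simp
    moreover have "df X * ?th = df X * df C * pr (- bs X)"
      using mult_rule[OF okD(10)[OF k(1)], of "df C * pr (- bs X)"] by (simp add: mult.assoc)
    moreover have "df X * df C * pr (- bs X) = df X * df C - df X * df X"
      unfolding mult.assoc q(6) by (simp add: right_diff_distrib)
    moreover have "?th * (pr (- bs X) * df C) = ?th * df C" by (simp add: mult.assoc)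
    ultimately show ?thesis using L2 okD(6)[OF k(1)] by (simp add: distrib_right)
  qed
  have pX: "pj X * pr (bs X) * df C = pr (bs X) * df C" "pj X * (pr (bs X) * h) = pr (bs X) * h"
  proof -
    have "pr (bs X) * (pj C * f) = pj X * f" for f by (rule mult_rule[OF s(3)])
    from this[of "df C"] this[of h] have "pr (bs X) * df C = pj X * df C" "pr (bs X) * h = pj X * h"
      by (simp_all add: okD(4)[OF k(2)] homD(2)[OF h])
    then show "pj X * pr (bs X) * df C = pr (bs X) * df C" "pj X * (pr (bs X) * h) = pr (bs X) * h"
      using mult_rule[OF okD(3)[OF k(1)], of h] okD(2)[OF k(1)] mult_rule[OF okD(2)[OF k(1)], of h] by (simp_all add: mult.assoc)
  qed
  have pT: "pr (- bs X) * (pj C - pj X) = pr (- bs X) * pj C" by (simp add: right_diff_distrib q(4))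
  have thp: "?th * (pj C - pj X) = ?th"
  proof -
    have "?th * (pj C - pj X) = pr (bs X) * df C * (pj C - pj X)" using pT q(1) by (simp add: mult.assoc)
    also have "\<dots> = pr (bs X) * (df C - df X)" by (simp add: mult.assoc right_diff_distrib okD(5)[OF k(2)] s(7))
    also have "\<dots> = ?th" using q(6) by (simp add: mult.assoc)
    finally show ?thesis .
  qed
  let ?G = "roof_leg X C h" and ?Z = "roof_apex X C S h"
  have G: "?G = pr (bs X) * h * k1 - ?th * k2" unfolding roof_leg_def ..
  have dth: "dg 1 ?th" using dg_mult[OF dg_mult[OF dg_pr okD(8)[OF k(2)] refl] dg_pr refl] by simp
  have Zp: "k1 * pj ?Z = pj S * k1" "k2 * pj ?Z = (pj C - pj X) * k2" "k1 * df ?Z = df S * k1"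
    "k2 * df ?Z = pr (- bs X) * h * k1 - pr (- bs X) * df C * k2"
  proof -
    have ee: "eps * (pr (- bs X) * f) = pr (- bs X) * f" for f :: "(int \<times> 'v, 'k) lin" by (rule mult_rule) simp
    show "k1 * pj ?Z = pj S * k1" "k2 * pj ?Z = (pj C - pj X) * k2" "k1 * df ?Z = df S * k1"
      "k2 * df ?Z = pr (- bs X) * h * k1 - pr (- bs X) * df C * k2"
      unfolding roof_apex_def cocn_def quo_def dgm.select_convs
      using mult_rule[OF okD(13)[OF S]] mult_rule[OF okD(14)[OF S]] mult_rule[OF okD(13)[OF k(1)]] mult_rule[OF okD(13)[OF k(2)]]
      by (simp_all add: algebra_simps blkr ee)
  qed
  show "hom ?Z X ?G"
    unfolding hom_def
  proof (intro conjI)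
    show "?G * pj ?Z = ?G"
      unfolding G using Zp(1,2) homD(1)[OF h] thp mult_rule[OF thp, of k2] mult_rule[OF homD(1)[OF h], of k1]
      by (simp add: left_diff_distrib mult.assoc)
    show "pj X * ?G = ?G"
    proof -
      have "pj X * (pr (bs X) * h * k1) = pr (bs X) * h * k1" using arg_cong[OF pX(2), of "\<lambda>f. f * k1"] by (simp add: mult.assoc)
      moreover have "pj X * (?th * k2) = ?th * k2"
        using arg_cong[OF pX(1), of "\<lambda>f. f * (pr (- bs X) * k2)"] by (simp add: mult.assoc)
      ultimately show ?thesis unfolding G by (simp add: right_diff_distrib)
    qed
    have "dg 0 (pr (bs X) * h * k1)" "dg 0 (?th * k2)"
      using dg_mult[OF dg_mult[OF dg_pr homD(4)[OF h] refl] dg_blk(3) refl] dg_mult[OF dth dg_blk(4) refl] by simp_all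
    then show "dg 0 ?G" unfolding G by (rule dg_diff)
    have "?G * df ?Z = pr (bs X) * h * (k1 * df ?Z) - ?th * (k2 * df ?Z)" unfolding G by (simp add: left_diff_distrib mult.assoc)
    also have "\<dots> = pr (bs X) * h * df S * k1 - ?th * (pr (- bs X) * h) * k1 + ?th * (pr (- bs X) * df C) * k2"
      unfolding Zp by (simp add: right_diff_distrib mult.assoc)
    also have "?th * (pr (- bs X) * h) = ?th * h" by (simp add: mult.assoc)
    also have "pr (bs X) * h * df S * k1 - ?th * h * k1 = df X * (pr (bs X) * h) * k1"
      unfolding t1[symmetric] by (simp add: distrib_right)
    also have "?th * (pr (- bs X) * df C) = - (df X * ?th)" using t2 by (simp add: add_eq_0_iff2)
    finally show "df X * ?G = ?G * df ?Z" unfolding G by (simp add: right_diff_distrib mult.assoc)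
  qed
  let ?s = "pr (- bs X) * pj C * k2"
  have "h * (pj S * k1) - ?G = df C * ?s + ?s * df ?Z"
  proof -
    have hk: "h * (pj S * k1) = h * k1" by (rule mult_rule[OF homD(1)[OF h]])
    have h2: "h = pr (bs X) * h + pr (- bs X) * h" unfolding c left_diff_distrib e by simp
    have pc: "pr (- bs X) * pj C = pj C * pr (- bs X)" using q(1,2) by simp
    have 1: "df C * ?s = df C * pr (- bs X) * k2"
      using arg_cong[OF pc, of "\<lambda>f. df C * f * k2"] mult_rule[OF okD(5)[OF k(2)], of "pr (- bs X) * k2"] by (simp add: mult.assoc)
    have pp: "pr (- bs X) * pj C * pr (- bs X) = pr (- bs X) * pj C" unfolding mult.assoc q(2) pT ..
    have "?s * df ?Z = pr (- bs X) * pj C * pr (- bs X) * h * k1 - pr (- bs X) * pj C * pr (- bs X) * df C * k2"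
      using Zp(4) by (simp add: mult.assoc right_diff_distrib)
    also have "\<dots> = pr (- bs X) * (pj C * h) * k1 - pr (- bs X) * (pj C * df C) * k2" unfolding pp by (simp add: mult.assoc)
    finally have 2: "?s * df ?Z = pr (- bs X) * h * k1 - pr (- bs X) * df C * k2"
      unfolding homD(2)[OF h] okD(4)[OF k(2)] .
    have "df C * pr (- bs X) = pr (- bs X) * df C * pr (- bs X) + ?th"
      using okD(14)[OF k(2)] mult_rule[OF okD(14)[OF k(2)], of "pr (- bs X)"] unfolding c by (simp add: left_diff_distrib mult.assoc)
    then have 3: "df C * pr (- bs X) * k2 = pr (- bs X) * df C * k2 + ?th * k2" unfolding dq by (simp add: distrib_right)
    have "h * k1 = pr (bs X) * h * k1 + pr (- bs X) * h * k1" using arg_cong[OF h2, of "\<lambda>f. f * k1"] by (simp add: distrib_right)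
    then show ?thesis unfolding hk G 1 2 3 by (simp add: algebra_simps)
  qed
  moreover have "?s * pj ?Z = ?s"
  proof -
    have "?s * pj ?Z = pr (- bs X) * pj C * (pj C - pj X) * k2" using Zp(2) by (simp add: mult.assoc)
    also have "pr (- bs X) * pj C * (pj C - pj X) = pr (- bs X) * (pj C - pj X)"
      by (simp add: mult.assoc right_diff_distrib okD(3)[OF k(2)] s(5))
    finally show ?thesis unfolding pT .
  qed
  moreover have "pj C * ?s = ?s"
  proof -
    have "pr (- bs X) * pj C = pj C * pr (- bs X)" using q(1,2) by simp
    then show ?thesis using mult_rule[OF okD(3)[OF k(2)], of "pr (- bs X) * k2"] by (simp add: mult.assoc[symmetric])
  qed
  moreover have "dg (- 1) ?s" using dg_mult[OF dg_mult[OF dg_pr okD(7)[OF k(2)] refl] dg_blk(4) refl] by simp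
  ultimately show "null ?Z C (h * (pj S * k1) - ?G)" unfolding null_def by blast
qed

text \<open>On a refinement \<open>W\<close> of the roof the map \<open>j * h\<close>, composed with
  the leg to \<open>S\<close>, is homotopic to the leg to \<open>X\<close>. Two fractions with a
  common refinement therefore agree after composition with the leg to \<open>S\<close>.\<close>

lemma fraction_collapse:
  assumes K: "Kext X C" and S: "ok S" and h: "hom S C h" and E: "Kext X E" and j: "hom C E j" "j * pr (bs X) = pj X"
    and U: "hom W (roof_apex X C S h) U" and F: "null W S (pj S * k1 * U - F)" and G: "null W X (roof_leg X C h * U - G)"
  shows "null W E (j * h * F - G)"
proof -
  note k = KextD[OF K] and kE = KextD[OF E]
  let ?G = "roof_leg X C h"
  have jX: "j * pj X = pj X" using mult_rule[OF j(2), of "pj X"] okD(1,3)[OF k(1)] by simp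
  have jG: "j * ?G = ?G" using mult_rule[OF jX, of ?G] homD(2)[OF roof_leg(2)[OF K S h]] by simp
  have 1: "null W E (j * h * (pj S * k1 * U - F))" by (rule null_comp_left[OF F hom_comp[OF h j(1)]])
  have 2: "null W E (j * (h * (pj S * k1) - ?G) * U)"
    by (rule null_comp_right[OF null_comp_left[OF roof_leg(3)[OF K S h] j(1)] U])
  have 3: "null W E (?G * U - G)" by (rule null_sub[OF G kE(5) k(1)])
  have eq: "j * h * F - G = j * (h * (pj S * k1) - ?G) * U - j * h * (pj S * k1 * U - F) + (?G * U - G)"
  proof -
    have "j * (h * (pj S * k1) - ?G) * U = j * h * (pj S * k1 * U) - ?G * U"
      unfolding right_diff_distrib left_diff_distrib jG by (simp add: mult.assoc)
    then show ?thesis by (simp add: right_diff_distrib)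
  qed
  show ?thesis unfolding eq by (rule null_add[OF null_diff[OF 2 1] 3])
qed

end

section \<open>Roofs in the Verdier quotient that represent fractions\<close>

context ring_setting
begin

lemma rep_comp:
  "rep X \<phi> \<chi> f F ==> rep Y \<chi> \<psi> g G ==> f \<in> cochain_maps R X Y ==> rep X \<phi> \<psi> (\<lambda>n x. g n (f n x)) (G * F)"
  unfolding rep_def by (simp add: cochain_mapsD(3))

lemma rep_id: "model X T \<phi> ==> rep X \<phi> \<phi> (\<lambda>n x. x) (pj T)"
  unfolding rep_def using modelD(4)[of X T \<phi>] unfolding Vn_def by blast

lemma rep_zmap: "model Y U \<chi> ==> rep X \<phi> \<chi> (zmap Y) 0"
  unfolding rep_def zmap_def by (simp add: model_zero)

lemma ushf_Vn:
  assumes T: "ok T" shows "v \<in> Vn (ushf T) n \<longleftrightarrow> rscale v ee = v \<and> app sg v \<in> Vn T (n + 1)"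
proof
  assume v: "v \<in> Vn (ushf T) n"
  then have e: "rscale v ee = v" unfolding Vn_def vs_iff by blast
  have p: "app sg' (app (pj T) (app sg v)) = v" using v unfolding Vn_def ushf_def by simp
  have "app (pj T) (app sg v) = app sg (app sg' (app (pj T) (app sg v)))"
    using sg_app(1)[of "app (pj T) (app sg v)"] app_okr(5)[OF T, of "app sg v"] unfolding vs_iff by simp
  then have "app (pj T) (app sg v) = app sg v" unfolding p .
  moreover have "app sg v \<in> vs (lev (n + 1))" using v dg_vs[OF dg_blk(5)] unfolding Vn_def by blast
  ultimately show "rscale v ee = v \<and> app sg v \<in> Vn T (n + 1)" using e unfolding Vn_def by blast
next
  assume v: "rscale v ee = v \<and> app sg v \<in> Vn T (n + 1)"
  have s: "app sg' (app sg v) = v" using sg_app(2) v by blast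
  have "app sg' (app sg v) \<in> vs (lev (n + 1 + - 1))" using v dg_vs[OF dg_blk(6)] unfolding Vn_def by blast
  then have "v \<in> vs (lev n)" unfolding s by simp
  moreover have "app (pj (ushf T)) v = v" using v s unfolding Vn_def ushf_def by simp
  ultimately show "v \<in> Vn (ushf T) n" unfolding Vn_def by blast
qed

lemma cocn_Vn:
  assumes A: "ok A" and B: "ok B"
  shows "v \<in> Vn (cocn A B g) n \<longleftrightarrow>
    v = app j1 (app k1 v) + app j2 (app k2 v) \<and> app k1 v \<in> Vn A n \<and> app k2 v \<in> Vn B (n - 1)"
proof
  assume v: "v \<in> Vn (cocn A B g) n"
  have p: "app j1 (app (pj A) (app k1 v)) + app j2 (app (pj B) (app k2 v)) = v" using v unfolding Vn_def cocn_def by simp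
  have a: "rscale (app (pj A) (app k1 v)) ee = app (pj A) (app k1 v)" "rscale (app (pj B) (app k2 v)) ee = app (pj B) (app k2 v)"
    using app_okr(5)[OF A, of "app k1 v"] app_okr(5)[OF B, of "app k2 v"] unfolding vs_iff by simp_all
  have "app k1 v = app k1 (app j1 (app (pj A) (app k1 v)) + app j2 (app (pj B) (app k2 v)))" unfolding p ..
  then have 1: "app k1 v = app (pj A) (app k1 v)" using blk_app(1)[OF a(1)] blk_app(3)[of "app (pj B) (app k2 v)"] by simp
  have "app k2 v = app k2 (app j1 (app (pj A) (app k1 v)) + app j2 (app (pj B) (app k2 v)))" unfolding p ..
  then have 2: "app k2 v = app (pj B) (app k2 v)" using blk_app(2)[OF a(2)] blk_app(4)[of "app (pj A) (app k1 v)"] by simp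
  have "app k1 v \<in> vs (lev (n + 0))" "app k2 v \<in> vs (lev (n + - 1))"
    using v dg_vs[OF dg_blk(3)] dg_vs[OF dg_blk(4)] unfolding Vn_def by blast+
  then show "v = app j1 (app k1 v) + app j2 (app k2 v) \<and> app k1 v \<in> Vn A n \<and> app k2 v \<in> Vn B (n - 1)"
    unfolding Vn_def using 1 2 p by simp
next
  assume v: "v = app j1 (app k1 v) + app j2 (app k2 v) \<and> app k1 v \<in> Vn A n \<and> app k2 v \<in> Vn B (n - 1)"
  have "app j1 (app k1 v) \<in> vs (lev (n + 0))" "app j2 (app k2 v) \<in> vs (lev (n - 1 + 1))"
    using v dg_vs[OF dg_blk(1)] dg_vs[OF dg_blk(2)] unfolding Vn_def by blast+
  then have "app j1 (app k1 v) + app j2 (app k2 v) \<in> vs (lev n)" by simp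
  then have l: "v \<in> vs (lev n)" using v by simp
  have "app (pj (cocn A B g)) v = app j1 (app (pj A) (app k1 v)) + app j2 (app (pj B) (app k2 v))" unfolding cocn_def by simp
  also have "\<dots> = v" using v unfolding Vn_def by simp
  finally show "v \<in> Vn (cocn A B g) n" using l unfolding Vn_def by blast
qed

text \<open>The cone is the cocone lowered by one degree, and the sign in \<open>ushf\<close> turns
  the cocone differential into that of the cone. So the matrix model comes from the cocone already
  at hand.\<close>

lemma cone_model:
  assumes Z: "model Z T \<phi>" and S: "model S U \<chi>" and F: "hom T U F" and f: "f \<in> cochain_maps R Z S" "rep Z \<phi> \<chi> f F"
  shows "model (cone Z S f) (ushf (cocn T U F)) (\<lambda>n p. app sg' (app j1 (\<phi> (n + 1) (fst p)) + app j2 (\<chi> n (snd p))))"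
proof -
  note d = modelD[OF Z] and e = modelD[OF S] and fm = cochain_mapsD[OF f(1)]
  let ?C = "cocn T U F"
  let ?om = "\<lambda>n p. app sg' (app j1 (\<phi> (n + 1) (fst p)) + app j2 (\<chi> n (snd p)))"
  have ok: "ok ?C" by (rule ok_cocn[OF d(2) e(2) F])
  have w: "rscale (app j1 a + app j2 b) ee = app j1 a + app j2 b" "app k1 (app j1 a + app j2 b) = a" "app k2 (app j1 a + app j2 b) = b"
    if "rscale a ee = a" "rscale b ee = b" for a b
    using that blk_app[of a] blk_app[of b] by (simp_all flip: app_rscale)
  have inV: "app sg' (app j1 a + app j2 b) \<in> Vn (ushf ?C) n" "app sg (app sg' (app j1 a + app j2 b)) = app j1 a + app j2 b"
    if ab: "a \<in> Vn T (n + 1)" "b \<in> Vn U n" for a b n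
  proof -
    note w = w[OF Vn_e[OF d(2) ab(1)] Vn_e[OF e(2) ab(2)]]
    show s: "app sg (app sg' (app j1 a + app j2 b)) = app j1 a + app j2 b" by (rule sg_app(1)[OF w(1)])
    have "app j1 a + app j2 b \<in> Vn ?C (n + 1)" unfolding cocn_Vn[OF d(2) e(2)] w(2,3) using ab by simp
    moreover have "rscale (app sg' (app j1 a + app j2 b)) ee = app sg' (app j1 a + app j2 b)"
      unfolding app_rscale[symmetric] w(1) ..
    ultimately show "app sg' (app j1 a + app j2 b) \<in> Vn (ushf ?C) n" unfolding ushf_Vn[OF ok] s by blast
  qed
  have hm: "?om n \<in> mod_hom R (mod_sum (Ob Z (n + 1)) (Ob S n)) (Vmod (Vn (ushf ?C) n))" for n
  proof (rule mod_homI)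
    show "?om n p \<in> carrier (Vmod (Vn (ushf ?C) n))" if "p \<in> carrier (mod_sum (Ob Z (n + 1)) (Ob S n))" for p
      using inV(1)[OF d(4) e(4)] that unfolding mod_sum_carrier(2) by simp
  qed (auto simp: mod_sum_def d(5,6) e(5,6) algebra_simps)
  have bij: "bij_betw (?om n) (carrier (mod_sum (Ob Z (n + 1)) (Ob S n))) (Vn (ushf ?C) n)" for n
    unfolding bij_betw_def
  proof
    show "inj_on (?om n) (carrier (mod_sum (Ob Z (n + 1)) (Ob S n)))"
    proof (rule inj_onI)
      fix p q assume pq: "p \<in> carrier (mod_sum (Ob Z (n + 1)) (Ob S n))" "q \<in> carrier (mod_sum (Ob Z (n + 1)) (Ob S n))"
        and eq: "?om n p = ?om n q"
      then have c: "fst p \<in> el Z (n + 1)" "snd p \<in> el S n" "fst q \<in> el Z (n + 1)" "snd q \<in> el S n"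
        unfolding mod_sum_carrier(2) by auto
      note V = d(4)[OF c(1)] e(4)[OF c(2)] d(4)[OF c(3)] e(4)[OF c(4)]
      have "app sg (?om n p) = app sg (?om n q)" unfolding eq ..
      then have E: "app j1 (\<phi> (n + 1) (fst p)) + app j2 (\<chi> n (snd p)) = app j1 (\<phi> (n + 1) (fst q)) + app j2 (\<chi> n (snd q))"
        unfolding inV(2)[OF V(1,2)] inV(2)[OF V(3,4)] .
      note wp = w[OF Vn_e[OF d(2) V(1)] Vn_e[OF e(2) V(2)]] and wq = w[OF Vn_e[OF d(2) V(3)] Vn_e[OF e(2) V(4)]]
      have "\<phi> (n + 1) (fst p) = \<phi> (n + 1) (fst q)" "\<chi> n (snd p) = \<chi> n (snd q)"
        using arg_cong[OF E, of "app k1"] arg_cong[OF E, of "app k2"] unfolding wp wq .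
      then have "fst p = fst q" "snd p = snd q" using inj_onD[OF d(9)] inj_onD[OF e(9)] c by blast+
      then show "p = q" by (rule prod_eqI)
    qed
    show "?om n ` carrier (mod_sum (Ob Z (n + 1)) (Ob S n)) = Vn (ushf ?C) n"
    proof
      show "?om n ` carrier (mod_sum (Ob Z (n + 1)) (Ob S n)) \<subseteq> Vn (ushf ?C) n"
        using mod_homD(1)[OF hm] by auto
      show "Vn (ushf ?C) n \<subseteq> ?om n ` carrier (mod_sum (Ob Z (n + 1)) (Ob S n))"
      proof
        fix v assume "v \<in> Vn (ushf ?C) n"
        then have v: "rscale v ee = v" "app sg v \<in> Vn ?C (n + 1)" unfolding ushf_Vn[OF ok] by auto
        then have u: "app sg v = app j1 (app k1 (app sg v)) + app j2 (app k2 (app sg v))"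
          "app k1 (app sg v) \<in> Vn T (n + 1)" "app k2 (app sg v) \<in> Vn U n" unfolding cocn_Vn[OF d(2) e(2)] by auto
        obtain x y where xy: "x \<in> el Z (n + 1)" "\<phi> (n + 1) x = app k1 (app sg v)"
          "y \<in> el S n" "\<chi> n y = app k2 (app sg v)" using d(8)[OF u(2)] e(8)[OF u(3)] by blast
        have "?om n (x, y) = v" using xy(2,4) u(1) sg_app(2)[OF v(1)] by simp
        then show "v \<in> ?om n ` carrier (mod_sum (Ob Z (n + 1)) (Ob S n))"
          using xy(1,3) by (intro image_eqI[of _ _ "(x, y)"]) (simp_all add: mod_sum_carrier(1))
      qed
    qed
  qed
  have cm: "app (df (ushf ?C)) (?om n p) = ?om (n + 1) (diff (cone Z S f) n p)" if p: "p \<in> carrier (Ob (cone Z S f) n)" for n p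
  proof -
    have c: "fst p \<in> el Z (n + 1)" "snd p \<in> el S n" using p unfolding cone_simps mod_sum_carrier(2) by auto
    let ?a = "\<phi> (n + 1) (fst p)" and ?b = "\<chi> n (snd p)"
    note V = d(4)[OF c(1)] e(4)[OF c(2)]
    note wp = w[OF Vn_e[OF d(2) V(1)] Vn_e[OF e(2) V(2)]]
    have dx: "diff Z (n + 1) (fst p) \<in> el Z (n + 1 + 1)" by (rule mod_homD(1)[OF d(12) c(1)])
    have dy: "diff S n (snd p) \<in> el S (n + 1)" by (rule mod_homD(1)[OF e(12) c(2)])
    have fx: "f (n + 1) (fst p) \<in> el S (n + 1)" by (rule fm(3)[OF c(1)])
    have "app (df (ushf ?C)) (?om n p) = - app sg' (app (df ?C) (app j1 ?a + app j2 ?b))"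
      unfolding ushf_def dgm.select_convs app_lin_simps inV(2)[OF V] ..
    also have "app (df ?C) (app j1 ?a + app j2 ?b) = app j1 (app (df T) ?a) + app j2 (app F ?a) - app j2 (app (df U) ?b)"
      unfolding cocn_def dgm.select_convs app_lin_simps wp(2,3) ..
    also have "\<dots> = - (app j1 (- \<phi> (n + 1 + 1) (diff Z (n + 1) (fst p))) +
        app j2 (\<chi> (n + 1) (diff S n (snd p)) - \<chi> (n + 1) (f (n + 1) (fst p))))"
      using d(7)[OF c(1)] e(7)[OF c(2)] f(2) c(1) unfolding rep_def by simp
    also have "\<dots> = - (app j1 (\<phi> (n + 1 + 1) (\<ominus>\<^bsub>Ob Z (n + 1 + 1)\<^esub> diff Z (n + 1) (fst p))) +
        app j2 (\<chi> (n + 1) (diff S n (snd p) \<ominus>\<^bsub>Ob S (n + 1)\<^esub> f (n + 1) (fst p))))"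
      unfolding model_minus(2)[OF Z dx dx] model_minus(1)[OF S dy fx] ..
    finally show ?thesis unfolding cone_simps by simp
  qed
  have "siso (cone Z S f) (icx (ushf ?C)) ?om"
    unfolding siso_def icx_def rmiso_def cone_simps(1)
    using hm bij cm unfolding cone_simps(1) by simp
  then show ?thesis unfolding model_def
    using is_complex_cone[OF d(1) e(1) f(1)] ok_ushf[OF ok] small_ushf[OF small_cocn[OF d(3) e(3)]] by blast
qed

text \<open>The cone lives on pairs, but its matrix model has a copy \<open>W\<close> on
  \<open>'v\<close>. With identities at \<open>Z\<close> and \<open>S\<close> and this copy in third
  place, the cone triangle of \<open>f\<close> itself witnesses exactness.\<close>

lemma Mor_tac_cocn:
  fixes Z S :: "('r, 'v) cochain"
  assumes Z: "model Z T \<phi>" and S: "model S U \<chi>" and F: "hom T U F" and f: "f \<in> cochain_maps R Z S" "rep Z \<phi> \<chi> f F"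
    and t: "TA (cocn T U F)"
  shows "Kclass R Z S f \<in> Mor_tac elts R Z S"
proof -
  note d = modelD[OF Z] and e = modelD[OF S]
  let ?C = "cone Z S f" and ?W = "ushf (cocn T U F)"
  obtain \<omega> where C: "model ?C ?W \<omega>" using cone_model[OF Z S F f] by blast
  note c = modelD[OF C]
  obtain W :: "('r, 'v) cochain" and \<psi> where W: "model W ?W \<psi>" using model_exists[OF c(2,3)] by blast
  note w = modelD[OF W]
  have ok: "ok (cocn T U F)" by (rule ok_cocn[OF d(2) e(2) F])
  have ta: "totally_acyclic elts R W" by (rule totally_acyclic_if_TA[OF W TA_ushf[OF ok t]])
  have i: "hom ?W ?W (pj ?W)" by (rule hom_id[OF c(2)])
  obtain \<gamma> where g: "\<gamma> \<in> cochain_maps R W ?C" "rep W \<psi> \<omega> \<gamma> (pj ?W)" using hom_to_cochain[OF W C i] by blast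
  obtain \<delta> where dl: "\<delta> \<in> cochain_maps R ?C W" "rep ?C \<omega> \<psi> \<delta> (pj ?W)" using hom_to_cochain[OF C W i] by blast
  have pp: "pj ?W * pj ?W = pj ?W" by (rule okD(3)[OF c(2)])
  have n0: "null ?W ?W (pj ?W - pj ?W)" using null_zero by simp
  note gd = cochain_maps_comp[OF dl(1) g(1)] and dg = cochain_maps_comp[OF g(1) dl(1)]
  have r1: "(\<lambda>n x. \<gamma> n (\<delta> n x), \<lambda>n x. x) \<in> homotopy_rel R ?C ?C"
    unfolding homotopy_iff_null[OF C C gd cochain_maps_id i rep_comp[OF dl(2) g(2) dl(1), unfolded pp] i rep_id[OF C]] by (rule n0)
  have r2: "(\<lambda>n x. \<delta> n (\<gamma> n x), \<lambda>n x. x) \<in> homotopy_rel R W W"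
    unfolding homotopy_iff_null[OF W W dg cochain_maps_id i rep_comp[OF g(2) dl(2) g(1), unfolded pp] i rep_id[OF W]] by (rule n0)
  have giso: "Kclass R W ?C \<gamma> \<in> Kisos R W ?C"
  proof -
    have "Kcomp R W W (Kclass R ?C W \<delta>) (Kclass R W ?C \<gamma>) = Kclass R W W (\<lambda>n x. x)"
      unfolding Kcomp_Kclass[OF w(1) c(1) w(1) g(1) dl(1)] using Kclass_eq_iff[OF w(1) w(1) dg cochain_maps_id] r2 by simp
    moreover have "Kcomp R ?C ?C (Kclass R W ?C \<gamma>) (Kclass R ?C W \<delta>) = Kclass R ?C ?C (\<lambda>n x. x)"
      unfolding Kcomp_Kclass[OF c(1) w(1) c(1) dl(1) g(1)] using Kclass_eq_iff[OF c(1) c(1) gd cochain_maps_id] r1 by simp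
    ultimately show ?thesis unfolding Kisos_def using Kclass_in_KHom[OF g(1)] Kclass_in_KHom[OF dl(1)] by blast
  qed
  let ?sh = "shift (- 1) Z"
  note sh = is_complex_shift[OF d(1)] and inj = cone_inj_map[OF d(1) e(1) f(1)] and pro = cone_proj_map[of R Z S f]
  note gi = cochain_maps_comp[OF inj dl(1)] and ph = cochain_maps_comp[OF g(1) pro]
  let ?G = "Kclass R S W (\<lambda>n x. \<delta> n (cone_inj Z n x))" and ?H = "Kclass R W ?sh (\<lambda>n x. cone_proj n (\<gamma> n x))"
  have eq1: "Kcomp R Z S (Kclass R S S (\<lambda>n x. x)) (Kclass R Z S f) = Kcomp R Z S (Kclass R Z S f) (Kclass R Z Z (\<lambda>n x. x))"
    unfolding Kcomp_Kclass[OF d(1) e(1) e(1) f(1) cochain_maps_id] Kcomp_Kclass[OF d(1) d(1) e(1) cochain_maps_id f(1)] ..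
  have eq2: "Kcomp R S ?C (Kclass R W ?C \<gamma>) ?G = Kcomp R S ?C (Kclass R S ?C (cone_inj Z)) (Kclass R S S (\<lambda>n x. x))"
  proof -
    have "(\<lambda>n x. \<gamma> n (\<delta> n (cone_inj Z n x)), \<lambda>n x. cone_inj Z n x) \<in> homotopy_rel R S ?C"
      by (rule homotopy_right[OF e(1) c(1) c(1) r1 inj])
    then show ?thesis
      unfolding Kcomp_Kclass[OF e(1) w(1) c(1) gi g(1)] Kcomp_Kclass[OF e(1) e(1) c(1) cochain_maps_id inj]
      using Kclass_eq_iff[OF e(1) c(1) cochain_maps_comp[OF gi g(1)] inj] by simp
  qed
  have eq3: "Kcomp R W ?sh (Kshift (- 1) (Kclass R Z Z (\<lambda>n x. x))) ?H = Kcomp R W ?sh (Kclass R ?C ?sh cone_proj) (Kclass R W ?C \<gamma>)"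
    unfolding Kshift_id[OF d(1) w(1) ph] Kcomp_Kclass[OF w(1) c(1) sh g(1) pro] ..
  have "exact_triangle elts R Z S W (Kclass R Z S f) ?G ?H"
    unfolding exact_triangle_def
    by (intro conjI model_KProj(3)[OF Z] model_KProj(3)[OF S] model_KProj(3)[OF W] Kclass_in_KHom f(1) gi ph
        bexI[OF _ model_KProj(3)[OF Z]] bexI[OF _ model_KProj(3)[OF S]] bexI[OF _ f(1)]
        bexI[OF _ Kclass_id_iso[OF d(1)]] bexI[OF _ Kclass_id_iso[OF e(1)]] bexI[OF _ giso] eq1 eq2 eq3)
  then show ?thesis unfolding Mor_tac_def
    using ta Kclass_in_KHom[OF f(1)] model_KProj(1)[OF Z] model_KProj(1)[OF S] by blast
qed

lemma roof_rel_refl: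
  assumes X: "is_complex R X" and Y: "is_complex R Y" and r: "r \<in> roofs elts R X Y"
  shows "(r, r) \<in> roof_rel elts R X Y"
proof -
  obtain Z F G where r': "r = (Z, F, G)" by (cases r)
  have Z: "is_complex R Z" and F: "F \<in> KHom R Z X" and G: "G \<in> KHom R Z Y"
    using r unfolding r' roofs_def Mor_tac_def KProj_def by auto
  obtain f where f: "f \<in> cochain_maps R Z X" "F = Kclass R Z X f" using KHomE[OF F] .
  obtain g where g: "g \<in> cochain_maps R Z Y" "G = Kclass R Z Y g" using KHomE[OF G] .
  let ?i = "Kclass R Z Z (\<lambda>n x. x)"
  have eq: "Kcomp R Z X F ?i = F" "Kcomp R Z Y G ?i = G"
    unfolding f(2) g(2) Kcomp_Kclass[OF Z Z X cochain_maps_id f(1)] Kcomp_Kclass[OF Z Z Y cochain_maps_id g(1)] by simp_all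
  have i: "?i \<in> KHom R Z Z" by (rule Kclass_in_KHom[OF cochain_maps_id])
  have "\<exists>Z'' F'' G''. (Z'', F'', G'') \<in> roofs elts R X Y \<and> (\<exists>U\<in>KHom R Z'' Z. \<exists>V\<in>KHom R Z'' Z.
      Kcomp R Z'' X F U = F'' \<and> F'' = Kcomp R Z'' X F V \<and> Kcomp R Z'' Y G U = G'' \<and> G'' = Kcomp R Z'' Y G V)"
    by (rule exI[of _ Z], rule exI[of _ F], rule exI[of _ G], intro conjI bexI[OF _ i] r[unfolded r']) (simp_all only: eq)
  then show ?thesis unfolding roof_rel_def r' mem_Collect_eq prod.case using r[unfolded r'] by (intro conjI)
qed

text \<open>A relation rather than a function, since models and representing cochain maps are
  obtained only by existence statements.\<close>

definition special_roof where
  "special_roof X S Xm \<phi>X Sm \<phi>S C h \<rho> \<longleftrightarrow> (\<exists>Z \<phi> f g. \<rho> = (Z, Kclass R Z Sm f, Kclass R Z Xm g) \<and>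
     model Z (roof_apex X C S h) \<phi> \<and> f \<in> cochain_maps R Z Sm \<and> g \<in> cochain_maps R Z Xm \<and>
     rep Z \<phi> \<phi>S f (pj S * k1) \<and> rep Z \<phi> \<phi>X g (roof_leg X C h))"

lemma special_roof_exists:
  fixes Xm Sm :: "('r, 'v) cochain"
  assumes mX: "model Xm X \<phi>X" and mS: "model Sm S \<phi>S" and K: "Kext X C" and h: "hom S C h"
  shows "\<exists>\<rho>\<in>roofs elts R Sm Xm. special_roof X S Xm \<phi>X Sm \<phi>S C h \<rho>"
proof -
  note k = KextD[OF K]
  note oS = modelD(2,3)[OF mS]
  have T: "ok (quo X C)" "TA (quo X C)" by (rule ok_quo[OF k(1,2,5)]) (rule TA_quo[OF k(1,2,5,6)])
  have sT: "sml (bs (quo X C))" unfolding quo_def using small_subset[OF k(4)] by simp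
  note L = roof_leg[OF K oS(1) h]
  let ?A = "roof_apex X C S h"
  have A: "ok ?A" "sml (bs ?A)" unfolding roof_apex_def by (rule ok_cocn[OF oS(1) T(1) L(1)]) (rule small_cocn[OF oS(2) sT])
  obtain Z :: "('r, 'v) cochain" and \<phi> where Z: "model Z ?A \<phi>" using model_exists[OF A] by blast
  have F: "hom ?A S (pj S * k1)" unfolding roof_apex_def by (rule cocn_proj[OF oS(1) T(1) L(1)])
  obtain f where f: "f \<in> cochain_maps R Z Sm" "rep Z \<phi> \<phi>S f (pj S * k1)" using hom_to_cochain[OF Z mS F] by blast
  obtain g where g: "g \<in> cochain_maps R Z Xm" "rep Z \<phi> \<phi>X g (roof_leg X C h)" using hom_to_cochain[OF Z mX L(2)] by blast
  have "TA (cocn ?A S (pj S * k1))" unfolding roof_apex_def by (rule TA_cocn_proj[OF oS(1) T L(1)])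
  then have "Kclass R Z Sm f \<in> Mor_tac elts R Z Sm" by (rule Mor_tac_cocn[OF Z mS F f])
  then have "(Z, Kclass R Z Sm f, Kclass R Z Xm g) \<in> roofs elts R Sm Xm"
    unfolding roofs_def using model_KProj(1)[OF Z] Kclass_in_KHom[OF g(1)] by simp
  then show ?thesis unfolding special_roof_def using Z f g by blast
qed

text \<open>On a common refinement \<open>Y\<close> the difference of the two maps to
  \<open>E\<close> is null-homotopic after the leg to \<open>S\<close>. This leg belongs to
  \<open>Mor_tac\<close>, so the difference factors through a totally acyclic complex.\<close>

lemma special_roof_vrel:
  fixes Xm Sm :: "('r, 'v) cochain"
  assumes mX: "model Xm X \<phi>X" and mS: "model Sm S \<phi>S"
    and K: "Kext X C" "hom S C h" "Kext X C'" "hom S C' h'"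
    and sp: "special_roof X S Xm \<phi>X Sm \<phi>S C h \<rho>" "special_roof X S Xm \<phi>X Sm \<phi>S C' h' \<rho>'"
    and rel: "(\<rho>, \<rho>') \<in> roof_rel elts R Sm Xm"
  shows "vrel X S C h C' h'"
  unfolding vrel_def
proof (intro allI impI, elim conjE)
  fix E j j' assume E: "Kext X E" and j: "hom C E j" "hom C' E j'" "j * pr (bs X) = pj X" "j' * pr (bs X) = pj X"
  note oS = modelD(2,3)[OF mS] and cS = modelD(1)[OF mS] and cX = modelD(1)[OF mX]
  obtain Z \<phi> f g where 1: "\<rho> = (Z, Kclass R Z Sm f, Kclass R Z Xm g)" "model Z (roof_apex X C S h) \<phi>"
    "f \<in> cochain_maps R Z Sm" "g \<in> cochain_maps R Z Xm" "rep Z \<phi> \<phi>S f (pj S * k1)" "rep Z \<phi> \<phi>X g (roof_leg X C h)"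
    using sp(1) unfolding special_roof_def by (elim exE conjE) (rule that)
  obtain Z' \<phi>' f' g' where 2: "\<rho>' = (Z', Kclass R Z' Sm f', Kclass R Z' Xm g')" "model Z' (roof_apex X C' S h') \<phi>'"
    "f' \<in> cochain_maps R Z' Sm" "g' \<in> cochain_maps R Z' Xm" "rep Z' \<phi>' \<phi>S f' (pj S * k1)" "rep Z' \<phi>' \<phi>X g' (roof_leg X C' h')"
    using sp(2) unfolding special_roof_def by (elim exE conjE) (rule that)
  obtain Y F G U V where Y: "(Y, F, G) \<in> roofs elts R Sm Xm" and UV: "U \<in> KHom R Y Z" "V \<in> KHom R Y Z'"
    and eq: "Kcomp R Y Sm (Kclass R Z Sm f) U = F" "F = Kcomp R Y Sm (Kclass R Z' Sm f') V"
      "Kcomp R Y Xm (Kclass R Z Xm g) U = G" "G = Kcomp R Y Xm (Kclass R Z' Xm g') V"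
    using rel unfolding roof_rel_def 1(1) 2(1) by auto
  have YP: "Y \<in> KProj elts R" and MF: "F \<in> Mor_tac elts R Y Sm" and GH: "G \<in> KHom R Y Xm" using Y unfolding roofs_def by auto
  have FH: "F \<in> KHom R Y Sm" using MF unfolding Mor_tac_def by blast
  obtain W \<psi> where mY: "model Y W \<psi>" using KProj_model[OF YP] by blast
  note cY = modelD(1)[OF mY]
  obtain f0 where f0: "f0 \<in> cochain_maps R Y Sm" "F = Kclass R Y Sm f0" using KHomE[OF FH] .
  obtain g0 where g0: "g0 \<in> cochain_maps R Y Xm" "G = Kclass R Y Xm g0" using KHomE[OF GH] .
  obtain u where u: "u \<in> cochain_maps R Y Z" "U = Kclass R Y Z u" using KHomE[OF UV(1)] .
  obtain v where v: "v \<in> cochain_maps R Y Z'" "V = Kclass R Y Z' v" using KHomE[OF UV(2)] .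
  obtain F0 where F0: "hom W S F0" "rep Y \<psi> \<phi>S f0 F0" using cochain_to_hom[OF mY mS f0(1)] by blast
  obtain G0 where G0: "hom W X G0" "rep Y \<psi> \<phi>X g0 G0" using cochain_to_hom[OF mY mX g0(1)] by blast
  \<comment> \<open>Both roofs are treated alike: after composition with \<open>F0\<close> each of
    them is homotopic to the same \<open>G0\<close>.\<close>
  have half: "null W E (i * k * F0 - G0)"
    if m: "model A (roof_apex X D S k) \<chi>" and D: "Kext X D" "hom S D k" and i: "hom D E i" "i * pr (bs X) = pj X"
      and a: "a \<in> cochain_maps R A Sm" "rep A \<chi> \<phi>S a (pj S * k1)" and b: "b \<in> cochain_maps R A Xm" "rep A \<chi> \<phi>X b (roof_leg X D k)"
      and t: "t \<in> cochain_maps R Y A"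
      and e: "F = Kcomp R Y Sm (Kclass R A Sm a) (Kclass R Y A t)" "G = Kcomp R Y Xm (Kclass R A Xm b) (Kclass R Y A t)"
    for A D k \<chi> i a b t
  proof -
    note cA = modelD(1)[OF m]
    note kD = KextD[OF D(1)] and L = roof_leg[OF D(1) oS(1) D(2)]
    obtain B where B: "hom W (roof_apex X D S k) B" "rep Y \<psi> \<chi> t B" using cochain_to_hom[OF mY m t] by blast
    have F: "hom (roof_apex X D S k) S (pj S * k1)"
      unfolding roof_apex_def by (rule cocn_proj[OF oS(1) ok_quo[OF kD(1,2,5)] L(1)])
    note at = cochain_maps_comp[OF t a(1)] and bt = cochain_maps_comp[OF t b(1)]
    have "(\<lambda>n x. a n (t n x), f0) \<in> homotopy_rel R Y Sm"
      using e(1) unfolding f0(2) Kcomp_Kclass[OF cY cA cS t a(1)] using Kclass_eq_iff[OF cY cS at f0(1)] by simp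
    then have 1: "null W S (pj S * k1 * B - F0)"
      unfolding homotopy_iff_null[OF mY mS at f0(1) hom_comp[OF B(1) F] rep_comp[OF B(2) a(2) t] F0] .
    have "(\<lambda>n x. b n (t n x), g0) \<in> homotopy_rel R Y Xm"
      using e(2) unfolding g0(2) Kcomp_Kclass[OF cY cA cX t b(1)] using Kclass_eq_iff[OF cY cX bt g0(1)] by simp
    then have 2: "null W X (roof_leg X D k * B - G0)"
      unfolding homotopy_iff_null[OF mY mX bt g0(1) hom_comp[OF B(1) L(2)] rep_comp[OF B(2) b(2) t] G0] .
    show ?thesis by (rule fraction_collapse[OF D(1) oS(1) D(2) E i B(1) 1 2])
  qed
  have n1: "null W E (j * h * F0 - G0)"
    by (rule half[OF 1(2) K(1,2) j(1,3) 1(3,5,4,6) u(1) eq(1,3)[symmetric, unfolded u(2)]])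
  have n2: "null W E (j' * h' * F0 - G0)"
    by (rule half[OF 2(2) K(3,4) j(2,4) 2(3,5,4,6) v(1) eq(2,4)[unfolded v(2)]])
  let ?K = "j * h - j' * h'"
  have "?K * F0 = (j * h * F0 - G0) - (j' * h' * F0 - G0)" by (simp add: left_diff_distrib)
  then have nK: "null W E (?K * F0 - 0)" using null_diff[OF n1 n2] by simp
  have hK: "hom S E ?K" by (rule hom_diff[OF hom_comp[OF K(2) j(1)] hom_comp[OF K(4) j(2)]])
  obtain Em :: "('r, 'v) cochain" and \<phi>E where mE: "model Em E \<phi>E" using model_exists[OF KextD(2,4)[OF E]] by blast
  note cE = modelD(1)[OF mE]
  obtain k where k: "k \<in> cochain_maps R Sm Em" "rep Sm \<phi>S \<phi>E k ?K" using hom_to_cochain[OF mS mE hK] by blast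
  have z: "hom W E 0" unfolding hom_def by simp
  have "(\<lambda>n x. k n (f0 n x), zmap Em) \<in> homotopy_rel R Y Em"
    unfolding homotopy_iff_null[OF mY mE cochain_maps_comp[OF f0(1) k(1)] zmap[OF cY cE]
      hom_comp[OF F0(1) hK] rep_comp[OF F0(2) k(2) f0(1)] z rep_zmap[OF mE]] by (rule nK)
  from Mor_tac_factor[OF MF[unfolded f0(2)] f0(1) cE k(1) this]
  obtain Q p l where Q: "totally_acyclic elts R Q" and pl: "p \<in> cochain_maps R Sm Q" "l \<in> cochain_maps R Q Em"
    "(k, \<lambda>n x. l n (p n x)) \<in> homotopy_rel R Sm Em" by blast
  have "Q \<in> KProj elts R" using Q unfolding totally_acyclic_def KProj_def by blast
  then obtain T \<tau> where mQ: "model Q T \<tau>" using KProj_model by blast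
  obtain P where P: "hom S T P" "rep Sm \<phi>S \<tau> p P" using cochain_to_hom[OF mS mQ pl(1)] by blast
  obtain L where L: "hom T E L" "rep Q \<tau> \<phi>E l L" using cochain_to_hom[OF mQ mE pl(2)] by blast
  have "null S E (?K - L * P)"
    using pl(3) unfolding homotopy_iff_null[OF mS mE k(1) cochain_maps_comp[OF pl(1,2)] hK k(2)
      hom_comp[OF P(1) L(1)] rep_comp[OF P(2) L(2) pl(1)]] .
  then show "\<exists>T g l. ok T \<and> sml (bs T) \<and> TA T \<and> hom S T g \<and> hom T E l \<and> null S E (j * h - j' * h' - l * g)"
    using modelD(2,3)[OF mQ] TA_if_totally_acyclic[OF mQ Q] P(1) L(1) by blast
qed

text \<open>Each fraction is sent to the class of a roof, and the classes form a set. One fraction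
  is kept for every class that occurs, with the code of the class in \<open>'v\<close> as its
  index.\<close>

theorem small_fractions_if_Verdier_small:
  assumes V: "Verdier_small_Homs elts R" and X: "ok X" "sml (bs X)" and S: "S \<in> tests"
  shows "small_fractions X S"
proof -
  obtain Xm :: "('r, 'v) cochain" and \<phi>X where mX: "model Xm X \<phi>X" using model_exists[OF X] by blast
  obtain Sm :: "('r, 'v) cochain" and \<phi>S where mS: "model Sm S \<phi>S" using model_exists[OF testsD(1,2)[OF S]] by blast
  let ?Q = "Verdier_Hom elts R Sm Xm" and ?r = "roof_rel elts R Sm Xm"
  have "sml ?Q" using V model_KProj(1)[OF mX] model_KProj(1)[OF mS] unfolding Verdier_small_Homs_def by blast
  then obtain c x where c: "bij_betw (c :: _ => 'v) ?Q (elts x)" using small_inject by blast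
  let ?I = "{p. Kext X (fst p) \<and> hom S (fst p) (snd p)}"
  have "\<forall>p\<in>?I. \<exists>\<rho>. \<rho> \<in> roofs elts R Sm Xm \<and> special_roof X S Xm \<phi>X Sm \<phi>S (fst p) (snd p) \<rho>"
    using special_roof_exists[OF mX mS] by blast
  from bchoice[OF this] obtain \<rho>
    where "\<forall>p\<in>?I. \<rho> p \<in> roofs elts R Sm Xm \<and> special_roof X S Xm \<phi>X Sm \<phi>S (fst p) (snd p) (\<rho> p)" ..
  note \<rho> = bspec[OF this, THEN conjunct1] bspec[OF this, THEN conjunct2]
  let ?cl = "\<lambda>p. ?r `` {\<rho> p}"
  have cl: "?cl p \<in> ?Q" if "p \<in> ?I" for p unfolding Verdier_Hom_def by (rule quotientI) (rule \<rho>(1)[OF that])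
  let ?code = "\<lambda>p. c (?cl p)"
  let ?J = "?code ` ?I"
  let ?d = "inv_into ?I ?code"
  have "?J \<subseteq> elts x" using cl c unfolding bij_betw_def by blast
  then have J: "sml ?J" using small_subset small_elts by blast
  have dI: "?d i \<in> ?I" if "i \<in> ?J" for i by (rule inv_into_into[OF that])
  show ?thesis
    unfolding small_fractions_def
  proof (rule exI[of _ ?J], rule exI[of _ "\<lambda>i. fst (?d i)"], rule exI[of _ "\<lambda>i. snd (?d i)"], intro conjI ballI allI impI J)
    fix i assume i: "i \<in> ?J"
    show "Kext X (fst (?d i))" "hom S (fst (?d i)) (snd (?d i))" using dI[OF i] by simp_all
  next
    fix C k assume Ck: "Kext X C \<and> hom S C k"
    then have p: "(C, k) \<in> ?I" by simp
    let ?i = "?code (C, k)"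
    have i: "?i \<in> ?J" by (rule imageI[OF p])
    note q = dI[OF i]
    have "?code (?d ?i) = ?i" by (rule f_inv_into_f[OF i])
    then have e: "?cl (?d ?i) = ?cl (C, k)" using c cl[OF p] cl[OF q] unfolding bij_betw_def inj_on_def by blast
    \<comment> \<open>Reflexivity puts the roof of the representative into its own class; equality
      of the two classes then relates the two roofs directly.\<close>
    have "\<rho> (?d ?i) \<in> ?cl (?d ?i)" using roof_rel_refl[OF modelD(1)[OF mS] modelD(1)[OF mX] \<rho>(1)[OF q]] by blast
    then have rel: "(\<rho> (C, k), \<rho> (?d ?i)) \<in> ?r" unfolding e by blast
    have "vrel X S C k (fst (?d ?i)) (snd (?d ?i))"
      by (rule special_roof_vrel[OF mX mS _ _ _ _ _ \<rho>(2)[OF q] rel]) (use Ck q \<rho>(2)[OF p] in simp_all)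
    then show "\<exists>i\<in>?J. vrel X S C k (fst (?d i)) (snd (?d i))" using i by (rule bexI)
  qed
qed

end

section \<open>Precovers\<close>

lemma right_module_ker:
  assumes X: "is_complex R X" shows "right_module R (ker_module X n)"
proof -
  note d = is_complexD[OF X]
  interpret M: right_module R "Ob X n" by (rule d)
  interpret N: right_module R "Ob X (n + 1)" by (rule d)
  note h = mod_homD[OF d(2)] mod_hom_zero[OF d(2,1,1)] mod_hom_uminus[OF d(2,1,1)]
  show ?thesis
  proof (rule right_moduleI)
    show "\<exists>y\<in>carrier (ker_module X n). y \<oplus>\<^bsub>ker_module X n\<^esub> x = \<zero>\<^bsub>ker_module X n\<^esub>"
      if "x \<in> carrier (ker_module X n)" for x
      using that by (intro bexI[of _ "\<ominus>\<^bsub>Ob X n\<^esub> x"])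
        (simp_all add: ker_module_def h M.M.l_neg minus_zero_module[OF d(1)])
  qed (auto simp: ker_module_def h M.R.ring_axioms M.M.a_ac M.smult_closed M.smult_add_scalar M.smult_add_vector
      M.smult_assoc M.smult_one smult_zero[OF d(1)])
qed

text \<open>Acyclicity lets the cycles in degree 0 be reached from degree -1, where the resolution
  has its top term.\<close>

lemma ker_module_carrier:
  assumes "acyclic_complex X" shows "carrier (ker_module X 0) = diff X (- 1) ` el X (- 1)"
  using spec[OF assms[unfolded acyclic_complex_def], of "- 1"] by (simp add: ker_module_def)

lemma ker_module_simps:
  "x \<in> carrier (ker_module X n) \<longleftrightarrow> x \<in> el X n \<and> diff X n x = \<zero>\<^bsub>Ob X (n + 1)\<^esub>"
  "x \<oplus>\<^bsub>ker_module X n\<^esub> y = x \<oplus>\<^bsub>Ob X n\<^esub> y" "a \<odot>\<^bsub>ker_module X n\<^esub> x = a \<odot>\<^bsub>Ob X n\<^esub> x" "\<zero>\<^bsub>ker_module X n\<^esub> = \<zero>\<^bsub>Ob X n\<^esub>"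
  unfolding ker_module_def by simp_all

context ring_setting
begin

lemma ev_zero: "right_module R M ==> ev M 0 = \<zero>\<^bsub>M\<^esub>"
proof -
  assume M: "right_module R M"
  interpret M: right_module R M by fact
  have "ev M 0 \<oplus>\<^bsub>M\<^esub> ev M 0 = ev M 0" using ev(2)[OF M, of 0 0] by simp
  then show ?thesis using ev(1)[OF M, of 0] M.M.add.l_cancel_one' by auto
qed

lemma submod_ev_kernel:
  assumes M: "right_module R M" shows "submod {x \<in> vs B. ev M x = \<zero>\<^bsub>M\<^esub>}"
proof -
  interpret M: right_module R M by fact
  show ?thesis unfolding submod_def
    by (auto simp: ev_zero[OF M] ev(2,3)[OF M] smult_zero[OF M])
qed

text \<open>\<open>M\<close> is presented by all its elements as generators in degree -1, with the
  kernel of \<open>ev M\<close> as relations. Maps from cycles in degree 0 to \<open>M\<close> are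
  described by maps from degree -1 to the generators that send boundaries to relations.\<close>

lemma precover_exists:
  assumes V: "Verdier_small_Homs elts R" and M: "M \<in> Modules elts R"
  shows "\<exists>G f. Gorenstein_projective_precover elts R M G f"
proof -
  have rM: "right_module R M" and sM: "sml (carrier M)" using M unfolding Modules_def by auto
  interpret M: right_module R M by (rule rM)
  let ?K = "{- 1 :: int} \<times> carrier M"
  let ?N = "{x \<in> vs ?K. ev M x = \<zero>\<^bsub>M\<^esub>}"
  have N: "?N \<subseteq> vs ?K" by blast
  have "\<exists>T th. ok T \<and> sml (bs T) \<and> TA T \<and> dg 0 th \<and> th * pj T = th \<and> pr ?K * th = th \<and>
      (\<forall>x. app (th * df T) x \<in> ?N) \<and>
      (\<forall>W f. ok W \<and> sml (bs W) \<and> TA W \<and> dg 0 f \<and> f * pj W = f \<and> pr ?K * f = f \<and>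
        (\<forall>x. app (f * df W) x \<in> ?N) --> (\<exists>w. hom W T w \<and> f = th * w))"
    by (rule inner_precover[OF _ sM submod_ev_kernel[OF rM] N]) (rule small_fractions_if_Verdier_small[OF V])
  then obtain T th where T: "ok T" "sml (bs T)" "TA T" and th: "th * pj T = th" "\<forall>x. app (th * df T) x \<in> ?N"
    and univ: "\<forall>W f. ok W \<and> sml (bs W) \<and> TA W \<and> dg 0 f \<and> f * pj W = f \<and> pr ?K * f = f \<and>
      (\<forall>x. app (f * df W) x \<in> ?N) --> (\<exists>w. hom W T w \<and> f = th * w)"
    by (elim exE conjE) (rule that)
  obtain X :: "('r, 'v) cochain" and \<phi> where X: "model X T \<phi>" using model_exists[OF T(1,2)] by blast
  note d = modelD[OF X]
  have taX: "totally_acyclic elts R X" by (rule totally_acyclic_if_TA[OF X T(3)])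
  have kX: "carrier (ker_module X 0) = diff X (- 1) ` el X (- 1)"
    by (rule ker_module_carrier) (use taX in \<open>simp add: totally_acyclic_def\<close>)
  let ?G = "ker_module X 0"
  have rG: "right_module R ?G" by (rule right_module_ker[OF d(1)])
  have "sml (carrier ?G)" by (rule small_subset[OF model_small[OF X, of 0]]) (auto simp: ker_module_simps)
  then have GM: "?G \<in> Modules elts R" unfolding Modules_def using rG by blast
  have "mod_iso R ?G ?G" unfolding mod_iso_def by (intro bexI[of _ "\<lambda>x. x"] mod_homI) (auto simp: bij_betw_def)
  then have GP: "Gorenstein_projective elts R ?G" unfolding Gorenstein_projective_def using GM taX by blast
  \<comment> \<open>Two preimages of a cycle differ by a boundary, which \<open>th\<close> sends to
    a relation; so the value in \<open>M\<close> depends on the cycle alone.\<close>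
  have indep: "ev M (app th v) = ev M (app th v')"
    if v: "app (pj T) v = v" "app (pj T) v' = v'" "app (df T) v = app (df T) v'" for v v'
  proof -
    have "app (pj T) (v - v') = v - v' \<and> app (df T) (v - v') = 0" using v by simp
    then obtain u where u: "v - v' = app (df T) u" using conjunct1[OF T(3)[unfolded TA_def']] by blast
    have "ev M (app (th * df T) u) = \<zero>\<^bsub>M\<^esub>" using spec[OF th(2), of u] by blast
    then have z: "ev M (app th (v - v')) = \<zero>\<^bsub>M\<^esub>" unfolding u by simp
    have "ev M (app th v) = ev M (app th v' + app th (v - v'))" by simp
    also have "\<dots> = ev M (app th v')" unfolding ev(2)[OF rM] z by (rule M.M.r_zero[OF ev(1)[OF rM]])
    finally show ?thesis .
  qed
  have "\<forall>x\<in>carrier ?G. \<exists>v. app (pj T) v = v \<and> app (df T) v = \<phi> 0 x"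
  proof
    fix x assume "x \<in> carrier ?G"
    then obtain y where y: "y \<in> el X (- 1)" "x = diff X (- 1) y" unfolding kX by blast
    have "app (pj T) (\<phi> (- 1) y) = \<phi> (- 1) y" using d(4)[OF y(1)] unfolding Vn_def by blast
    moreover have "app (df T) (\<phi> (- 1) y) = \<phi> 0 x" using d(7)[OF y(1)] y(2) by simp
    ultimately show "\<exists>v. app (pj T) v = v \<and> app (df T) v = \<phi> 0 x" by blast
  qed
  from bchoice[OF this] obtain Y where "\<forall>x\<in>carrier ?G. app (pj T) (Y x) = Y x \<and> app (df T) (Y x) = \<phi> 0 x" ..
  note Y = bspec[OF this, THEN conjunct1] bspec[OF this, THEN conjunct2]
  define f where "f x = ev M (app th (Y x))" for x
  have fI: "f x = ev M (app th v)" if "x \<in> carrier ?G" "app (pj T) v = v" "app (df T) v = \<phi> 0 x" for x v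
    unfolding f_def by (rule indep[OF Y(1)[OF that(1)] that(2)]) (use Y(2)[OF that(1)] that(3) in simp)
  have fm: "f \<in> mod_hom R ?G M"
  proof (rule mod_homI)
    show "f x \<in> carrier M" if "x \<in> carrier ?G" for x unfolding f_def by (rule ev(1)[OF rM])
    show "f (x \<oplus>\<^bsub>?G\<^esub> y) = f x \<oplus>\<^bsub>M\<^esub> f y" if xy: "x \<in> carrier ?G" "y \<in> carrier ?G" for x y
    proof -
      have c: "x \<oplus>\<^bsub>?G\<^esub> y \<in> carrier ?G" using rG xy by (simp add: right_module.axioms(2) abelian_groupE(1))
      have "app (df T) (Y x + Y y) = \<phi> 0 (x \<oplus>\<^bsub>?G\<^esub> y)"
        using Y(2) xy d(5)[of x 0 y] unfolding ker_module_simps by simp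
      then have "f (x \<oplus>\<^bsub>?G\<^esub> y) = ev M (app th (Y x + Y y))" using Y(1) xy by (intro fI[OF c]) simp_all
      then show ?thesis unfolding f_def by (simp add: ev(2)[OF rM])
    qed
    show "f (a \<odot>\<^bsub>?G\<^esub> x) = a \<odot>\<^bsub>M\<^esub> f x" if a: "a \<in> carrier R" and x: "x \<in> carrier ?G" for a x
    proof -
      have c: "a \<odot>\<^bsub>?G\<^esub> x \<in> carrier ?G" by (rule right_module.smult_closed[OF rG a x])
      have "app (df T) (rscale (Y x) (emb R a)) = \<phi> 0 (a \<odot>\<^bsub>?G\<^esub> x)"
        using Y(2)[OF x] x d(6)[OF a, of x 0] unfolding ker_module_simps by simp
      then have "f (a \<odot>\<^bsub>?G\<^esub> x) = ev M (app th (rscale (Y x) (emb R a)))" using Y(1)[OF x] by (intro fI[OF c]) simp_all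
      then show ?thesis unfolding f_def using a by (simp add: ev(3)[OF rM])
    qed
  qed
  have "\<exists>k\<in>mod_hom R G' ?G. \<forall>x\<in>carrier G'. f (k x) = h x"
    if G': "Gorenstein_projective elts R G'" and h: "h \<in> mod_hom R G' M" for G' h
  proof -
    obtain X' where X': "totally_acyclic elts R X'" and iso: "mod_iso R G' (ker_module X' 0)"
      using G' unfolding Gorenstein_projective_def by blast
    have rG': "right_module R G'" using G' unfolding Gorenstein_projective_def Modules_def by blast
    obtain i where i: "rmiso R G' (ker_module X' 0) i" using iso unfolding mod_iso_def rmiso_def by blast
    then have im: "i \<in> mod_hom R G' (ker_module X' 0)" and ii: "inj_on i (carrier G')" unfolding rmiso_def bij_betw_def by auto
    let ?i' = "inv_into (carrier G') i"
    have i': "?i' \<in> mod_hom R (ker_module X' 0) G'" using rmiso_inv[OF i rG'] unfolding rmiso_def by blast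
    have "X' \<in> KProj elts R" using X' unfolding totally_acyclic_def KProj_def by blast
    then obtain W \<psi> where W: "model X' W \<psi>" using KProj_model by blast
    note e = modelD[OF W]
    have taW: "TA W" by (rule TA_if_totally_acyclic[OF W X'])
    have kX': "carrier (ker_module X' 0) = diff X' (- 1) ` el X' (- 1)"
      by (rule ker_module_carrier) (use X' in \<open>simp add: totally_acyclic_def\<close>)
    let ?P = "Ob X' (- 1)"
    have rP: "right_module R ?P" by (rule e)
    have P: "projective elts R ?P" using X' unfolding totally_acyclic_def by blast
    \<comment> \<open>The degree 0 in this basis is a mere label, as \<open>ev\<close> looks only at
      the second component.\<close>
    obtain \<sigma> where \<sigma>: "\<sigma> \<in> mod_hom R ?P (Vmod (vs ({0} \<times> carrier ?P)))" "\<forall>x\<in>carrier ?P. ev ?P (\<sigma> x) = x"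
      using projective_split[OF P] by blast
    let ?h = "\<lambda>y. h (?i' (diff X' (- 1) y))"
    have d1: "diff X' (- 1) \<in> mod_hom R ?P (ker_module X' 0)"
    proof (rule mod_homI)
      show "diff X' (- 1) x \<in> carrier (ker_module X' 0)" if "x \<in> carrier ?P" for x unfolding kX' using that by blast
    qed (use mod_homD[OF e(12)[of "- 1"]] in \<open>simp_all add: ker_module_simps\<close>)
    have hm: "?h \<in> mod_hom R ?P M" by (rule mod_hom_comp[OF mod_hom_comp[OF d1 i'] h])
    \<comment> \<open>\<open>?h\<close> is the given map after the differential. \<open>L\<close>
      lifts it to the generators of \<open>M\<close>, sending a basis vector to the generator named
      by its value.\<close>
    define L where "L = ext (\<lambda>j. bas (- 1 :: int, ?h (ev ?P (bas j))))"
    have hc: "?h (ev ?P z) \<in> carrier M" for z by (rule mod_homD(1)[OF hm ev(1)[OF rP]])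
    have Lb: "app L (bas j) = bas (- 1, ?h (ev ?P (bas j)))" for j unfolding L_def by (simp add: app_ext_bas)
    have LK: "app L z \<in> vs ?K" for z
    proof -
      have "pr ?K * L = L"
      proof (rule pr_absorb_leftI)
        show "L * eps = L" unfolding L_def by simp
        show "app L (bas j) \<in> vs ?K" for j unfolding Lb using hc by simp
      qed
      then show ?thesis unfolding pr_absorb_left by blast
    qed
    have Lev: "ev M (app L z) = ?h (ev ?P z)" if z: "rscale z ee = z" for z
    proof (rule vec_agree[OF rM, of "\<lambda>z. ev M (app L z)" "\<lambda>z. ?h (ev ?P z)"])
      show "ev M (app L x) \<in> carrier M" for x by (rule ev(1)[OF rM])
      show "ev M (app L (x + y)) = ev M (app L x) \<oplus>\<^bsub>M\<^esub> ev M (app L y)" for x y by (simp add: ev(2)[OF rM])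
      show "ev M (app L (rscale x a)) = val R a \<odot>\<^bsub>M\<^esub> ev M (app L x)" for x a by (simp add: ev(3)[OF rM])
      show "?h (ev ?P (x + y)) = ?h (ev ?P x) \<oplus>\<^bsub>M\<^esub> ?h (ev ?P y)" for x y
        unfolding ev(2)[OF rP] by (rule mod_homD(2)[OF hm ev(1)[OF rP] ev(1)[OF rP]])
      show "?h (ev ?P (rscale x a)) = val R a \<odot>\<^bsub>M\<^esub> ?h (ev ?P x)" for x a
        unfolding ev(3)[OF rP] by (rule mod_homD(3)[OF hm val_simps(1) ev(1)[OF rP]])
      show "ev M (app L (bas j)) = ?h (ev ?P (bas j))" for j unfolding Lb by (rule ev(4)[OF rM hc])
    qed (rule hc z)+
    let ?u = "\<lambda>y. app L (\<sigma> y)"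
    have \<sigma>e: "rscale (\<sigma> y) ee = \<sigma> y" if "y \<in> carrier ?P" for y
      using mod_homD(1)[OF \<sigma>(1) that] unfolding Vmod_simps vs_iff by blast
    have "\<exists>F. F * pj W = F \<and> F * pr (lev (- 1)) = F \<and> (\<forall>y\<in>carrier ?P. app F (\<psi> (- 1) y) = ?u y) \<and>
      (\<forall>z. \<exists>y\<in>carrier ?P. app F z = ?u y)"
    proof (rule lin_of[OF W])
      show "rscale (?u y) ee = ?u y" for y using LK[of "\<sigma> y"] unfolding vs_iff by blast
    qed (use mod_homD[OF \<sigma>(1)] in simp_all)
    then obtain F where F: "F * pj W = F" "F * pr (lev (- 1)) = F" "\<And>y. y \<in> carrier ?P ==> app F (\<psi> (- 1) y) = ?u y"
      "\<And>z. \<exists>y\<in>carrier ?P. app F z = ?u y" by (elim exE conjE) (rule that; blast)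
    have FK: "pr ?K * F = F" unfolding pr_absorb_left
    proof
      fix z
      obtain y where "app F z = ?u y" using F(4) by blast
      then show "app F z \<in> vs ?K" using LK by simp
    qed
    have "pr (lev (- 1)) * F = F" by (rule pr_mono_left[OF FK]) auto
    then have dF: "dg 0 F" by (intro dg_single[OF F(2)]) simp
    have FP: "ev M (app F (\<psi> (- 1) y)) = ?h y" if y: "y \<in> carrier ?P" for y
      using F(3)[OF y] Lev[OF \<sigma>e[OF y]] bspec[OF \<sigma>(2) y] by simp
    \<comment> \<open>The degree -1 part of a boundary is a cycle, and \<open>?h\<close>, which
      begins with the differential, sends it to zero.\<close>
    have FN: "app (F * df W) x \<in> ?N" for x
    proof -
      let ?z = "app (pr (lev (- 1))) (app (df W) x)"
      have z: "?z \<in> Vn W (- 1)" using Vn_pr[OF e(2), of "- 1" "app (df W) x"] app_okr(2)[OF e(2)] by simp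
      then obtain y where y: "y \<in> carrier ?P" "\<psi> (- 1) y = ?z" using e(8) by blast
      have c: "df W * pr (lev (- 1)) = pr (lev 0) * df W" using dg_lev[OF okD(8)[OF e(2)], of "- 1"] by simp
      have "app (df W) ?z = 0" using app_cong[OF c, of "app (df W) x"] app_okr(4)[OF e(2)] by simp
      then have "\<psi> 0 (diff X' (- 1) y) = \<psi> 0 \<zero>\<^bsub>Ob X' 0\<^esub>" using e(7)[OF y(1)] y(2) model_zero[OF W] by simp
      moreover have "diff X' (- 1) y \<in> el X' 0" "\<zero>\<^bsub>Ob X' 0\<^esub> \<in> el X' 0"
        using mod_homD(1)[OF d1 y(1)] right_module_ker[OF e(1), of 0]
        by (auto simp: ker_module_simps intro!: abelian_groupE(2)[OF right_module.axioms(2)[OF e(11)]])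
      ultimately have "diff X' (- 1) y = \<zero>\<^bsub>ker_module X' 0\<^esub>" using inj_onD[OF e(9)] unfolding ker_module_simps by blast
      then have "?h y = \<zero>\<^bsub>M\<^esub>"
        using mod_hom_zero[OF mod_hom_comp[OF i' h] right_module_ker[OF e(1)] rM] by simp
      moreover have "app (F * df W) x = app F (\<psi> (- 1) y)"
        using app_cong[OF F(2), of "app (df W) x"] y(2) by simp
      moreover have "app (F * df W) x \<in> vs ?K" using FK unfolding pr_absorb_left by simp
      ultimately show ?thesis using FP[OF y(1)] by simp
    qed
    then have "\<exists>w. hom W T w \<and> F = th * w"
      by (intro spec[OF spec[OF univ], THEN mp] conjI e(2,3) taW dF F(1) FK allI)
    then obtain w where w: "hom W T w" "F = th * w" by blast
    obtain \<kappa> where \<kappa>: "\<kappa> \<in> cochain_maps R X' X" "rep X' \<psi> \<phi> \<kappa> w" using hom_to_cochain[OF W X w(1)] by blast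
    have \<kappa>G: "\<kappa> 0 z \<in> carrier ?G" if z: "z \<in> carrier (ker_module X' 0)" for z
      using z cochain_mapsD(2,3)[OF \<kappa>(1), of z 0] mod_hom_zero[OF cochain_mapsD(1)[OF \<kappa>(1)] e(11) d(11), of "0 + 1"]
      unfolding ker_module_simps by simp
    have \<kappa>m: "\<kappa> 0 \<in> mod_hom R (ker_module X' 0) ?G"
      by (rule mod_homI) (use \<kappa>G mod_homD[OF cochain_mapsD(1)[OF \<kappa>(1)]] in \<open>simp_all add: ker_module_simps\<close>)
    have "f (\<kappa> 0 (i x)) = h x" if x: "x \<in> carrier G'" for x
    proof -
      have ix: "i x \<in> carrier (ker_module X' 0)" by (rule mod_homD(1)[OF im x])
      then obtain y where y: "y \<in> carrier ?P" "i x = diff X' (- 1) y" unfolding kX' by blast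
      \<comment> \<open>\<open>w\<close> turns a preimage of the cycle in \<open>W\<close> into a
        preimage of its image in \<open>T\<close>, and \<open>f\<close> may be computed with any
        preimage.\<close>
      let ?v = "app w (\<psi> (- 1) y)"
      have "app (df T) ?v = app w (app (df W) (\<psi> (- 1) y))"
        using app_cong[OF homD(3)[OF w(1)], of "\<psi> (- 1) y"] by simp
      also have "\<dots> = \<phi> 0 (\<kappa> 0 (i x))"
        using e(7)[OF y(1)] y(2) \<kappa>(2) ix unfolding rep_def ker_module_simps by simp
      finally have dv: "app (df T) ?v = \<phi> 0 (\<kappa> 0 (i x))" .
      have pv: "app (pj T) ?v = ?v" using app_cong[OF homD(2)[OF w(1)], of "\<psi> (- 1) y"] by simp
      have "f (\<kappa> 0 (i x)) = ev M (app F (\<psi> (- 1) y))" unfolding w(2) using fI[OF \<kappa>G[OF ix] pv dv] by simp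
      also have "\<dots> = h (?i' (i x))" unfolding FP[OF y(1)] y(2) ..
      also have "?i' (i x) = x" by (rule inv_into_f_f[OF ii x])
      finally show ?thesis .
    qed
    then show ?thesis using mod_hom_comp[OF im \<kappa>m] by (intro bexI[of _ "\<lambda>x. \<kappa> 0 (i x)"]) simp_all
  qed
  then show ?thesis unfolding Gorenstein_projective_precover_def using GP fm by blast
qed

end

theorem corollary3p4:
  fixes elts :: "'v \<Rightarrow> 'v set" and R :: "('r, 'q) ring_scheme"
  assumes "set_universe elts"
    and "ring R" and "small elts (carrier R)"
    and "Verdier_small_Homs elts R"
  shows "\<forall>M\<in>Modules elts R. \<exists>G f. Gorenstein_projective_precover elts R M G f"
proof -
  interpret set_universe elts by fact
  interpret ring R by fact
  interpret ring_setting elts R by unfold_locales (rule assms(3))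
  show ?thesis using precover_exists[OF assms(4)] by blast
qed

end
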